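(* Fix $p>0$ and $\alpha\in\mathbb R$. 1. Let $\sigma$ be a finite Borel measure on $\mathbb S^{d-1}$, let $q:(0,\infty)\times\mathbb S^{d-1}\to(0,\infty)$ be a Borel function such that for all $u\in\mathbb S^{d-1}$ the function $q(\cdot,u)$ is completely monotone with $\lim_{r\to\infty}q(r,u)=0$, and let $$M(B)=\int_{\mathbb S^{d-1}}\int_0^\infty 1_B(ru)\,q(r^p,u)\,r^{-\alpha-1}\,dr\,\sigma(du),\qquad B\in\mathfrak B(\mathbb R^d).$$ Let $R$ be the Borel measure associated with $(q,\sigma)$ as described in the context. Then $$M(A)=\int_{\mathbb R^d}\int_0^\infty 1_A(tx)\,t^{-1-\alpha}e^{-t^p}\,dt\,R(dx),\qquad A\in\mathfrak B(\mathbb R^d),\qquad ( * )$$ or equivalently $$M(A)=p^{-1}\int_{\mathbb R^d}\int_0^\infty 1_A(t^{1/p}x)\,t^{-1-\alpha/p}e^{-t}\,dt\,R(dx),\qquad A\in\mathfrak B(\mathbb R^d).$$ 2. Let $R$ be a Borel measure on $\mathbb R^d$. Formula $( * )$ defines a L\'evy measure $M$ if and only if either $R=0$ or the following hold: $\alpha<2$, $R(\{0\})=0$, and $$\int_{\mathbb R^d}(|x|^2\wedge|x|^\alpha)\,R(dx)<\infty\ \text{ if }\alpha\in(0,2),$$ $$\int_{\mathbb R^d}\left(|x|^2\wedge[1+\log^+|x|]\right)R(dx)<\infty\ \text{ if }\alpha=0,$$ $$\int_{\mathbb R^d}(|x|^2\wedge1)\,R(dx)<\infty\ \text{ if }\alpha<0.$$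 Moreover, when $R$ satisfies these conditions, $M$ is the L\'evy measure of a $p$-tempered $\alpha$-stable distribution and it uniquely determines $R$ (for the fixed $\alpha$ and $p$). 3. A $p$-tempered $\alpha$-stable distribution is proper if and only if, in addition to the conditions of part 2, its measure $R$ satisfies $$\int_{\mathbb R^d}|x|^\alpha R(dx)<\infty.$$ 4. If $R$ satisfies $\int_{\mathbb R^d}|x|^\alpha R(dx)<\infty$, then in the representation $M(B)=\int_{\mathbb S^{d-1}}\int_0^\infty 1_B(ru)q(r^p,u)r^{-\alpha-1}\,dr\,\sigma(du)$, normalized so that $\lim_{r\downarrow0}q(r,u)=1$ for every $u\in\mathbb S^{d-1}$, the measure $\sigma$ is given by $$\sigma(B)=\int_{\mathbb R^d}1_B\left(\frac{x}{|x|}\right)|x|^\alpha R(dx),\qquad B\in\mathfrak B(\mathbb S^{d-1}).$$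
   Context: $\mathbb S^{d-1}$ is the unit sphere of $\mathbb R^d$, and $\mathfrak B(\cdot)$ denotes Borel sets. A measure $M$ on $\mathbb R^d$ is a L\'evy measure if $M(\{0\})=0$ and $\int_{\mathbb R^d}(|x|^2\wedge1)M(dx)<\infty$. For $\alpha<2$, $p>0$, an infinitely divisible probability measure on $\mathbb R^d$ is called $p$-tempered $\alpha$-stable if it has no Gaussian part and its L\'evy measure has the form $M(B)=\int_{\mathbb S^{d-1}}\int_0^\infty 1_B(ru)q(r^p,u)r^{-\alpha-1}\,dr\,\sigma(du)$, where $\sigma$ is a finite Borel measure on $\mathbb S^{d-1}$ and $q:(0,\infty)\times\mathbb S^{d-1}\to(0,\infty)$ is Borel with $q(\cdot,u)$ completely monotone and $\lim_{r\to\infty}q(r,u)=0$ for all $u$. It is called proper if its L\'evy measure admits such a representation with, in addition, $\lim_{r\downarrow0}q(r,u)=1$ for every $u\in\mathbb S^{d-1}$. Measure $R$ associated with $(q,\sigma)$: by Bernstein's theorem $q(r^p,u)=\int_{(0,\infty)}e^{-r^ps}\,Q_u(ds)$ for a measurable family $\{Q_u\}_{u\in\mathbb S^{d-1}}$ of Borel measures on $(0,\infty)$. Put $$Q(A)=\int_{\mathbb S^{d-1}}\int_{(0,\infty)}1_A(ru)\,Q_u(dr)\,\sigma(du),\qquad R(A)=\int_{\mathbb R^d}1_A\left(\frac{x}{|x|^{1+1/p}}\right)|x|^{\alpha/p}\,Q(dx),\qquad A\in\mathfrak B(\mathbb R^d).$$ The measure $R$ of a $p$-tempered $\alpha$-stable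 distribution in parts 3 and 4 is the measure so obtained from its L\'evy measure. *)

theory Defs
  imports "HOL-Probability.Probability"
begin

definition completely_monotone :: "(real \<Rightarrow> real) \<Rightarrow> bool" where
  "completely_monotone f \<longleftrightarrow>
     (\<forall>n. \<forall>r>0. (deriv ^^ n) f differentiable (at r) \<and> 0 \<le> (-1) ^ n * (deriv ^^ n) f r)"


definition levy_measure :: "'a::euclidean_space measure \<Rightarrow> bool" where
  "levy_measure M \<longleftrightarrow>
     sets M = sets borel \<and> emeasure M {0} = 0 \<and>
     (\<integral>\<^sup>+x. ennreal (min ((norm x)\<^sup>2) 1) \<partial>M) < \<infinity>"

(* For every n, mu is the law of a sum of n independent variables with a common law nu. *)
definition infinitely_divisible :: "'a::euclidean_space measure \<Rightarrow> bool" where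
  "infinitely_divisible \<mu> \<longleftrightarrow>
     prob_space \<mu> \<and> sets \<mu> = sets borel \<and>
     (\<forall>n\<ge>1. \<exists>\<nu>. prob_space \<nu> \<and> sets \<nu> = sets borel \<and>
        \<mu> = distr (PiM {..<n::nat} (\<lambda>_. \<nu>)) borel (\<lambda>x. \<Sum>i<n. x i))"

definition char_fun :: "'a::euclidean_space measure \<Rightarrow> 'a \<Rightarrow> complex" where
  "char_fun \<mu> z = (CLINT x|\<mu>. iexp (z \<bullet> x))"

(* Levy-Khintchine representation with Gaussian covariance A, Levy measure M and shift b,
   relative to the truncation by the closed unit ball. Another truncation function changes
   only b. *)
definition has_levy_triplet ::
  "'a::euclidean_space measure \<Rightarrow> ('a \<Rightarrow> 'a) \<Rightarrow> 'a measure \<Rightarrow> 'a \<Rightarrow> bool" where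
  "has_levy_triplet \<mu> A M b \<longleftrightarrow>
     linear A \<and> (\<forall>x y. A x \<bullet> y = x \<bullet> A y) \<and> (\<forall>x. 0 \<le> x \<bullet> A x) \<and> levy_measure M \<and>
     (\<forall>z. char_fun \<mu> z =
        exp (- complex_of_real (z \<bullet> A z) / 2 + \<i> * complex_of_real (b \<bullet> z) +
             (CLINT x|M. iexp (z \<bullet> x) - 1 -
                \<i> * complex_of_real ((z \<bullet> x) * indicator (cball 0 1) x))))"

definition nongaussian_with_levy_measure ::
  "'a::euclidean_space measure \<Rightarrow> 'a measure \<Rightarrow> bool" where
  "nongaussian_with_levy_measure \<mu> M \<longleftrightarrow> (\<exists>b. has_levy_triplet \<mu> (\<lambda>_. 0) M b)"


definition tempering_pair ::
  "(real \<Rightarrow> 'a::euclidean_space \<Rightarrow> real) \<Rightarrow> 'a measure \<Rightarrow> bool" where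
  "tempering_pair q \<sigma> \<longleftrightarrow>
     sets \<sigma> = sets (restrict_space borel (sphere 0 1)) \<and> finite_measure \<sigma> \<and>
     (\<lambda>(r, u). q r u) \<in> borel_measurable
        (restrict_space borel {0<..} \<Otimes>\<^sub>M restrict_space borel (sphere 0 1)) \<and>
     (\<forall>u\<in>sphere 0 1.
        (\<forall>r>0. 0 < q r u) \<and> completely_monotone (\<lambda>r. q r u) \<and>
        ((\<lambda>r. q r u) \<longlongrightarrow> 0) at_top)"

definition normalized_tempering :: "(real \<Rightarrow> 'a::euclidean_space \<Rightarrow> real) \<Rightarrow> bool" where
  "normalized_tempering q \<longleftrightarrow> (\<forall>u\<in>sphere 0 1. ((\<lambda>r. q r u) \<longlongrightarrow> 1) (at_right 0))"

definition polar_tempered ::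
  "real \<Rightarrow> real \<Rightarrow> (real \<Rightarrow> 'a::euclidean_space \<Rightarrow> real) \<Rightarrow> 'a measure \<Rightarrow> 'a set \<Rightarrow> ennreal" where
  "polar_tempered p \<alpha> q \<sigma> B =
     (\<integral>\<^sup>+u. (\<integral>\<^sup>+r\<in>{0<..}. indicator B (r *\<^sub>R u) *
        ennreal (q (r powr p) u * r powr (- \<alpha> - 1)) \<partial>lborel) \<partial>\<sigma>)"

definition tempered_representation ::
  "real \<Rightarrow> real \<Rightarrow> 'a::euclidean_space measure \<Rightarrow> (real \<Rightarrow> 'a \<Rightarrow> real) \<Rightarrow> 'a measure \<Rightarrow> bool" where
  "tempered_representation p \<alpha> M q \<sigma> \<longleftrightarrow>
     tempering_pair q \<sigma> \<and> sets M = sets borel \<and>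
     (\<forall>B\<in>sets borel. emeasure M B = polar_tempered p \<alpha> q \<sigma> B)"

definition tempered_stable :: "real \<Rightarrow> real \<Rightarrow> 'a::euclidean_space measure \<Rightarrow> bool" where
  "tempered_stable p \<alpha> \<mu> \<longleftrightarrow>
     \<alpha> < 2 \<and> 0 < p \<and> infinitely_divisible \<mu> \<and>
     (\<exists>M q \<sigma>. nongaussian_with_levy_measure \<mu> M \<and> tempered_representation p \<alpha> M q \<sigma>)"

definition proper_tempered_stable :: "real \<Rightarrow> real \<Rightarrow> 'a::euclidean_space measure \<Rightarrow> bool" where
  "proper_tempered_stable p \<alpha> \<mu> \<longleftrightarrow>
     tempered_stable p \<alpha> \<mu> \<and>
     (\<exists>M q \<sigma>. nongaussian_with_levy_measure \<mu> M \<and> tempered_representation p \<alpha> M q \<sigma> \<and>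
        normalized_tempering q)"


definition bernstein_family ::
  "real \<Rightarrow> (real \<Rightarrow> 'a::euclidean_space \<Rightarrow> real) \<Rightarrow> ('a \<Rightarrow> real measure) \<Rightarrow> bool" where
  "bernstein_family p q Qu \<longleftrightarrow>
     (\<forall>u\<in>sphere 0 1. sets (Qu u) = sets (restrict_space borel {0<..})) \<and>
     (\<forall>A\<in>sets (restrict_space borel {0<..}).
        (\<lambda>u. emeasure (Qu u) A) \<in> borel_measurable (restrict_space borel (sphere 0 1))) \<and>
     (\<forall>u\<in>sphere 0 1. \<forall>r>0.
        ennreal (q (r powr p) u) = (\<integral>\<^sup>+s. ennreal (exp (- (r powr p) * s)) \<partial>Qu u))"

(* The weight norm x powr (alpha / p) and the map x / norm x powr (1 + 1 / p) have junk
   values at 0; they are irrelevant because the measure Q below does not charge 0. *)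
definition associated_measure ::
  "real \<Rightarrow> real \<Rightarrow> (real \<Rightarrow> 'a::euclidean_space \<Rightarrow> real) \<Rightarrow> 'a measure \<Rightarrow> 'a measure \<Rightarrow> bool" where
  "associated_measure p \<alpha> q \<sigma> R \<longleftrightarrow>
     (\<exists>Qu Q. bernstein_family p q Qu \<and>
        sets Q = sets borel \<and>
        (\<forall>A\<in>sets borel. emeasure Q A = (\<integral>\<^sup>+u. (\<integral>\<^sup>+r. indicator A (r *\<^sub>R u) \<partial>Qu u) \<partial>\<sigma>)) \<and>
        sets R = sets borel \<and>
        (\<forall>A\<in>sets borel. emeasure R A =
           (\<integral>\<^sup>+x. indicator A (x /\<^sub>R (norm x powr (1 + 1 / p))) *
              ennreal (norm x powr (\<alpha> / p)) \<partial>Q)))"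

definition associated_measure_of_law ::
  "real \<Rightarrow> real \<Rightarrow> 'a::euclidean_space measure \<Rightarrow> 'a measure \<Rightarrow> bool" where
  "associated_measure_of_law p \<alpha> \<mu> R \<longleftrightarrow>
     (\<exists>M q \<sigma>. nongaussian_with_levy_measure \<mu> M \<and> tempered_representation p \<alpha> M q \<sigma> \<and>
        associated_measure p \<alpha> q \<sigma> R)"

definition levy_mixture ::
  "real \<Rightarrow> real \<Rightarrow> 'a::euclidean_space measure \<Rightarrow> 'a set \<Rightarrow> ennreal" where
  "levy_mixture p \<alpha> R A =
     (\<integral>\<^sup>+x. (\<integral>\<^sup>+t\<in>{0<..}. indicator A (t *\<^sub>R x) *
        ennreal (t powr (- 1 - \<alpha>) * exp (- (t powr p))) \<partial>lborel) \<partial>R)"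

definition levy_mixture' ::
  "real \<Rightarrow> real \<Rightarrow> 'a::euclidean_space measure \<Rightarrow> 'a set \<Rightarrow> ennreal" where
  "levy_mixture' p \<alpha> R A =
     ennreal (1 / p) * (\<integral>\<^sup>+x. (\<integral>\<^sup>+t\<in>{0<..}. indicator A ((t powr (1 / p)) *\<^sub>R x) *
        ennreal (t powr (- 1 - \<alpha> / p) * exp (- t)) \<partial>lborel) \<partial>R)"

definition integrability_conditions :: "real \<Rightarrow> 'a::euclidean_space measure \<Rightarrow> bool" where
  "integrability_conditions \<alpha> R \<longleftrightarrow>
     \<alpha> < 2 \<and> emeasure R {0} = 0 \<and>
     (0 < \<alpha> \<and> \<alpha> < 2 \<longrightarrow> (\<integral>\<^sup>+x. ennreal (min ((norm x)\<^sup>2) (norm x powr \<alpha>)) \<partial>R) < \<infinity>) \<and>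
     (\<alpha> = 0 \<longrightarrow> (\<integral>\<^sup>+x. ennreal (min ((norm x)\<^sup>2) (1 + max 0 (ln (norm x)))) \<partial>R) < \<infinity>) \<and>
     (\<alpha> < 0 \<longrightarrow> (\<integral>\<^sup>+x. ennreal (min ((norm x)\<^sup>2) 1) \<partial>R) < \<infinity>)"

definition finite_alpha_moment :: "real \<Rightarrow> 'a::euclidean_space measure \<Rightarrow> bool" where
  "finite_alpha_moment \<alpha> R \<longleftrightarrow> (\<integral>\<^sup>+x. ennreal (norm x powr \<alpha>) \<partial>R) < \<infinity>"

end

theory Submission
  imports Defs
begin

text \<open>
  A \<open>p\<close>-tempered \<open>\<alpha>\<close>-stable Levy measure is, along each ray, a mixture of the elementary densities
  \<open>r powr (- \<alpha> - 1) * exp (- (r powr p) * s)\<close>, because a completely monotone function vanishing at infinity is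
  a Laplace transform (\<open>bernstein\<close>). Substituting \<open>r = t * s powr (- 1 / p)\<close> turns every such density
  into the single kernel \<open>t powr (- 1 - \<alpha>) * exp (- (t powr p))\<close> transported to the point
  \<open>(s powr (- 1 / p)) *\<^sub>R u\<close>, and the mixing measure that collects these points with the weight
  \<open>s powr (\<alpha> / p)\<close> is exactly \<open>R\<close> (\<open>polar_disintegration\<close>). So the mixture formula is Tonelli's theorem
  together with one substitution (\<open>levy_mixture_eq_polar_tempered\<close>). What remains is a measurable choice of the
  Bernstein measures. It comes from the Hausdorff moment problem: a measure on the unit interval is an explicit
  limit of expressions in its moments, so a family of such measures is measurable as soon as its moments are
  (\<open>kernel_measurable_from_moments\<close>).

  The truncated second moment of the mixture is the integral over \<open>R\<close> of a function of \<open>norm x\<close> that is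
  comparable with the weight in the integrability conditions if \<open>\<alpha> < 2\<close> and infinite off the origin otherwise; this
  gives the criterion \<open>levy_mixture_levy_iff\<close>. A law with a given Levy measure is built as a convergent sum of
  independent compensated Poisson laws, and it is infinitely divisible because the same construction applies to the
  Levy measure divided by \<open>n\<close> (\<open>infinitely_divisible_exists\<close>). To see that the mixture of a measure \<open>R\<close> is tempered stable,
  \<open>R\<close> is written in the coordinates \<open>direction x\<close> and \<open>norm x powr (- p)\<close>; the factor
  \<open>norm x powr \<alpha> * exp (- (norm x powr (- p)))\<close> makes it finite, and disintegrating over the direction yields the
  measures whose Laplace transforms form \<open>q\<close> (\<open>polar_disintegration_exists\<close>).

  \<open>R\<close> is unique since the mixture of a cone over \<open>A\<close> has a radial density which displays the Laplace transform of the part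
  of \<open>R\<close> lying over \<open>A\<close> (\<open>levy_mixture_injective\<close>). The Levy measure is in turn determined by the law
  (\<open>levy_measure_unique\<close>), because second differences of the Levy exponent are characteristic functions of finite
  measures. Hence \<open>R\<close> is a function of the law, whichever pair \<open>(q, \<sigma>)\<close> produced it.

  The statements on proper laws compare masses. The Bernstein measure in the direction \<open>u\<close> has the total mass \<open>q (0+) u\<close>,
  and testing the polar formula with \<open>norm x powr \<alpha>\<close> on a cone gives the integral of these masses against \<open>\<sigma>\<close>
  (\<open>alpha_moment_cone\<close>). For a normalized \<open>q\<close> this is \<open>\<sigma>\<close> itself, hence finite. Conversely, if it is finite, the masses are
  finite almost everywhere and can be moved from \<open>q\<close> into \<open>\<sigma>\<close> (\<open>normalized_representation_exists\<close>).
\<close>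

section \<open>Moments of measures on the unit interval\<close>

definition unit_interval_measure :: "real measure \<Rightarrow> bool" where
  "unit_interval_measure \<mu> \<longleftrightarrow>
     finite_measure \<mu> \<and> sets \<mu> = sets borel \<and> (AE x in \<mu>. 0 \<le> x \<and> x \<le> 1)"

lemma unit_interval_integrable:
  fixes f :: "real \<Rightarrow> real"
  assumes \<mu>: "unit_interval_measure \<mu>" and f: "f \<in> borel_measurable borel"
    and b: "\<And>x. 0 \<le> x \<Longrightarrow> x \<le> 1 \<Longrightarrow> \<bar>f x\<bar> \<le> B"
  shows "integrable \<mu> f"
proof -
  interpret finite_measure \<mu> using \<mu> by (simp add: unit_interval_measure_def)
  have s: "sets \<mu> = sets borel" using \<mu> by (simp add: unit_interval_measure_def)
  have "AE x in \<mu>. 0 \<le> x \<and> x \<le> 1" using \<mu> by (simp add: unit_interval_measure_def)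
  then have "AE x in \<mu>. norm (f x) \<le> B" by eventually_elim (auto intro: b)
  moreover have "f \<in> borel_measurable \<mu>" using f s by (simp cong: measurable_cong_sets)
  ultimately show ?thesis by (rule integrable_const_bound)
qed

lemma unit_interval_power_integrable:
  assumes "unit_interval_measure \<mu>" shows "integrable \<mu> (\<lambda>x. x ^ n)"
  by (rule unit_interval_integrable[OF assms, of _ 1]) (auto simp: power_le_one)

lemma polynomial_approximation_unit_interval:
  fixes f :: "real \<Rightarrow> real"
  assumes "continuous_on {0..1} f"
  shows "\<exists>N a. \<forall>n. \<forall>x\<in>{0..1}. \<bar>f x - (\<Sum>i\<le>N n. a n i * x ^ i)\<bar> < 1 / real (Suc n)"
proof -
  have "\<exists>(N::nat) a. \<forall>x\<in>{0..1}. \<bar>f x - (\<Sum>i\<le>N. a i * x ^ i)\<bar> < 1 / real (Suc n)" for n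
  proof -
    obtain g where "real_polynomial_function g" "\<And>x. x \<in> {0..1} \<Longrightarrow> \<bar>f x - g x\<bar> < 1 / real (Suc n)"
      using Stone_Weierstrass_real_polynomial_function[OF compact_Icc assms, of "1 / real (Suc n)"] by auto
    then show ?thesis unfolding real_polynomial_function_iff_sum by fastforce
  qed
  then show ?thesis by metis
qed

text \<open>
  By Weierstrass approximation on the unit interval. The coefficients depend on \<open>f\<close> alone and serve all measures
  simultaneously; this uniformity is what later makes families of measures measurable.
\<close>

lemma integral_as_moment_limit:
  fixes f :: "real \<Rightarrow> real"
  assumes f: "continuous_on UNIV f"
  shows "\<exists>N a. \<forall>\<mu>. unit_interval_measure \<mu> \<longrightarrow>
    (\<lambda>n. \<Sum>i\<le>N n. a n i * (\<integral>x. x ^ i \<partial>\<mu>)) \<longlonglongrightarrow> (\<integral>x. f x \<partial>\<mu>)"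
proof -
  obtain N :: "nat \<Rightarrow> nat" and a where Na:
    "\<And>n x. x \<in> {0..1} \<Longrightarrow> \<bar>f x - (\<Sum>i\<le>N n. a n i * x ^ i)\<bar> < 1 / real (Suc n)"
    using polynomial_approximation_unit_interval[OF continuous_on_subset[OF f]] by (metis subset_UNIV)
  have "(\<lambda>n. \<Sum>i\<le>N n. a n i * (\<integral>x. x ^ i \<partial>\<mu>)) \<longlonglongrightarrow> (\<integral>x. f x \<partial>\<mu>)" if \<mu>: "unit_interval_measure \<mu>" for \<mu>
  proof -
    interpret finite_measure \<mu> using \<mu> by (simp add: unit_interval_measure_def)
    have fm: "f \<in> borel_measurable borel" using f by (rule borel_measurable_continuous_onI)
    have "compact (f ` {0..1})" by (intro compact_continuous_image continuous_on_subset[OF f]) auto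
    then obtain B where B: "\<And>x. x \<in> {0..1} \<Longrightarrow> \<bar>f x\<bar> \<le> B"
      using compact_imp_bounded bounded_iff by (metis image_eqI real_norm_def)
    have fi: "integrable \<mu> f" by (rule unit_interval_integrable[OF \<mu> fm, of B]) (auto intro: B)
    have pi: "integrable \<mu> (\<lambda>x. \<Sum>i\<le>N n. a n i * x ^ i)" for n
      by (intro Bochner_Integration.integrable_sum integrable_mult_right unit_interval_power_integrable \<mu>)
    have eq: "(\<integral>x. (\<Sum>i\<le>N n. a n i * x ^ i) \<partial>\<mu>) = (\<Sum>i\<le>N n. a n i * (\<integral>x. x ^ i \<partial>\<mu>))" for n
      by (simp add: Bochner_Integration.integral_sum integrable_mult_right unit_interval_power_integrable[OF \<mu>])
    have "norm ((\<Sum>i\<le>N n. a n i * (\<integral>x. x ^ i \<partial>\<mu>)) - (\<integral>x. f x \<partial>\<mu>)) \<le> measure \<mu> (space \<mu>) * (1 / real (Suc n))" for n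
    proof -
      have ae: "AE x in \<mu>. 0 \<le> x \<and> x \<le> 1" using \<mu> by (simp add: unit_interval_measure_def)
      have "norm ((\<Sum>i\<le>N n. a n i * (\<integral>x. x ^ i \<partial>\<mu>)) - (\<integral>x. f x \<partial>\<mu>)) = norm (\<integral>x. (\<Sum>i\<le>N n. a n i * x ^ i) - f x \<partial>\<mu>)"
        using fi pi eq by simp
      also have "\<dots> \<le> (\<integral>x. norm ((\<Sum>i\<le>N n. a n i * x ^ i) - f x) \<partial>\<mu>)" by (rule integral_norm_bound)
      also have "\<dots> \<le> (\<integral>x. 1 / real (Suc n) \<partial>\<mu>)"
      proof (rule integral_mono_AE)
        show "integrable \<mu> (\<lambda>x. norm ((\<Sum>i\<le>N n. a n i * x ^ i) - f x))" using fi pi by simp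
        show "AE x in \<mu>. norm ((\<Sum>i\<le>N n. a n i * x ^ i) - f x) \<le> 1 / real (Suc n)"
          using ae
        proof eventually_elim
          case (elim x) then show ?case using Na[of x n] by (simp add: abs_minus_commute)
        qed
      qed simp
      finally show ?thesis by simp
    qed
    moreover have "(\<lambda>n. measure \<mu> (space \<mu>) * (1 / real (Suc n))) \<longlonglongrightarrow> 0"
      using tendsto_mult_left[OF LIMSEQ_Suc[OF lim_1_over_n], of "measure \<mu> (space \<mu>)"] by simp
    ultimately have "(\<lambda>n. (\<Sum>i\<le>N n. a n i * (\<integral>x. x ^ i \<partial>\<mu>)) - (\<integral>x. f x \<partial>\<mu>)) \<longlonglongrightarrow> 0"
      by (rule Lim_null_comparison[OF always_eventually, OF allI])
    then show ?thesis by (rule LIM_zero_cancel)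
  qed
  then show ?thesis by blast
qed

lemma abs_cts_step_le_1: "a < b \<Longrightarrow> \<bar>cts_step a b x\<bar> \<le> 1"
  by (auto simp: cts_step_def abs_le_iff divide_le_eq_1 divide_simps)

text \<open>
  The indicator of \<open>{..t}\<close> is a decreasing limit of continuous steps, whose integrals are limits of moment expressions. As
  the formula is the same for every measure, it gives both uniqueness and measurability.
\<close>

lemma cdf_as_moment_limit:
  "\<exists>N a. \<forall>\<mu>. unit_interval_measure \<mu> \<longrightarrow>
     measure \<mu> {..t::real} = lim (\<lambda>m. lim (\<lambda>n. \<Sum>i\<le>N m n. a m n i * (\<integral>x. x ^ i \<partial>\<mu>)))"
proof -
  define f where "f m = cts_step t (t + 1 / real (Suc m))" for m
  have c: "continuous_on UNIV (f m)" for m unfolding f_def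
    by (rule uniformly_continuous_imp_continuous[OF cts_step_uniformly_continuous]) simp
  have "\<forall>m. \<exists>N a. \<forall>\<mu>. unit_interval_measure \<mu> \<longrightarrow>
    (\<lambda>n. \<Sum>i\<le>N n. a n i * (\<integral>x. x ^ i \<partial>\<mu>)) \<longlonglongrightarrow> (\<integral>x. f m x \<partial>\<mu>)"
    using integral_as_moment_limit[OF c] by blast
  from choice[OF this] obtain N where "\<forall>m. \<exists>a. \<forall>\<mu>. unit_interval_measure \<mu> \<longrightarrow>
    (\<lambda>n. \<Sum>i\<le>N m n. a n i * (\<integral>x. x ^ i \<partial>\<mu>)) \<longlonglongrightarrow> (\<integral>x. f m x \<partial>\<mu>)" by blast
  from choice[OF this] obtain a where Na: "\<And>m \<mu>. unit_interval_measure \<mu> \<Longrightarrow>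
    (\<lambda>n. \<Sum>i\<le>N m n. a m n i * (\<integral>x. x ^ i \<partial>\<mu>)) \<longlonglongrightarrow> (\<integral>x. f m x \<partial>\<mu>)" by blast
  have "measure \<mu> {..t} = lim (\<lambda>m. lim (\<lambda>n. \<Sum>i\<le>N m n. a m n i * (\<integral>x. x ^ i \<partial>\<mu>)))"
    if \<mu>: "unit_interval_measure \<mu>" for \<mu>
  proof -
    interpret finite_measure \<mu> using \<mu> by (simp add: unit_interval_measure_def)
    have s: "sets \<mu> = sets borel" using \<mu> by (simp add: unit_interval_measure_def)
    have "(\<lambda>m. \<integral>x. f m x \<partial>\<mu>) \<longlonglongrightarrow> (\<integral>x. indicator {..t} x \<partial>\<mu>)"
    proof (rule integral_dominated_convergence[where w="\<lambda>_. 1"])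
      show "f m \<in> borel_measurable \<mu>" for m using borel_measurable_continuous_onI[OF c[of m]] s
        by (simp cong: measurable_cong_sets)
      show "AE x in \<mu>. (\<lambda>m. f m x) \<longlonglongrightarrow> indicator {..t} x"
      proof (intro AE_I2)
        fix x show "(\<lambda>m. f m x) \<longlonglongrightarrow> indicator {..t} x"
        proof (cases "x \<le> t")
          case True then show ?thesis by (simp add: f_def cts_step_def)
        next
          case False
          have "eventually (\<lambda>m. 1 / real (Suc m) < x - t) sequentially"
            using False order_tendstoD(2)[OF LIMSEQ_Suc[OF lim_1_over_n], of "x - t"] by simp
          then have "eventually (\<lambda>m. f m x = 0) sequentially"
            by eventually_elim (use False in \<open>auto simp: f_def cts_step_def\<close>)
          then show ?thesis using False by (simp add: tendsto_eventually)
        qed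
      qed
      show "AE x in \<mu>. norm (f m x) \<le> 1" for m
        unfolding f_def by (intro AE_I2) (simp add: abs_cts_step_le_1)
    qed (use s in \<open>auto cong: measurable_cong_sets\<close>)
    moreover have "(\<integral>x. indicator {..t} x \<partial>\<mu>) = measure \<mu> {..t}" using s by (simp add: sets_eq_imp_space_eq[OF s])
    moreover have "lim (\<lambda>n. \<Sum>i\<le>N m n. a m n i * (\<integral>x. x ^ i \<partial>\<mu>)) = (\<integral>x. f m x \<partial>\<mu>)" for m
      by (rule limI) (rule Na[OF \<mu>])
    ultimately show ?thesis by (simp add: limI)
  qed
  then show ?thesis by blast
qed

lemma unit_interval_measure_eqI:
  assumes "unit_interval_measure \<mu>" "unit_interval_measure \<nu>"
    and "\<And>n. (\<integral>x. x ^ n \<partial>\<mu>) = (\<integral>x. x ^ n \<partial>\<nu>)"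
  shows "\<mu> = \<nu>"
proof (rule cdf_unique')
  show "finite_borel_measure \<mu>" "finite_borel_measure \<nu>"
    using assms by (auto simp: unit_interval_measure_def finite_borel_measure_def finite_borel_measure_axioms_def)
  show "cdf \<mu> = cdf \<nu>"
  proof
    fix t
    obtain N a where Na: "\<And>\<mu>. unit_interval_measure \<mu> \<Longrightarrow>
      measure \<mu> {..t::real} = lim (\<lambda>m. lim (\<lambda>n. \<Sum>i\<le>N m n. a m n i * (\<integral>x. x ^ i \<partial>\<mu>)))"
      using cdf_as_moment_limit[of t] by blast
    show "cdf \<mu> t = cdf \<nu> t" using Na[OF assms(1)] Na[OF assms(2)] by (simp add: cdf_def assms(3))
  qed
qed

lemma kernel_measurable_from_moments:
  assumes K: "\<And>u. u \<in> space S \<Longrightarrow> prob_space (K u) \<and> unit_interval_measure (K u)"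
    and m: "\<And>n. (\<lambda>u. \<integral>x. x ^ n \<partial>K u) \<in> borel_measurable S"
  shows "K \<in> S \<rightarrow>\<^sub>M subprob_algebra borel"
proof (rule measurable_subprob_algebra_generated[where \<Omega>=UNIV and G="range (\<lambda>t::real. {..t})"])
  show "sets borel = sigma_sets UNIV (range (\<lambda>t::real. {..t}))"
    by (subst borel_eq_atMost) (simp add: sets_measure_of)
  show "Int_stable (range (\<lambda>t::real. {..t}))"
    unfolding Int_stable_def by (auto simp: Int_atMost)
  show "subprob_space (K u)" if "u \<in> space S" for u using K[OF that] by (simp add: prob_space_imp_subprob_space)
  show "sets (K u) = sets borel" if "u \<in> space S" for u using K[OF that] by (simp add: unit_interval_measure_def)
  show "(\<lambda>u. emeasure (K u) A) \<in> borel_measurable S" if "A \<in> range (\<lambda>t::real. {..t})" for A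
  proof -
    from that obtain t where A: "A = {..t}" by (elim rangeE)
    obtain N a where Na: "\<And>\<mu>. unit_interval_measure \<mu> \<Longrightarrow>
      measure \<mu> {..t::real} = lim (\<lambda>m. lim (\<lambda>n. \<Sum>i\<le>N m n. a m n i * (\<integral>x. x ^ i \<partial>\<mu>)))"
      using cdf_as_moment_limit[of t] by blast
    have "(\<lambda>u. ennreal (lim (\<lambda>m. lim (\<lambda>n. \<Sum>i\<le>N m n. a m n i * (\<integral>x. x ^ i \<partial>K u))))) \<in> borel_measurable S"
      using m by (intro measurable_compose[OF _ measurable_ennreal] borel_measurable_lim_metric borel_measurable_sum
         borel_measurable_times borel_measurable_const)
    then show ?thesis
      by (rule measurable_cong[THEN iffD1, rotated])
         (use K Na in \<open>simp add: A finite_measure.emeasure_eq_measure prob_space.finite_measure\<close>)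
  qed
  have "(\<lambda>u. 1::ennreal) \<in> borel_measurable S" by simp
  then show "(\<lambda>u. emeasure (K u) UNIV) \<in> borel_measurable S"
  proof (rule measurable_cong[THEN iffD1, rotated])
    fix u assume u: "u \<in> space S"
    have "space (K u) = UNIV" using K[OF u] by (metis unit_interval_measure_def sets_eq_imp_space_eq space_borel)
    then show "1 = emeasure (K u) UNIV" using K[OF u] prob_space.emeasure_space_1 by metis
  qed
qed auto

text \<open>
  In the intended case \<open>D k n\<close> is the integral of \<open>(1 - x) ^ k * x ^ n\<close>, and this is the binomial expansion of
  \<open>((1 - x) + x) ^ n * x ^ m\<close>; the recursion alone suffices for it.
\<close>

lemma hausdorff_weights_total:
  fixes D :: "nat \<Rightarrow> nat \<Rightarrow> real"
  assumes rec: "\<And>k n. D (Suc k) n = D k n - D k (Suc n)"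
  shows "(\<Sum>j\<le>n. real (n choose j) * D (n - j) (m + j)) = D 0 m"
proof (induction n)
  case 0 then show ?case by simp
next
  case (Suc n)
  have 1: "(\<Sum>j\<le>n. real (n choose Suc j) * D (n - j) (m + Suc j)) + D (Suc n) m =
      (\<Sum>j\<le>Suc n. real (n choose j) * D (Suc n - j) (m + j))"
    by (subst sum.atMost_Suc_shift) simp
  have "(\<Sum>j\<le>Suc n. real (Suc n choose j) * D (Suc n - j) (m + j)) =
      D (Suc n) m + (\<Sum>j\<le>n. real (Suc n choose Suc j) * D (n - j) (m + Suc j))"
    by (subst sum.atMost_Suc_shift) simp
  also have "\<dots> = (\<Sum>j\<le>n. real (n choose j) * D (n - j) (m + Suc j)) +
      ((\<Sum>j\<le>n. real (n choose Suc j) * D (n - j) (m + Suc j)) + D (Suc n) m)"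
    by (simp add: sum.distrib algebra_simps)
  also have "\<dots> = (\<Sum>j\<le>n. real (n choose j) * D (n - j) (m + Suc j)) +
      (\<Sum>j\<le>n. real (n choose j) * D (Suc n - j) (m + j))"
    unfolding 1 by simp
  also have "\<dots> = (\<Sum>j\<le>n. real (n choose j) * D (n - j) (m + j))"
    unfolding sum.distrib[symmetric] by (intro sum.cong refl) (simp add: Suc_diff_le rec algebra_simps)
  finally show ?case using Suc by simp
qed

text \<open>
  The binomial moments of the weights \<open>(N choose k) * D (N - k) k\<close>. Up to the factor \<open>N choose m\<close> they do
  not depend on \<open>N\<close>, which is why the limit of the discrete measures below has the prescribed moments.
\<close>

lemma hausdorff_factorial_moments:
  fixes D :: "nat \<Rightarrow> nat \<Rightarrow> real"
  assumes rec: "\<And>k n. D (Suc k) n = D k n - D k (Suc n)" and "m \<le> N"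
  shows "(\<Sum>k\<le>N. real (N choose k) * D (N - k) k * real (k choose m)) = real (N choose m) * D 0 m"
proof -
  have "(\<Sum>k\<le>N. real (N choose k) * D (N - k) k * real (k choose m)) =
      (\<Sum>k\<in>{m..N}. real (N choose k) * D (N - k) k * real (k choose m))"
    by (intro sum.mono_neutral_right) auto
  also have "\<dots> = (\<Sum>j\<in>{0..N - m}. real (N choose (m + j)) * D (N - (m + j)) (m + j) * real ((m + j) choose m))"
    using sum.atLeastAtMost_shift_0[OF \<open>m \<le> N\<close>, of "\<lambda>k. real (N choose k) * D (N - k) k * real (k choose m)"]
    by (simp add: o_def)
  also have "\<dots> = (\<Sum>j\<le>N - m. real (N choose m) * (real ((N - m) choose j) * D (N - m - j) (m + j)))"
  proof (rule sum.cong)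
    fix j assume "j \<in> {..N - m}"
    then have "real (N choose (m + j)) * real ((m + j) choose m) = real (N choose m) * real ((N - m) choose j)"
      using choose_mult[of m "m + j" N] \<open>m \<le> N\<close> unfolding of_nat_mult[symmetric] by (simp)
    then show "real (N choose (m + j)) * D (N - (m + j)) (m + j) * real ((m + j) choose m) =
      real (N choose m) * (real ((N - m) choose j) * D (N - m - j) (m + j))" by simp
  qed auto
  also have "\<dots> = real (N choose m) * D 0 m"
    using hausdorff_weights_total[of D, OF rec, of "N - m" m] by (simp add: sum_distrib_left[symmetric])
  finally show ?thesis .
qed

text \<open>
  The ratio of the binomial coefficients is a product of \<open>m\<close> factors \<open>(k - i) / (N - i)\<close>, each of which is within
  \<open>m / N\<close> of \<open>k / N\<close>. So for large \<open>N\<close> binomial moments can be traded for ordinary ones.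
\<close>

lemma power_vs_binomial_ratio:
  assumes "k \<le> N" "m \<le> N" "0 < N"
  shows "\<bar>(real k / real N) ^ m - real (k choose m) / real (N choose m)\<bar> \<le> real (m * m) / real N"
proof -
  define w where "w i = real (k - i) / real (N - i)" for i
  have w01: "0 \<le> w i" "w i \<le> 1" if "i < m" for i
    using that assms by (auto simp: w_def divide_le_eq)
  have "real (k choose m) / real (N choose m) = (\<Prod>i<m. w i)"
  proof (cases "m \<le> k")
    case True
    have "(\<Prod>i<m. w i) = (\<Prod>i=0..<m. (real (k - i) / real (m - i)) / (real (N - i) / real (m - i)))"
      by (rule prod.cong) (auto simp: w_def lessThan_atLeast0)
    then show ?thesis using True assms by (simp add: binomial_altdef_of_nat prod_dividef)
  next
    case False
    then have "(\<Prod>i<m. w i) = 0" by (intro prod_zero) (auto simp: w_def intro!: bexI[of _ k])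
    then show ?thesis using False by (simp add: binomial_eq_0)
  qed
  moreover have "(real k / real N) ^ m = (\<Prod>i<m. real k / real N)" by simp
  ultimately have "\<bar>(real k / real N) ^ m - real (k choose m) / real (N choose m)\<bar> = norm ((\<Prod>i<m. real k / real N) - (\<Prod>i<m. w i))"
    by simp
  also have "\<dots> \<le> (\<Sum>i<m. norm (real k / real N - w i))"
    by (rule norm_prod_diff) (use assms w01 in \<open>auto simp: divide_le_eq\<close>)
  also have "\<dots> \<le> (\<Sum>i<m. real m / real N)"
  proof (rule sum_mono)
    fix i assume "i \<in> {..<m}"
    then have i: "i < m" by simp
    have "\<bar>real k / real N - w i\<bar> \<le> real i / real N"
    proof (cases "i \<le> k")
      case True
      have pos: "0 < real N" "0 < real N - real i" using i assms by auto
      have "real k / real N - w i = real i * (real N - real k) / (real N * (real N - real i))"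
        using True i assms pos by (simp add: w_def of_nat_diff field_simps)
      moreover have "0 \<le> real i * (real N - real k) / (real N * (real N - real i))" using assms pos by simp
      moreover have "real i * (real N - real k) / (real N * (real N - real i)) \<le> real i / real N"
      proof -
        have "(real N - real k) / (real N - real i) \<le> 1" using True pos by simp
        then have "real i / real N * ((real N - real k) / (real N - real i)) \<le> real i / real N * 1"
          by (intro mult_left_mono) auto
        then show ?thesis by simp
      qed
      ultimately show ?thesis by linarith
    next
      case False then show ?thesis using assms by (simp add: w_def divide_right_mono)
    qed
    also have "\<dots> \<le> real m / real N" using i by (simp add: divide_right_mono)
    finally show "norm (real k / real N - w i) \<le> real m / real N" by simp
  qed
  finally show ?thesis by simp
qed

text \<open>
  Put the mass \<open>(N choose k) * D (N - k) k\<close> at the point \<open>k / N\<close>. These probability measures live on the unit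
  interval, so a subsequence converges weakly, and its moments converge to \<open>D 0 m\<close> by the two preceding lemmas.
\<close>

theorem hausdorff_moment_problem:
  fixes D :: "nat \<Rightarrow> nat \<Rightarrow> real"
  assumes pos: "\<And>k n. 0 \<le> D k n" and rec: "\<And>k n. D (Suc k) n = D k n - D k (Suc n)" and D00: "D 0 0 = 1"
  shows "\<exists>\<mu>. prob_space \<mu> \<and> unit_interval_measure \<mu> \<and> (\<forall>n. (\<integral>x. x ^ n \<partial>\<mu>) = D 0 n)"
proof -
  define w where "w N k = real (N choose k) * D (N - k) k" for N k
  have w0: "0 \<le> w N k" for N k by (simp add: w_def pos)
  have w1: "(\<Sum>k\<le>N. w N k) = 1" for N
    using hausdorff_weights_total[of D, OF rec, of N 0] by (simp add: w_def D00)
  define \<nu> where "\<nu> N = distr (point_measure {..N} (\<lambda>k. ennreal (w N k))) borel (\<lambda>k. real k / real N)" for N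
  have s: "sets (\<nu> N) = sets borel" "space (\<nu> N) = UNIV" for N by (simp_all add: \<nu>_def)
  have int: "(\<integral>x. f x \<partial>\<nu> N) = (\<Sum>k\<le>N. w N k * f (real k / real N))"
    if "f \<in> borel_measurable borel" for N and f :: "real \<Rightarrow> real"
    unfolding \<nu>_def using that w0
    by (subst integral_distr) (auto simp: lebesgue_integral_point_measure_finite measurable_point_measure_eq1)
  have em: "emeasure (\<nu> N) A = (\<Sum>k | k \<le> N \<and> real k / real N \<in> A. ennreal (w N k))" if "A \<in> sets borel" for A N
  proof -
    have "emeasure (\<nu> N) A = emeasure (point_measure {..N} (\<lambda>k. ennreal (w N k))) {k. k \<le> N \<and> real k / real N \<in> A}"
      unfolding \<nu>_def using that
      by (subst emeasure_distr) (auto simp: space_point_measure sets_point_measure measurable_def intro!: arg_cong2[where f=emeasure])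
    also have "\<dots> = (\<Sum>k | k \<le> N \<and> real k / real N \<in> A. ennreal (w N k))"
      by (rule emeasure_point_measure_finite) auto
    finally show ?thesis .
  qed
  have unit: "emeasure (\<nu> N) A = 1" if "A \<in> sets borel" "{0..1} \<subseteq> A" for A N
  proof -
    have "{k. k \<le> N \<and> real k / real N \<in> A} = {..N}" using that(2) by (auto simp: subset_eq divide_le_eq)
    then have "emeasure (\<nu> N) A = (\<Sum>k\<le>N. ennreal (w N k))" using em[OF that(1)] by simp
    also have "\<dots> = 1" using w1[of N] w0 by (simp add: sum_ennreal)
    finally show ?thesis .
  qed
  have rd: "real_distribution (\<nu> N)" for N
    unfolding real_distribution_def real_distribution_axioms_def
    by (auto intro!: prob_spaceI simp: unit s)
  have tight: "tight \<nu>"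
    unfolding tight_def
  proof (intro conjI allI impI rd)
    fix e :: real assume "0 < e"
    have "measure (\<nu> n) {-1<..1} = 1" for n
    proof -
      have "emeasure (\<nu> n) {-1<..1} = 1" by (rule unit) auto
      then show ?thesis by (simp add: measure_def)
    qed
    then show "\<exists>a b. a < b \<and> (\<forall>n. 1 - e < measure (\<nu> n) {a<..b})"
      using \<open>0 < e\<close> by (intro exI[of _ "-1"] exI[of _ 1]) auto
  qed
  obtain r \<mu> where r: "strict_mono (r :: nat \<Rightarrow> nat)" and rm: "real_distribution \<mu>" and wc: "weak_conv_m (\<lambda>n. \<nu> (r n)) \<mu>"
    using tight_imp_convergent_subsubsequence[OF tight, of id] by (auto simp: o_def strict_mono_def)
  interpret \<mu>: real_distribution \<mu> by fact
  \<comment> \<open>The identity on the unit interval, extended to a bounded continuous function on the line so that weak convergence applies to its powers.\<close>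
  define c where "c x = max 0 (min 1 x)" for x :: real
  have cc: "isCont c x" for x unfolding c_def by (intro continuous_intros)
  have conv: "(\<lambda>n. \<integral>x. f x \<partial>\<nu> (r n)) \<longlonglongrightarrow> (\<integral>x. f x \<partial>\<mu>)"
    if "\<And>x. isCont f x" "\<And>x. norm (f x) \<le> 1" for f :: "real \<Rightarrow> real"
    by (rule weak_conv_imp_integral_bdd_continuous_conv[OF rd rm wc that])
  have ae: "AE x in \<mu>. 0 \<le> x \<and> x \<le> 1"
  proof -
    define g where "g x = min 1 \<bar>x - c x\<bar>" for x
    have gc: "isCont g x" for x unfolding g_def using cc by (intro continuous_intros) auto
    have gm: "g \<in> borel_measurable borel"
      by (intro borel_measurable_continuous_onI continuous_at_imp_continuous_on ballI gc)
    have g0: "0 \<le> g x" and g1: "norm (g x) \<le> 1" for x by (auto simp: g_def)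
    have "c (real k / real N) = real k / real N" if "k \<le> N" for k N
      using that by (auto simp: c_def divide_le_eq)
    then have "(\<integral>x. g x \<partial>\<nu> N) = 0" for N by (subst int[OF gm]) (auto simp: g_def)
    then have "(\<integral>x. g x \<partial>\<mu>) = 0" using conv[OF gc g1] by (simp add: LIMSEQ_const_iff)
    moreover have "integrable \<mu> g" using g1 gm by (intro \<mu>.integrable_const_bound[of _ 1]) auto
    ultimately have "AE x in \<mu>. g x = 0"
      using integral_nonneg_eq_0_iff_AE[of \<mu> g] g0 by simp
    then show ?thesis by eventually_elim (auto simp: g_def c_def min_def max_def split: if_splits)
  qed
  have mom: "(\<integral>x. x ^ m \<partial>\<mu>) = D 0 m" for m
  proof -
    have c1: "norm (c x ^ m) \<le> 1" for x by (auto simp: c_def power_le_one)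
    have cm: "(\<lambda>x. c x ^ m) \<in> borel_measurable borel"
      using cc by (intro borel_measurable_continuous_onI continuous_at_imp_continuous_on ballI continuous_intros) auto
    have A: "\<bar>(\<integral>x. c x ^ m \<partial>\<nu> N) - D 0 m\<bar> \<le> real (m * m) / real N" if N: "m \<le> N" "0 < N" for N
    proof -
      have "(\<integral>x. c x ^ m \<partial>\<nu> N) = (\<Sum>k\<le>N. w N k * (real k / real N) ^ m)"
        unfolding int[OF cm] by (intro sum.cong refl) (auto simp: c_def divide_le_eq)
      moreover have "D 0 m = (\<Sum>k\<le>N. w N k * (real (k choose m) / real (N choose m)))"
      proof -
        have "real (N choose m) \<noteq> 0" using N by simp
        then have "D 0 m = (\<Sum>k\<le>N. w N k * real (k choose m)) / real (N choose m)"
          using hausdorff_factorial_moments[of D, OF rec N(1)] by (simp add: w_def)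
        then show ?thesis by (simp add: sum_divide_distrib)
      qed
      ultimately have "\<bar>(\<integral>x. c x ^ m \<partial>\<nu> N) - D 0 m\<bar> =
          \<bar>\<Sum>k\<le>N. w N k * ((real k / real N) ^ m - real (k choose m) / real (N choose m))\<bar>"
        by (simp add: sum_subtractf right_diff_distrib)
      also have "\<dots> \<le> (\<Sum>k\<le>N. w N k * (real (m * m) / real N))"
      proof (intro order_trans[OF sum_abs] sum_mono)
        fix k assume "k \<in> {..N}"
        then have "w N k * \<bar>(real k / real N) ^ m - real (k choose m) / real (N choose m)\<bar> \<le> w N k * (real (m * m) / real N)"
          using power_vs_binomial_ratio[OF _ N, of k] w0 by (intro mult_left_mono) auto
        then show "\<bar>w N k * ((real k / real N) ^ m - real (k choose m) / real (N choose m))\<bar> \<le> w N k * (real (m * m) / real N)"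
          using w0 by (simp add: abs_mult)
      qed
      also have "\<dots> = real (m * m) / real N" unfolding sum_distrib_right[symmetric] using w1[of N] by simp
      finally show ?thesis .
    qed
    have "(\<lambda>n. \<integral>x. c x ^ m \<partial>\<nu> (r n)) \<longlonglongrightarrow> D 0 m"
    proof (rule LIM_zero_cancel, rule Lim_null_comparison)
      show "eventually (\<lambda>n. norm ((\<integral>x. c x ^ m \<partial>\<nu> (r n)) - D 0 m) \<le> real (m * m) / real (r n)) sequentially"
        using eventually_ge_at_top[of "Suc m"]
      proof eventually_elim
        case (elim n)
        then have "Suc m \<le> r n" using seq_suble[OF r, of n] by linarith
        then show ?case using A[of "r n"] by simp
      qed
      have "(\<lambda>n. real (m * m) / real n) \<longlonglongrightarrow> 0" by (rule lim_const_over_n)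
      then show "(\<lambda>n. real (m * m) / real (r n)) \<longlonglongrightarrow> 0"
        using LIMSEQ_subseq_LIMSEQ[OF _ r] by (fastforce simp: o_def)
    qed
    moreover have "(\<lambda>n. \<integral>x. c x ^ m \<partial>\<nu> (r n)) \<longlonglongrightarrow> (\<integral>x. c x ^ m \<partial>\<mu>)"
      using cc c1 by (intro conv) (auto intro!: continuous_intros)
    ultimately have "(\<integral>x. c x ^ m \<partial>\<mu>) = D 0 m" using LIMSEQ_unique by blast
    moreover have "(\<integral>x. c x ^ m \<partial>\<mu>) = (\<integral>x. x ^ m \<partial>\<mu>)"
    proof (rule integral_cong_AE)
      show "AE x in \<mu>. c x ^ m = x ^ m" using ae by eventually_elim (simp add: c_def)
    qed (use cm in simp_all)
    ultimately show ?thesis by simp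
  qed
  show ?thesis
    using ae mom \<mu>.prob_space_axioms
    by (intro exI[of _ \<mu>]) (auto simp: unit_interval_measure_def \<mu>.finite_measure)
qed

section \<open>Completely monotone functions and Bernstein's theorem\<close>

lemma completely_monotone_DERIV:
  assumes "completely_monotone f" "0 < r"
  shows "((deriv ^^ n) f has_real_derivative (deriv ^^ Suc n) f r) (at r)"
  using assms DERIV_deriv_iff_real_differentiable[of "(deriv ^^ n) f" r] by (simp add: completely_monotone_def)

lemma completely_monotone_sign:
  assumes "completely_monotone f" "0 < r" shows "0 \<le> (-1) ^ n * (deriv ^^ n) f r"
  using assms by (auto simp: completely_monotone_def)

lemma completely_monotone_nonneg: "completely_monotone f \<Longrightarrow> 0 < r \<Longrightarrow> 0 \<le> f r"
  using completely_monotone_sign[of f r 0] by simp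

lemma completely_monotone_isCont: "completely_monotone f \<Longrightarrow> 0 < r \<Longrightarrow> isCont f r"
  using completely_monotone_DERIV[of f r 0] DERIV_isCont by fastforce

lemma completely_monotone_derivs_antimono:
  assumes f: "completely_monotone f" and "0 < x" "x \<le> y"
  shows "(-1) ^ n * (deriv ^^ n) f y \<le> (-1) ^ n * (deriv ^^ n) f x"
proof (rule DERIV_nonpos_imp_nonincreasing[OF \<open>x \<le> y\<close>])
  fix z assume "x \<le> z" "z \<le> y"
  then have z: "0 < z" using \<open>0 < x\<close> by simp
  show "\<exists>d. ((\<lambda>z. (-1) ^ n * (deriv ^^ n) f z) has_real_derivative d) (at z) \<and> d \<le> 0"
    using completely_monotone_sign[OF f z, of "Suc n"]
    by (intro exI[of _ "(-1) ^ n * (deriv ^^ Suc n) f z"] conjI DERIV_cmult completely_monotone_DERIV f z) simp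
qed

text \<open>
  Each derivative of a completely monotone function is monotone with alternating direction, so differences with a positive step
  inherit the sign pattern.
\<close>

lemma completely_monotone_difference:
  assumes f: "completely_monotone f" and h: "0 \<le> h"
  shows "completely_monotone (\<lambda>x. f x - f (x + h))"
proof -
  let ?g = "\<lambda>x. f x - f (x + h)"
  have D: "((\<lambda>x. (deriv ^^ n) f x - (deriv ^^ n) f (x + h)) has_real_derivative
        ((deriv ^^ Suc n) f r - (deriv ^^ Suc n) f (r + h))) (at r)" if "0 < r" for n r
    using that h completely_monotone_DERIV[OF f, of r n] completely_monotone_DERIV[OF f, of "r + h" n]
    by (intro DERIV_diff) (auto simp: DERIV_shift)
  have E: "\<forall>r>0. (deriv ^^ n) ?g r = (deriv ^^ n) f r - (deriv ^^ n) f (r + h)" for n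
  proof (induction n)
    case 0 then show ?case by simp
  next
    case (Suc n)
    show ?case
    proof (intro allI impI)
      fix r :: real assume r: "0 < r"
      have "((deriv ^^ n) ?g has_real_derivative ((deriv ^^ Suc n) f r - (deriv ^^ Suc n) f (r + h))) (at r)"
        by (rule has_field_derivative_transform_within_open[OF D[OF r] open_greaterThan[of 0]]) (use r Suc in auto)
      then show "(deriv ^^ Suc n) ?g r = (deriv ^^ Suc n) f r - (deriv ^^ Suc n) f (r + h)"
        using DERIV_imp_deriv by fastforce
    qed
  qed
  show ?thesis
    unfolding completely_monotone_def
  proof (intro allI impI conjI)
    fix n and r :: real assume r: "0 < r"
    have "((deriv ^^ n) ?g has_real_derivative ((deriv ^^ Suc n) f r - (deriv ^^ Suc n) f (r + h))) (at r)"
      by (rule has_field_derivative_transform_within_open[OF D[OF r] open_greaterThan[of 0]]) (use r E in auto)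
    then show "(deriv ^^ n) ?g differentiable (at r)" by (auto simp: real_differentiable_def)
    show "0 \<le> (-1) ^ n * (deriv ^^ n) ?g r"
      using completely_monotone_derivs_antimono[OF f r, of "r + h" n] r h E[of n] by (simp add: right_diff_distrib)
  qed
qed

text \<open>
  Iterated differences of \<open>f\<close> along the grid \<open>a + n * h\<close> are nonnegative, which is precisely the hypothesis of the
  Hausdorff moment problem.
\<close>

lemma completely_monotone_grid_moments:
  assumes f: "completely_monotone f" and a: "0 < a" "0 < f a" and h: "0 \<le> h"
  shows "\<exists>\<mu>. prob_space \<mu> \<and> unit_interval_measure \<mu> \<and> (\<forall>n. (\<integral>x. x ^ n \<partial>\<mu>) = f (a + real n * h) / f a)"
proof -
  define g where "g k = ((\<lambda>g x. g x - g (x + h)) ^^ k) f" for k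
  have cm: "completely_monotone (g k)" for k
    unfolding g_def by (induction k) (auto intro: f completely_monotone_difference h)
  have gs: "g (Suc k) x = g k x - g k (x + h)" for k x by (simp add: g_def)
  have pos: "0 < a + real n * h" for n using a h by (simp add: add_pos_nonneg)
  have "\<exists>\<mu>. prob_space \<mu> \<and> unit_interval_measure \<mu> \<and>
      (\<forall>n. (\<integral>x. x ^ n \<partial>\<mu>) = (\<lambda>k n. g k (a + real n * h) / f a) 0 n)"
  proof (rule hausdorff_moment_problem)
    show "0 \<le> g k (a + real n * h) / f a" for k n
      using completely_monotone_nonneg[OF cm pos] a by simp
    show "g (Suc k) (a + real n * h) / f a = g k (a + real n * h) / f a - g k (a + real (Suc n) * h) / f a" for k n
      by (simp add: gs diff_divide_distrib algebra_simps)
  qed (use a in \<open>simp add: g_def\<close>)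
  then show ?thesis by (simp add: g_def)
qed

text \<open>
  The measures obtained on the grids of step \<open>1 / 2 ^ j\<close> are consistent: raising to the power \<open>2 ^ j\<close> sends the
  \<open>j\<close>-th one to the one for the step 1. Hence the latter interpolates \<open>f\<close> at all dyadic points, and everywhere by continuity.
  The base point \<open>a\<close> has to be positive since \<open>f\<close> may be unbounded near 0.
\<close>

lemma bernstein_shifted:
  assumes f: "completely_monotone f" and a: "0 < a" "0 < f a"
  shows "\<exists>\<mu>. prob_space \<mu> \<and> unit_interval_measure \<mu> \<and> (\<forall>r>0. (\<integral>x. x powr r \<partial>\<mu>) = f (a + r) / f a)"
proof -
  have "\<forall>j::nat. \<exists>\<mu>. prob_space \<mu> \<and> unit_interval_measure \<mu> \<and> (\<forall>n. (\<integral>x. x ^ n \<partial>\<mu>) = f (a + real n * (1 / 2 ^ j)) / f a)"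
    by (intro allI completely_monotone_grid_moments f a) simp
  from choice[OF this] obtain \<mu> where prob: "\<And>j. prob_space (\<mu> j)" and unit: "\<And>j. unit_interval_measure (\<mu> j)"
    and mom: "\<And>j n. (\<integral>x. x ^ n \<partial>\<mu> j) = f (a + real n * (1 / 2 ^ j)) / f a"
    by blast
  have s: "sets (\<mu> j) = sets borel" for j using unit by (simp add: unit_interval_measure_def)
  note [measurable_cong] = s
  have ae: "AE x in \<mu> j. 0 \<le> x \<and> x \<le> 1" for j using unit by (simp add: unit_interval_measure_def)
  have consistent: "distr (\<mu> j) borel (\<lambda>x. x ^ 2 ^ j) = \<mu> 0" for j
  proof (rule unit_interval_measure_eqI)
    interpret prob_space "\<mu> j" by (rule prob)
    show "unit_interval_measure (distr (\<mu> j) borel (\<lambda>x. x ^ 2 ^ j))"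
      unfolding unit_interval_measure_def
    proof (intro conjI finite_measure_distr)
      have "AE x in \<mu> j. 0 \<le> x ^ 2 ^ j \<and> x ^ 2 ^ j \<le> 1"
        using ae[of j] by eventually_elim (simp add: power_le_one)
      then show "AE x in distr (\<mu> j) borel (\<lambda>x. x ^ 2 ^ j). 0 \<le> x \<and> x \<le> 1"
        by (subst AE_distr_iff) simp_all
    qed simp_all
    show "(\<integral>x. x ^ n \<partial>distr (\<mu> j) borel (\<lambda>x. x ^ 2 ^ j)) = (\<integral>x. x ^ n \<partial>\<mu> 0)" for n
      by (subst integral_distr) (simp_all add: mom power_mult[symmetric])
  qed (rule unit)
  interpret prob_space "\<mu> 0" by (rule prob)
  have dyadic: "(\<integral>x. x powr (real n / 2 ^ j) \<partial>\<mu> 0) = f (a + real n / 2 ^ j) / f a" if "0 < n" for n j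
  proof -
    have "(\<integral>x. x powr (real n / 2 ^ j) \<partial>\<mu> 0) = (\<integral>x. (x ^ 2 ^ j) powr (real n / 2 ^ j) \<partial>\<mu> j)"
      by (subst consistent[of j, symmetric], subst integral_distr) simp_all
    also have "\<dots> = (\<integral>x. x ^ n \<partial>\<mu> j)"
    proof (intro integral_cong_AE)
      show "AE x in \<mu> j. (x ^ 2 ^ j) powr (real n / 2 ^ j) = x ^ n"
        using ae[of j]
      proof eventually_elim
        case (elim x)
        show ?case
        proof (cases "x = 0")
          case False
          then have "x ^ 2 ^ j = x powr (2 ^ j)" using elim powr_realpow[of x "2 ^ j"] by simp
          then have "(x ^ 2 ^ j) powr (real n / 2 ^ j) = x powr real n" by (simp add: powr_powr)
          then show ?thesis using False elim by (simp add: powr_realpow)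
        qed (use that in \<open>simp add: zero_power\<close>)
      qed
    qed simp_all
    finally show ?thesis by (simp add: mom)
  qed
  have "(\<integral>x. x powr r \<partial>\<mu> 0) = f (a + r) / f a" if r: "0 < r" for r
  proof -
    \<comment> \<open>Dyadic approximation from above, which keeps the exponents positive.\<close>
    define n where "n j = nat \<lceil>r * 2 ^ j\<rceil>" for j :: nat
    define t where "t j = real (n j) / 2 ^ j" for j :: nat
    have n0: "0 < n j" for j using r by (simp add: n_def)
    have nb: "r * 2 ^ j \<le> real (n j)" "real (n j) \<le> r * 2 ^ j + 1" for j
      using r of_int_ceiling_le_add_one[of "r * 2 ^ j"] by (auto simp: n_def)
    have tb: "r \<le> t j" "t j \<le> r + (1/2) ^ j" for j
      using nb[of j] by (auto simp: t_def field_simps)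
    have "(\<lambda>j. (1/2::real) ^ j) \<longlonglongrightarrow> 0" by (intro LIMSEQ_power_zero) simp
    then have "(\<lambda>j. r + (1/2) ^ j) \<longlonglongrightarrow> r + 0" by (intro tendsto_add tendsto_const)
    then have tl: "t \<longlonglongrightarrow> r"
      by (intro tendsto_sandwich[OF _ _ tendsto_const, of r t]) (use tb in auto)
    have "(\<lambda>j. \<integral>x. x powr t j \<partial>\<mu> 0) \<longlonglongrightarrow> (\<integral>x. x powr r \<partial>\<mu> 0)"
    proof (rule integral_dominated_convergence[where w="\<lambda>_. 1"])
      show "AE x in \<mu> 0. (\<lambda>j. x powr t j) \<longlonglongrightarrow> x powr r"
      proof (intro AE_I2)
        fix x :: real show "(\<lambda>j. x powr t j) \<longlonglongrightarrow> x powr r"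
          using tl by (cases "x = 0") (auto intro!: tendsto_powr)
      qed
      show "AE x in \<mu> 0. norm (x powr t j) \<le> 1" for j
        using ae[of 0]
      proof eventually_elim
        case (elim x)
        have "x powr t j \<le> 1 powr t j" using elim tb(1)[of j] r by (intro powr_mono2) auto
        then show ?case by simp
      qed
    qed simp_all
    then have "(\<lambda>j. f (a + t j) / f a) \<longlonglongrightarrow> (\<integral>x. x powr r \<partial>\<mu> 0)"
      using dyadic[OF n0] by (simp add: t_def)
    moreover have "(\<lambda>j. f (a + t j) / f a) \<longlonglongrightarrow> f (a + r) / f a"
    proof -
      have "(\<lambda>j. a + t j) \<longlonglongrightarrow> a + r" using tl by (intro tendsto_intros)
      moreover have "isCont f (a + r)" using completely_monotone_isCont[OF f] a r by simp
      ultimately have "(\<lambda>j. f (a + t j)) \<longlonglongrightarrow> f (a + r)" by (rule isCont_tendsto_compose[rotated])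
      then show ?thesis using a by (intro tendsto_divide tendsto_const) auto
    qed
    ultimately show ?thesis by (rule LIMSEQ_unique)
  qed
  then show ?thesis using prob unit by blast
qed

text \<open>
  Letting the exponent tend to 0 shows that 0 carries no mass, by continuity of \<open>f\<close> at \<open>a\<close>. Letting it tend to infinity
  shows that 1 carries none, as \<open>f\<close> vanishes at infinity.
\<close>

lemma bernstein_shifted_support:
  assumes f: "completely_monotone f" and a: "0 < a" "0 < f a" and f0: "(f \<longlongrightarrow> 0) at_top"
    and \<mu>: "prob_space \<mu>" "unit_interval_measure \<mu>" and mom: "\<And>r. 0 < r \<Longrightarrow> (\<integral>x. x powr r \<partial>\<mu>) = f (a + r) / f a"
  shows "AE x in \<mu>. 0 < x \<and> x < 1"
proof -
  interpret prob_space \<mu> by fact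
  have s[measurable_cong]: "sets \<mu> = sets borel" using \<mu> by (simp add: unit_interval_measure_def)
  have ae: "AE x in \<mu>. 0 \<le> x \<and> x \<le> 1" using \<mu> by (simp add: unit_interval_measure_def)
  have "(\<lambda>n. \<integral>x. x powr (1 / real (Suc n)) \<partial>\<mu>) \<longlonglongrightarrow> (\<integral>x. indicator {0<..} x \<partial>\<mu>)"
  proof (rule integral_dominated_convergence[where w="\<lambda>_. 1"])
    show "AE x in \<mu>. (\<lambda>n. x powr (1 / real (Suc n))) \<longlonglongrightarrow> indicator {0<..} x"
      using ae
    proof eventually_elim
      case (elim x)
      show ?case
      proof (cases "x = 0")
        case False
        have "(\<lambda>n. x powr (1 / real (Suc n))) \<longlonglongrightarrow> x powr 0"
          using False by (intro tendsto_powr tendsto_const LIMSEQ_Suc[OF lim_1_over_n]) auto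
        then show ?thesis using False elim by simp
      qed simp
    qed
    show "AE x in \<mu>. norm (x powr (1 / real (Suc n))) \<le> 1" for n
      using ae by eventually_elim (use powr_mono2[of "1 / real (Suc n)" _ 1] in auto)
  qed simp_all
  moreover have "(\<lambda>n. \<integral>x. x powr (1 / real (Suc n)) \<partial>\<mu>) \<longlonglongrightarrow> 1"
  proof -
    have "(\<lambda>n. a + 1 / real (Suc n)) \<longlonglongrightarrow> a + 0" by (intro tendsto_intros LIMSEQ_Suc[OF lim_1_over_n])
    then have "(\<lambda>n. f (a + 1 / real (Suc n))) \<longlonglongrightarrow> f a"
      using isCont_tendsto_compose[OF completely_monotone_isCont[OF f a(1)]] by simp
    then have "(\<lambda>n. f (a + 1 / real (Suc n)) / f a) \<longlonglongrightarrow> f a / f a" using a by (intro tendsto_divide tendsto_const) auto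
    then show ?thesis using a mom by simp
  qed
  ultimately have "(\<integral>x. indicator {0<..} x \<partial>\<mu>) = (1::real)" by (rule LIMSEQ_unique)
  then have "prob {0<..} = 1" by (simp add: sets_eq_imp_space_eq[OF s])
  then have 1: "AE x in \<mu>. x \<in> {0<..}" using prob_eq_1[of "{0<..}"] by simp
  have "(\<lambda>n. \<integral>x. x powr real (Suc n) \<partial>\<mu>) \<longlonglongrightarrow> (\<integral>x. indicator {1} x \<partial>\<mu>)"
  proof (rule integral_dominated_convergence[where w="\<lambda>_. 1"])
    show "AE x in \<mu>. (\<lambda>n. x powr real (Suc n)) \<longlonglongrightarrow> indicator {1} x"
      using ae 1
    proof eventually_elim
      case (elim x)
      show ?case
      proof (cases "x = 1")
        case False
        then have "(\<lambda>n. x ^ Suc n) \<longlonglongrightarrow> 0" using elim by (intro LIMSEQ_Suc LIMSEQ_power_zero) auto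
        moreover have "x powr real (Suc n) = x ^ Suc n" for n using elim by (intro powr_realpow) simp
        ultimately show ?thesis using False by simp
      qed simp
    qed
    show "AE x in \<mu>. norm (x powr real (Suc n)) \<le> 1" for n
      using ae by eventually_elim (use powr_mono2[of "real (Suc n)" _ 1] in auto)
  qed simp_all
  moreover have "(\<lambda>n. \<integral>x. x powr real (Suc n) \<partial>\<mu>) \<longlonglongrightarrow> 0"
  proof -
    have "filterlim (\<lambda>n. a + real (Suc n)) at_top sequentially"
      by (intro filterlim_tendsto_add_at_top[OF tendsto_const] filterlim_compose[OF filterlim_real_sequentially filterlim_Suc])
    then have "(\<lambda>n. f (a + real (Suc n))) \<longlonglongrightarrow> 0" by (rule filterlim_compose[OF f0])
    then have "(\<lambda>n. f (a + real (Suc n)) / f a) \<longlonglongrightarrow> 0 / f a" using a by (intro tendsto_divide tendsto_const) auto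
    then show ?thesis using mom by simp
  qed
  ultimately have "(\<integral>x. indicator {1} x \<partial>\<mu>) = (0::real)" by (rule LIMSEQ_unique)
  then have "prob {1} = 0" by (simp add: sets_eq_imp_space_eq[OF s])
  then have 2: "AE x in \<mu>. x \<notin> {1}" using prob_eq_0[of "{1}"] s by simp
  show ?thesis using 1 2 ae by eventually_elim auto
qed

text \<open>
  Bernstein's theorem, transported to the unit interval by \<open>x = exp (- s)\<close> and with the Laplace measure weighted by
  \<open>exp (- s)\<close>, which makes it a probability measure after division by \<open>f 1\<close>. Only exponents below 1 need an argument: the measure
  with base point \<open>r\<close> and the one with base point 1 have densities with respect to each other, namely multiples of powers.
\<close>

theorem bernstein:
  assumes f: "completely_monotone f" and pos: "\<And>r. 0 < r \<Longrightarrow> 0 < f r" and f0: "(f \<longlongrightarrow> 0) at_top"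
  shows "\<exists>\<mu>. prob_space \<mu> \<and> unit_interval_measure \<mu> \<and> (AE x in \<mu>. 0 < x \<and> x < 1) \<and>
    (\<forall>r>0. (\<integral>\<^sup>+x. ennreal (x powr (r - 1)) \<partial>\<mu>) = ennreal (f r / f 1))"
proof -
  have "\<forall>a. \<exists>\<mu>. 0 < a \<longrightarrow> prob_space \<mu> \<and> unit_interval_measure \<mu> \<and> (AE x in \<mu>. 0 < x \<and> x < 1) \<and>
     (\<forall>r>0. (\<integral>x. x powr r \<partial>\<mu>) = f (a + r) / f a)"
    using bernstein_shifted[OF f _ pos] bernstein_shifted_support[OF f _ pos f0] by meson
  from choice[OF this] obtain \<mu> where prob: "\<And>a. 0 < a \<Longrightarrow> prob_space (\<mu> a)" and unit: "\<And>a. 0 < a \<Longrightarrow> unit_interval_measure (\<mu> a)"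
    and ae: "\<And>a. 0 < a \<Longrightarrow> AE x in \<mu> a. 0 < x \<and> x < 1"
    and mom: "\<And>a r. 0 < a \<Longrightarrow> 0 < r \<Longrightarrow> (\<integral>x. x powr r \<partial>\<mu> a) = f (a + r) / f a"
    by blast
  have s: "sets (\<mu> a) = sets borel" if "0 < a" for a using unit[OF that] by (simp add: unit_interval_measure_def)
  have nn: "(\<integral>\<^sup>+x. ennreal (x powr r) \<partial>\<mu> a) = ennreal (f (a + r) / f a)" if a: "0 < a" and r: "0 < r" for a r
  proof -
    interpret prob_space "\<mu> a" by (rule prob[OF a])
    have "integrable (\<mu> a) (\<lambda>x. x powr r)"
      by (rule unit_interval_integrable[OF unit[OF a], of _ 1]) (use r powr_mono2[of r _ 1] in auto)
    then show ?thesis using mom[OF a r] by (simp add: nn_integral_eq_integral)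
  qed
  have "(\<integral>\<^sup>+x. ennreal (x powr (r - 1)) \<partial>\<mu> 1) = ennreal (f r / f 1)" if r: "0 < r" for r
  proof -
    consider "1 < r" | "r = 1" | "r < 1" by linarith
    then show ?thesis
    proof cases
      case 1 then show ?thesis using nn[of 1 "r - 1"] by simp
    next
      case 2
      have "(\<integral>\<^sup>+x. ennreal (x powr 0) \<partial>\<mu> 1) = (\<integral>\<^sup>+x. 1 \<partial>\<mu> 1)"
      proof (rule nn_integral_cong_AE)
        show "AE x in \<mu> 1. ennreal (x powr 0) = 1" using ae[OF zero_less_one] by eventually_elim simp
      qed
      then show ?thesis using 2 pos[of 1] prob[of 1] by (simp add: prob_space.emeasure_space_1)
    next
      case 3
      define c where "c = f r / f 1"
      have c: "0 < c" using pos[of 1] pos[OF r] by (simp add: c_def)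
      note [measurable_cong] = s[OF r]
      \<comment> \<open>Tilting the measure with base point \<open>r\<close> moves its base point to 1; the constant restores total mass 1.\<close>
      define \<nu> where "\<nu> = density (\<mu> r) (\<lambda>x. ennreal (c * x powr (1 - r)))"
      interpret prob_space "\<mu> r" by (rule prob[OF r])
      have tot: "emeasure \<nu> (space \<nu>) = 1"
      proof -
        have "emeasure \<nu> (space \<nu>) = (\<integral>\<^sup>+x. ennreal c * ennreal (x powr (1 - r)) \<partial>\<mu> r)"
          unfolding \<nu>_def using c by (subst emeasure_density) (auto simp: ennreal_mult intro!: nn_integral_cong)
        also have "\<dots> = ennreal c * ennreal (f 1 / f r)"
          using nn[OF r, of "1 - r"] 3 by (subst nn_integral_cmult) auto
        also have "\<dots> = 1" using c pos[of 1] pos[OF r] by (simp add: c_def ennreal_mult[symmetric])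
        finally show ?thesis .
      qed
      have "\<nu> = \<mu> 1"
      proof (rule unit_interval_measure_eqI)
        have "finite_measure \<nu>" using tot by (intro finite_measureI) simp
        moreover have "AE x in \<mu> r. 0 < ennreal (c * x powr (1 - r)) \<longrightarrow> 0 \<le> x \<and> x \<le> 1"
          using ae[OF r] by eventually_elim simp
        then have "AE x in \<nu>. 0 \<le> x \<and> x \<le> 1"
          unfolding \<nu>_def by (subst AE_density) simp_all
        moreover have "sets \<nu> = sets borel" using s[OF r] by (simp add: \<nu>_def)
        ultimately show "unit_interval_measure \<nu>" by (simp add: unit_interval_measure_def)
        show "unit_interval_measure (\<mu> 1)" by (rule unit) simp
        fix n :: nat
        have "(\<integral>x. x ^ n \<partial>\<nu>) = (\<integral>x. c * x powr (1 - r) * x ^ n \<partial>\<mu> r)"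
          unfolding \<nu>_def using c by (subst integral_density) auto
        also have "\<dots> = (\<integral>x. c * x powr (real n + (1 - r)) \<partial>\<mu> r)"
        proof (rule integral_cong_AE)
          show "AE x in \<mu> r. c * x powr (1 - r) * x ^ n = c * x powr (real n + (1 - r))"
            using ae[OF r] by eventually_elim (simp add: powr_realpow[symmetric] powr_add mult.commute del: powr_realpow)
        qed simp_all
        also have "\<dots> = c * (f (r + (real n + (1 - r))) / f r)"
          using mom[OF r, of "real n + (1 - r)"] 3 by simp
        also have "\<dots> = f (1 + real n) / f 1" using pos[OF r] by (simp add: c_def add.commute)
        also have "\<dots> = (\<integral>x. x ^ n \<partial>\<mu> 1)"
        proof (cases "n = 0")
          case True then show ?thesis using pos[of 1] prob_space.prob_space[OF prob[of 1]] by simp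
        next
          case False
          have "(\<integral>x. x ^ n \<partial>\<mu> 1) = (\<integral>x. x powr real n \<partial>\<mu> 1)"
          proof (rule integral_cong_AE)
            show "AE x in \<mu> 1. x ^ n = x powr real n"
              using ae[OF zero_less_one] by eventually_elim (simp add: powr_realpow)
          qed (use s[of 1] in \<open>simp_all cong: measurable_cong_sets\<close>)
          then show ?thesis using mom[of 1 "real n"] False by simp
        qed
        finally show "(\<integral>x. x ^ n \<partial>\<nu>) = (\<integral>x. x ^ n \<partial>\<mu> 1)" .
      qed
      then have "(\<integral>\<^sup>+x. ennreal (x powr (r - 1)) \<partial>\<mu> 1) = (\<integral>\<^sup>+x. ennreal (x powr (r - 1)) \<partial>\<nu>)" by simp
      also have "\<dots> = (\<integral>\<^sup>+x. ennreal (c * x powr (1 - r)) * ennreal (x powr (r - 1)) \<partial>\<mu> r)"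
        unfolding \<nu>_def by (subst nn_integral_density) auto
      also have "\<dots> = (\<integral>\<^sup>+x. ennreal c \<partial>\<mu> r)"
      proof (rule nn_integral_cong_AE)
        show "AE x in \<mu> r. ennreal (c * x powr (1 - r)) * ennreal (x powr (r - 1)) = ennreal c"
          using ae[OF r]
          by eventually_elim (use c in \<open>simp add: ennreal_mult[symmetric] mult.assoc powr_add[symmetric]\<close>)
      qed
      also have "\<dots> = ennreal (f r / f 1)" by (simp add: emeasure_space_1 c_def)
      finally show ?thesis .
    qed
  qed
  then show ?thesis using prob[of 1] unit[of 1] ae[of 1] by (intro exI[of _ "\<mu> 1"]) auto
qed

section \<open>Laplace transforms of measures on the half line\<close>

text \<open>
  The term of order \<open>n\<close> in the exponential series, applied with half of the rate. It provides the dominating functions for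
  differentiating Laplace transforms.
\<close>

lemma power_times_exp_le:
  fixes s :: real
  assumes "0 \<le> s" "0 < r"
  shows "s ^ n * exp (- r * s) \<le> fact n * (2 / r) ^ n * exp (- (r / 2) * s)"
proof -
  have "(r / 2 * s) ^ n / fact n \<le> exp (r / 2 * s)"
  proof -
    have "(\<Sum>k\<in>{n}. (r / 2 * s) ^ k /\<^sub>R fact k) \<le> (\<Sum>k. (r / 2 * s) ^ k /\<^sub>R fact k)"
      using assms by (intro sum_le_suminf summable_exp_generic) auto
    then show ?thesis unfolding exp_def real_scaleR_def divide_inverse_commute by simp
  qed
  then have "s ^ n \<le> fact n * (2 / r) ^ n * exp (r / 2 * s)"
    using assms by (simp add: field_simps power_mult_distrib power_divide)
  then have "s ^ n * exp (- r * s) \<le> fact n * (2 / r) ^ n * exp (r / 2 * s) * exp (- r * s)"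
    by (intro mult_right_mono) auto
  also have "\<dots> = fact n * (2 / r) ^ n * exp (- (r / 2) * s)"
    by (simp add: mult.assoc exp_add[symmetric] algebra_simps)
  finally show ?thesis .
qed

lemma exp_difference_quotient_bound:
  fixes s :: real
  assumes s: "0 \<le> s" and h: "\<bar>h\<bar> \<le> r / 2" "h \<noteq> 0"
  shows "\<bar>(exp (- (r + h) * s) - exp (- r * s)) / h\<bar> \<le> s * exp (- (r / 2) * s)"
proof -
  have *: "\<bar>exp k - 1\<bar> \<le> \<bar>k\<bar> * exp \<bar>k\<bar>" for k :: real
  proof (cases "0 \<le> k")
    case True
    have "1 - k \<le> exp (- k)" using exp_ge_add_one_self[of "- k"] by simp
    then have "(1 - k) * exp k \<le> exp (- k) * exp k" by (intro mult_right_mono) auto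
    then have "exp k - k * exp k \<le> 1" by (simp add: exp_add[symmetric] left_diff_distrib)
    moreover have "1 \<le> exp k" using True by simp
    ultimately show ?thesis using True by simp
  next
    case False
    have "- k \<le> - k * exp (- k)" using False mult_left_mono[of 1 "exp (- k)" "- k"] by simp
    moreover have "1 + k \<le> exp k" by (rule exp_ge_add_one_self)
    moreover have "exp k \<le> 1" using False by simp
    ultimately show ?thesis using False by linarith
  qed
  have hs: "\<bar>- h * s\<bar> \<le> r / 2 * s" using s h mult_right_mono[of "\<bar>h\<bar>" "r / 2" s] by (simp add: abs_mult)
  have "- (r + h) * s = - r * s + - h * s" by (simp add: algebra_simps)
  then have "exp (- (r + h) * s) - exp (- r * s) = exp (- r * s) * (exp (- h * s) - 1)"
    by (simp only: exp_add right_diff_distrib mult_1_right)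
  then have "\<bar>exp (- (r + h) * s) - exp (- r * s)\<bar> = exp (- r * s) * \<bar>exp (- h * s) - 1\<bar>"
    by (simp only: abs_mult abs_exp_cancel)
  also have "\<dots> \<le> exp (- r * s) * (\<bar>- h * s\<bar> * exp (r / 2 * s))"
  proof (intro mult_left_mono order_trans[OF *] )
    show "exp \<bar>- h * s\<bar> \<le> exp (r / 2 * s)" using hs by (simp only: exp_le_cancel_iff)
  qed simp_all
  also have "\<dots> = \<bar>h\<bar> * s * (exp (- r * s) * exp (r / 2 * s))"
    using s by (simp add: abs_mult)
  also have "exp (- r * s) * exp (r / 2 * s) = exp (- (r / 2) * s)"
    unfolding exp_add[symmetric] by (rule arg_cong[of _ _ exp]) simp
  finally show ?thesis using h by (simp add: divide_le_eq mult_ac)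
qed

locale laplace_measure =
  fixes Q :: "real measure"
  assumes sets_Q[measurable_cong, simp]: "sets Q = sets borel"
    and nonneg_AE: "AE s in Q. 0 \<le> s"
    and integrable_exp: "\<And>r. 0 < r \<Longrightarrow> integrable Q (\<lambda>s. exp (- r * s))"
begin

lemma integrable_power_exp:
  assumes r: "0 < r" shows "integrable Q (\<lambda>s. s ^ n * exp (- r * s))"
proof (rule Bochner_Integration.integrable_bound)
  show "integrable Q (\<lambda>s. fact n * (2 / r) ^ n * exp (- (r / 2) * s))"
    using r by (intro integrable_mult_right integrable_exp) simp
  show "AE s in Q. norm (s ^ n * exp (- r * s)) \<le> norm (fact n * (2 / r) ^ n * exp (- (r / 2) * s))"
    using nonneg_AE by eventually_elim (use power_times_exp_le[OF _ r] r in \<open>simp add: abs_mult\<close>)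
qed simp

text \<open>
  Differentiation under the integral sign; the difference quotients are dominated for steps of at most \<open>r / 2\<close>.
\<close>

lemma DERIV_power_exp:
  assumes r: "0 < r"
  shows "((\<lambda>r. \<integral>s. s ^ n * exp (- r * s) \<partial>Q) has_real_derivative - (\<integral>s. s ^ Suc n * exp (- r * s) \<partial>Q)) (at r)"
proof -
  define d where "d s h = s ^ n * ((exp (- (r + h) * s) - exp (- r * s)) / h)" for s h :: real
  have bound: "norm (d s h) \<le> s ^ Suc n * exp (- (r / 2) * s)" if "0 \<le> s" "\<bar>h\<bar> \<le> r / 2" "h \<noteq> 0" for s h
  proof -
    have "s ^ n * \<bar>(exp (- (r + h) * s) - exp (- r * s)) / h\<bar> \<le> s ^ n * (s * exp (- (r / 2) * s))"
      using that by (intro mult_left_mono exp_difference_quotient_bound) auto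
    then show ?thesis using that by (simp add: d_def abs_mult mult_ac)
  qed
  have lim: "((\<lambda>h. d s h) \<longlongrightarrow> - (s ^ Suc n * exp (- r * s))) (at 0)" for s
  proof -
    have "((\<lambda>r. exp (- r * s)) has_real_derivative (- s * exp (- r * s))) (at r)"
      by (auto intro!: derivative_eq_intros)
    then have "((\<lambda>h. (exp (- (r + h) * s) - exp (- r * s)) / h) \<longlongrightarrow> - s * exp (- r * s)) (at 0)"
      unfolding DERIV_def .
    then have "((\<lambda>h. s ^ n * ((exp (- (r + h) * s) - exp (- r * s)) / h)) \<longlongrightarrow> s ^ n * (- s * exp (- r * s))) (at 0)"
      by (intro tendsto_mult tendsto_const)
    then show ?thesis unfolding d_def by (simp add: ac_simps)
  qed
  have "((\<lambda>h. \<integral>s. d s h \<partial>Q) \<longlongrightarrow> (\<integral>s. - (s ^ Suc n * exp (- r * s)) \<partial>Q)) (at 0)"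
    unfolding tendsto_at_iff_sequentially
  proof (intro allI impI)
    fix X :: "nat \<Rightarrow> real" assume X: "\<forall>i. X i \<in> UNIV - {0}" "X \<longlonglongrightarrow> 0"
    have "eventually (\<lambda>i. \<bar>X i\<bar> < r / 2) sequentially"
      using order_tendstoD(2)[OF tendsto_rabs[OF X(2)], of "r / 2"] r by simp
    then obtain N where N: "\<And>i. N \<le> i \<Longrightarrow> \<bar>X i\<bar> < r / 2" unfolding eventually_sequentially by blast
    have "(\<lambda>i. \<integral>s. d s (X (i + N)) \<partial>Q) \<longlonglongrightarrow> (\<integral>s. - (s ^ Suc n * exp (- r * s)) \<partial>Q)"
    proof (rule integral_dominated_convergence[where w="\<lambda>s. s ^ Suc n * exp (- (r / 2) * s)"])
      show "integrable Q (\<lambda>s. s ^ Suc n * exp (- (r / 2) * s))" by (rule integrable_power_exp) (use r in simp)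
      show "AE s in Q. (\<lambda>i. d s (X (i + N))) \<longlonglongrightarrow> - (s ^ Suc n * exp (- r * s))"
      proof (intro AE_I2 LIMSEQ_ignore_initial_segment)
        fix s show "(\<lambda>i. d s (X i)) \<longlonglongrightarrow> - (s ^ Suc n * exp (- r * s))"
          using lim[of s, unfolded tendsto_at_iff_sequentially o_def] X by blast
      qed
      show "AE s in Q. norm (d s (X (i + N))) \<le> s ^ Suc n * exp (- (r / 2) * s)" for i
        using nonneg_AE
      proof eventually_elim
        case (elim s)
        show ?case using N[of "i + N"] X(1) elim by (intro bound) auto
      qed
      show "(\<lambda>s. d s (X (i + N))) \<in> borel_measurable Q" for i unfolding d_def by measurable
    qed simp_all
    then show "((\<lambda>h. \<integral>s. d s h \<partial>Q) \<circ> X) \<longlonglongrightarrow> (\<integral>s. - (s ^ Suc n * exp (- r * s)) \<partial>Q)"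
      using LIMSEQ_offset[of "\<lambda>i. \<integral>s. d s (X i) \<partial>Q" N] by (simp add: o_def)
  qed
  moreover have "eventually (\<lambda>h. (\<integral>s. d s h \<partial>Q) = ((\<integral>s. s ^ n * exp (- (r + h) * s) \<partial>Q) - (\<integral>s. s ^ n * exp (- r * s) \<partial>Q)) / h) (at 0)"
    unfolding eventually_at
  proof (intro exI[of _ r] conjI ballI impI r)
    fix h :: real assume h: "h \<noteq> 0 \<and> dist h 0 < r"
    then have "\<bar>h\<bar> < r" by simp
    then have "0 < r + h" by linarith
    note i = integrable_power_exp[OF this, of n] integrable_power_exp[OF r, of n]
    have "(\<integral>s. d s h \<partial>Q) = (\<integral>s. (s ^ n * exp (- (r + h) * s) - s ^ n * exp (- r * s)) / h \<partial>Q)"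
      by (simp only: d_def times_divide_eq_right right_diff_distrib)
    also have "\<dots> = ((\<integral>s. s ^ n * exp (- (r + h) * s) \<partial>Q) - (\<integral>s. s ^ n * exp (- r * s) \<partial>Q)) / h"
      by (simp only: integral_divide_zero Bochner_Integration.integral_diff[OF i])
    finally show "(\<integral>s. d s h \<partial>Q) = ((\<integral>s. s ^ n * exp (- (r + h) * s) \<partial>Q) - (\<integral>s. s ^ n * exp (- r * s) \<partial>Q)) / h" .
  qed
  ultimately have "((\<lambda>h. ((\<integral>s. s ^ n * exp (- (r + h) * s) \<partial>Q) - (\<integral>s. s ^ n * exp (- r * s) \<partial>Q)) / h) \<longlongrightarrow>
      (\<integral>s. - (s ^ Suc n * exp (- r * s)) \<partial>Q)) (at 0)"
    by (rule Lim_transform_eventually)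
  moreover have "(\<integral>s. - (s ^ Suc n * exp (- r * s)) \<partial>Q) = - (\<integral>s. s ^ Suc n * exp (- r * s) \<partial>Q)"
    by (rule Bochner_Integration.integral_minus)
  ultimately show ?thesis by (simp only: DERIV_def)
qed

lemma laplace_derivs:
  "0 < r \<Longrightarrow> (deriv ^^ n) (\<lambda>r. \<integral>s. exp (- r * s) \<partial>Q) r = (-1) ^ n * (\<integral>s. s ^ n * exp (- r * s) \<partial>Q)"
proof (induction n arbitrary: r)
  case 0 then show ?case by simp
next
  case (Suc n)
  have "((\<lambda>r. (-1) ^ n * (\<integral>s. s ^ n * exp (- r * s) \<partial>Q)) has_real_derivative
      (-1) ^ n * - (\<integral>s. s ^ Suc n * exp (- r * s) \<partial>Q)) (at r)"
    by (intro DERIV_cmult DERIV_power_exp Suc.prems)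
  then have "((deriv ^^ n) (\<lambda>r. \<integral>s. exp (- r * s) \<partial>Q) has_real_derivative
      (-1) ^ n * - (\<integral>s. s ^ Suc n * exp (- r * s) \<partial>Q)) (at r)"
    by (rule has_field_derivative_transform_within_open[OF _ open_greaterThan[of 0]]) (use Suc in auto)
  then show ?case using DERIV_imp_deriv by fastforce
qed

theorem completely_monotone_laplace: "completely_monotone (\<lambda>r. \<integral>s. exp (- r * s) \<partial>Q)"
  unfolding completely_monotone_def
proof (intro allI impI conjI)
  fix n and r :: real assume r: "0 < r"
  have "((\<lambda>r. (-1) ^ n * (\<integral>s. s ^ n * exp (- r * s) \<partial>Q)) has_real_derivative
      (-1) ^ n * - (\<integral>s. s ^ Suc n * exp (- r * s) \<partial>Q)) (at r)"
    by (intro DERIV_cmult DERIV_power_exp r)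
  then have "((deriv ^^ n) (\<lambda>r. \<integral>s. exp (- r * s) \<partial>Q) has_real_derivative
      (-1) ^ n * - (\<integral>s. s ^ Suc n * exp (- r * s) \<partial>Q)) (at r)"
    by (rule has_field_derivative_transform_within_open[OF _ open_greaterThan[of 0]]) (use r laplace_derivs in auto)
  then show "(deriv ^^ n) (\<lambda>r. \<integral>s. exp (- r * s) \<partial>Q) differentiable at r" by (auto simp: real_differentiable_def)
  have "0 \<le> (\<integral>s. s ^ n * exp (- r * s) \<partial>Q)"
    using nonneg_AE by (intro integral_nonneg_AE) (auto elim!: eventually_mono)
  then show "0 \<le> (-1) ^ n * (deriv ^^ n) (\<lambda>r. \<integral>s. exp (- r * s) \<partial>Q) r"
    unfolding laplace_derivs[OF r] by (simp add: mult.assoc[symmetric] power_mult_distrib[symmetric])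
qed

lemma isCont_laplace: "0 < r \<Longrightarrow> isCont (\<lambda>r. \<integral>s. exp (- r * s) \<partial>Q) r"
  using DERIV_power_exp[of r 0] DERIV_isCont by fastforce

lemma laplace_tendsto_0:
  assumes "AE s in Q. 0 < s" shows "((\<lambda>r. \<integral>s. exp (- r * s) \<partial>Q) \<longlongrightarrow> 0) at_top"
proof -
  have "((\<lambda>r. \<integral>s. exp (- r * s) \<partial>Q) \<longlongrightarrow> (\<integral>s. 0 \<partial>Q)) at_top"
  proof (rule integral_dominated_convergence_at_top[where w="\<lambda>s. exp (- 1 * s)"])
    show "integrable Q (\<lambda>s. exp (- 1 * s))" by (rule integrable_exp) simp
    show "AE s in Q. ((\<lambda>r. exp (- r * s)) \<longlongrightarrow> 0) at_top"
      using assms by eventually_elim real_asymp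
    show "\<forall>\<^sub>F r in at_top. AE s in Q. norm (exp (- r * s)) \<le> exp (- 1 * s)"
      using eventually_ge_at_top[of 1]
    proof eventually_elim
      case (elim r)
      show ?case
        using nonneg_AE
      proof eventually_elim
        case (elim s)
        then have "1 * s \<le> r * s" using \<open>1 \<le> r\<close> by (intro mult_right_mono) auto
        then show ?case by simp
      qed
    qed
  qed simp_all
  then show ?thesis by simp
qed

end

text \<open>
  Under \<open>x = exp (- s)\<close> and with the weight \<open>exp (- s)\<close> the values of the Laplace transform at positive integers become the moments
  of a finite measure on the unit interval, and those determine it.
\<close>

theorem laplace_unique:
  assumes \<mu>: "sets \<mu> = sets borel" "AE s in \<mu>. 0 \<le> s" and \<nu>: "sets \<nu> = sets borel" "AE s in \<nu>. 0 \<le> s"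
    and eq: "\<And>r. 0 < r \<Longrightarrow> (\<integral>\<^sup>+s. ennreal (exp (- r * s)) \<partial>\<mu>) = (\<integral>\<^sup>+s. ennreal (exp (- r * s)) \<partial>\<nu>)"
    and fin: "\<And>r. 0 < r \<Longrightarrow> (\<integral>\<^sup>+s. ennreal (exp (- r * s)) \<partial>\<mu>) < \<infinity>"
  shows "\<mu> = (\<nu> :: real measure)"
proof -
  \<comment> \<open>The transport to the unit interval; \<open>inv\<close> below is its inverse.\<close>
  define T where "T M = distr (density M (\<lambda>s. ennreal (exp (- s)))) borel (\<lambda>s. exp (- s))" for M :: "real measure"
  have unit: "unit_interval_measure (T M)" and mom: "ennreal (\<integral>x. x ^ n \<partial>T M) = (\<integral>\<^sup>+s. ennreal (exp (- real (Suc n) * s)) \<partial>M)"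
    and inv: "M = density (distr (T M) borel (\<lambda>x. - ln x)) (\<lambda>s. ennreal (exp s))"
    if M: "sets M = sets borel" "AE s in M. 0 \<le> s" and fM: "(\<integral>\<^sup>+s. ennreal (exp (- s)) \<partial>M) < \<infinity>" for M n
  proof -
    note [measurable_cong] = M(1)
    have "emeasure (T M) (space (T M)) = (\<integral>\<^sup>+s. ennreal (exp (- s)) \<partial>M)"
      unfolding T_def by (subst emeasure_distr) (auto simp: emeasure_density sets_eq_imp_space_eq[OF M(1)])
    then have f: "finite_measure (T M)" using fM by (intro finite_measureI) auto
    moreover have "AE x in T M. 0 \<le> x \<and> x \<le> 1"
    proof -
      have "AE s in M. 0 < ennreal (exp (- s)) \<longrightarrow> 0 \<le> exp (- s) \<and> exp (- s) \<le> 1" using M(2) by eventually_elim simp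
      then show ?thesis unfolding T_def by (subst AE_distr_iff) (simp_all add: AE_density)
    qed
    moreover have "sets (T M) = sets borel" by (simp add: T_def)
    ultimately show u: "unit_interval_measure (T M)" by (simp add: unit_interval_measure_def)
    have "AE x in T M. 0 \<le> x ^ n" using \<open>AE x in T M. 0 \<le> x \<and> x \<le> 1\<close> by eventually_elim simp
    then have "ennreal (\<integral>x. x ^ n \<partial>T M) = (\<integral>\<^sup>+x. ennreal (x ^ n) \<partial>T M)"
      using unit_interval_power_integrable[OF u] by (simp add: nn_integral_eq_integral)
    also have "\<dots> = (\<integral>\<^sup>+s. ennreal (exp (- s)) * ennreal (exp (- s) ^ n) \<partial>M)"
      unfolding T_def by (subst nn_integral_distr, simp, simp, subst nn_integral_density) auto
    also have "\<dots> = (\<integral>\<^sup>+s. ennreal (exp (- real (Suc n) * s)) \<partial>M)"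
      by (intro nn_integral_cong)
         (simp add: ennreal_mult[symmetric] exp_of_nat_mult[symmetric] exp_add[symmetric] algebra_simps)
    finally show "ennreal (\<integral>x. x ^ n \<partial>T M) = (\<integral>\<^sup>+s. ennreal (exp (- real (Suc n) * s)) \<partial>M)" .
    have "distr (T M) borel (\<lambda>x. - ln x) = distr (density M (\<lambda>s. ennreal (exp (- s)))) borel (\<lambda>s. s)"
      unfolding T_def by (subst distr_distr) (auto simp: o_def)
    also have "\<dots> = density M (\<lambda>s. ennreal (exp (- s)))" by (rule distr_id2) (simp add: M)
    finally have "density (distr (T M) borel (\<lambda>x. - ln x)) (\<lambda>s. ennreal (exp s)) =
        density M (\<lambda>s. ennreal (exp (- s)) * ennreal (exp s))"
      by (simp add: density_density_eq)
    also have "\<dots> = density M (\<lambda>_. 1)"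
      by (intro density_cong) (auto simp: ennreal_mult[symmetric] exp_add[symmetric])
    finally show "M = density (distr (T M) borel (\<lambda>x. - ln x)) (\<lambda>s. ennreal (exp s))" by (simp add: density_1)
  qed
  have f1: "(\<integral>\<^sup>+s. ennreal (exp (- s)) \<partial>\<mu>) < \<infinity>" "(\<integral>\<^sup>+s. ennreal (exp (- s)) \<partial>\<nu>) < \<infinity>"
    using eq[of 1] fin[of 1] by simp_all
  have "T \<mu> = T \<nu>"
  proof (rule unit_interval_measure_eqI[OF unit unit])
    fix n
    have "ennreal (\<integral>x. x ^ n \<partial>T \<mu>) = ennreal (\<integral>x. x ^ n \<partial>T \<nu>)"
      using mom[OF \<mu> f1(1), of n] mom[OF \<nu> f1(2), of n] eq[of "real (Suc n)"] by simp
    moreover have "0 \<le> (\<integral>x. x ^ n \<partial>T \<mu>)" "0 \<le> (\<integral>x. x ^ n \<partial>T \<nu>)"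
      using unit[OF \<mu> f1(1)] unit[OF \<nu> f1(2)] unfolding unit_interval_measure_def
      by (auto intro!: integral_nonneg_AE elim!: eventually_mono)
    ultimately show "(\<integral>x. x ^ n \<partial>T \<mu>) = (\<integral>x. x ^ n \<partial>T \<nu>)" by simp
  qed (use \<mu> \<nu> f1 in auto)
  then show ?thesis using inv[OF \<mu> f1(1)] inv[OF \<nu> f1(2)] by simp
qed

section \<open>Uniqueness of characteristic functions in Euclidean space\<close>

text \<open>
  Levy's uniqueness theorem for probability measures on the line, after division by the common total mass, which is the value at 0.
\<close>

lemma finite_measure_char_unique:
  fixes M N :: "real measure"
  assumes M: "finite_measure M" "sets M = sets borel" and N: "finite_measure N" "sets N = sets borel"
    and eq: "\<And>t. (CLINT x|M. iexp (t * x)) = (CLINT x|N. iexp (t * x))"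
  shows "M = N"
proof -
  interpret M: finite_measure M by fact
  interpret N: finite_measure N by fact
  note [measurable_cong] = M(2) N(2)
  have sp: "space M = UNIV" "space N = UNIV" using M(2) N(2) by (auto dest: sets_eq_imp_space_eq)
  define m where "m = measure M UNIV"
  have mN: "measure N UNIV = m" using eq[of 0] sp by (simp add: m_def)
  show ?thesis
  proof (cases "m = 0")
    case True
    have "emeasure M A = 0" "emeasure N A = 0" for A
      using True mN M.bounded_measure[of A] N.bounded_measure[of A] sp
      by (simp_all add: m_def M.emeasure_eq_measure N.emeasure_eq_measure measure_le_0_iff)
    then show ?thesis using M(2) N(2) by (intro measure_eqI) auto
  next
    case False
    then have m: "0 < m" by (simp add: m_def zero_less_measure_iff less_le)
    define S where "S K = density K (\<lambda>_. ennreal (1 / m))" for K :: "real measure"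
    have rd: "real_distribution (S K)" if "finite_measure K" "sets K = sets borel" "measure K UNIV = m" for K
    proof -
      interpret K: finite_measure K by fact
      have "emeasure (S K) (space (S K)) = ennreal (1 / m) * emeasure K UNIV"
        using that(2) by (simp add: S_def emeasure_density nn_integral_cmult sets_eq_imp_space_eq[OF that(2)])
      also have "\<dots> = 1" using m that(3) by (simp add: K.emeasure_eq_measure ennreal_mult[symmetric])
      finally show ?thesis using that(2)
        by (auto intro!: prob_spaceI simp: real_distribution_def real_distribution_axioms_def S_def)
    qed
    have ch: "char (S K) t = complex_of_real (1 / m) * (CLINT x|K. iexp (t * x))" if "sets K = sets borel" for K t
    proof -
      have [measurable_cong]: "sets K = sets borel" by fact
      have "char (S K) t = (CLINT x|K. (1 / m) *\<^sub>R iexp (t * x))"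
        unfolding char_def S_def using m by (subst integral_density) auto
      then show ?thesis by (simp add: scaleR_conv_of_real)
    qed
    have "S M = S N"
      using M N eq mN by (intro Levy_uniqueness rd ext) (auto simp: m_def ch)
    moreover have "K = density (S K) (\<lambda>_. ennreal m)" if "sets K = sets borel" for K
      using m by (simp add: S_def density_density_eq ennreal_mult[symmetric] density_1)
    ultimately show ?thesis using M(2) N(2) by metis
  qed
qed

lemma (in finite_measure) integrable_bounded_complex:
  fixes f :: "'a \<Rightarrow> complex"
  assumes "f \<in> borel_measurable M" "\<And>x. norm (f x) \<le> B" shows "integrable M f"
  using assms by (intro integrable_const_bound[of _ B]) auto

text \<open>
  Induction over the coordinates. In the step, a new coordinate event is handled by one-dimensional uniqueness, applied to the images
  under that coordinate of the measure with density \<open>g x * (1 + Re (c * iexp (w \<bullet> x)))\<close>. The added constant makes the density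
  nonnegative, which keeps the argument within positive measures, and three values of \<open>c\<close> recover the exponential.
\<close>

lemma char_determines_coordinate_events:
  fixes M N :: "'a::euclidean_space measure"
  assumes M: "finite_measure M" "sets M = sets borel" and N: "finite_measure N" "sets N = sets borel"
    and eq: "\<And>z. (CLINT x|M. iexp (z \<bullet> x)) = (CLINT x|N. iexp (z \<bullet> x))"
    and A: "\<And>b. A b \<in> sets borel" and S: "finite S"
  shows "(CLINT x|M. complex_of_real (\<Prod>b\<in>S. indicator (A b) (x \<bullet> b)) * iexp (w \<bullet> x)) =
         (CLINT x|N. complex_of_real (\<Prod>b\<in>S. indicator (A b) (x \<bullet> b)) * iexp (w \<bullet> x))"
  using S
proof (induction S arbitrary: w rule: finite_induct)
  case empty then show ?case using eq by simp
next
  case (insert b S)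
  note [measurable] = A
  interpret M: finite_measure M by fact
  interpret N: finite_measure N by fact
  define g where "g x = (\<Prod>b\<in>S. indicator (A b) (x \<bullet> b) :: real)" for x :: 'a
  have g01: "0 \<le> g x" "g x \<le> 1" for x unfolding g_def by (auto intro!: prod_nonneg prod_le_1 simp: indicator_def)
  have gm[measurable]: "g \<in> borel_measurable borel" unfolding g_def by measurable
  have IH: "(CLINT x|M. g x * iexp (w \<bullet> x)) = (CLINT x|N. g x * iexp (w \<bullet> x))" for w
    using insert.IH[of w] by (simp add: g_def)
  define h where "h c x = g x * (1 + Re (c * iexp (w \<bullet> x)))" for c x
  have h0: "0 \<le> h c x" "h c x \<le> 2" if "norm c = 1" for c x
  proof -
    have "\<bar>Re (c * iexp (w \<bullet> x))\<bar> \<le> 1" using abs_Re_le_cmod[of "c * iexp (w \<bullet> x)"] that by (simp add: norm_mult)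
    then have "0 \<le> 1 + Re (c * iexp (w \<bullet> x))" "1 + Re (c * iexp (w \<bullet> x)) \<le> 2" by linarith+
    then show "0 \<le> h c x" "h c x \<le> 2" using g01[of x] mult_mono[of "g x" 1 "1 + Re (c * iexp (w \<bullet> x))" 2]
      unfolding h_def by simp_all
  qed
  have hm[measurable]: "h c \<in> borel_measurable borel" for c unfolding h_def by measurable
  define P where "P c K = distr (density K (\<lambda>x. ennreal (h c x))) borel (\<lambda>x. x \<bullet> b)" for c and K :: "'a measure"
  have Pfin: "finite_measure (P c K)" if K: "finite_measure K" "sets K = sets borel" and c: "norm c = 1" for c K
  proof -
    note [measurable_cong] = K(2)
    have "emeasure (P c K) (space (P c K)) = (\<integral>\<^sup>+x. ennreal (h c x) \<partial>K)"
      unfolding P_def by (subst emeasure_distr) (auto simp: emeasure_density sets_eq_imp_space_eq[OF K(2)])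
    also have "\<dots> \<le> (\<integral>\<^sup>+x. 2 \<partial>K)" using h0[OF c] by (intro nn_integral_mono) (simp add: ennreal_le_iff2[of _ 2, simplified])
    also have "\<dots> < \<infinity>" using K(1) finite_measure.emeasure_finite[OF K(1)] by (simp add: ennreal_mult_less_top less_top)
    finally show ?thesis by (intro finite_measureI) auto
  qed
  have Pint: "(CLINT y|P c K. f y) = (CLINT x|K. h c x * f (x \<bullet> b))"
    if K: "sets K = sets borel" and c: "norm c = 1" and f[measurable]: "f \<in> borel_measurable borel" for c K and f :: "real \<Rightarrow> complex"
  proof -
    note [measurable_cong] = K
    show ?thesis unfolding P_def using h0[OF c]
      by (subst integral_distr, simp, simp, subst integral_density) (auto simp: scaleR_conv_of_real)
  qed
  \<comment> \<open>The characteristic function of \<open>P c K\<close> splits into three values covered by the induction hypothesis.\<close>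
  have split: "(CLINT x|K. h c x * iexp (t * (x \<bullet> b))) = (CLINT x|K. g x * iexp ((t *\<^sub>R b) \<bullet> x)) +
      c / 2 * (CLINT x|K. g x * iexp ((w + t *\<^sub>R b) \<bullet> x)) + cnj c / 2 * (CLINT x|K. g x * iexp ((t *\<^sub>R b - w) \<bullet> x))"
    if K: "finite_measure K" "sets K = sets borel" for K c t
  proof -
    interpret K: finite_measure K by fact
    note [measurable_cong] = K(2)
    have i: "integrable K (\<lambda>x. g x * iexp (v \<bullet> x))" for v
      by (rule K.integrable_bounded_complex[of _ 1]) (use g01 in \<open>auto simp: norm_mult\<close>)
    have "h c x * iexp (t * (x \<bullet> b)) = g x * iexp ((t *\<^sub>R b) \<bullet> x) + (c / 2 * (g x * iexp ((w + t *\<^sub>R b) \<bullet> x)) +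
        cnj c / 2 * (g x * iexp ((t *\<^sub>R b - w) \<bullet> x)))" for x
    proof -
      have "complex_of_real (Re (c * iexp (w \<bullet> x))) = (c * iexp (w \<bullet> x) + cnj c * iexp (- (w \<bullet> x))) / 2"
        by (simp add: complex_eq_iff exp_cnj[symmetric] Re_exp Im_exp)
      then have "complex_of_real (h c x) = g x * (1 + (c * iexp (w \<bullet> x) + cnj c * iexp (- (w \<bullet> x))) / 2)"
        by (simp add: h_def)
      moreover have "iexp ((w + t *\<^sub>R b) \<bullet> x) = iexp (w \<bullet> x) * iexp (t * (x \<bullet> b))"
        unfolding exp_add[symmetric] by (rule arg_cong[of _ _ exp]) (simp add: inner_add_left inner_commute[of x b] algebra_simps)
      moreover have "iexp ((t *\<^sub>R b - w) \<bullet> x) = iexp (- (w \<bullet> x)) * iexp (t * (x \<bullet> b))"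
        unfolding exp_add[symmetric] by (rule arg_cong[of _ _ exp]) (simp add: inner_diff_left inner_commute[of x b] algebra_simps)
      moreover have "(t *\<^sub>R b) \<bullet> x = t * (x \<bullet> b)" by (simp add: inner_commute[of x b])
      moreover have "G * (1 + (c * W + d * V) / 2) * E = G * E + (c / 2 * (G * (W * E)) + d / 2 * (G * (V * E)))"
        for G W V E d :: complex by (simp add: field_simps)
      ultimately show ?thesis by (simp only:)
    qed
    moreover have "(CLINT x|K. F x + (a * G x + d * H x)) = (CLINT x|K. F x) + a * (CLINT x|K. G x) + d * (CLINT x|K. H x)"
      if "integrable K F" "integrable K G" "integrable K H" for F G H :: "'a \<Rightarrow> complex" and a d
      using that by simp
    ultimately show ?thesis using i by (simp only:)
  qed
  have Peq: "P c M = P c N" if c: "norm c = 1" for c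
  proof (rule finite_measure_char_unique)
    fix t
    have "(CLINT y|P c M. iexp (t * y)) = (CLINT x|M. h c x * iexp (t * (x \<bullet> b)))"
      by (rule Pint[OF M(2) c]) simp
    also have "\<dots> = (CLINT x|N. h c x * iexp (t * (x \<bullet> b)))" unfolding split[OF M] split[OF N] IH ..
    also have "\<dots> = (CLINT y|P c N. iexp (t * y))" by (rule Pint[OF N(2) c, symmetric]) simp
    finally show "(CLINT y|P c M. iexp (t * y)) = (CLINT y|P c N. iexp (t * y))" .
  qed (use Pfin M N c in \<open>auto simp: P_def\<close>)
  define G where "G x = g x * indicator (A b) (x \<bullet> b)" for x
  have G01: "\<bar>G x\<bar> \<le> 1" for x using g01[of x] by (simp add: G_def indicator_def)
  have Gm[measurable]: "G \<in> borel_measurable borel" unfolding G_def by measurable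
  have R: "(CLINT x|M. G x * (1 + Re (c * iexp (w \<bullet> x)))) = (CLINT x|N. G x * (1 + Re (c * iexp (w \<bullet> x))))"
    if c: "norm c = 1" for c
  proof -
    have "(CLINT x|M. h c x * complex_of_real (indicator (A b) (x \<bullet> b))) = (CLINT x|N. h c x * complex_of_real (indicator (A b) (x \<bullet> b)))"
      using Pint[OF M(2) c, of "\<lambda>y. complex_of_real (indicator (A b) y)"] Pint[OF N(2) c, of "\<lambda>y. complex_of_real (indicator (A b) y)"] Peq[OF c] by simp
    then show ?thesis by (simp add: h_def G_def mult_ac)
  qed
  \<comment> \<open>The exponential as a combination of the nonnegative densities for \<open>c\<close> equal to \<open>1\<close>, \<open>- \<i>\<close> and \<open>- 1\<close>.\<close>
  have final: "(CLINT x|K. G x * iexp (w \<bullet> x)) = (1 - \<i>) / 2 * (CLINT x|K. G x * (1 + Re (1 * iexp (w \<bullet> x))))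
      + \<i> * (CLINT x|K. G x * (1 + Re (-\<i> * iexp (w \<bullet> x)))) + (- 1 - \<i>) / 2 * (CLINT x|K. G x * (1 + Re (- 1 * iexp (w \<bullet> x))))"
    if K: "finite_measure K" "sets K = sets borel" for K
  proof -
    interpret K: finite_measure K by fact
    note [measurable_cong] = K(2)
    have i: "integrable K (\<lambda>x. complex_of_real (G x * (1 + Re (c * iexp (w \<bullet> x)))))" if c: "norm c = 1" for c
    proof (rule K.integrable_bounded_complex[of _ 2])
      fix x
      have "\<bar>Re (c * iexp (w \<bullet> x))\<bar> \<le> 1" using abs_Re_le_cmod[of "c * iexp (w \<bullet> x)"] c by (simp add: norm_mult)
      then have "\<bar>1 + Re (c * iexp (w \<bullet> x))\<bar> \<le> 2" by linarith
      then have "\<bar>G x\<bar> * \<bar>1 + Re (c * iexp (w \<bullet> x))\<bar> \<le> 1 * 2" using G01[of x] by (intro mult_mono) auto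
      then show "norm (complex_of_real (G x * (1 + Re (c * iexp (w \<bullet> x))))) \<le> 2"
        by (simp only: norm_of_real abs_mult)
    qed measurable
    have e: "G x * iexp (w \<bullet> x) = (1 - \<i>) / 2 * (G x * (1 + Re (1 * iexp (w \<bullet> x))))
      + \<i> * (G x * (1 + Re (-\<i> * iexp (w \<bullet> x)))) + (- 1 - \<i>) / 2 * (G x * (1 + Re (- 1 * iexp (w \<bullet> x))))" for x
      by (simp add: complex_eq_iff Re_exp Im_exp algebra_simps)
    have "(CLINT x|K. a * F x + b * H x + d * L x) = a * (CLINT x|K. F x) + b * (CLINT x|K. H x) + d * (CLINT x|K. L x)"
      if "integrable K F" "integrable K H" "integrable K L" for F H L :: "'a \<Rightarrow> complex" and a b d
      using that by simp
    then show ?thesis unfolding e using i by (simp only: norm_one norm_minus_cancel norm_ii)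
  qed
  have "(CLINT x|M. G x * iexp (w \<bullet> x)) = (CLINT x|N. G x * iexp (w \<bullet> x))"
    unfolding final[OF M] final[OF N] by (simp only: R norm_one norm_minus_cancel norm_ii)
  then show ?case using insert.hyps by (simp add: G_def g_def mult_ac)
qed

text \<open>
  Open boxes are intersections of coordinate events, and they generate the Borel sets.
\<close>

theorem finite_measure_char_fun_unique:
  fixes M N :: "'a::euclidean_space measure"
  assumes M: "finite_measure M" "sets M = sets borel" and N: "finite_measure N" "sets N = sets borel"
    and eq: "\<And>z. (CLINT x|M. iexp (z \<bullet> x)) = (CLINT x|N. iexp (z \<bullet> x))"
  shows "M = N"
proof -
  interpret M: finite_measure M by fact
  interpret N: finite_measure N by fact
  have box: "emeasure M (box a c) = emeasure N (box a c)" for a c :: 'a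
  proof -
    define A where "A b = {a \<bullet> b<..<c \<bullet> b}" for b
    have *: "(\<Prod>b\<in>Basis. indicator (A b) (x \<bullet> b)) = (indicator (box a c) x :: real)" for x :: 'a
    proof (cases "x \<in> box a c")
      case True then show ?thesis by (auto simp: mem_box A_def)
    next
      case False
      then obtain b where "b \<in> Basis" "x \<bullet> b \<notin> A b" by (auto simp: mem_box A_def)
      then have "(\<Prod>b\<in>Basis. indicator (A b) (x \<bullet> b)) = (0::real)"
        by (intro prod_zero) (auto intro!: bexI[of _ b])
      then show ?thesis using False by simp
    qed
    have "(CLINT x|M. complex_of_real (indicator (box a c) x)) = (CLINT x|N. complex_of_real (indicator (box a c) x))"
      using char_determines_coordinate_events[OF M N eq _ finite_Basis, of A 0] unfolding * by (simp add: A_def)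
    then have "measure M (box a c \<inter> space M) = measure N (box a c \<inter> space N)" by simp
    then show ?thesis using M(2) N(2) 
      by (simp add: sets_eq_imp_space_eq[OF M(2)] sets_eq_imp_space_eq[OF N(2)] M.emeasure_eq_measure N.emeasure_eq_measure)
  qed
  let ?E = "range (\<lambda>(a, b). box a b :: 'a set)"
  show ?thesis
  proof (rule measure_eqI_generator_eq[where E="?E" and \<Omega>=UNIV and A="\<lambda>n::nat. box (- (real n *\<^sub>R One)) (real n *\<^sub>R One)"])
    show "Int_stable ?E" by (auto simp: Int_stable_def box_Int_box)
    show "sets M = sigma_sets UNIV ?E" "sets N = sigma_sets UNIV ?E"
      using M(2) N(2) by (simp_all add: borel_eq_box)
  qed (auto simp: box UN_box_eq_UNIV)
qed

section \<open>Uniqueness of the Levy measure\<close>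

definition levy_kernel :: "'a::euclidean_space \<Rightarrow> 'a \<Rightarrow> complex" where
  "levy_kernel z x = iexp (z \<bullet> x) - 1 - \<i> * complex_of_real ((z \<bullet> x) * indicator (cball 0 1) x)"

lemma levy_kernel_measurable[measurable]: "levy_kernel z \<in> borel_measurable borel"
proof -
  have [measurable]: "cball (0::'a) 1 \<in> sets borel" by (intro borel_closed closed_cball)
  show ?thesis unfolding levy_kernel_def[abs_def] by measurable
qed

lemma norm_iexp_minus_one_minus: "norm (iexp t - 1 - \<i> * complex_of_real t) \<le> t\<^sup>2 / 2"
  using iexp_approx1[of t 1] by (simp add: power2_eq_square algebra_simps)

lemma inner_power2_le: "((z::'a::real_inner) \<bullet> x)\<^sup>2 \<le> (norm z)\<^sup>2 * (norm x)\<^sup>2"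
  using Cauchy_Schwarz_ineq[of z x] by (simp add: power2_norm_eq_inner)

text \<open>
  Near the origin the compensator removes the linear term, leaving a quadratic bound; far away the kernel is bounded by 2. Both
  ranges are controlled by the truncated square that a Levy measure integrates.
\<close>

lemma levy_kernel_bound:
  "norm (levy_kernel z x) \<le> ((norm z)\<^sup>2 + 2) * min ((norm x)\<^sup>2) 1"
proof (cases "norm x \<le> 1")
  case True
  have "norm (levy_kernel z x) \<le> (z \<bullet> x)\<^sup>2 / 2"
    using True norm_iexp_minus_one_minus[of "z \<bullet> x"] by (simp add: levy_kernel_def)
  also have "\<dots> \<le> ((norm z)\<^sup>2 + 2) * (norm x)\<^sup>2"
    using inner_power2_le[of z x] zero_le_power2[of "norm x"] mult_nonneg_nonneg[OF zero_le_power2[of "norm z"] zero_le_power2[of "norm x"]]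
    unfolding distrib_right by linarith
  also have "(norm x)\<^sup>2 = min ((norm x)\<^sup>2) 1" using True by (simp add: power_le_one min_def)
  finally show ?thesis .
next
  case False
  have "norm (levy_kernel z x) \<le> 2"
    using False norm_triangle_ineq4[of "iexp (z \<bullet> x)" 1] by (simp add: levy_kernel_def)
  also have "\<dots> \<le> ((norm z)\<^sup>2 + 2) * 1" by simp
  also have "1 = min ((norm x)\<^sup>2) 1" using False one_le_power[of "norm x" 2] by (simp add: min_absorb2)
  finally show ?thesis .
qed

lemma one_minus_cos_bound: "1 - cos t \<le> (t::real)\<^sup>2 / 2"
proof -
  have "1 - cos t = 2 * (sin (t / 2))\<^sup>2" using cos_double_sin[of "t / 2"] by simp
  also have "(sin (t / 2))\<^sup>2 \<le> (t / 2)\<^sup>2" using abs_sin_x_le_abs_x[of "t / 2"] by (intro abs_le_square_iff[THEN iffD1]) simp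
  finally show ?thesis by (simp add: power_divide)
qed

lemma one_minus_cos_inner_bound:
  fixes w x :: "'a::real_inner" shows "1 - cos (w \<bullet> x) \<le> ((norm w)\<^sup>2 + 2) * min ((norm x)\<^sup>2) 1"
proof (cases "norm x \<le> 1")
  case True
  have "1 - cos (w \<bullet> x) \<le> (w \<bullet> x)\<^sup>2 / 2" by (rule one_minus_cos_bound)
  also have "\<dots> \<le> ((norm w)\<^sup>2 + 2) * (norm x)\<^sup>2"
    using inner_power2_le[of w x] zero_le_power2[of "norm x"] mult_nonneg_nonneg[OF zero_le_power2[of "norm w"] zero_le_power2[of "norm x"]]
    unfolding distrib_right by linarith
  also have "(norm x)\<^sup>2 = min ((norm x)\<^sup>2) 1" using True by (simp add: power_le_one min_def)
  finally show ?thesis .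
next
  case False
  have "1 - cos (w \<bullet> x) \<le> 2" using cos_ge_minus_one[of "w \<bullet> x"] by simp
  also have "\<dots> \<le> ((norm w)\<^sup>2 + 2) * 1" by simp
  finally show ?thesis using False one_le_power[of "norm x" 2] by (simp add: min_absorb2)
qed

context
  fixes M :: "'a::euclidean_space measure"
  assumes M: "levy_measure M"
begin

lemma levy_sets[measurable_cong]: "sets M = sets borel" using M by (simp add: levy_measure_def)

lemma levy_integrable_min: "integrable M (\<lambda>x. min ((norm x)\<^sup>2) 1)"
  using M by (intro integrableI_bounded) (auto simp: levy_measure_def)

lemma levy_integrable_bound:
  fixes f :: "'a \<Rightarrow> 'b::{banach, second_countable_topology}"
  assumes [measurable]: "f \<in> borel_measurable borel" and "\<And>x. norm (f x) \<le> C * min ((norm x)\<^sup>2) 1"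
  shows "integrable M f"
  by (rule Bochner_Integration.integrable_bound[OF integrable_mult_right[OF levy_integrable_min, of C]])
     (auto intro!: AE_I2 order_trans[OF assms(2)])

lemma integrable_levy_kernel: "integrable M (levy_kernel z)"
  by (rule levy_integrable_bound[OF _ levy_kernel_bound]) measurable

lemma isCont_levy_exponent: "isCont (\<lambda>z. CLINT x|M. levy_kernel z x) z"
  unfolding continuous_at_sequentially
proof (intro allI impI)
  fix X assume X: "X \<longlonglongrightarrow> z"
  then obtain K where K: "\<And>n. norm (X n) \<le> K" using convergent_imp_Bseq[OF convergentI[OF X]] by (auto simp: Bseq_def)
  have "(\<lambda>n. CLINT x|M. levy_kernel (X n) x) \<longlonglongrightarrow> (CLINT x|M. levy_kernel z x)"
  proof (rule integral_dominated_convergence[where w="\<lambda>x. (K\<^sup>2 + 2) * min ((norm x)\<^sup>2) 1"])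
    show "integrable M (\<lambda>x. (K\<^sup>2 + 2) * min ((norm x)\<^sup>2) 1)" by (intro integrable_mult_right levy_integrable_min)
    show "AE x in M. (\<lambda>n. levy_kernel (X n) x) \<longlonglongrightarrow> levy_kernel z x"
      unfolding levy_kernel_def by (intro AE_I2 tendsto_intros X)
    show "AE x in M. norm (levy_kernel (X n) x) \<le> (K\<^sup>2 + 2) * min ((norm x)\<^sup>2) 1" for n
    proof (intro AE_I2 order_trans[OF levy_kernel_bound] mult_right_mono)
      show "(norm (X n))\<^sup>2 + 2 \<le> K\<^sup>2 + 2" using K[of n] by (simp add: power_mono)
    qed simp
  qed measurable
  then show "((\<lambda>z. CLINT x|M. levy_kernel z x) \<circ> X) \<longlonglongrightarrow> (CLINT x|M. levy_kernel z x)" by (simp add: o_def)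
qed

text \<open>
  Taking second differences cancels both the drift and the compensator and replaces the Levy measure by the finite measure with density
  \<open>1 - cos (w \<bullet> x)\<close>, so that uniqueness of characteristic functions becomes available.
\<close>

lemma levy_exponent_second_difference:
  "2 * (CLINT x|M. levy_kernel z x) - (CLINT x|M. levy_kernel (z + w) x) - (CLINT x|M. levy_kernel (z - w) x) =
   2 * (CLINT x|density M (\<lambda>x. ennreal (1 - cos (w \<bullet> x))). iexp (z \<bullet> x))"
proof -
  have "2 * levy_kernel z x - levy_kernel (z + w) x - levy_kernel (z - w) x = 2 * (iexp (z \<bullet> x) * complex_of_real (1 - cos (w \<bullet> x)))" for x
    by (simp add: levy_kernel_def complex_eq_iff Re_exp Im_exp inner_add_left inner_diff_left cos_add cos_diff sin_add sin_diff algebra_simps)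
  then have "(CLINT x|M. 2 * levy_kernel z x - levy_kernel (z + w) x - levy_kernel (z - w) x) =
      2 * (CLINT x|M. complex_of_real (1 - cos (w \<bullet> x)) * iexp (z \<bullet> x))"
    by (simp add: mult.commute)
  also have "(CLINT x|M. complex_of_real (1 - cos (w \<bullet> x)) * iexp (z \<bullet> x)) =
      (CLINT x|density M (\<lambda>x. ennreal (1 - cos (w \<bullet> x))). iexp (z \<bullet> x))"
    by (subst integral_density) (auto simp: scaleR_conv_of_real)
  finally show ?thesis using integrable_levy_kernel by simp
qed

lemma finite_measure_one_minus_cos: "finite_measure (density M (\<lambda>x. ennreal (1 - cos (w \<bullet> x))))"
proof (rule finite_measureI)
  have "integrable M (\<lambda>x. 1 - cos (w \<bullet> x))"
    by (rule levy_integrable_bound[of _ "(norm w)\<^sup>2 + 2"]) (use one_minus_cos_inner_bound[of w] in auto)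
  then have "(\<integral>\<^sup>+x. ennreal (1 - cos (w \<bullet> x)) \<partial>M) < \<infinity>"
    by (subst nn_integral_eq_integral) auto
  then show "emeasure (density M (\<lambda>x. ennreal (1 - cos (w \<bullet> x)))) (space (density M (\<lambda>x. ennreal (1 - cos (w \<bullet> x))))) \<noteq> \<infinity>"
    by (simp add: emeasure_density cong: nn_integral_cong)
qed

end

declare levy_sets[measurable_cong del]

text \<open>
  A countable combination of the densities \<open>1 - cos (w \<bullet> x)\<close> that is finite everywhere and vanishes only at the origin. The scales
  \<open>2 ^ n\<close> are there because a single frequency misses the points with \<open>w \<bullet> x\<close> in \<open>2 * pi * \<int>\<close>.
\<close>

definition cosine_weight :: "'a::euclidean_space \<Rightarrow> ennreal" where
  "cosine_weight x = (\<Sum>n. \<Sum>b\<in>Basis. ennreal ((1/2) ^ n) * ennreal (1 - cos ((b /\<^sub>R 2 ^ n) \<bullet> x)))"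

lemma cosine_weight_measurable[measurable]: "cosine_weight \<in> borel_measurable borel"
  unfolding cosine_weight_def[abs_def] by measurable

lemma cosine_weight_finite: "cosine_weight (x::'a::euclidean_space) < \<top>"
proof -
  have "cosine_weight x \<le> (\<Sum>n. ennreal (2 * DIM('a) * (1/2) ^ n))"
    unfolding cosine_weight_def
  proof (intro suminf_le allI summableI)
    fix n
    have "(\<Sum>b\<in>(Basis::'a set). ennreal ((1/2) ^ n) * ennreal (1 - cos ((b /\<^sub>R 2 ^ n) \<bullet> x))) \<le> (\<Sum>b\<in>(Basis::'a set). ennreal ((1/2) ^ n * 2))"
    proof (intro sum_mono)
      fix b
      have "(1/2) ^ n * (1 - cos ((b /\<^sub>R 2 ^ n) \<bullet> x)) \<le> (1/2) ^ n * 2"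
        using cos_ge_minus_one[of "(b /\<^sub>R 2 ^ n) \<bullet> x"] by (intro mult_left_mono) auto
      then show "ennreal ((1/2) ^ n) * ennreal (1 - cos ((b /\<^sub>R 2 ^ n) \<bullet> x)) \<le> ennreal ((1/2) ^ n * 2)"
        by (simp only: ennreal_mult'[symmetric] ennreal_leI zero_le_power zero_le_divide_1_iff zero_le_numeral)
    qed
    also have "\<dots> = ennreal (2 * DIM('a) * (1/2) ^ n)"
      by (subst sum_ennreal) (auto simp: mult_ac)
    finally show "(\<Sum>b\<in>(Basis::'a set). ennreal ((1/2) ^ n) * ennreal (1 - cos ((b /\<^sub>R 2 ^ n) \<bullet> x))) \<le> ennreal (2 * DIM('a) * (1/2) ^ n)" .
  qed
  also have "\<dots> < \<top>"
    by (subst suminf_ennreal2) (auto intro!: summable_mult summable_geometric)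
  finally show ?thesis .
qed

lemma cosine_weight_pos:
  assumes "x \<noteq> (0::'a::euclidean_space)" shows "0 < cosine_weight x"
proof -
  obtain b where b: "b \<in> Basis" "b \<bullet> x \<noteq> 0" using assms by (metis euclidean_all_zero_iff inner_commute)
  obtain n where n: "\<bar>b \<bullet> x\<bar> < 2 ^ n" using real_arch_pow[of 2 "\<bar>b \<bullet> x\<bar>"] by auto
  define t where "t = (b /\<^sub>R 2 ^ n) \<bullet> x"
  have t: "t \<noteq> 0" "\<bar>t\<bar> < 1" using b n by (auto simp: t_def field_simps abs_mult)
  then have "\<bar>t\<bar> < pi" using pi_gt3 by linarith
  then have "cos \<bar>t\<bar> < cos 0" using t by (intro cos_monotone_0_pi) auto
  then have "0 < 1 - cos t" by simp
  then have "0 < ennreal ((1/2) ^ n) * ennreal (1 - cos t)" by (simp add: ennreal_zero_less_mult_iff)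
  also have "\<dots> \<le> (\<Sum>b\<in>Basis. ennreal ((1/2) ^ n) * ennreal (1 - cos ((b /\<^sub>R 2 ^ n) \<bullet> x)))"
    unfolding t_def by (rule member_le_sum[OF b(1)]) auto
  also have "\<dots> \<le> cosine_weight x"
    unfolding cosine_weight_def
    using sum_le_suminf[OF summableI, of "{n}" "\<lambda>n. \<Sum>b\<in>Basis. ennreal ((1/2) ^ n) * ennreal (1 - cos ((b /\<^sub>R 2 ^ n) \<bullet> x))"] by simp
  finally show ?thesis .
qed

text \<open>
  Two Levy exponents of the same law differ by a continuous function with values in \<open>2 * pi * \<i> * \<int>\<close> that vanishes at the origin, so they
  agree. Their second differences then identify \<open>M\<close> and \<open>M'\<close> after multiplication with each \<open>1 - cos (w \<bullet> x)\<close>, hence after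
  multiplication with the weight above, which can be divided out off the origin.
\<close>

theorem levy_measure_unique:
  assumes "nongaussian_with_levy_measure \<mu> M" "nongaussian_with_levy_measure \<mu> M'"
  shows "M = M'"
proof -
  obtain b b' where bM: "has_levy_triplet \<mu> (\<lambda>_. 0) M b" and bM': "has_levy_triplet \<mu> (\<lambda>_. 0) M' b'"
    using assms by (auto simp: nongaussian_with_levy_measure_def)
  have M: "levy_measure M" and M': "levy_measure M'" using bM bM' by (auto simp: has_levy_triplet_def)
  note sM = levy_sets[OF M] and sM' = levy_sets[OF M']
  note [measurable_cong] = sM sM'
  define \<psi> where "\<psi> b M z = \<i> * complex_of_real (b \<bullet> z) + (CLINT x|M. levy_kernel z x)" for b and M :: "'a measure" and z
  have ch: "char_fun \<mu> z = exp (\<psi> b M z)" "char_fun \<mu> z = exp (\<psi> b' M' z)" for z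
    using bM bM' unfolding has_levy_triplet_def \<psi>_def levy_kernel_def by auto
  define D where "D z = \<psi> b M z - \<psi> b' M' z" for z
  have D1: "exp (D z) = 1" for z using ch[of z] by (simp add: D_def exp_diff)
  \<comment> \<open>The logarithm of a characteristic function is only determined up to \<open>2 * pi * \<i>\<close>; continuity removes the ambiguity.\<close>
  have "D constant_on UNIV"
  proof (rule continuous_discrete_range_constant)
    show "connected (UNIV :: 'a set)" by (rule connected_UNIV)
    show "continuous_on UNIV D"
      unfolding D_def \<psi>_def
      by (intro continuous_at_imp_continuous_on ballI continuous_intros isCont_levy_exponent M M')
    show "\<exists>e>0. \<forall>y. y \<in> UNIV \<and> D y \<noteq> D x \<longrightarrow> e \<le> norm (D y - D x)" for x
    proof (intro exI[of _ "2 * pi"] conjI allI impI)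
      fix y assume ne: "y \<in> UNIV \<and> D y \<noteq> D x"
      obtain m n :: int where mn: "Im (D x) = of_int (2 * m) * pi" "Im (D y) = of_int (2 * n) * pi"
        and re: "Re (D x) = 0" "Re (D y) = 0"
        using D1[of x] D1[of y] unfolding exp_eq_1 by blast
      have "m \<noteq> n" using ne mn re by (auto simp: complex_eq_iff)
      then have "1 \<le> \<bar>real_of_int (n - m)\<bar>" by linarith
      then have "2 * pi * 1 \<le> 2 * pi * \<bar>real_of_int (n - m)\<bar>" by (intro mult_left_mono) auto
      also have "\<dots> = \<bar>Im (D y - D x)\<bar>"
        by (simp add: mn abs_mult[symmetric] left_diff_distrib[symmetric] algebra_simps flip: abs_mult_pos)
           (simp add: abs_mult[symmetric] algebra_simps abs_if)
      also have "\<dots> \<le> norm (D y - D x)" by (rule abs_Im_le_cmod)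
      finally show "2 * pi \<le> norm (D y - D x)" by simp
    qed simp
  qed
  then have "D z = D 0" for z by (metis constant_on_def UNIV_I)
  moreover have "D 0 = 0" by (simp add: D_def \<psi>_def levy_kernel_def)
  ultimately have \<psi>eq: "\<psi> b M z = \<psi> b' M' z" for z by (metis D_def eq_iff_diff_eq_0)
  have second: "2 * \<psi> b M z - \<psi> b M (z + w) - \<psi> b M (z - w) =
      2 * (CLINT x|density M (\<lambda>x. ennreal (1 - cos (w \<bullet> x))). iexp (z \<bullet> x))" if "levy_measure M" for b M z w
    unfolding levy_exponent_second_difference[OF that, symmetric] \<psi>_def by (simp add: inner_add_right inner_diff_right algebra_simps)
  have \<rho>: "density M (\<lambda>x. ennreal (1 - cos (w \<bullet> x))) = density M' (\<lambda>x. ennreal (1 - cos (w \<bullet> x)))" for w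
  proof (rule finite_measure_char_fun_unique)
    show "(CLINT x|density M (\<lambda>x. ennreal (1 - cos (w \<bullet> x))). iexp (z \<bullet> x)) =
        (CLINT x|density M' (\<lambda>x. ennreal (1 - cos (w \<bullet> x))). iexp (z \<bullet> x))" for z
      using second[OF M, of b z w] second[OF M', of b' z w] \<psi>eq by simp
  qed (use finite_measure_one_minus_cos[OF M] finite_measure_one_minus_cos[OF M'] sM sM' in auto)
  have cw: "density M cosine_weight = density M' cosine_weight"
  proof (rule measure_eqI)
    fix A assume "A \<in> sets (density M cosine_weight)"
    then have A[measurable]: "A \<in> sets borel" using sM by simp
    have E: "emeasure (density K cosine_weight) A =
      (\<Sum>n. \<Sum>b\<in>Basis. ennreal ((1/2) ^ n) * emeasure (density K (\<lambda>x. ennreal (1 - cos ((b /\<^sub>R 2 ^ n) \<bullet> x)))) A)"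
      if K: "sets K = sets borel" for K :: "'a measure"
    proof -
      note [measurable_cong] = K
      have "emeasure (density K cosine_weight) A = (\<integral>\<^sup>+x. cosine_weight x * indicator A x \<partial>K)"
        by (rule emeasure_density) (use K A in \<open>simp_all cong: measurable_cong_sets\<close>)
      also have "\<dots> = (\<integral>\<^sup>+x. (\<Sum>n. \<Sum>b\<in>Basis. ennreal ((1/2) ^ n) * (ennreal (1 - cos ((b /\<^sub>R 2 ^ n) \<bullet> x)) * indicator A x)) \<partial>K)"
        by (simp only: cosine_weight_def ennreal_suminf_multc[symmetric] sum_distrib_right mult.assoc)
      also have "\<dots> = (\<Sum>n. \<Sum>b\<in>Basis. \<integral>\<^sup>+x. ennreal ((1/2) ^ n) * (ennreal (1 - cos ((b /\<^sub>R 2 ^ n) \<bullet> x)) * indicator A x) \<partial>K)"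
      proof (subst nn_integral_suminf)
        show "(\<Sum>n. \<integral>\<^sup>+x. (\<Sum>b\<in>Basis. ennreal ((1/2) ^ n) * (ennreal (1 - cos ((b /\<^sub>R 2 ^ n) \<bullet> x)) * indicator A x)) \<partial>K) =
          (\<Sum>n. \<Sum>b\<in>Basis. \<integral>\<^sup>+x. ennreal ((1/2) ^ n) * (ennreal (1 - cos ((b /\<^sub>R 2 ^ n) \<bullet> x)) * indicator A x) \<partial>K)"
          by (intro suminf_cong nn_integral_sum) measurable
      qed measurable
      also have "\<dots> = (\<Sum>n. \<Sum>b\<in>Basis. ennreal ((1/2) ^ n) * emeasure (density K (\<lambda>x. ennreal (1 - cos ((b /\<^sub>R 2 ^ n) \<bullet> x)))) A)"
      proof (intro suminf_cong sum.cong refl)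
        fix n and b :: 'a
        have "(\<integral>\<^sup>+x. ennreal ((1/2) ^ n) * (ennreal (1 - cos ((b /\<^sub>R 2 ^ n) \<bullet> x)) * indicator A x) \<partial>K) =
          ennreal ((1/2) ^ n) * (\<integral>\<^sup>+x. ennreal (1 - cos ((b /\<^sub>R 2 ^ n) \<bullet> x)) * indicator A x \<partial>K)"
          by (rule nn_integral_cmult) measurable
        also have "(\<integral>\<^sup>+x. ennreal (1 - cos ((b /\<^sub>R 2 ^ n) \<bullet> x)) * indicator A x \<partial>K) =
          emeasure (density K (\<lambda>x. ennreal (1 - cos ((b /\<^sub>R 2 ^ n) \<bullet> x)))) A"
          by (rule emeasure_density[symmetric]) measurable
        finally show "(\<integral>\<^sup>+x. ennreal ((1/2) ^ n) * (ennreal (1 - cos ((b /\<^sub>R 2 ^ n) \<bullet> x)) * indicator A x) \<partial>K) =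
          ennreal ((1/2) ^ n) * emeasure (density K (\<lambda>x. ennreal (1 - cos ((b /\<^sub>R 2 ^ n) \<bullet> x)))) A" .
      qed
      finally show ?thesis .
    qed
    show "emeasure (density M cosine_weight) A = emeasure (density M' cosine_weight) A"
      unfolding E[OF sM] E[OF sM'] \<rho> ..
  qed (simp add: sM sM')
  have inv: "K = density (density K cosine_weight) (\<lambda>x. 1 / cosine_weight x)" if K: "levy_measure K" for K :: "'a measure"
  proof -
    note [measurable_cong] = levy_sets[OF K]
    have "AE x in K. x \<noteq> 0" using K by (intro AE_I[of _ _ "{0}"]) (auto simp: levy_measure_def)
    then have "AE x in K. cosine_weight x * (1 / cosine_weight x) = 1"
    proof eventually_elim
      case (elim x)
      show ?case using cosine_weight_pos[OF elim] cosine_weight_finite[of x]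
        by (simp add: ennreal_times_divide ennreal_divide_self)
    qed
    then have "density K (\<lambda>x. cosine_weight x * (1 / cosine_weight x)) = density K (\<lambda>_. 1)" by (intro density_cong) auto
    then show ?thesis by (simp add: density_density_eq density_1)
  qed
  show ?thesis using inv[OF M] inv[OF M'] cw by simp
qed

section \<open>Poisson and compensated Poisson laws\<close>

lemma integrable_iexp_inner:
  assumes "finite_measure (M :: 'a::euclidean_space measure)" "sets M = sets borel"
  shows "integrable M (\<lambda>x. iexp (z \<bullet> x))"
proof -
  interpret finite_measure M by fact
  note [measurable_cong] = assms(2)
  show ?thesis by (rule integrable_bounded_complex[of _ 1]) auto
qed

lemma char_fun_product_sum:
  fixes M :: "'i \<Rightarrow> 'a::euclidean_space measure"
  assumes M: "\<And>i. prob_space (M i)" "\<And>i. sets (M i) = sets borel" and J: "finite J" "J \<subseteq> I"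
  shows "(CLINT \<omega>|PiM I M. iexp (z \<bullet> (\<Sum>i\<in>J. \<omega> i))) = (\<Prod>i\<in>J. char_fun (M i) z)"
proof -
  interpret product_prob_space M I
    by (intro product_prob_spaceI M)
  note [measurable_cong] = M(2)
  have e: "iexp (z \<bullet> (\<Sum>i\<in>J. \<omega> i)) = (\<Prod>i\<in>J. iexp (z \<bullet> \<omega> i))" for \<omega> :: "'i \<Rightarrow> 'a"
    using J(1) by (simp add: inner_sum_right sum_distrib_left exp_sum)
  have "(CLINT \<omega>|PiM I M. iexp (z \<bullet> (\<Sum>i\<in>J. \<omega> i))) = (CLINT \<omega>|PiM I M. (\<Prod>i\<in>J. iexp (z \<bullet> restrict \<omega> J i)))"
    unfolding e by (intro Bochner_Integration.integral_cong prod.cong refl) auto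
  also have "\<dots> = (CLINT \<omega>|distr (PiM I M) (PiM J M) (\<lambda>x. restrict x J). (\<Prod>i\<in>J. iexp (z \<bullet> \<omega> i)))"
    using J by (subst integral_distr) (auto intro!: measurable_restrict_subset borel_measurable_prod)
  also have "\<dots> = (CLINT \<omega>|PiM J M. (\<Prod>i\<in>J. iexp (z \<bullet> \<omega> i)))"
    using distr_PiM_restrict_finite[OF J] by simp
  also have "\<dots> = (\<Prod>i\<in>J. char_fun (M i) z)"
    unfolding char_fun_def using J M
    by (subst product_integral_prod) (auto intro!: integrable_iexp_inner prob_space.finite_measure)
  finally show ?thesis .
qed

lemma norm_power2_eq_sum: "(norm (x::'a::euclidean_space))\<^sup>2 = (\<Sum>b\<in>Basis. (b \<bullet> x)\<^sup>2)"
  unfolding power2_norm_eq_inner by (subst euclidean_inner) (simp add: power2_eq_square inner_commute[of x])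

lemma prob_space_char_fun_unique:
  fixes \<mu> \<nu> :: "'a::euclidean_space measure"
  assumes "prob_space \<mu>" "sets \<mu> = sets borel" "prob_space \<nu>" "sets \<nu> = sets borel"
    and "\<And>z. char_fun \<mu> z = char_fun \<nu> z"
  shows "\<mu> = \<nu>"
  using assms by (intro finite_measure_char_fun_unique) (auto simp: char_fun_def prob_space.finite_measure)

text \<open>
  The sum of a Poisson number, with the total mass of \<open>\<rho>\<close> as parameter, of independent steps distributed according to the normalized
  \<open>\<rho>\<close>; the characteristic function is summed over the number of steps.
\<close>

lemma compound_poisson_exists:
  fixes \<rho> :: "'a::euclidean_space measure"
  assumes \<rho>: "finite_measure \<rho>" "sets \<rho> = sets borel"
  shows "\<exists>\<mu>. prob_space \<mu> \<and> sets \<mu> = sets borel \<and> (\<forall>z. char_fun \<mu> z = exp (CLINT x|\<rho>. iexp (z \<bullet> x) - 1))"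
proof -
  interpret \<rho>: finite_measure \<rho> by fact
  note [measurable_cong] = \<rho>(2)
  have sp: "space \<rho> = UNIV" using \<rho>(2) by (auto dest: sets_eq_imp_space_eq)
  define c where "c = measure \<rho> UNIV"
  show ?thesis
  proof (cases "c = 0")
    case True
    have "emeasure \<rho> A = 0" for A
      using True \<rho>.bounded_measure[of A] sp
      by (simp add: c_def \<rho>.emeasure_eq_measure measure_le_0_iff)
    then have "\<rho> = null_measure borel" by (intro measure_eqI) (auto simp: \<rho>)
    then have "(CLINT x|\<rho>. iexp (z \<bullet> x) - 1) = 0" for z by simp
    moreover have "char_fun (return borel 0) z = 1" for z :: 'a
      unfolding char_fun_def by (subst integral_return) auto
    ultimately show ?thesis by (intro exI[of _ "return borel 0"]) (auto intro: prob_space_return)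
  next
    case False
    then have c: "0 < c" by (simp add: c_def zero_less_measure_iff less_le)
    define P where "P = density \<rho> (\<lambda>_. ennreal (1 / c))"
    have P: "prob_space P"
    proof
      have "emeasure P (space P) = ennreal (1 / c) * emeasure \<rho> UNIV"
        by (simp add: P_def emeasure_density nn_integral_cmult sp)
      also have "\<dots> = 1" using c by (simp add: \<rho>.emeasure_eq_measure ennreal_mult[symmetric] c_def)
      finally show "emeasure P (space P) = 1" .
    qed
    have sP[measurable_cong]: "sets P = sets borel" by (simp add: P_def \<rho>)
    define \<phi> where "\<phi> z = char_fun P z" for z
    have \<phi>: "(CLINT x|\<rho>. iexp (z \<bullet> x) - 1) = complex_of_real c * (\<phi> z - 1)" for z
    proof -
      have "\<phi> z = (CLINT x|\<rho>. (1 / c) *\<^sub>R iexp (z \<bullet> x))"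
        unfolding \<phi>_def char_fun_def P_def using c by (subst integral_density) auto
      then have "complex_of_real c * \<phi> z = (CLINT x|\<rho>. iexp (z \<bullet> x))"
        using c by (simp add: scaleR_conv_of_real)
      moreover have "(CLINT x|\<rho>. iexp (z \<bullet> x) - 1) = (CLINT x|\<rho>. iexp (z \<bullet> x)) - complex_of_real c"
        using integrable_iexp_inner[OF \<rho>] by (simp add: sp c_def scaleR_conv_of_real)
      ultimately show ?thesis by (simp add: algebra_simps)
    qed
    define \<Omega> where "\<Omega> = PiM (UNIV :: nat set) (\<lambda>_. P)"
    define N where "N = measure_pmf (poisson_pmf c)"
    define X where "X = (\<lambda>(n::nat, \<omega>::nat \<Rightarrow> 'a). \<Sum>i<n. \<omega> i)"
    interpret \<Omega>: prob_space \<Omega> unfolding \<Omega>_def by (intro prob_space_PiM P)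
    interpret N: prob_space N unfolding N_def by (rule measure_pmf.prob_space_axioms)
    interpret pair_prob_space N \<Omega> ..
    have sets_N: "sets (N \<Otimes>\<^sub>M \<Omega>) = sets (count_space UNIV \<Otimes>\<^sub>M \<Omega>)"
      by (intro sets_pair_measure_cong) (simp_all add: N_def)
    have X[measurable]: "X \<in> borel_measurable (N \<Otimes>\<^sub>M \<Omega>)"
    proof -
      have "X \<in> borel_measurable (count_space UNIV \<Otimes>\<^sub>M \<Omega>)"
        by (rule measurable_pair_measure_countable1) (simp_all add: X_def \<Omega>_def)
      then show ?thesis by (simp add: measurable_cong_sets[OF sets_N refl])
    qed
    define \<mu> where "\<mu> = distr (N \<Otimes>\<^sub>M \<Omega>) borel X"
    have "char_fun \<mu> z = exp (complex_of_real c * (\<phi> z - 1))" for z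
    proof -
      have \<phi>1: "norm (\<phi> z) \<le> 1"
      proof -
        interpret PP: prob_space P by (rule P)
        have "norm (\<phi> z) \<le> (\<integral>x. norm (iexp (z \<bullet> x)) \<partial>P)" unfolding \<phi>_def char_fun_def by (rule integral_norm_bound)
        then show ?thesis by (simp add: PP.prob_space)
      qed
      have "char_fun \<mu> z = (CLINT w|N \<Otimes>\<^sub>M \<Omega>. iexp (z \<bullet> X w))"
        unfolding char_fun_def \<mu>_def by (subst integral_distr) auto
      also have "\<dots> = (CLINT n|N. (CLINT \<omega>|\<Omega>. iexp (z \<bullet> X (n, \<omega>))))"
        by (rule integral_fst'[symmetric], rule P.integrable_bounded_complex[of _ 1]) auto
      also have "\<dots> = (CLINT n|N. \<phi> z ^ n)"
      proof (intro Bochner_Integration.integral_cong refl)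
        fix n show "(CLINT \<omega>|\<Omega>. iexp (z \<bullet> X (n, \<omega>))) = \<phi> z ^ n"
          using char_fun_product_sum[of "\<lambda>_. P" "{..<n}" UNIV z] P sP by (simp add: X_def \<Omega>_def \<phi>_def)
      qed
      also have "\<dots> = (CLINT n|count_space UNIV. pmf (poisson_pmf c) n *\<^sub>R \<phi> z ^ n)"
        unfolding N_def measure_pmf_eq_density by (subst integral_density) (auto simp del: pmf_poisson)
      also have "\<dots> = (\<Sum>n. pmf (poisson_pmf c) n *\<^sub>R \<phi> z ^ n)"
      proof (rule integral_count_space_nat)
        have "integrable N (\<lambda>n. \<phi> z ^ n)"
          by (rule N.integrable_bounded_complex[of _ 1]) (use \<phi>1 in \<open>auto simp: N_def norm_power power_le_one\<close>)
        then show "integrable (count_space UNIV) (\<lambda>n. pmf (poisson_pmf c) n *\<^sub>R \<phi> z ^ n)"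
          unfolding N_def measure_pmf_eq_density by (subst (asm) integrable_density) (auto simp del: pmf_poisson)
      qed
      also have "\<dots> = (\<Sum>n. exp (- complex_of_real c) * ((complex_of_real c * \<phi> z) ^ n /\<^sub>R fact n))"
        using c by (intro suminf_cong) (simp add: scaleR_conv_of_real power_mult_distrib field_simps exp_of_real[symmetric])
      also have "\<dots> = exp (- complex_of_real c) * (\<Sum>n. (complex_of_real c * \<phi> z) ^ n /\<^sub>R fact n)"
        by (rule suminf_mult[OF summable_exp_generic])
      also have "(\<Sum>n. (complex_of_real c * \<phi> z) ^ n /\<^sub>R fact n) = exp (complex_of_real c * \<phi> z)"
        by (simp add: exp_def)
      finally show ?thesis by (simp add: exp_add[symmetric] right_diff_distrib)
    qed
    moreover have "prob_space \<mu>" unfolding \<mu>_def by (rule P.prob_space_distr) simp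
    ultimately show ?thesis by (intro exI[of _ \<mu>]) (auto simp: \<phi> \<mu>_def)
  qed
qed

text \<open>
  Fatou's lemma applied to \<open>2 * (1 - cos (t * y)) / t\<^sup>2\<close>, which converges to \<open>y\<^sup>2\<close> as \<open>t\<close> tends to 0; its expectation is
  read off from the characteristic function.
\<close>

lemma second_moment_from_char_fun:
  fixes \<rho> \<mu> :: "'a::euclidean_space measure"
  assumes \<rho>: "sets \<rho> = sets borel" "integrable \<rho> (\<lambda>x. (norm x)\<^sup>2)" "AE x in \<rho>. norm x \<le> 1"
    and \<mu>: "prob_space \<mu>" "sets \<mu> = sets borel"
    and ch: "\<And>z. char_fun \<mu> z = exp (CLINT x|\<rho>. levy_kernel z x)"
  shows "(\<integral>\<^sup>+x. ennreal ((b \<bullet> x)\<^sup>2) \<partial>\<mu>) \<le> ennreal (\<integral>x. (b \<bullet> x)\<^sup>2 \<partial>\<rho>)"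
proof -
  interpret prob_space \<mu> by fact
  note [measurable_cong] = \<rho>(1) \<mu>(2)
  define v where "v = (\<integral>x. (b \<bullet> x)\<^sup>2 \<partial>\<rho>)"
  have vi: "integrable \<rho> (\<lambda>x. (b \<bullet> x)\<^sup>2)"
    by (rule Bochner_Integration.integrable_bound[OF integrable_mult_right[OF \<rho>(2), of "(norm b)\<^sup>2"]])
       (auto intro!: AE_I2 inner_power2_le)
  define t where "t n = 1 / real (Suc n)" for n
  have t: "t n > 0" for n by (simp add: t_def)
  have tl: "t \<longlonglongrightarrow> 0" unfolding t_def by (rule LIMSEQ_Suc[OF lim_1_over_n])
  have bound: "2 * (1 - Re (char_fun \<mu> (t n *\<^sub>R b))) / (t n)\<^sup>2 \<le> v + (t n)\<^sup>2 * v\<^sup>2 / 4" for n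
  proof -
    define w where "w = (CLINT x|\<rho>. levy_kernel (t n *\<^sub>R b) x)"
    have kb: "AE x in \<rho>. norm (levy_kernel (t n *\<^sub>R b) x) \<le> (t n)\<^sup>2 / 2 * (b \<bullet> x)\<^sup>2"
      using \<rho>(3)
    proof eventually_elim
      case (elim x)
      then show ?case using norm_iexp_minus_one_minus[of "(t n *\<^sub>R b) \<bullet> x"] by (simp add: levy_kernel_def power_mult_distrib)
    qed
    have ki: "integrable \<rho> (levy_kernel (t n *\<^sub>R b))"
      using kb by (intro Bochner_Integration.integrable_bound[OF integrable_mult_right[OF vi, of "(t n)\<^sup>2 / 2"]]) auto
    have "norm w \<le> (\<integral>x. norm (levy_kernel (t n *\<^sub>R b) x) \<partial>\<rho>)" unfolding w_def by (rule integral_norm_bound)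
    also have "\<dots> \<le> (\<integral>x. (t n)\<^sup>2 / 2 * (b \<bullet> x)\<^sup>2 \<partial>\<rho>)"
      using kb ki vi by (intro integral_mono_AE) auto
    finally have w: "norm w \<le> (t n)\<^sup>2 * v / 2" by (simp add: v_def)
    have "Re w = (\<integral>x. Re (levy_kernel (t n *\<^sub>R b) x) \<partial>\<rho>)" unfolding w_def using ki by simp
    also have "\<dots> \<le> (\<integral>x. 0 \<partial>\<rho>)"
    proof (rule integral_mono)
      show "integrable \<rho> (\<lambda>x. Re (levy_kernel (t n *\<^sub>R b) x))" using ki by simp
    qed (simp_all add: levy_kernel_def Re_exp)
    finally have re: "Re w \<le> 0" by simp
    have "1 - Re (exp w) = (1 - exp (Re w)) + exp (Re w) * (1 - cos (Im w))" by (simp add: Re_exp algebra_simps)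
    also have "\<dots> \<le> - Re w + 1 * ((Im w)\<^sup>2 / 2)"
    proof (rule add_mono)
      show "1 - exp (Re w) \<le> - Re w" using exp_ge_add_one_self[of "Re w"] by linarith
      show "exp (Re w) * (1 - cos (Im w)) \<le> 1 * ((Im w)\<^sup>2 / 2)"
        using re one_minus_cos_bound[of "Im w"] by (intro mult_mono) auto
    qed
    also have "\<dots> \<le> norm w + (norm w)\<^sup>2 / 2"
      using abs_Re_le_cmod[of w] power_mono[OF abs_Im_le_cmod[of w], of 2] by simp
    also have "\<dots> \<le> (t n)\<^sup>2 * v / 2 + ((t n)\<^sup>2 * v / 2)\<^sup>2 / 2"
      using w by (intro add_mono divide_right_mono power_mono) auto
    finally have "2 * (1 - Re (exp w)) \<le> (v + (t n)\<^sup>2 * v\<^sup>2 / 4) * (t n)\<^sup>2"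
      by (simp add: power2_eq_square algebra_simps)
    then show ?thesis using t[of n] by (simp add: ch w_def divide_le_eq)
  qed
  have "(\<integral>\<^sup>+x. ennreal ((b \<bullet> x)\<^sup>2) \<partial>\<mu>) = (\<integral>\<^sup>+x. liminf (\<lambda>n. ennreal (2 * (1 - cos (t n * (b \<bullet> x))) / (t n)\<^sup>2)) \<partial>\<mu>)"
  proof (intro nn_integral_cong)
    fix x
    define y where "y = b \<bullet> x"
    have "((\<lambda>t. 2 * (1 - cos (t * y)) / t\<^sup>2) \<longlongrightarrow> y\<^sup>2) (at_right 0)"
      unfolding power2_eq_square by real_asymp
    moreover have "filterlim t (at_right 0) sequentially"
      using tl t[THEN less_imp_neq, symmetric] t by (auto simp: filterlim_at intro!: eventuallyI)
    ultimately have "(\<lambda>n. 2 * (1 - cos (t n * y)) / (t n)\<^sup>2) \<longlonglongrightarrow> y\<^sup>2" by (rule filterlim_compose)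
    then have L: "(\<lambda>n. ennreal (2 * (1 - cos (t n * y)) / (t n)\<^sup>2)) \<longlonglongrightarrow> ennreal (y\<^sup>2)" by (rule tendsto_ennrealI)
    show "ennreal ((b \<bullet> x)\<^sup>2) = liminf (\<lambda>n. ennreal (2 * (1 - cos (t n * (b \<bullet> x))) / (t n)\<^sup>2))"
      using lim_imp_Liminf[OF trivial_limit_sequentially L] unfolding y_def by (rule sym)
  qed
  also have "\<dots> \<le> liminf (\<lambda>n. \<integral>\<^sup>+x. ennreal (2 * (1 - cos (t n * (b \<bullet> x))) / (t n)\<^sup>2) \<partial>\<mu>)"
    by (rule nn_integral_liminf) measurable
  also have "\<dots> \<le> liminf (\<lambda>n. ennreal (v + (t n)\<^sup>2 * v\<^sup>2 / 4))"
  proof (intro Liminf_mono always_eventually allI)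
    fix n
    have i: "integrable \<mu> (\<lambda>x. iexp ((t n *\<^sub>R b) \<bullet> x))" by (rule integrable_iexp_inner[OF finite_measure_axioms \<mu>(2)])
    then have "integrable \<mu> (\<lambda>x. Re (iexp ((t n *\<^sub>R b) \<bullet> x)))" by (rule integrable_Re)
    then have ci: "integrable \<mu> (\<lambda>x. cos (t n * (b \<bullet> x)))" by (simp add: Re_exp)
    have "Re (char_fun \<mu> (t n *\<^sub>R b)) = (\<integral>x. cos (t n * (b \<bullet> x)) \<partial>\<mu>)"
      unfolding char_fun_def using integral_Re[OF i] by (simp add: Re_exp)
    then have "(\<integral>x. 2 * (1 - cos (t n * (b \<bullet> x))) / (t n)\<^sup>2 \<partial>\<mu>) = 2 * (1 - Re (char_fun \<mu> (t n *\<^sub>R b))) / (t n)\<^sup>2"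
      using ci by (simp add: prob_space)
    moreover have "(\<integral>\<^sup>+x. ennreal (2 * (1 - cos (t n * (b \<bullet> x))) / (t n)\<^sup>2) \<partial>\<mu>) = ennreal (\<integral>x. 2 * (1 - cos (t n * (b \<bullet> x))) / (t n)\<^sup>2 \<partial>\<mu>)"
      using ci by (intro nn_integral_eq_integral) auto
    ultimately show "(\<integral>\<^sup>+x. ennreal (2 * (1 - cos (t n * (b \<bullet> x))) / (t n)\<^sup>2) \<partial>\<mu>) \<le> ennreal (v + (t n)\<^sup>2 * v\<^sup>2 / 4)"
      using ennreal_leI[OF bound[of n]] by (simp only:)
  qed
  also have "\<dots> = ennreal v"
  proof -
    have "(\<lambda>n. v + (t n)\<^sup>2 * v\<^sup>2 / 4) \<longlonglongrightarrow> v + 0\<^sup>2 * v\<^sup>2 / 4" by (intro tendsto_intros tl) simp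
    then have "(\<lambda>n. ennreal (v + (t n)\<^sup>2 * v\<^sup>2 / 4)) \<longlonglongrightarrow> ennreal v" by (intro tendsto_ennrealI) simp
    then show ?thesis by (simp add: lim_imp_Liminf)
  qed
  finally show ?thesis by (simp add: v_def)
qed

text \<open>
  A compound Poisson law translated by its mean. The bound on the second moment is what makes sums of such laws over small shells converge.
\<close>

lemma compensated_poisson_exists:
  fixes \<rho> :: "'a::euclidean_space measure"
  assumes \<rho>: "finite_measure \<rho>" "sets \<rho> = sets borel" "AE x in \<rho>. norm x \<le> 1"
  shows "\<exists>\<mu>. prob_space \<mu> \<and> sets \<mu> = sets borel \<and> (\<forall>z. char_fun \<mu> z = exp (CLINT x|\<rho>. levy_kernel z x)) \<and>
    (\<integral>\<^sup>+x. ennreal ((norm x)\<^sup>2) \<partial>\<mu>) \<le> ennreal (\<integral>x. (norm x)\<^sup>2 \<partial>\<rho>)"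
proof -
  interpret \<rho>: finite_measure \<rho> by fact
  note [measurable_cong] = \<rho>(2)
  have xi: "integrable \<rho> (\<lambda>x. x)" using \<rho>(3) by (intro \<rho>.integrable_const_bound[of _ 1]) auto
  have x2: "integrable \<rho> (\<lambda>x. (norm x)\<^sup>2)"
  proof (rule \<rho>.integrable_const_bound[of _ 1])
    show "AE x in \<rho>. norm ((norm x)\<^sup>2) \<le> 1" using \<rho>(3) by eventually_elim (simp add: power_le_one)
  qed simp
  define m where "m = (\<integral>x. x \<partial>\<rho>)"
  obtain \<mu>0 where \<mu>0: "prob_space \<mu>0" and s0[measurable_cong]: "sets \<mu>0 = sets borel"
    and ch0: "\<And>z. char_fun \<mu>0 z = exp (CLINT x|\<rho>. iexp (z \<bullet> x) - 1)"
    using compound_poisson_exists[OF \<rho>(1,2)] by blast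
  define \<mu> where "\<mu> = distr \<mu>0 borel (\<lambda>x. x - m)"
  have p: "prob_space \<mu>" unfolding \<mu>_def by (rule prob_space.prob_space_distr[OF \<mu>0]) measurable
  have s: "sets \<mu> = sets borel" by (simp add: \<mu>_def)
  have ch: "char_fun \<mu> z = exp (CLINT x|\<rho>. levy_kernel z x)" for z
  proof -
    have "char_fun \<mu> z = (CLINT x|\<mu>0. iexp (- (z \<bullet> m)) * iexp (z \<bullet> x))"
      unfolding char_fun_def \<mu>_def
      by (subst integral_distr) (auto simp: inner_diff_right exp_add[symmetric] algebra_simps)
    also have "\<dots> = iexp (- (z \<bullet> m)) * exp (CLINT x|\<rho>. iexp (z \<bullet> x) - 1)"
      by (simp add: ch0[symmetric] char_fun_def)
    also have "\<dots> = exp ((CLINT x|\<rho>. iexp (z \<bullet> x) - 1) - \<i> * complex_of_real (z \<bullet> m))"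
      unfolding exp_add[symmetric] by (rule arg_cong[of _ _ exp]) simp
    also have "(CLINT x|\<rho>. iexp (z \<bullet> x) - 1) - \<i> * complex_of_real (z \<bullet> m) =
        (CLINT x|\<rho>. (iexp (z \<bullet> x) - 1) - \<i> * complex_of_real (z \<bullet> x))"
    proof -
      have "z \<bullet> m = (\<integral>x. z \<bullet> x \<partial>\<rho>)" unfolding m_def using xi by simp
      moreover have "integrable \<rho> (\<lambda>x. z \<bullet> x)" using xi by simp
      moreover have "integrable \<rho> (\<lambda>x. iexp (z \<bullet> x) - 1)" using integrable_iexp_inner[OF \<rho>(1,2)] by simp
      ultimately show ?thesis by simp
    qed
    also have "\<dots> = (CLINT x|\<rho>. levy_kernel z x)"
    proof (rule integral_cong_AE)
      show "AE x in \<rho>. iexp (z \<bullet> x) - 1 - \<i> * complex_of_real (z \<bullet> x) = levy_kernel z x"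
        using \<rho>(3) by eventually_elim (simp add: levy_kernel_def)
    qed measurable
    finally show ?thesis .
  qed
  have "(\<integral>\<^sup>+x. ennreal ((norm x)\<^sup>2) \<partial>\<mu>) = (\<integral>\<^sup>+x. (\<Sum>b\<in>Basis. ennreal ((b \<bullet> x)\<^sup>2)) \<partial>\<mu>)"
    by (intro nn_integral_cong) (simp add: norm_power2_eq_sum sum_nonneg)
  also have "\<dots> = (\<Sum>b\<in>Basis. \<integral>\<^sup>+x. ennreal ((b \<bullet> x)\<^sup>2) \<partial>\<mu>)" using s by (intro nn_integral_sum) (auto cong: measurable_cong_sets)
  also have "\<dots> \<le> (\<Sum>b\<in>(Basis::'a set). ennreal (\<integral>x. (b \<bullet> x)\<^sup>2 \<partial>\<rho>))"
    by (intro sum_mono second_moment_from_char_fun[OF \<rho>(2) x2 \<rho>(3) p s ch])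
  also have "\<dots> = ennreal (\<Sum>b\<in>(Basis::'a set). \<integral>x. (b \<bullet> x)\<^sup>2 \<partial>\<rho>)" by (intro sum_ennreal) simp
  also have "(\<Sum>b\<in>(Basis::'a set). \<integral>x. (b \<bullet> x)\<^sup>2 \<partial>\<rho>) = (\<integral>x. (\<Sum>b\<in>(Basis::'a set). (b \<bullet> x)\<^sup>2) \<partial>\<rho>)"
  proof (rule Bochner_Integration.integral_sum[symmetric])
    fix b :: 'a show "integrable \<rho> (\<lambda>x. (b \<bullet> x)\<^sup>2)"
      by (rule Bochner_Integration.integrable_bound[OF integrable_mult_right[OF x2, of "(norm b)\<^sup>2"]])
         (auto intro!: AE_I2 inner_power2_le)
  qed
  also have "\<dots> = (\<integral>x. (norm x)\<^sup>2 \<partial>\<rho>)"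
    by (intro Bochner_Integration.integral_cong) (simp_all add: norm_power2_eq_sum)
  finally show ?thesis using p s ch by blast
qed


text \<open>
  Summable first absolute moments make the series of independent variables converge absolutely almost surely, and dominated convergence
  transfers this to characteristic functions.
\<close>

lemma random_series_char_fun:
  fixes M :: "nat \<Rightarrow> 'a::euclidean_space measure"
  assumes M: "\<And>k. prob_space (M k)" "\<And>k. sets (M k) = sets borel"
    and a: "\<And>k. (\<integral>\<^sup>+x. ennreal (norm x) \<partial>M k) \<le> ennreal (a k)" "\<And>k. 0 \<le> a k" "summable a"
  shows "\<exists>\<mu>. prob_space \<mu> \<and> sets \<mu> = sets borel \<and> (\<forall>z. (\<lambda>n. \<Prod>k<n. char_fun (M k) z) \<longlonglongrightarrow> char_fun \<mu> z)"
proof -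
  interpret product_prob_space M UNIV by (intro product_prob_spaceI M)
  define \<Omega> where "\<Omega> = PiM (UNIV :: nat set) M"
  interpret \<Omega>: prob_space \<Omega> unfolding \<Omega>_def by (intro prob_space_PiM M)
  note [measurable_cong] = M(2)
  have [measurable]: "(\<lambda>\<omega>. \<omega> k) \<in> borel_measurable \<Omega>" for k
    using measurable_component_singleton[of k UNIV M] by (simp add: \<Omega>_def M(2) cong: measurable_cong_sets)
  have comp: "(\<integral>\<^sup>+\<omega>. f (\<omega> k) \<partial>\<Omega>) = (\<integral>\<^sup>+x. f x \<partial>M k)" if "f \<in> borel_measurable borel" for f k
  proof -
    have "(\<integral>\<^sup>+x. f x \<partial>M k) = (\<integral>\<^sup>+x. f x \<partial>distr \<Omega> (M k) (\<lambda>\<omega>. \<omega> k))"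
      using PiM_component[of k] by (simp add: \<Omega>_def)
    also have "\<dots> = (\<integral>\<^sup>+\<omega>. f (\<omega> k) \<partial>\<Omega>)"
    proof (rule nn_integral_distr)
      show "(\<lambda>\<omega>. \<omega> k) \<in> \<Omega> \<rightarrow>\<^sub>M M k" unfolding \<Omega>_def by (rule measurable_component_singleton) simp
    qed (use that M(2)[of k] in \<open>simp cong: measurable_cong_sets\<close>)
    finally show ?thesis by simp
  qed
  have "(\<integral>\<^sup>+\<omega>. (\<Sum>k. ennreal (norm (\<omega> k))) \<partial>\<Omega>) = (\<Sum>k. \<integral>\<^sup>+\<omega>. ennreal (norm (\<omega> k)) \<partial>\<Omega>)"
    by (rule nn_integral_suminf) measurable
  also have "\<dots> = (\<Sum>k. \<integral>\<^sup>+x. ennreal (norm x) \<partial>M k)" by (intro suminf_cong comp) measurable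
  also have "\<dots> \<le> (\<Sum>k. ennreal (a k))" by (intro suminf_le a(1)) auto
  also have "\<dots> < \<infinity>" using a(2,3) by (simp add: suminf_ennreal2 less_top[symmetric])
  finally have "(\<integral>\<^sup>+\<omega>. (\<Sum>k. ennreal (norm (\<omega> k))) \<partial>\<Omega>) \<noteq> \<infinity>" by simp
  then have "AE \<omega> in \<Omega>. (\<Sum>k. ennreal (norm (\<omega> k))) \<noteq> \<infinity>"
    by (intro nn_integral_noteq_infinite) measurable
  then have conv: "AE \<omega> in \<Omega>. (\<lambda>n. \<Sum>k<n. \<omega> k) \<longlonglongrightarrow> (\<Sum>k. \<omega> k)"
  proof eventually_elim
    case (elim \<omega>)
    then have "summable (\<lambda>k. norm (\<omega> k))" by (intro summable_suminf_not_top) auto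
    then show ?case by (rule summable_LIMSEQ[OF summable_norm_cancel])
  qed
  define \<mu> where "\<mu> = distr \<Omega> borel (\<lambda>\<omega>. \<Sum>k. \<omega> k)"
  have Sm[measurable]: "(\<lambda>\<omega>. \<Sum>k. \<omega> k) \<in> borel_measurable \<Omega>" by measurable
  have "(\<lambda>n. \<Prod>k<n. char_fun (M k) z) \<longlonglongrightarrow> char_fun \<mu> z" for z
  proof -
    have "(\<lambda>n. CLINT \<omega>|\<Omega>. iexp (z \<bullet> (\<Sum>k<n. \<omega> k))) \<longlonglongrightarrow> (CLINT \<omega>|\<Omega>. iexp (z \<bullet> (\<Sum>k. \<omega> k)))"
    proof (rule integral_dominated_convergence[where w="\<lambda>_. 1"])
      show "AE \<omega> in \<Omega>. (\<lambda>n. iexp (z \<bullet> (\<Sum>k<n. \<omega> k))) \<longlonglongrightarrow> iexp (z \<bullet> (\<Sum>k. \<omega> k))"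
        using conv by eventually_elim (intro tendsto_intros)
    qed simp_all
    moreover have "char_fun \<mu> z = (CLINT \<omega>|\<Omega>. iexp (z \<bullet> (\<Sum>k. \<omega> k)))"
      unfolding char_fun_def \<mu>_def by (subst integral_distr) auto
    moreover have "(CLINT \<omega>|\<Omega>. iexp (z \<bullet> (\<Sum>k<n. \<omega> k))) = (\<Prod>k<n. char_fun (M k) z)" for n
      unfolding \<Omega>_def by (rule char_fun_product_sum[OF M]) auto
    ultimately show ?thesis by simp
  qed
  moreover have "prob_space \<mu>" unfolding \<mu>_def by (rule \<Omega>.prob_space_distr) measurable
  ultimately show ?thesis by (intro exI[of _ \<mu>]) (simp add: \<mu>_def)
qed

text \<open>
  The second moment of a Levy measure over small balls tends to 0, so the radii can be chosen to make it decay geometrically.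
\<close>

lemma small_ball_radii:
  fixes M :: "'a::euclidean_space measure"
  assumes M: "levy_measure M"
  shows "\<exists>r. r 0 = (1::real) \<and> (\<forall>k. 0 < r k) \<and> decseq r \<and> r \<longlonglongrightarrow> 0 \<and>
    (\<forall>k. (\<integral>x. (norm x)\<^sup>2 * indicator {x. norm x \<le> r (Suc k)} x \<partial>M) \<le> (1/4) ^ k)"
proof -
  note [measurable_cong] = levy_sets[OF M]
  define F where "F e = (\<integral>x. (norm x)\<^sup>2 * indicator {x. norm x \<le> e} x \<partial>M)" for e
  have Fi: "integrable M (\<lambda>x. (norm x)\<^sup>2 * indicator {x. norm x \<le> e} x)" if "e \<le> 1" for e
    by (rule levy_integrable_bound[OF M, of _ 1]) (use that in \<open>auto simp: indicator_def min_def abs_square_le_1 split: if_splits\<close>)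
  have Fmono: "F d \<le> F e" if "d \<le> e" "e \<le> 1" for d e
    unfolding F_def using that by (intro integral_mono Fi) (auto simp: indicator_def)
  have "(\<lambda>n. F (1 / real (Suc n))) \<longlonglongrightarrow> (\<integral>x. 0 \<partial>M)"
    unfolding F_def
  proof (rule integral_dominated_convergence[where w="\<lambda>x. min ((norm x)\<^sup>2) 1"])
    show "integrable M (\<lambda>x. min ((norm x)\<^sup>2) 1)" by (rule levy_integrable_min[OF M])
    show "AE x in M. (\<lambda>n. (norm x)\<^sup>2 * indicator {x. norm x \<le> 1 / real (Suc n)} x) \<longlonglongrightarrow> 0"
    proof (intro AE_I2)
      fix x :: 'a
      show "(\<lambda>n. (norm x)\<^sup>2 * indicator {x. norm x \<le> 1 / real (Suc n)} x) \<longlonglongrightarrow> 0"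
      proof (cases "x = 0")
        case False
        then have "eventually (\<lambda>n. 1 / real (Suc n) < norm x) sequentially"
          using order_tendstoD(2)[OF LIMSEQ_Suc[OF lim_1_over_n], of "norm x"] by simp
        then have "eventually (\<lambda>n. (norm x)\<^sup>2 * indicator {x. norm x \<le> 1 / real (Suc n)} x = (0::real)) sequentially"
          by eventually_elim (simp add: indicator_def)
        then show ?thesis by (simp add: tendsto_eventually)
      qed simp
    qed
    show "AE x in M. norm ((norm x)\<^sup>2 * indicator {x. norm x \<le> 1 / real (Suc n)} x) \<le> min ((norm x)\<^sup>2) 1" for n
    proof (intro AE_I2)
      fix x :: 'a
      have "norm x \<le> 1" if "norm x \<le> 1 / real (Suc n)" using that order_trans[of _ "1 / real (Suc n)" 1] by simp
      then show "norm ((norm x)\<^sup>2 * indicator {x. norm x \<le> 1 / real (Suc n)} x) \<le> min ((norm x)\<^sup>2) 1"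
        by (auto simp: indicator_def power_le_one)
    qed
  qed measurable
  then have lim: "(\<lambda>n. F (1 / real (Suc n))) \<longlonglongrightarrow> 0" by simp
  have "\<exists>e>0. e \<le> 1 / real (Suc k) \<and> F e \<le> (1/4) ^ k" for k :: nat
  proof -
    have "eventually (\<lambda>n. F (1 / real (Suc n)) < (1/4) ^ k) sequentially"
      using order_tendstoD(2)[OF lim, of "(1/4) ^ k"] by simp
    then obtain n where n: "n \<ge> k" "F (1 / real (Suc n)) < (1/4) ^ k"
      unfolding eventually_sequentially by (metis nle_le)
    have "1 / real (Suc n) \<le> 1 / real (Suc k)" using n(1) by (intro divide_left_mono) auto
    then show ?thesis using n(2) by (intro exI[of _ "1 / real (Suc n)"]) auto
  qed
  then obtain e where e: "\<And>k. 0 < e k" "\<And>k. e k \<le> 1 / real (Suc k)" "\<And>k. F (e k) \<le> (1/4) ^ k" by metis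
  define r where "r = rec_nat (1::real) (\<lambda>k s. min s (e k))"
  have r0: "r 0 = 1" and rS: "r (Suc k) = min (r k) (e k)" for k by (simp_all add: r_def)
  have rpos: "0 < r k" for k by (induction k) (auto simp: r0 rS e)
  have dec: "decseq r" by (rule decseq_SucI) (simp add: rS)
  have "(\<lambda>k. r (Suc k)) \<longlonglongrightarrow> 0"
    by (rule tendsto_sandwich[OF _ _ tendsto_const LIMSEQ_Suc[OF lim_1_over_n]])
       (auto simp: rS less_imp_le[OF rpos] less_imp_le[OF e(1)] intro!: eventuallyI min.coboundedI2 e(2)[simplified])
  then have "r \<longlonglongrightarrow> 0" by (rule LIMSEQ_imp_Suc)
  moreover have "F (r (Suc k)) \<le> (1/4) ^ k" for k
  proof -
    have "e k \<le> 1" using e(2)[of k] order_trans[of _ "1 / real (Suc k)" 1] by simp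
    then have "F (r (Suc k)) \<le> F (e k)" by (intro Fmono) (simp_all add: rS)
    then show ?thesis using e(3)[of k] by simp
  qed
  ultimately show ?thesis using r0 rpos dec unfolding F_def by blast
qed

section \<open>Existence of infinitely divisible laws\<close>

lemma levy_integrable_indicator:
  assumes M: "levy_measure M" and d: "0 < d" "d \<le> 1" and A: "A \<in> sets borel" "\<And>x. x \<in> A \<Longrightarrow> d < norm x"
  shows "integrable M (indicator A :: 'a::euclidean_space \<Rightarrow> real)"
proof (rule levy_integrable_bound[OF M, of _ "1 / d\<^sup>2"])
  fix x :: 'a
  show "norm (indicator A x :: real) \<le> 1 / d\<^sup>2 * min ((norm x)\<^sup>2) 1"
  proof (cases "x \<in> A")
    case True
    have "d\<^sup>2 \<le> min ((norm x)\<^sup>2) 1" using A(2)[OF True] d by (simp add: power_mono power_le_one)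
    then show ?thesis using True d by (simp add: le_divide_eq)
  qed simp
qed (use A in simp)

lemma
  assumes M: "levy_measure M" and A: "A \<in> sets borel"
  shows finite_measure_restricted: "integrable M (indicator A :: 'a::euclidean_space \<Rightarrow> real) \<Longrightarrow>
      finite_measure (density M (\<lambda>x. ennreal (indicator A x)))"
    and integral_restricted: "f \<in> borel_measurable borel \<Longrightarrow>
      (\<integral>x. f x \<partial>density M (\<lambda>x. ennreal (indicator A x))) = (\<integral>x. indicator A x *\<^sub>R (f x :: 'b::{banach, second_countable_topology}) \<partial>M)"
proof -
  note [measurable_cong] = levy_sets[OF M] and [measurable] = A
  show "finite_measure (density M (\<lambda>x. ennreal (indicator A x)))" if "integrable M (indicator A :: 'a \<Rightarrow> real)"
  proof (rule finite_measureI)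
    have "(\<integral>\<^sup>+x. ennreal (indicator A x) \<partial>M) = ennreal (\<integral>x. indicator A x \<partial>M)"
      by (rule nn_integral_eq_integral[OF that]) simp
    then show "emeasure (density M (\<lambda>x. ennreal (indicator A x))) (space (density M (\<lambda>x. ennreal (indicator A x)))) \<noteq> \<infinity>"
      by (simp add: emeasure_density cong: nn_integral_cong)
  qed
  show "(\<integral>x. f x \<partial>density M (\<lambda>x. ennreal (indicator A x))) = (\<integral>x. indicator A x *\<^sub>R f x \<partial>M)"
    if "f \<in> borel_measurable borel"
    using that by (intro integral_density) auto
qed

text \<open>
  The unit ball without the origin is cut into shells, each of finite mass, and the compensated Poisson laws of the shells are added independently.
  The radii are chosen with second moments of order \<open>4 powr (- k)\<close>, so the first moments are of order \<open>2 powr (- k)\<close> and the series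
  converges. The mass outside the unit ball is finite and contributes an ordinary compound Poisson law.
\<close>

theorem levy_khintchine_exists:
  fixes M :: "'a::euclidean_space measure"
  assumes M: "levy_measure M"
  shows "\<exists>\<mu>. prob_space \<mu> \<and> sets \<mu> = sets borel \<and> (\<forall>z. char_fun \<mu> z = exp (CLINT x|M. levy_kernel z x))"
proof -
  note [measurable_cong] = levy_sets[OF M]
  obtain r where r0: "r 0 = (1::real)" and rpos: "\<And>k. 0 < r k" and rdec: "decseq r" and rlim: "r \<longlonglongrightarrow> 0"
    and rint: "\<And>k. (\<integral>x. (norm x)\<^sup>2 * indicator {x. norm x \<le> r (Suc k)} x \<partial>M) \<le> (1/4) ^ k"
    using small_ball_radii[OF M] by blast
  have r1: "r k \<le> 1" for k using decseqD[OF rdec, of 0 k] r0 by simp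
  define Sh where "Sh k = {x::'a. r (Suc k) < norm x \<and> norm x \<le> r k}" for k
  have Shm[measurable]: "Sh k \<in> sets borel" for k unfolding Sh_def by measurable
  have Shi: "integrable M (indicator (Sh k) :: 'a \<Rightarrow> real)" for k
    by (rule levy_integrable_indicator[OF M rpos[of "Suc k"] r1]) (auto simp: Sh_def)
  define \<rho> where "\<rho> k = density M (\<lambda>x. ennreal (indicator (Sh k) x))" for k
  have \<rho>fin: "finite_measure (\<rho> k)" for k unfolding \<rho>_def by (rule finite_measure_restricted[OF M Shm Shi])
  have \<rho>s: "sets (\<rho> k) = sets borel" for k by (simp add: \<rho>_def levy_sets[OF M])
  have \<rho>1: "AE x in \<rho> k. norm x \<le> 1" for k
    unfolding \<rho>_def using order_trans[OF _ r1[of k]]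
    by (subst AE_density) (auto simp: Sh_def indicator_def intro!: AE_I2)
  have "\<forall>k. \<exists>\<mu>. prob_space \<mu> \<and> sets \<mu> = sets borel \<and> (\<forall>z. char_fun \<mu> z = exp (CLINT x|\<rho> k. levy_kernel z x)) \<and>
    (\<integral>\<^sup>+x. ennreal ((norm x)\<^sup>2) \<partial>\<mu>) \<le> ennreal (\<integral>x. (norm x)\<^sup>2 \<partial>\<rho> k)"
    by (intro allI compensated_poisson_exists \<rho>fin \<rho>s \<rho>1)
  from choice[OF this] obtain \<mu> where \<mu>: "\<And>k. prob_space (\<mu> k)" "\<And>k. sets (\<mu> k) = sets borel"
    and ch: "\<And>k z. char_fun (\<mu> k) z = exp (CLINT x|\<rho> k. levy_kernel z x)"
    and m2: "\<And>k. (\<integral>\<^sup>+x. ennreal ((norm x)\<^sup>2) \<partial>\<mu> k) \<le> ennreal (\<integral>x. (norm x)\<^sup>2 \<partial>\<rho> k)"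
    by blast
  define V where "V k = (\<integral>x. (norm x)\<^sup>2 \<partial>\<rho> k)" for k
  have V0: "0 \<le> V k" for k by (simp add: V_def)
  define C where "C = 4 + V 0"
  have VC: "V k \<le> C * (1/4) ^ k" for k
  proof (cases k)
    case 0 then show ?thesis by (simp add: C_def)
  next
    case (Suc j)
    have "V (Suc j) = (\<integral>x. indicator (Sh (Suc j)) x *\<^sub>R (norm x)\<^sup>2 \<partial>M)"
      unfolding V_def \<rho>_def by (rule integral_restricted[OF M Shm]) measurable
    also have "\<dots> \<le> (\<integral>x. (norm x)\<^sup>2 * indicator {x. norm x \<le> r (Suc j)} x \<partial>M)"
    proof (rule integral_mono)
      have le: "(norm x)\<^sup>2 \<le> 1" if "norm x \<le> r (Suc j)" for x :: 'a
        using that r1[of "Suc j"] by (intro power_le_one) auto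
      show "integrable M (\<lambda>x. indicator (Sh (Suc j)) x *\<^sub>R (norm x)\<^sup>2)"
        by (rule levy_integrable_bound[OF M, of _ 1]) (auto simp: indicator_def Sh_def le)
      show "integrable M (\<lambda>x. (norm x)\<^sup>2 * indicator {x. norm x \<le> r (Suc j)} x)"
        by (rule levy_integrable_bound[OF M, of _ 1]) (auto simp: indicator_def le)
    qed (auto simp: indicator_def Sh_def)
    also have "\<dots> \<le> 4 * (1/4) ^ Suc j" using rint[of j] by simp
    also have "\<dots> \<le> C * (1/4) ^ Suc j" using V0[of 0] by (intro mult_right_mono) (simp_all add: C_def)
    finally show ?thesis using Suc by simp
  qed
  define a where "a k = (C + 1) * (1/2) ^ k" for k :: nat
  have C0: "0 \<le> C" using V0[of 0] by (simp add: C_def)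
  have m1: "(\<integral>\<^sup>+x. ennreal (norm x) \<partial>\<mu> k) \<le> ennreal (a k)" for k
  proof -
    interpret \<mu>: prob_space "\<mu> k" by (rule \<mu>)
    note [measurable_cong] = \<mu>(2)
    \<comment> \<open>By the arithmetic-geometric mean inequality, up to a constant, the second moment bounds the first one at the geometric rate \<open>1 / 2\<close>.\<close>
    have le: "s \<le> 2 ^ k * s\<^sup>2 + (1/2) ^ k" if "0 \<le> s" for s :: real
    proof (cases "1 \<le> 2 ^ k * s")
      case True
      then have "1 * s \<le> (2 ^ k * s) * s" using that by (intro mult_right_mono) auto
      also have "\<dots> = 2 ^ k * s\<^sup>2" by (simp add: power2_eq_square)
      finally show ?thesis by (simp add: add_increasing2)
    next
      case False
      then have "s \<le> (1/2) ^ k" by (simp add: power_divide field_simps)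
      then show ?thesis by (simp add: add_increasing)
    qed
    have "(\<integral>\<^sup>+x. ennreal (norm x) \<partial>\<mu> k) \<le> (\<integral>\<^sup>+x. ennreal (2 ^ k) * ennreal ((norm x)\<^sup>2) + ennreal ((1/2) ^ k) \<partial>\<mu> k)"
      using le by (intro nn_integral_mono) (simp add: ennreal_mult[symmetric] ennreal_plus[symmetric] ennreal_leI del: ennreal_plus)
    also have "\<dots> = ennreal (2 ^ k) * (\<integral>\<^sup>+x. ennreal ((norm x)\<^sup>2) \<partial>\<mu> k) + ennreal ((1/2) ^ k)"
      by (subst nn_integral_add) (auto simp: nn_integral_cmult \<mu>.emeasure_space_1)
    also have "\<dots> \<le> ennreal (2 ^ k) * ennreal (V k) + ennreal ((1/2) ^ k)"
      using m2[of k] by (intro add_mono mult_left_mono) (auto simp: V_def)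
    also have "\<dots> = ennreal (2 ^ k * V k + (1/2) ^ k)"
      using V0 by (simp add: ennreal_mult[symmetric] ennreal_plus[symmetric] del: ennreal_plus)
    also have "2 ^ k * V k + (1/2) ^ k \<le> 2 ^ k * (C * (1/4) ^ k) + (1/2) ^ k" by (intro add_mono mult_left_mono VC) auto
    also have "(2::real) ^ k * (C * (1/4) ^ k) + (1/2) ^ k = a k"
    proof -
      have "(2::real) ^ k * (1/4) ^ k = (1/2) ^ k" by (simp add: power_mult_distrib[symmetric])
      then show ?thesis by (simp add: a_def algebra_simps)
    qed
    finally show ?thesis by (simp add: ennreal_leI)
  qed
  have "\<exists>\<mu>s. prob_space \<mu>s \<and> sets \<mu>s = sets borel \<and> (\<forall>z. (\<lambda>n. \<Prod>k<n. char_fun (\<mu> k) z) \<longlonglongrightarrow> char_fun \<mu>s z)"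
  proof (rule random_series_char_fun[OF \<mu> m1])
    show "0 \<le> a k" for k using C0 by (simp add: a_def)
    show "summable a" unfolding a_def by (intro summable_mult summable_geometric) simp
  qed
  then obtain \<mu>s where \<mu>s: "prob_space \<mu>s" "sets \<mu>s = sets borel"
    and lim: "\<And>z. (\<lambda>n. \<Prod>k<n. char_fun (\<mu> k) z) \<longlonglongrightarrow> char_fun \<mu>s z" by blast
  have ks: "integrable M (\<lambda>x. indicator A x *\<^sub>R levy_kernel z x)" if "A \<in> sets borel" for A z
    using integrable_levy_kernel[OF M] that levy_sets[OF M] by (intro integrable_mult_indicator) auto
  have chs: "char_fun \<mu>s z = exp (CLINT x|M. indicator {x. 0 < norm x \<and> norm x \<le> 1} x *\<^sub>R levy_kernel z x)" for z
  proof (rule LIMSEQ_unique[OF lim])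
    have "(\<Prod>k<n. char_fun (\<mu> k) z) = exp (CLINT x|M. indicator {x. r n < norm x \<and> norm x \<le> 1} x *\<^sub>R levy_kernel z x)" for n
    proof -
      have "(\<Sum>k<n. indicator (Sh k) x) = (indicator {x. r n < norm x \<and> norm x \<le> 1} x :: real)" for x
      proof (induction n)
        case 0 then show ?case by (simp add: r0 indicator_def)
      next
        case (Suc n)
        have "r (Suc n) \<le> r n" "r n \<le> 1" using decseq_SucD[OF rdec] r1 by auto
        then show ?case using Suc by (auto simp: Sh_def indicator_def)
      qed
      then have "(CLINT x|M. indicator {x. r n < norm x \<and> norm x \<le> 1} x *\<^sub>R levy_kernel z x) =
          (CLINT x|M. (\<Sum>k<n. indicator (Sh k) x *\<^sub>R levy_kernel z x))"
        by (simp add: scaleR_sum_left[symmetric])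
      also have "\<dots> = (\<Sum>k<n. CLINT x|\<rho> k. levy_kernel z x)"
        unfolding \<rho>_def by (subst Bochner_Integration.integral_sum) (auto intro!: ks sum.cong simp: integral_restricted[OF M])
      finally show ?thesis by (simp add: ch exp_sum)
    qed
    moreover have "(\<lambda>n. CLINT x|M. indicator {x. r n < norm x \<and> norm x \<le> 1} x *\<^sub>R levy_kernel z x) \<longlonglongrightarrow>
        (CLINT x|M. indicator {x. 0 < norm x \<and> norm x \<le> 1} x *\<^sub>R levy_kernel z x)"
    proof (rule integral_dominated_convergence[where w="\<lambda>x. norm (levy_kernel z x)"])
      show "integrable M (\<lambda>x. norm (levy_kernel z x))" using integrable_levy_kernel[OF M] by simp
      show "AE x in M. (\<lambda>n. indicator {x. r n < norm x \<and> norm x \<le> 1} x *\<^sub>R levy_kernel z x) \<longlonglongrightarrow>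
        indicator {x. 0 < norm x \<and> norm x \<le> 1} x *\<^sub>R levy_kernel z x"
      proof (intro AE_I2 tendsto_scaleR tendsto_const)
        fix x :: 'a
        show "(\<lambda>n. indicator {x. r n < norm x \<and> norm x \<le> 1} x :: real) \<longlonglongrightarrow> indicator {x. 0 < norm x \<and> norm x \<le> 1} x"
        proof (cases "x = 0")
          case True
          have "\<not> r n < 0" for n using rpos[of n] by simp
          then show ?thesis using True by (simp add: indicator_def)
        next
          case False
          then have "eventually (\<lambda>n. r n < norm x) sequentially" using order_tendstoD(2)[OF rlim] by simp
          then have "eventually (\<lambda>n. indicator {x. r n < norm x \<and> norm x \<le> 1} x = (indicator {x. 0 < norm x \<and> norm x \<le> 1} x :: real)) sequentially"
            by eventually_elim (use False in \<open>simp add: indicator_def\<close>)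
          then show ?thesis by (simp add: tendsto_eventually)
        qed
      qed
      show "AE x in M. norm (indicator {x. r n < norm x \<and> norm x \<le> 1} x *\<^sub>R levy_kernel z x) \<le> norm (levy_kernel z x)" for n
        by (auto simp: indicator_def)
    qed measurable
    ultimately show "(\<lambda>n. \<Prod>k<n. char_fun (\<mu> k) z) \<longlonglongrightarrow> exp (CLINT x|M. indicator {x. 0 < norm x \<and> norm x \<le> 1} x *\<^sub>R levy_kernel z x)"
      by (simp add: tendsto_exp)
  qed
  define L where "L = {x::'a. 1 < norm x}"
  have Lm[measurable]: "L \<in> sets borel" unfolding L_def by measurable
  have Li: "integrable M (indicator L :: 'a \<Rightarrow> real)"
    by (rule levy_integrable_indicator[OF M, of 1]) (auto simp: L_def)
  obtain \<mu>l where \<mu>l: "prob_space \<mu>l" "sets \<mu>l = sets borel"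
    and chl0: "\<And>z. char_fun \<mu>l z = exp (CLINT x|density M (\<lambda>x. ennreal (indicator L x)). iexp (z \<bullet> x) - 1)"
    using compound_poisson_exists[OF finite_measure_restricted[OF M Lm Li]] levy_sets[OF M] by auto
  have chl: "char_fun \<mu>l z = exp (CLINT x|M. indicator L x *\<^sub>R levy_kernel z x)" for z
    unfolding chl0
    by (subst integral_restricted[OF M Lm])
       (auto intro!: arg_cong[of _ _ exp] Bochner_Integration.integral_cong simp: L_def indicator_def levy_kernel_def)
  \<comment> \<open>The law is that of the sum of two independent variables, indexed by \<open>bool\<close>: one for the jumps in the unit ball and one for the others.\<close>
  define N where "N b = (if b then \<mu>s else \<mu>l)" for b
  have N: "prob_space (N b)" "sets (N b) = sets borel" for b using \<mu>s \<mu>l by (auto simp: N_def)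
  note [measurable_cong] = N(2)
  define \<nu> where "\<nu> = distr (PiM UNIV N) borel (\<lambda>\<omega>. \<Sum>b\<in>UNIV. \<omega> b)"
  have meas[measurable]: "(\<lambda>\<omega>. \<Sum>b\<in>UNIV. \<omega> b) \<in> borel_measurable (PiM UNIV N)"
    by (intro borel_measurable_sum) simp
  have "char_fun \<nu> z = exp (CLINT x|M. levy_kernel z x)" for z
  proof -
    have "char_fun \<nu> z = (CLINT \<omega>|PiM UNIV N. iexp (z \<bullet> (\<Sum>b\<in>UNIV. \<omega> b)))"
      unfolding char_fun_def \<nu>_def by (subst integral_distr) auto
    also have "\<dots> = char_fun \<mu>s z * char_fun \<mu>l z"
      using char_fun_product_sum[of N UNIV UNIV z] N by (simp add: UNIV_bool N_def mult.commute)
    also have "\<dots> = exp (CLINT x|M. indicator {x. 0 < norm x \<and> norm x \<le> 1} x *\<^sub>R levy_kernel z x + indicator L x *\<^sub>R levy_kernel z x)"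
      unfolding chs chl exp_add[symmetric] by (subst Bochner_Integration.integral_add) (auto intro!: ks)
    also have "(\<lambda>x. indicator {x. 0 < norm x \<and> norm x \<le> 1} x *\<^sub>R levy_kernel z x + indicator L x *\<^sub>R levy_kernel z x) = levy_kernel z"
      by (rule ext) (auto simp: indicator_def L_def levy_kernel_def)
    finally show ?thesis .
  qed
  moreover have "prob_space \<nu>" unfolding \<nu>_def by (intro prob_space.prob_space_distr prob_space_PiM N meas)
  ultimately show ?thesis by (intro exI[of _ \<nu>]) (simp add: \<nu>_def)
qed

lemma levy_measure_scale:
  assumes M: "levy_measure M" and c: "0 \<le> c" shows "levy_measure (density M (\<lambda>_. ennreal c))"
proof -
  note [measurable_cong] = levy_sets[OF M]
  show ?thesis using M by (auto simp: levy_measure_def emeasure_density nn_integral_density nn_integral_cmult nn_integral_cmult_indicator ennreal_mult_less_top)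
qed

text \<open>
  The law belonging to the Levy measure divided by \<open>n\<close> is an \<open>n\<close>-th convolution root: its characteristic function is an \<open>n\<close>-th root of
  the original one, without any choice of branch, since the exponents are given explicitly.
\<close>

theorem infinitely_divisible_exists:
  fixes M :: "'a::euclidean_space measure"
  assumes M: "levy_measure M"
  shows "\<exists>\<mu>. infinitely_divisible \<mu> \<and> nongaussian_with_levy_measure \<mu> M"
proof -
  obtain \<mu> where \<mu>: "prob_space \<mu>" "sets \<mu> = sets borel" and ch: "\<And>z. char_fun \<mu> z = exp (CLINT x|M. levy_kernel z x)"
    using levy_khintchine_exists[OF M] by blast
  have "\<exists>\<nu>. prob_space \<nu> \<and> sets \<nu> = sets borel \<and> \<mu> = distr (PiM {..<n} (\<lambda>_. \<nu>)) borel (\<lambda>x. \<Sum>i<n. x i)"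
    if n: "1 \<le> n" for n :: nat
  proof -
    define K where "K = density M (\<lambda>_. ennreal (1 / real n))"
    have K: "levy_measure K" unfolding K_def by (rule levy_measure_scale[OF M]) simp
    obtain \<nu> where \<nu>: "prob_space \<nu>" "sets \<nu> = sets borel" and ch': "\<And>z. char_fun \<nu> z = exp (CLINT x|K. levy_kernel z x)"
      using levy_khintchine_exists[OF K] by blast
    note [measurable_cong] = \<nu>(2)
    have meas[measurable]: "(\<lambda>x. \<Sum>i<n. x i) \<in> borel_measurable (PiM {..<n} (\<lambda>_. \<nu>))"
      by (intro borel_measurable_sum) simp
    have "\<mu> = distr (PiM {..<n} (\<lambda>_. \<nu>)) borel (\<lambda>x. \<Sum>i<n. x i)"
    proof (rule prob_space_char_fun_unique[OF \<mu>])
      show "prob_space (distr (PiM {..<n} (\<lambda>_. \<nu>)) borel (\<lambda>x. \<Sum>i<n. x i))"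
        by (intro prob_space.prob_space_distr prob_space_PiM \<nu> meas)
      fix z
      have "char_fun (distr (PiM {..<n} (\<lambda>_. \<nu>)) borel (\<lambda>x. \<Sum>i<n. x i)) z = char_fun \<nu> z ^ n"
        unfolding char_fun_def[of "distr _ _ _"] using char_fun_product_sum[of "\<lambda>_. \<nu>" "{..<n}" "{..<n}" z] \<nu>
        by (subst integral_distr) auto
      also have "\<dots> = exp (of_nat n * (CLINT x|K. levy_kernel z x))" by (simp add: ch' exp_of_nat_mult)
      also have "(CLINT x|K. levy_kernel z x) = (CLINT x|M. (1 / real n) *\<^sub>R levy_kernel z x)"
        unfolding K_def using levy_sets[OF M] by (intro integral_density) (auto cong: measurable_cong_sets)
      also have "of_nat n * \<dots> = (CLINT x|M. levy_kernel z x)" using n by (simp add: scaleR_conv_of_real)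
      finally show "char_fun \<mu> z = char_fun (distr (PiM {..<n} (\<lambda>_. \<nu>)) borel (\<lambda>x. \<Sum>i<n. x i)) z"
        by (simp add: ch)
    qed simp
    then show ?thesis using \<nu> by blast
  qed
  then have "infinitely_divisible \<mu>" using \<mu> by (auto simp: infinitely_divisible_def)
  moreover have "has_levy_triplet \<mu> (\<lambda>_. 0) M 0"
    unfolding has_levy_triplet_def using M ch by (simp add: levy_kernel_def linear_zero)
  ultimately show ?thesis by (auto simp: nongaussian_with_levy_measure_def)
qed

section \<open>Polar coordinates and the associated measure\<close>

text \<open>
  The integrals with respect to a measure, described by positive homogeneity, additivity and monotone convergence. In this form iterated integrals such as
  those of the polar representation become measures, and identities between values on sets extend to integrals of functions, without transition
  kernels.
\<close>

definition positive_functional :: "'a measure \<Rightarrow> (('a \<Rightarrow> ennreal) \<Rightarrow> ennreal) \<Rightarrow> bool" where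
  "positive_functional N I \<longleftrightarrow>
     (\<forall>c. \<forall>f\<in>borel_measurable N. I (\<lambda>x. c * f x) = c * I f) \<and>
     (\<forall>f\<in>borel_measurable N. \<forall>g\<in>borel_measurable N. I (\<lambda>x. f x + g x) = I f + I g) \<and>
     (\<forall>F :: nat \<Rightarrow> _. (\<forall>i. F i \<in> borel_measurable N) \<longrightarrow> incseq F \<longrightarrow> I (\<lambda>x. SUP i. F i x) = (SUP i. I (F i)))"

lemma positive_functional_add:
  "positive_functional N I \<Longrightarrow> f \<in> borel_measurable N \<Longrightarrow> g \<in> borel_measurable N \<Longrightarrow> I (\<lambda>x. f x + g x) = I f + I g"
  by (simp add: positive_functional_def)

lemma positive_functional_mono:
  assumes I: "positive_functional N I" and f: "f \<in> borel_measurable N" and g: "g \<in> borel_measurable N" and le: "\<And>x. f x \<le> g x"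
  shows "I f \<le> I g"
proof -
  define F where "F i = (if i = 0 then f else g)" for i :: nat
  have "incseq F" using le by (intro incseq_SucI) (auto simp: F_def le_fun_def)
  moreover have "\<forall>i. F i \<in> borel_measurable N" using f g by (simp add: F_def)
  ultimately have "I (\<lambda>x. SUP i. F i x) = (SUP i. I (F i))" using I by (simp add: positive_functional_def)
  moreover have "(SUP i. F i x) = g x" for x
    by (rule antisym) (auto intro!: SUP_least SUP_upper2[of 1] simp: F_def le)
  moreover have "I (F 0) \<le> (SUP i. I (F i))" by (rule SUP_upper) simp
  ultimately show ?thesis by (simp add: F_def)
qed

lemma positive_functional_weighted_integral:
  assumes [measurable]: "g \<in> K \<rightarrow>\<^sub>M N" "w \<in> borel_measurable K"
  shows "positive_functional N (\<lambda>f. \<integral>\<^sup>+y. f (g y) * w y \<partial>K)"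
  unfolding positive_functional_def
proof (intro conjI allI ballI impI)
  fix c and f :: "'b \<Rightarrow> ennreal" assume [measurable]: "f \<in> borel_measurable N"
  show "(\<integral>\<^sup>+y. c * f (g y) * w y \<partial>K) = c * (\<integral>\<^sup>+y. f (g y) * w y \<partial>K)"
    by (subst nn_integral_cmult[symmetric]) (auto simp: mult.assoc)
  fix f' :: "'b \<Rightarrow> ennreal" assume [measurable]: "f' \<in> borel_measurable N"
  show "(\<integral>\<^sup>+y. (f (g y) + f' (g y)) * w y \<partial>K) = (\<integral>\<^sup>+y. f (g y) * w y \<partial>K) + (\<integral>\<^sup>+y. f' (g y) * w y \<partial>K)"
    by (subst nn_integral_add[symmetric]) (auto simp: distrib_right)
next
  fix F :: "nat \<Rightarrow> 'b \<Rightarrow> ennreal" assume F: "\<forall>i. F i \<in> borel_measurable N" "incseq F"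
  have [measurable]: "F i \<in> borel_measurable N" for i using F by simp
  have "(SUP i. F i (g y)) * w y = (SUP i. F i (g y) * w y)" for y
    by (simp add: SUP_mult_right_ennreal)
  then have "(\<integral>\<^sup>+y. (SUP i. F i (g y)) * w y \<partial>K) = (\<integral>\<^sup>+y. (SUP i. F i (g y) * w y) \<partial>K)" by simp
  also have "\<dots> = (SUP i. \<integral>\<^sup>+y. F i (g y) * w y \<partial>K)"
    using F(2) by (intro nn_integral_monotone_convergence_SUP) (auto simp: incseq_def le_fun_def intro!: mult_right_mono)
  finally show "(\<integral>\<^sup>+y. (SUP i. F i (g y)) * w y \<partial>K) = (SUP i. \<integral>\<^sup>+y. F i (g y) * w y \<partial>K)" .
qed

lemma positive_functional_integral:
  assumes J: "\<And>x. x \<in> space S \<Longrightarrow> positive_functional N (J x)"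
    and m: "\<And>f. f \<in> borel_measurable N \<Longrightarrow> (\<lambda>x. J x f) \<in> borel_measurable S"
  shows "positive_functional N (\<lambda>f. \<integral>\<^sup>+x. J x f \<partial>S)"
  unfolding positive_functional_def
proof (intro conjI allI ballI impI)
  fix c and f :: "'b \<Rightarrow> ennreal" assume f: "f \<in> borel_measurable N"
  have "(\<integral>\<^sup>+x. J x (\<lambda>y. c * f y) \<partial>S) = (\<integral>\<^sup>+x. c * J x f \<partial>S)"
    using J f by (intro nn_integral_cong) (simp add: positive_functional_def)
  then show "(\<integral>\<^sup>+x. J x (\<lambda>y. c * f y) \<partial>S) = c * (\<integral>\<^sup>+x. J x f \<partial>S)" using m[OF f] by (simp add: nn_integral_cmult)
  fix g :: "'b \<Rightarrow> ennreal" assume g: "g \<in> borel_measurable N"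
  have "(\<integral>\<^sup>+x. J x (\<lambda>y. f y + g y) \<partial>S) = (\<integral>\<^sup>+x. J x f + J x g \<partial>S)"
    using J f g by (intro nn_integral_cong) (simp add: positive_functional_def)
  then show "(\<integral>\<^sup>+x. J x (\<lambda>y. f y + g y) \<partial>S) = (\<integral>\<^sup>+x. J x f \<partial>S) + (\<integral>\<^sup>+x. J x g \<partial>S)"
    using m[OF f] m[OF g] by (simp add: nn_integral_add)
next
  fix F :: "nat \<Rightarrow> 'b \<Rightarrow> ennreal" assume F: "\<forall>i. F i \<in> borel_measurable N" "incseq F"
  have "(\<integral>\<^sup>+x. J x (\<lambda>y. SUP i. F i y) \<partial>S) = (\<integral>\<^sup>+x. (SUP i. J x (F i)) \<partial>S)"
    using J F by (intro nn_integral_cong) (simp add: positive_functional_def)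
  also have "\<dots> = (SUP i. \<integral>\<^sup>+x. J x (F i) \<partial>S)"
  proof (rule nn_integral_monotone_convergence_SUP_AE)
    show "AE x in S. J x (F i) \<le> J x (F (Suc i))" for i
    proof (rule AE_I2)
      fix x assume x: "x \<in> space S"
      show "J x (F i) \<le> J x (F (Suc i))"
        by (rule positive_functional_mono[OF J[OF x]]) (use F incseq_SucD[OF F(2)] in \<open>auto simp: le_fun_def\<close>)
    qed
  qed (use m F in auto)
  finally show "(\<integral>\<^sup>+x. J x (\<lambda>y. SUP i. F i y) \<partial>S) = (SUP i. \<integral>\<^sup>+x. J x (F i) \<partial>S)" .
qed

lemma positive_functional_zero: "positive_functional N I \<Longrightarrow> I (\<lambda>_. 0) = 0"
  unfolding positive_functional_def by (elim conjE allE[of _ 0] ballE[of _ _ "\<lambda>_. 0"]) auto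

text \<open>
  Measure-theoretic induction: agreement on indicators passes to simple functions and to monotone limits.
\<close>

lemma nn_integral_eq_functional:
  assumes I: "positive_functional M I" and em: "\<And>A. A \<in> sets M \<Longrightarrow> emeasure M A = I (indicator A)"
    and sp: "space M = UNIV" and f: "f \<in> borel_measurable M"
  shows "(\<integral>\<^sup>+x. f x \<partial>M) = I f"
  using f
proof (induction f rule: borel_measurable_induct)
  case (cong f g)
  then have "f = g" using sp by auto
  then show ?case using cong by simp
next
  case (set A) then show ?case using em by simp
next
  case (mult u c)
  then show ?case using I by (simp add: nn_integral_cmult positive_functional_def)
next
  case (add u v)
  then show ?case using I by (simp add: nn_integral_add positive_functional_def)
next
  case (seq U)
  have "(\<integral>\<^sup>+x. (SUP i. U i) x \<partial>M) = (\<integral>\<^sup>+x. (SUP i. U i x) \<partial>M)" by (simp add: image_comp)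
  also have "\<dots> = (SUP i. \<integral>\<^sup>+x. U i x \<partial>M)"
    using seq by (intro nn_integral_monotone_convergence_SUP) auto
  also have "\<dots> = (SUP i. I (U i))" using seq by (simp add: fun_eq_iff)
  also have "\<dots> = I (\<lambda>x. SUP i. U i x)" using I seq by (simp add: positive_functional_def)
  also have "(\<lambda>x. SUP i. U i x) = (SUP i. U i)" by (simp add: fun_eq_iff image_comp)
  finally show ?case .
qed

lemma measure_from_functional:
  assumes I: "positive_functional N I" and sp: "space N = UNIV"
  shows "\<exists>M. sets M = sets N \<and> (\<forall>A\<in>sets N. emeasure M A = I (indicator A))"
proof -
  define M where "M = measure_of UNIV (sets N) (\<lambda>A. I (indicator A))"
  have sM: "sets M = sets N" unfolding M_def using sets.sets_measure_of_eq[of N] sp by simp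
  have emp: "I (indicator {}) = 0" using positive_functional_zero[OF I] by (simp add: indicator_def[abs_def])
  have fin: "I (\<lambda>x. \<Sum>i<n. indicator (A i) x) = (\<Sum>i<n. I (indicator (A i)))" if A: "range A \<subseteq> sets N" for A :: "nat \<Rightarrow> 'a set" and n
  proof (induction n)
    case 0 then show ?case using positive_functional_zero[OF I] by simp
  next
    case (Suc n)
    have [measurable]: "A i \<in> sets N" for i using A by auto
    have "I (\<lambda>x. (\<Sum>i<n. indicator (A i) x) + indicator (A n) x) = I (\<lambda>x. \<Sum>i<n. indicator (A i) x) + I (indicator (A n))"
      by (rule positive_functional_add[OF I]) measurable
    then show ?case using Suc by simp
  qed
  have "emeasure M A = I (indicator A)" if A: "A \<in> sets N" for A
  proof (rule emeasure_measure_of[OF M_def])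
    show "countably_additive (sets M) (\<lambda>A. I (indicator A))"
      unfolding countably_additive_def
    proof (intro allI impI)
      fix A :: "nat \<Rightarrow> 'a set" assume A: "range A \<subseteq> sets M" "disjoint_family A"
      then have AN: "range A \<subseteq> sets N" using sM by simp
      have [measurable]: "indicator (A i) \<in> borel_measurable N" for i using AN by (intro borel_measurable_indicator) auto
      have "(\<Sum>i. I (indicator (A i))) = (SUP n. \<Sum>i<n. I (indicator (A i)))" by (rule suminf_eq_SUP)
      also have "\<dots> = (SUP n. I (\<lambda>x. \<Sum>i<n. indicator (A i) x))" using fin[OF AN] by simp
      also have "\<dots> = I (\<lambda>x. SUP n. \<Sum>i<n. indicator (A i) x)"
      proof -
        have "incseq (\<lambda>n x. \<Sum>i<n. indicator (A i) x :: ennreal)"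
          by (intro incseq_SucI) (auto simp: le_fun_def)
        moreover have "(\<lambda>x. \<Sum>i<n. indicator (A i) x :: ennreal) \<in> borel_measurable N" for n by measurable
        ultimately show ?thesis using I by (simp add: positive_functional_def)
      qed
      also have "(\<lambda>x. SUP n. \<Sum>i<n. indicator (A i) x :: ennreal) = indicator (\<Union>i. A i)"
        by (rule ext) (simp add: suminf_eq_SUP[symmetric] suminf_indicator[OF A(2)])
      finally show "(\<Sum>i. I (indicator (A i))) = I (indicator (\<Union>i. A i))" .
    qed
  qed (use A sM emp sets.space_closed[of N] sp in \<open>auto simp: positive_def\<close>)
  then show ?thesis using sM by blast
qed

abbreviation sphere_space :: "'a::euclidean_space measure" where
  "sphere_space \<equiv> restrict_space borel (sphere 0 1)"

abbreviation halfline_space :: "real measure" where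
  "halfline_space \<equiv> restrict_space borel {0<..}"

lemma space_sphere_space[simp]: "space sphere_space = sphere 0 1" by (simp add: space_restrict_space)
lemma space_halfline_space[simp]: "space halfline_space = {0<..}" by (simp add: space_restrict_space)

lemma sphere_space_id: "(\<lambda>u. u) \<in> borel_measurable sphere_space"
  by (rule measurable_restrict_space1) simp
lemma halfline_space_id: "(\<lambda>s. s) \<in> borel_measurable halfline_space"
  by (rule measurable_restrict_space1) simp

text \<open>
  The substitution rule for compact intervals, combined with exhaustion of the half line by intervals
  bounded away from 0, where the derivative of the power is continuous.
\<close>

lemma nn_integral_powr_substitution:
  fixes h :: "real \<Rightarrow> ennreal"
  assumes a: "0 < a" and h[measurable]: "h \<in> borel_measurable borel"
  shows "(\<integral>\<^sup>+t\<in>{0<..}. h t \<partial>lborel) = (\<integral>\<^sup>+v\<in>{0<..}. h (v powr a) * ennreal (a * v powr (a - 1)) \<partial>lborel)"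
proof -
  define l where "l n = 1 / real (Suc n)" for n
  define u where "u n = real (Suc n)" for n
  have lu: "0 < l n" "l n < u n + 1" "l n \<le> u n" for n
  proof -
    have "l n \<le> 1" "1 \<le> u n" by (simp_all add: l_def u_def)
    moreover show "0 < l n" by (simp add: l_def)
    ultimately show "l n < u n + 1" "l n \<le> u n" by linarith+
  qed
  have step: "(\<integral>\<^sup>+t. h t * indicator {l n powr a..(u n + 1) powr a} t \<partial>lborel) =
     (\<integral>\<^sup>+v. h (v powr a) * ennreal (a * v powr (a - 1)) * indicator {l n..u n + 1} v \<partial>lborel)" for n
  proof (rule nn_integral_substitution_aux[OF h])
    fix x assume "x \<in> {l n..u n + 1}"
    then have x: "0 < x" using lu[of n] by simp
    then show "((\<lambda>v. v powr a) has_real_derivative a * x powr (a - 1)) (at x)"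
      by (auto intro!: derivative_eq_intros)
    show "0 \<le> a * x powr (a - 1)" using a by simp
  next
    show "continuous_on {l n..u n + 1} (\<lambda>v. a * v powr (a - 1))"
      using lu(1)[of n] by (intro continuous_intros) auto
  qed (use lu in auto)
  \<comment> \<open>Exhaustion of the half line by compact intervals, applied to both sides with different endpoints.\<close>
  have sup: "(\<integral>\<^sup>+x\<in>{0<..}. g x \<partial>lborel) = (SUP n. \<integral>\<^sup>+x. g x * indicator {b n..c n} x \<partial>lborel)"
    if g[measurable]: "g \<in> borel_measurable borel" and dec: "decseq b" and inc: "incseq c" and b0: "\<And>n. 0 < b n"
      and bl: "b \<longlonglongrightarrow> 0" and cl: "filterlim c at_top sequentially" for g :: "real \<Rightarrow> ennreal" and b c :: "nat \<Rightarrow> real"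
  proof -
    have "g x * indicator {0<..} x = (SUP n. g x * indicator {b n..c n} x)" for x
    proof (rule antisym)
      show "(SUP n. g x * indicator {b n..c n} x) \<le> g x * indicator {0<..} x"
        using b0 by (intro SUP_least mult_left_mono) (auto simp: indicator_def intro: less_le_trans)
      show "g x * indicator {0<..} x \<le> (SUP n. g x * indicator {b n..c n} x)"
      proof (cases "0 < x")
        case True
        have "eventually (\<lambda>n. b n < x) sequentially" using order_tendstoD(2)[OF bl True] .
        moreover have "eventually (\<lambda>n. x \<le> c n) sequentially" using cl by (simp add: filterlim_at_top)
        ultimately have "eventually (\<lambda>n. b n < x \<and> x \<le> c n) sequentially" by eventually_elim simp
        then obtain n where "b n < x" "x \<le> c n" by (auto simp: eventually_sequentially)
        then show ?thesis using True by (intro SUP_upper2[of n]) (auto simp: indicator_def)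
      qed simp
    qed
    then have "(\<integral>\<^sup>+x\<in>{0<..}. g x \<partial>lborel) = (\<integral>\<^sup>+x. (SUP n. g x * indicator {b n..c n} x) \<partial>lborel)" by simp
    also have "\<dots> = (SUP n. \<integral>\<^sup>+x. g x * indicator {b n..c n} x \<partial>lborel)"
    proof (rule nn_integral_monotone_convergence_SUP)
      show "incseq (\<lambda>n x. g x * indicator {b n..c n} x)"
      proof (intro incseq_SucI le_funI mult_left_mono)
        fix n x show "indicator {b n..c n} x \<le> (indicator {b (Suc n)..c (Suc n)} x :: ennreal)"
          using decseq_SucD[OF dec, of n] incseq_SucD[OF inc, of n] by (auto simp: indicator_def)
      qed simp
    qed measurable
    finally show ?thesis .
  qed
  have l: "decseq l" "l \<longlonglongrightarrow> 0"
    unfolding l_def by (intro decseq_SucI divide_left_mono; simp) (rule LIMSEQ_Suc[OF lim_1_over_n])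
  have u: "incseq (\<lambda>n. u n + 1)" "filterlim (\<lambda>n. u n + 1) at_top sequentially"
    unfolding u_def by (auto intro!: incseq_SucI) real_asymp
  have "(\<integral>\<^sup>+t\<in>{0<..}. h t \<partial>lborel) = (SUP n. \<integral>\<^sup>+t. h t * indicator {l n powr a..(u n + 1) powr a} t \<partial>lborel)"
  proof (rule sup[OF h])
    show "decseq (\<lambda>n. l n powr a)"
    proof (rule decseq_SucI)
      fix n show "l (Suc n) powr a \<le> l n powr a"
        using a lu(1)[of "Suc n"] decseq_SucD[OF l(1), of n] by (intro powr_mono2) auto
    qed
    show "incseq (\<lambda>n. (u n + 1) powr a)" using a by (intro incseq_SucI powr_mono2) (auto simp: u_def)
    show "(\<lambda>n. l n powr a) \<longlonglongrightarrow> 0" unfolding l_def using a by real_asymp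
    show "filterlim (\<lambda>n. (u n + 1) powr a) at_top sequentially" unfolding u_def using a by real_asymp
    show "0 < l n powr a" for n using lu(1)[of n] by simp
  qed
  also have "\<dots> = (SUP n. \<integral>\<^sup>+v. h (v powr a) * ennreal (a * v powr (a - 1)) * indicator {l n..u n + 1} v \<partial>lborel)"
    unfolding step ..
  also have "\<dots> = (\<integral>\<^sup>+v\<in>{0<..}. h (v powr a) * ennreal (a * v powr (a - 1)) \<partial>lborel)"
    by (rule sup[symmetric]) (use l u lu in auto)
  finally show ?thesis .
qed


lemma bernstein_sets: "bernstein_family p q Qu \<Longrightarrow> u \<in> sphere 0 1 \<Longrightarrow> sets (Qu u) = sets halfline_space"
  by (simp add: bernstein_family_def)

lemma bernstein_space: "bernstein_family p q Qu \<Longrightarrow> u \<in> sphere 0 1 \<Longrightarrow> space (Qu u) = {0<..}"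
  using sets_eq_imp_space_eq[OF bernstein_sets] by simp

lemma bernstein_transform:
  assumes Q: "bernstein_family p q Qu" and p: "0 < p" and u: "u \<in> sphere 0 1" and r: "0 < r"
  shows "(\<integral>\<^sup>+s. ennreal (exp (- r * s)) \<partial>Qu u) = ennreal (q r u)"
proof -
  have "(r powr (1 / p)) powr p = r" using r p by (simp add: powr_powr)
  moreover have "0 < r powr (1 / p)" using r by simp
  ultimately show ?thesis using Q u unfolding bernstein_family_def by metis
qed

lemma bernstein_integral_measurable:
  assumes Q: "bernstein_family p q Qu" and h: "h \<in> borel_measurable halfline_space"
  shows "(\<lambda>u. \<integral>\<^sup>+s. h s \<partial>Qu u) \<in> borel_measurable sphere_space"
  using h
proof (induction h rule: borel_measurable_induct)
  case (cong f g)
  then show ?case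
    by (subst measurable_cong[where g="\<lambda>u. \<integral>\<^sup>+s. g s \<partial>Qu u"]) (auto intro!: nn_integral_cong simp: bernstein_space[OF Q])
next
  case (set A)
  have "(\<lambda>u. emeasure (Qu u) A) \<in> borel_measurable sphere_space" using Q set by (auto simp: bernstein_family_def)
  then show ?case
    by (rule measurable_cong[THEN iffD1, rotated]) (use set in \<open>simp add: bernstein_sets[OF Q]\<close>)
next
  case (mult f c)
  have "(\<lambda>u. c * (\<integral>\<^sup>+s. f s \<partial>Qu u)) \<in> borel_measurable sphere_space" using mult by simp
  then show ?case
    by (rule measurable_cong[THEN iffD1, rotated])
       (use mult in \<open>simp add: nn_integral_cmult measurable_cong_sets[OF bernstein_sets[OF Q] refl]\<close>)
next
  case (add f g)
  have "(\<lambda>u. (\<integral>\<^sup>+s. g s \<partial>Qu u) + (\<integral>\<^sup>+s. f s \<partial>Qu u)) \<in> borel_measurable sphere_space" using add by simp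
  then show ?case
    by (rule measurable_cong[THEN iffD1, rotated])
       (use add in \<open>simp add: nn_integral_add measurable_cong_sets[OF bernstein_sets[OF Q] refl]\<close>)
next
  case (seq U)
  have "(\<lambda>u. SUP i. \<integral>\<^sup>+s. U i s \<partial>Qu u) \<in> borel_measurable sphere_space" using seq by (intro borel_measurable_SUP) auto
  moreover have "(SUP i. \<integral>\<^sup>+s. U i s \<partial>Qu u) = (\<integral>\<^sup>+s. (SUP i. U i) s \<partial>Qu u)" if "u \<in> sphere 0 1" for u
  proof -
    have "(SUP i. U i) = (\<lambda>s. SUP i. U i s)" by (simp add: fun_eq_iff image_comp)
    then show ?thesis
      using nn_integral_monotone_convergence_SUP[of U "Qu u"] seq
      by (simp add: measurable_cong_sets[OF bernstein_sets[OF Q that] refl])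
  qed
  ultimately show ?case
    by (elim measurable_cong[THEN iffD1, rotated]) (simp only: space_sphere_space)
qed

text \<open>
  The Bernstein measures may be infinite. Multiplication with \<open>exp (- s)\<close> and division by more than the resulting mass, which is finite,
  turns them into a subprobability kernel, for which joint measurability results are available; \<open>bernstein_kernel_inverse\<close> undoes it.
\<close>

definition bernstein_kernel :: "('a \<Rightarrow> real measure) \<Rightarrow> 'a \<Rightarrow> real measure" where
  "bernstein_kernel Qu u = density (Qu u) (\<lambda>s. ennreal (exp (- s)) / (1 + (\<integral>\<^sup>+s. ennreal (exp (- s)) \<partial>Qu u)))"

lemma exp_halfline_measurable[measurable]: "(\<lambda>s. ennreal (exp (c * s))) \<in> borel_measurable halfline_space"
  by (intro measurable_restrict_space1) simp

lemma exp_minus_halfline_measurable[measurable]: "(\<lambda>s. ennreal (exp (- s))) \<in> borel_measurable halfline_space"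
  by (intro measurable_restrict_space1) simp

context
  fixes p :: real and q :: "real \<Rightarrow> 'a::euclidean_space \<Rightarrow> real" and Qu
  assumes Q: "bernstein_family p q Qu" and p: "0 < p"
begin

lemma bernstein_mass_finite: "u \<in> sphere 0 1 \<Longrightarrow> (\<integral>\<^sup>+s. ennreal (exp (- s)) \<partial>Qu u) < \<top>"
  using bernstein_transform[OF Q p, of u 1] by simp

lemma bernstein_kernel_measurable: "bernstein_kernel Qu \<in> sphere_space \<rightarrow>\<^sub>M subprob_algebra halfline_space"
proof (rule measurable_subprob_algebra)
  define c where "c u = 1 + (\<integral>\<^sup>+s. ennreal (exp (- s)) \<partial>Qu u)" for u
  have c[measurable]: "c \<in> borel_measurable sphere_space"
    unfolding c_def using bernstein_integral_measurable[OF Q exp_minus_halfline_measurable] by simp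
  have em: "emeasure (bernstein_kernel Qu u) A = (\<integral>\<^sup>+s. ennreal (exp (- s)) * indicator A s \<partial>Qu u) / c u"
    if u: "u \<in> sphere 0 1" and A: "A \<in> sets halfline_space" for u A
  proof -
    note [measurable_cong] = bernstein_sets[OF Q u]
    have [measurable]: "A \<in> sets (Qu u)" using A bernstein_sets[OF Q u] by simp
    have "emeasure (bernstein_kernel Qu u) A = (\<integral>\<^sup>+s. (ennreal (exp (- s)) / c u) * indicator A s \<partial>Qu u)"
      unfolding bernstein_kernel_def c_def by (rule emeasure_density) measurable
    also have "\<dots> = (\<integral>\<^sup>+s. (ennreal (exp (- s)) * indicator A s) / c u \<partial>Qu u)"
      by (intro nn_integral_cong) (simp add: divide_ennreal_def mult_ac)
    also have "\<dots> = (\<integral>\<^sup>+s. ennreal (exp (- s)) * indicator A s \<partial>Qu u) / c u"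
      by (rule nn_integral_divide) measurable
    finally show ?thesis .
  qed
  show "sets (bernstein_kernel Qu u) = sets halfline_space" if "u \<in> space sphere_space" for u
    using that bernstein_sets[OF Q] by (simp add: bernstein_kernel_def)
  show "subprob_space (bernstein_kernel Qu u)" if "u \<in> space sphere_space" for u
  proof (rule subprob_spaceI)
    have u: "u \<in> sphere 0 1" using that by simp
    have sp: "space (bernstein_kernel Qu u) = {0<..}" using bernstein_space[OF Q u] by (simp add: bernstein_kernel_def)
    have "emeasure (bernstein_kernel Qu u) {0<..} = (\<integral>\<^sup>+s. ennreal (exp (- s)) * indicator {0<..} s \<partial>Qu u) / c u"
      by (rule em[OF u]) (simp add: sets_restrict_space_iff)
    also have "(\<integral>\<^sup>+s. ennreal (exp (- s)) * indicator {0<..} s \<partial>Qu u) = (\<integral>\<^sup>+s. ennreal (exp (- s)) \<partial>Qu u)"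
      by (intro nn_integral_cong) (simp add: bernstein_space[OF Q u])
    also have "\<dots> / c u \<le> 1"
    proof (rule divide_le_posI_ennreal)
      show "0 < c u" unfolding c_def by (rule less_le_trans[OF zero_less_one]) simp
    qed (simp add: c_def)
    finally show "emeasure (bernstein_kernel Qu u) (space (bernstein_kernel Qu u)) \<le> 1" by (simp add: sp)
    show "space (bernstein_kernel Qu u) \<noteq> {}" using sp by auto
  qed
  fix A assume A: "A \<in> sets halfline_space"
  have "(\<lambda>u. (\<integral>\<^sup>+s. ennreal (exp (- s)) * indicator A s \<partial>Qu u) / c u) \<in> borel_measurable sphere_space"
    using A by (intro borel_measurable_divide_ennreal c bernstein_integral_measurable[OF Q] borel_measurable_times_ennreal
      exp_minus_halfline_measurable borel_measurable_indicator)
  then show "(\<lambda>u. emeasure (bernstein_kernel Qu u) A) \<in> borel_measurable sphere_space"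
    by (rule measurable_cong[THEN iffD1, rotated]) (simp add: em A)
qed

lemma bernstein_kernel_inverse:
  assumes u: "u \<in> sphere 0 1" and f: "f \<in> borel_measurable halfline_space"
  shows "(\<integral>\<^sup>+s. f s \<partial>Qu u) = (\<integral>\<^sup>+s. f s * (ennreal (exp s) * (1 + (\<integral>\<^sup>+s. ennreal (exp (- s)) \<partial>Qu u))) \<partial>bernstein_kernel Qu u)"
proof -
  define c where "c = 1 + (\<integral>\<^sup>+s. ennreal (exp (- s)) \<partial>Qu u)"
  have c: "c \<noteq> 0" "c \<noteq> \<top>" using bernstein_mass_finite[OF u] by (auto simp: c_def)
  note [measurable_cong] = bernstein_sets[OF Q u] and [measurable] = f
  have [measurable]: "(\<lambda>s. ennreal (exp s)) \<in> borel_measurable halfline_space" by (intro measurable_restrict_space1) simp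
  have one: "ennreal (exp (- s)) / c * (ennreal (exp s) * c) = 1" for s :: real
  proof -
    have "ennreal (exp (- s)) / c * (ennreal (exp s) * c) = (ennreal (exp (- s)) * ennreal (exp s)) * (c / c)"
      by (simp add: divide_ennreal_def mult_ac)
    also have "\<dots> = 1" using c by (simp add: ennreal_mult[symmetric] exp_add[symmetric] ennreal_divide_self less_top)
    finally show ?thesis .
  qed
  have "(\<integral>\<^sup>+s. f s * (ennreal (exp s) * c) \<partial>bernstein_kernel Qu u) = (\<integral>\<^sup>+s. ennreal (exp (- s)) / c * (f s * (ennreal (exp s) * c)) \<partial>Qu u)"
    unfolding bernstein_kernel_def c_def[symmetric] by (rule nn_integral_density) measurable
  also have "\<dots> = (\<integral>\<^sup>+s. f s \<partial>Qu u)"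
    using one by (intro nn_integral_cong) (metis mult.left_commute mult.right_neutral)
  finally show ?thesis by (simp add: c_def)
qed

lemma bernstein_joint_measurable:
  assumes [measurable]: "(\<lambda>(u, s). f u s) \<in> borel_measurable (sphere_space \<Otimes>\<^sub>M halfline_space)"
  shows "(\<lambda>u. \<integral>\<^sup>+s. f u s \<partial>Qu u) \<in> borel_measurable sphere_space"
proof -
  have [measurable]: "(\<lambda>u. \<integral>\<^sup>+s. ennreal (exp (- s)) \<partial>Qu u) \<in> borel_measurable sphere_space"
    by (rule bernstein_integral_measurable[OF Q]) measurable
  have [measurable]: "(\<lambda>s. ennreal (exp s)) \<in> borel_measurable halfline_space" by (intro measurable_restrict_space1) simp
  have "(\<lambda>u. \<integral>\<^sup>+s. f u s * (ennreal (exp s) * (1 + (\<integral>\<^sup>+s. ennreal (exp (- s)) \<partial>Qu u))) \<partial>bernstein_kernel Qu u) \<in> borel_measurable sphere_space"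
    by (rule nn_integral_measurable_subprob_algebra2[OF _ bernstein_kernel_measurable]) measurable
  then show ?thesis
  proof (rule measurable_cong[THEN iffD1, rotated])
    fix u :: 'a assume "u \<in> space sphere_space"
    then have u: "u \<in> sphere 0 1" by simp
    have "f u \<in> borel_measurable halfline_space"
      using measurable_Pair2[OF assms, of u] u by simp
    then show "(\<integral>\<^sup>+s. f u s * (ennreal (exp s) * (1 + (\<integral>\<^sup>+s. ennreal (exp (- s)) \<partial>Qu u))) \<partial>bernstein_kernel Qu u) = (\<integral>\<^sup>+s. f u s \<partial>Qu u)"
      using bernstein_kernel_inverse[OF u] by simp
  qed
qed

lemma bernstein_sigma_finite:
  assumes u: "u \<in> sphere 0 1" shows "sigma_finite_measure (Qu u)"
proof -
  have cong: "measurable (Qu u) N = measurable halfline_space N" for N :: "ennreal measure"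
    by (rule measurable_cong_sets[OF bernstein_sets[OF Q u] refl])
  have m1: "(\<lambda>s. ennreal (exp (- s))) \<in> borel_measurable (Qu u)"
    unfolding cong by (rule exp_minus_halfline_measurable)
  have m2: "(\<lambda>s. ennreal (exp s)) \<in> borel_measurable (Qu u)"
    unfolding cong by (intro measurable_restrict_space1) simp
  define F where "F = density (Qu u) (\<lambda>s. ennreal (exp (- s)))"
  have "emeasure F (space F) = (\<integral>\<^sup>+s. ennreal (exp (- s)) * indicator (space (Qu u)) s \<partial>Qu u)"
    unfolding F_def space_density by (rule emeasure_density[OF m1]) simp
  also have "\<dots> = (\<integral>\<^sup>+s. ennreal (exp (- s)) \<partial>Qu u)" by (intro nn_integral_cong) simp
  finally interpret F: finite_measure F
    using bernstein_mass_finite[OF u] by (intro finite_measureI) simp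
  have "density F (\<lambda>s. ennreal (exp s)) = density (Qu u) (\<lambda>s. ennreal (exp (- s)) * ennreal (exp s))"
    unfolding F_def by (rule density_density_eq[OF m1 m2])
  also have "\<dots> = density (Qu u) (\<lambda>_. 1)"
    using m1 m2 by (intro density_cong) (auto simp: ennreal_mult[symmetric] exp_add[symmetric])
  finally have "Qu u = density F (\<lambda>s. ennreal (exp s))" by (simp add: density_1)
  moreover have "sigma_finite_measure (density F (\<lambda>s. ennreal (exp s)))"
    using m2 by (subst F.sigma_finite_iff_density_finite) (simp_all add: F_def)
  ultimately show ?thesis by simp
qed

end

text \<open>
  The relation between \<open>R\<close> and the Bernstein family, with the intermediate measure \<open>Q\<close> eliminated: the map defining \<open>R\<close> from \<open>Q\<close> sends
  \<open>s *\<^sub>R u\<close> to \<open>(s powr (- 1 / p)) *\<^sub>R u\<close>. All later arguments use this formula only.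
\<close>

definition polar_disintegration :: "real \<Rightarrow> real \<Rightarrow> 'a::euclidean_space measure \<Rightarrow> 'a measure \<Rightarrow> ('a \<Rightarrow> real measure) \<Rightarrow> bool" where
  "polar_disintegration p \<alpha> R \<sigma> Qu \<longleftrightarrow>
     (\<forall>F\<in>borel_measurable borel. (\<integral>\<^sup>+x. F x \<partial>R) =
        (\<integral>\<^sup>+u. (\<integral>\<^sup>+s. F ((s powr (- 1 / p)) *\<^sub>R u) * ennreal (s powr (\<alpha> / p)) \<partial>Qu u) \<partial>\<sigma>))"

lemma polar_pair_measurable[measurable]:
  "(\<lambda>(u, s). s *\<^sub>R u) \<in> (sphere_space \<Otimes>\<^sub>M halfline_space) \<rightarrow>\<^sub>M (borel :: 'a::euclidean_space measure)"
proof -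
  have [measurable]: "fst \<in> (sphere_space \<Otimes>\<^sub>M halfline_space) \<rightarrow>\<^sub>M (borel :: 'a measure)"
    by (rule measurable_compose[OF measurable_fst sphere_space_id])
  have [measurable]: "snd \<in> ((sphere_space :: 'a measure) \<Otimes>\<^sub>M halfline_space) \<rightarrow>\<^sub>M borel"
    by (rule measurable_compose[OF measurable_snd halfline_space_id])
  show ?thesis unfolding case_prod_beta' by measurable
qed

context
  fixes p \<alpha> :: real and q :: "real \<Rightarrow> 'a::euclidean_space \<Rightarrow> real" and Qu and \<sigma> :: "'a measure"
  assumes Q: "bernstein_family p q Qu" and p: "0 < p" and s\<sigma>: "sets \<sigma> = sets sphere_space"
begin

lemma sigma_space: "space \<sigma> = sphere 0 1"
  using sets_eq_imp_space_eq[OF s\<sigma>] by simp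

lemma sigma_measurable_cong: "f \<in> borel_measurable sphere_space \<Longrightarrow> f \<in> borel_measurable \<sigma>"
  using measurable_cong_sets[OF s\<sigma> refl] by blast

lemma slice_measurable: "u \<in> sphere 0 1 \<Longrightarrow> (\<lambda>s. s *\<^sub>R u) \<in> Qu u \<rightarrow>\<^sub>M borel"
  unfolding measurable_cong_sets[OF bernstein_sets[OF Q] refl] by (intro measurable_restrict_space1) measurable

lemma polar_functional:
  "positive_functional borel (\<lambda>f. \<integral>\<^sup>+u. (\<integral>\<^sup>+s. f (s *\<^sub>R u) \<partial>Qu u) \<partial>\<sigma>)"
proof (rule positive_functional_integral)
  show "positive_functional borel (\<lambda>f. \<integral>\<^sup>+s. f (s *\<^sub>R u) \<partial>Qu u)" if "u \<in> space \<sigma>" for u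
    using positive_functional_weighted_integral[OF slice_measurable, of u "\<lambda>_. 1"] that by (simp add: sigma_space)
  fix f :: "'a \<Rightarrow> ennreal" assume [measurable]: "f \<in> borel_measurable borel"
  have "(\<lambda>(u, s). f (s *\<^sub>R u)) \<in> borel_measurable (sphere_space \<Otimes>\<^sub>M halfline_space)"
    using measurable_compose[OF polar_pair_measurable, of f borel] by (simp add: case_prod_beta')
  then show "(\<lambda>u. \<integral>\<^sup>+s. f (s *\<^sub>R u) \<partial>Qu u) \<in> borel_measurable \<sigma>"
    by (intro sigma_measurable_cong bernstein_joint_measurable[OF Q p])
qed

lemma associated_integral:
  assumes QM: "sets QM = sets borel" "\<And>A. A \<in> sets borel \<Longrightarrow> emeasure QM A = (\<integral>\<^sup>+u. (\<integral>\<^sup>+r. indicator A (r *\<^sub>R u) \<partial>Qu u) \<partial>\<sigma>)"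
    and R: "sets R = sets borel" "\<And>A. A \<in> sets borel \<Longrightarrow> emeasure R A =
      (\<integral>\<^sup>+x. indicator A (x /\<^sub>R (norm x powr (1 + 1 / p))) * ennreal (norm x powr (\<alpha> / p)) \<partial>QM)"
  shows "polar_disintegration p \<alpha> R \<sigma> Qu"
  unfolding polar_disintegration_def
proof
  fix F :: "'a \<Rightarrow> ennreal" assume F[measurable]: "F \<in> borel_measurable borel"
  note [measurable_cong] = QM(1) R(1)
  define T where "T x = x /\<^sub>R (norm x powr (1 + 1 / p))" for x :: 'a
  define w where "w x = ennreal (norm x powr (\<alpha> / p))" for x :: 'a
  have Tw[measurable]: "T \<in> borel_measurable borel" "w \<in> borel_measurable borel" unfolding T_def w_def by measurable
  have "positive_functional R (\<lambda>f. \<integral>\<^sup>+x. f (T x) * w x \<partial>QM)"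
    by (rule positive_functional_weighted_integral) measurable
  then have "(\<integral>\<^sup>+x. F x \<partial>R) = (\<integral>\<^sup>+x. F (T x) * w x \<partial>QM)"
    using F R by (intro nn_integral_eq_functional) (auto simp: T_def w_def sets_eq_imp_space_eq[OF R(1)] cong: measurable_cong_sets)
  also have "\<dots> = (\<integral>\<^sup>+u. (\<integral>\<^sup>+s. F (T (s *\<^sub>R u)) * w (s *\<^sub>R u) \<partial>Qu u) \<partial>\<sigma>)"
  proof (rule nn_integral_eq_functional[where I="\<lambda>f. \<integral>\<^sup>+u. (\<integral>\<^sup>+s. f (s *\<^sub>R u) \<partial>Qu u) \<partial>\<sigma>"])
    show "positive_functional QM (\<lambda>f. \<integral>\<^sup>+u. (\<integral>\<^sup>+s. f (s *\<^sub>R u) \<partial>Qu u) \<partial>\<sigma>)"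
      using polar_functional by (simp add: positive_functional_def measurable_cong_sets[OF QM(1) refl])
  qed (use QM in \<open>auto simp: sets_eq_imp_space_eq[OF QM(1)]\<close>)
  also have "\<dots> = (\<integral>\<^sup>+u. (\<integral>\<^sup>+s. F ((s powr (- 1 / p)) *\<^sub>R u) * ennreal (s powr (\<alpha> / p)) \<partial>Qu u) \<partial>\<sigma>)"
  proof (intro nn_integral_cong)
    fix u s assume "u \<in> space \<sigma>" and s: "s \<in> space (Qu u)"
    then have u: "norm u = 1" "0 < s" by (auto simp: sigma_space bernstein_space[OF Q])
    have "s / s powr (1 + 1 / p) = s powr 1 / s powr (1 + 1 / p)" using u by simp
    also have "\<dots> = s powr (- 1 / p)" unfolding powr_diff[symmetric] by simp
    finally have "T (s *\<^sub>R u) = (s powr (- 1 / p)) *\<^sub>R u" using u by (simp add: T_def divide_inverse mult.commute)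
    then show "F (T (s *\<^sub>R u)) * w (s *\<^sub>R u) = F ((s powr (- 1 / p)) *\<^sub>R u) * ennreal (s powr (\<alpha> / p))"
      using u by (simp add: w_def)
  qed
  finally show "(\<integral>\<^sup>+x. F x \<partial>R) = (\<integral>\<^sup>+u. (\<integral>\<^sup>+s. F ((s powr (- 1 / p)) *\<^sub>R u) * ennreal (s powr (\<alpha> / p)) \<partial>Qu u) \<partial>\<sigma>)" .
qed

lemma associated_exists: "\<exists>R. associated_measure p \<alpha> q \<sigma> R"
proof -
  obtain QM where QM: "sets QM = sets borel" "\<And>A. A \<in> sets borel \<Longrightarrow> emeasure QM A = (\<integral>\<^sup>+u. (\<integral>\<^sup>+r. indicator A (r *\<^sub>R u) \<partial>Qu u) \<partial>\<sigma>)"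
    using measure_from_functional[OF polar_functional] by auto
  note [measurable_cong] = QM(1)
  have "positive_functional borel (\<lambda>f. \<integral>\<^sup>+x. f (x /\<^sub>R (norm x powr (1 + 1 / p))) * ennreal (norm x powr (\<alpha> / p)) \<partial>QM)"
    by (rule positive_functional_weighted_integral) measurable
  from measure_from_functional[OF this] obtain R :: "'a measure" where "sets R = sets borel" "\<And>A. A \<in> sets borel \<Longrightarrow> emeasure R A =
      (\<integral>\<^sup>+x. indicator A (x /\<^sub>R (norm x powr (1 + 1 / p))) * ennreal (norm x powr (\<alpha> / p)) \<partial>QM)"
    by auto
  then show ?thesis unfolding associated_measure_def using Q QM by blast
qed

end

lemma associated_measure_disintegration:
  assumes R: "associated_measure p \<alpha> q \<sigma> R" and p: "0 < p" and s\<sigma>: "sets \<sigma> = sets sphere_space"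
  shows "\<exists>Qu. bernstein_family p q Qu \<and> polar_disintegration p \<alpha> R \<sigma> Qu \<and> sets R = sets borel"
proof -
  obtain Qu Q where "bernstein_family p q Qu" "sets Q = sets borel"
    "\<forall>A\<in>sets borel. emeasure Q A = (\<integral>\<^sup>+u. (\<integral>\<^sup>+r. indicator A (r *\<^sub>R u) \<partial>Qu u) \<partial>\<sigma>)" "sets R = sets borel"
    "\<forall>A\<in>sets borel. emeasure R A = (\<integral>\<^sup>+x. indicator A (x /\<^sub>R (norm x powr (1 + 1 / p))) * ennreal (norm x powr (\<alpha> / p)) \<partial>Q)"
    using R unfolding associated_measure_def by blast
  then show ?thesis using associated_integral[OF _ p s\<sigma>] by blast
qed

section \<open>Existence of Bernstein families and the mixture formula\<close>

lemma tempering_pair_section_measurable: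
  assumes "tempering_pair q \<sigma>" "0 < r" shows "(\<lambda>u. q r u) \<in> borel_measurable sphere_space"
proof -
  have "(\<lambda>(r, u). q r u) \<in> borel_measurable (halfline_space \<Otimes>\<^sub>M sphere_space)"
    using assms(1) by (simp add: tempering_pair_def)
  from measurable_Pair2[OF this, of r] assms(2) show ?thesis by simp
qed

text \<open>
  The inverse of \<open>s \<mapsto> exp (- s)\<close> on the open unit interval. The value 1 elsewhere merely keeps it inside the half line; the
  measures to which it is applied live on the open interval.
\<close>

definition neg_log :: "real \<Rightarrow> real" where
  "neg_log x = (if 0 < x \<and> x < 1 then - ln x else 1)"

lemma neg_log_measurable: "neg_log \<in> borel \<rightarrow>\<^sub>M halfline_space"
  by (rule measurable_restrict_space2) (auto simp: neg_log_def[abs_def])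

lemma neg_log_borel_measurable[measurable]: "neg_log \<in> borel_measurable borel"
  unfolding neg_log_def[abs_def] by measurable

text \<open>
  Passing from the unit interval back to the half line: \<open>s = - ln x\<close> turns \<open>x powr (t - 1)\<close>
  into \<open>exp (- t * s)\<close> times \<open>exp s\<close>, and the latter factor is absorbed as a density.
\<close>

lemma bernstein_family_from_unit_kernel:
  fixes q :: "real \<Rightarrow> 'a::euclidean_space \<Rightarrow> real"
  assumes \<kappa>m: "\<kappa> \<in> sphere_space \<rightarrow>\<^sub>M subprob_algebra borel" and ae: "\<And>u. u \<in> sphere 0 1 \<Longrightarrow> AE x in \<kappa> u. 0 < x \<and> x < 1"
    and c: "c \<in> borel_measurable sphere_space"
    and tr: "\<And>u t. u \<in> sphere 0 1 \<Longrightarrow> 0 < t \<Longrightarrow> ennreal (c u) * (\<integral>\<^sup>+x. ennreal (x powr (t - 1)) \<partial>\<kappa> u) = ennreal (q t u)"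
  shows "\<exists>Qu. bernstein_family p q Qu \<and> (\<forall>u\<in>sphere 0 1. \<forall>h\<in>borel_measurable halfline_space.
    (\<integral>\<^sup>+s. h s \<partial>Qu u) = (\<integral>\<^sup>+x. ennreal (c u) * ennreal (exp (neg_log x)) * h (neg_log x) \<partial>\<kappa> u))"
proof -
  note [measurable] = \<kappa>m c neg_log_measurable
  have s\<kappa>: "sets (\<kappa> u) = sets borel" if "u \<in> sphere 0 1" for u using sets_kernel[OF \<kappa>m] that by simp
  have [measurable]: "(\<lambda>s. ennreal (exp s)) \<in> borel_measurable halfline_space" by (intro measurable_restrict_space1) simp
  define Qu where "Qu u = density (distr (\<kappa> u) halfline_space neg_log) (\<lambda>s. ennreal (c u) * ennreal (exp s))" for u
  have int: "(\<integral>\<^sup>+s. h s \<partial>Qu u) = (\<integral>\<^sup>+x. ennreal (c u) * ennreal (exp (neg_log x)) * h (neg_log x) \<partial>\<kappa> u)"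
    if u: "u \<in> sphere 0 1" and [measurable]: "h \<in> borel_measurable halfline_space" for u h
  proof -
    have "(\<integral>\<^sup>+s. h s \<partial>Qu u) = (\<integral>\<^sup>+s. ennreal (c u) * ennreal (exp s) * h s \<partial>distr (\<kappa> u) halfline_space neg_log)"
      unfolding Qu_def by (rule nn_integral_density) measurable
    also have "\<dots> = (\<integral>\<^sup>+x. ennreal (c u) * ennreal (exp (neg_log x)) * h (neg_log x) \<partial>\<kappa> u)"
    proof (rule nn_integral_distr)
      show "neg_log \<in> \<kappa> u \<rightarrow>\<^sub>M halfline_space" using neg_log_measurable by (simp add: measurable_cong_sets[OF s\<kappa>[OF u] refl])
      have "(\<lambda>s. ennreal (c u) * ennreal (exp s) * h s) \<in> borel_measurable halfline_space" by measurable
      then show "(\<lambda>s. ennreal (c u) * ennreal (exp s) * h s) \<in> borel_measurable (distr (\<kappa> u) halfline_space neg_log)"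
        by simp
    qed
    finally show ?thesis .
  qed
  have "bernstein_family p q Qu"
    unfolding bernstein_family_def
  proof (intro conjI ballI allI impI)
    show "sets (Qu u) = sets halfline_space" for u by (simp add: Qu_def)
    fix A :: "real set" assume A[measurable]: "A \<in> sets halfline_space"
    have [measurable]: "(\<lambda>x. ennreal (exp (neg_log x))) \<in> borel_measurable borel" unfolding neg_log_def by measurable
    have [measurable]: "(\<lambda>x. indicator A (neg_log x) :: ennreal) \<in> borel_measurable borel"
      by (rule measurable_compose[OF neg_log_measurable]) simp
    have "(\<lambda>u. \<integral>\<^sup>+x. ennreal (c u) * ennreal (exp (neg_log x)) * indicator A (neg_log x) \<partial>\<kappa> u) \<in> borel_measurable sphere_space"
      by (rule nn_integral_measurable_subprob_algebra2[OF _ \<kappa>m]) measurable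
    then show "(\<lambda>u. emeasure (Qu u) A) \<in> borel_measurable sphere_space"
    proof (rule measurable_cong[THEN iffD1, rotated])
      fix u :: 'a assume "u \<in> space sphere_space"
      then show "(\<integral>\<^sup>+x. ennreal (c u) * ennreal (exp (neg_log x)) * indicator A (neg_log x) \<partial>\<kappa> u) = emeasure (Qu u) A"
        using int[of u "indicator A"] A by (simp add: Qu_def)
    qed
  next
    fix u :: 'a and r :: real assume u: "u \<in> sphere 0 1" and r: "0 < r"
    define t where "t = r powr p"
    have t: "0 < t" using r by (simp add: t_def)
    have "(\<integral>\<^sup>+s. ennreal (exp (- t * s)) \<partial>Qu u) = (\<integral>\<^sup>+x. ennreal (c u) * ennreal (exp (neg_log x)) * ennreal (exp (- t * neg_log x)) \<partial>\<kappa> u)"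
      by (rule int[OF u]) measurable
    also have "\<dots> = (\<integral>\<^sup>+x. ennreal (c u) * ennreal (x powr (t - 1)) \<partial>\<kappa> u)"
    proof (rule nn_integral_cong_AE)
      show "AE x in \<kappa> u. ennreal (c u) * ennreal (exp (neg_log x)) * ennreal (exp (- t * neg_log x)) = ennreal (c u) * ennreal (x powr (t - 1))"
        using ae[OF u]
      proof eventually_elim
        case (elim x)
        then have "exp (neg_log x) * exp (- t * neg_log x) = x powr (t - 1)"
          by (simp add: neg_log_def powr_def exp_add[symmetric] algebra_simps)
        then show ?case by (simp add: mult.assoc ennreal_mult[symmetric])
      qed
    qed
    also have "\<dots> = ennreal (c u) * (\<integral>\<^sup>+x. ennreal (x powr (t - 1)) \<partial>\<kappa> u)"
      using s\<kappa>[OF u] by (intro nn_integral_cmult) (simp cong: measurable_cong_sets)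
    also have "\<dots> = ennreal (q t u)"
      by (rule tr[OF u t])
    finally show "ennreal (q (r powr p) u) = (\<integral>\<^sup>+s. ennreal (exp (- (r powr p) * s)) \<partial>Qu u)"
      by (simp add: t_def)
  qed
  then show ?thesis using int by blast
qed

text \<open>
  Bernstein's theorem gives a measure for each direction separately. The measures on the unit interval that it provides are unique, and their
  moments \<open>q (n + 1) u / q 1 u\<close> are measurable in \<open>u\<close>; hence so are the measures.
\<close>

lemma bernstein_family_exists:
  fixes q :: "real \<Rightarrow> 'a::euclidean_space \<Rightarrow> real"
  assumes q: "tempering_pair q \<sigma>"
  shows "\<exists>Qu. bernstein_family p q Qu"
proof -
  have qpos: "0 < q r u" if "u \<in> sphere 0 1" "0 < r" for r u using q that by (auto simp: tempering_pair_def)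
  have "\<forall>u. \<exists>\<mu>. u \<in> sphere 0 1 \<longrightarrow> prob_space \<mu> \<and> unit_interval_measure \<mu> \<and> (AE x in \<mu>. 0 < x \<and> x < 1) \<and>
    (\<forall>r>0. (\<integral>\<^sup>+x. ennreal (x powr (r - 1)) \<partial>\<mu>) = ennreal (q r u / q 1 u))"
  proof
    fix u :: 'a
    show "\<exists>\<mu>. u \<in> sphere 0 1 \<longrightarrow> prob_space \<mu> \<and> unit_interval_measure \<mu> \<and> (AE x in \<mu>. 0 < x \<and> x < 1) \<and>
      (\<forall>r>0. (\<integral>\<^sup>+x. ennreal (x powr (r - 1)) \<partial>\<mu>) = ennreal (q r u / q 1 u))"
    proof (cases "u \<in> sphere 0 1")
      case True
      then show ?thesis using q bernstein[of "\<lambda>r. q r u"] unfolding tempering_pair_def by blast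
    qed simp
  qed
  from choice[OF this] obtain \<kappa> where \<kappa>: "\<And>u. u \<in> sphere 0 1 \<Longrightarrow> prob_space (\<kappa> u) \<and> unit_interval_measure (\<kappa> u)"
    and ae: "\<And>u. u \<in> sphere 0 1 \<Longrightarrow> AE x in \<kappa> u. 0 < x \<and> x < 1"
    and tr: "\<And>u r. u \<in> sphere 0 1 \<Longrightarrow> 0 < r \<Longrightarrow> (\<integral>\<^sup>+x. ennreal (x powr (r - 1)) \<partial>\<kappa> u) = ennreal (q r u / q 1 u)"
    by blast
  have s\<kappa>: "sets (\<kappa> u) = sets borel" if "u \<in> sphere 0 1" for u using \<kappa>[OF that] by (simp add: unit_interval_measure_def)
  have [measurable]: "q 1 \<in> borel_measurable sphere_space" by (rule tempering_pair_section_measurable[OF q]) simp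
  have \<kappa>m[measurable]: "\<kappa> \<in> sphere_space \<rightarrow>\<^sub>M subprob_algebra borel"
  proof (rule kernel_measurable_from_moments)
    show "prob_space (\<kappa> u) \<and> unit_interval_measure (\<kappa> u)" if "u \<in> space sphere_space" for u using \<kappa> that by simp
    fix n :: nat
    have "(\<lambda>u. q (real n + 1) u / q 1 u) \<in> borel_measurable sphere_space"
      by (intro borel_measurable_divide tempering_pair_section_measurable[OF q]) auto
    then show "(\<lambda>u. \<integral>x. x ^ n \<partial>\<kappa> u) \<in> borel_measurable sphere_space"
    proof (rule measurable_cong[THEN iffD1, rotated])
      fix u :: 'a assume "u \<in> space sphere_space"
      then have u: "u \<in> sphere 0 1" by simp
      have "(\<integral>x. x ^ n \<partial>\<kappa> u) = enn2real (\<integral>\<^sup>+x. ennreal (x ^ n) \<partial>\<kappa> u)"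
        using ae[OF u] s\<kappa>[OF u] by (intro integral_eq_nn_integral) (auto elim!: eventually_mono cong: measurable_cong_sets)
      also have "(\<integral>\<^sup>+x. ennreal (x ^ n) \<partial>\<kappa> u) = (\<integral>\<^sup>+x. ennreal (x powr ((real n + 1) - 1)) \<partial>\<kappa> u)"
      proof (rule nn_integral_cong_AE)
        show "AE x in \<kappa> u. ennreal (x ^ n) = ennreal (x powr (real n + 1 - 1))"
          using ae[OF u] by eventually_elim (simp add: powr_realpow)
      qed
      also have "\<dots> = ennreal (q (real n + 1) u / q 1 u)" by (rule tr[OF u]) simp
      finally show "q (real n + 1) u / q 1 u = (\<integral>x. x ^ n \<partial>\<kappa> u)"
        using qpos[OF u, of "real n + 1"] qpos[OF u, of 1] by simp
    qed
  qed
  have "\<exists>Qu. bernstein_family p q Qu \<and> (\<forall>u\<in>sphere 0 1. \<forall>h\<in>borel_measurable halfline_space.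
    (\<integral>\<^sup>+s. h s \<partial>Qu u) = (\<integral>\<^sup>+x. ennreal (q 1 u) * ennreal (exp (neg_log x)) * h (neg_log x) \<partial>\<kappa> u))"
  proof (rule bernstein_family_from_unit_kernel[OF \<kappa>m ae])
    show "q 1 \<in> borel_measurable sphere_space" by measurable
    show "ennreal (q 1 u) * (\<integral>\<^sup>+x. ennreal (x powr (t - 1)) \<partial>\<kappa> u) = ennreal (q t u)" if "u \<in> sphere 0 1" "0 < t" for u t
      using tr[OF that] qpos[OF that(1), of 1] qpos[OF that] by (simp add: ennreal_mult[symmetric])
  qed
  then show ?thesis by blast
qed

lemma nn_integral_halfline_scale:
  fixes g :: "real \<Rightarrow> ennreal"
  assumes c: "0 < c" and [measurable]: "g \<in> borel_measurable borel"
  shows "(\<integral>\<^sup>+t\<in>{0<..}. g t \<partial>lborel) = ennreal c * (\<integral>\<^sup>+r\<in>{0<..}. g (c * r) \<partial>lborel)"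
proof -
  have "(\<integral>\<^sup>+t\<in>{0<..}. g t \<partial>lborel) = ennreal \<bar>c\<bar> * (\<integral>\<^sup>+r. g (0 + c * r) * indicator {0<..} (0 + c * r) \<partial>lborel)"
    using c by (intro nn_integral_real_affine) auto
  then show ?thesis using c by (simp add: indicator_def zero_less_mult_iff)
qed

text \<open>
  The substitution \<open>t = c * r\<close>. With \<open>c powr p = s\<close> it moves the parameter \<open>s\<close> of a tempered density into the position of the mass point.
\<close>

lemma radial_integral_scale:
  assumes c: "0 < c" and p: "0 < p" and [measurable]: "f \<in> borel_measurable borel"
  shows "(\<integral>\<^sup>+t\<in>{0<..}. f t * ennreal (t powr (- 1 - \<alpha>) * exp (- (t powr p))) \<partial>lborel) * ennreal (c powr \<alpha>) =
    (\<integral>\<^sup>+r\<in>{0<..}. f (c * r) * ennreal (r powr (- \<alpha> - 1) * exp (- (r powr p) * c powr p)) \<partial>lborel)"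
proof -
  have "(\<integral>\<^sup>+t\<in>{0<..}. f t * ennreal (t powr (- 1 - \<alpha>) * exp (- (t powr p))) \<partial>lborel) * ennreal (c powr \<alpha>) =
    ennreal (c powr \<alpha>) * (ennreal c * (\<integral>\<^sup>+r\<in>{0<..}. f (c * r) * ennreal ((c * r) powr (- 1 - \<alpha>) * exp (- ((c * r) powr p))) \<partial>lborel))"
    by (subst nn_integral_halfline_scale[OF c]) (simp_all add: mult.commute)
  also have "\<dots> = (\<integral>\<^sup>+r. ennreal (c powr \<alpha> * c) * (f (c * r) * ennreal ((c * r) powr (- 1 - \<alpha>) * exp (- ((c * r) powr p))) * indicator {0<..} r) \<partial>lborel)"
    using c by (subst nn_integral_cmult) (simp_all add: ennreal_mult mult.assoc)
  also have "\<dots> = (\<integral>\<^sup>+r\<in>{0<..}. f (c * r) * ennreal (r powr (- \<alpha> - 1) * exp (- (r powr p) * c powr p)) \<partial>lborel)"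
  proof (intro nn_integral_cong)
    fix r :: real
    show "ennreal (c powr \<alpha> * c) * (f (c * r) * ennreal ((c * r) powr (- 1 - \<alpha>) * exp (- ((c * r) powr p))) * indicator {0<..} r) =
      f (c * r) * ennreal (r powr (- \<alpha> - 1) * exp (- (r powr p) * c powr p)) * indicator {0<..} r"
    proof (cases "0 < r")
      case True
      have "c powr \<alpha> * c * c powr (- 1 - \<alpha>) = c powr (\<alpha> + 1 + (- 1 - \<alpha>))"
        unfolding powr_add using c by simp
      then have k: "c powr \<alpha> * c * c powr (- 1 - \<alpha>) = 1" using c by simp
      have "c powr \<alpha> * c * ((c * r) powr (- 1 - \<alpha>) * exp (- ((c * r) powr p))) =
        (c powr \<alpha> * c * c powr (- 1 - \<alpha>)) * (r powr (- 1 - \<alpha>) * exp (- ((c * r) powr p)))"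
        using c True by (simp add: powr_mult mult_ac)
      also have "\<dots> = r powr (- \<alpha> - 1) * exp (- (r powr p) * c powr p)"
        unfolding k using c True by (simp add: powr_mult mult.commute minus_diff_commute)
      finally have e: "c powr \<alpha> * c * ((c * r) powr (- 1 - \<alpha>) * exp (- ((c * r) powr p))) = r powr (- \<alpha> - 1) * exp (- (r powr p) * c powr p)" .
      have "ennreal (c powr \<alpha> * c) * (f (c * r) * ennreal ((c * r) powr (- 1 - \<alpha>) * exp (- ((c * r) powr p)))) =
        f (c * r) * ennreal (c powr \<alpha> * c * ((c * r) powr (- 1 - \<alpha>) * exp (- ((c * r) powr p))))"
        using c by (subst ennreal_mult) (auto simp: mult_ac)
      then show ?thesis using True unfolding e by simp
    qed simp
  qed
  finally show ?thesis .
qed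

lemma levy_mixture_inner_measurable[measurable]:
  assumes [measurable]: "A \<in> sets (borel :: 'a::euclidean_space measure)"
  shows "(\<lambda>x::'a. \<integral>\<^sup>+t\<in>{0<..}. indicator A (t *\<^sub>R x) * ennreal (t powr (- 1 - \<alpha>) * exp (- (t powr p))) \<partial>lborel) \<in> borel_measurable borel"
  by measurable

text \<open>
  Inserting the polar form of \<open>R\<close>, rescaling the radial integral and exchanging the order of integration recovers the Laplace transform
  \<open>q (r powr p) u\<close> of the Bernstein measure under the radial integral.
\<close>

theorem levy_mixture_eq_polar_tempered:
  fixes q :: "real \<Rightarrow> 'a::euclidean_space \<Rightarrow> real"
  assumes Q: "bernstein_family p q Qu" and p: "0 < p" and s\<sigma>: "sets \<sigma> = sets sphere_space"
    and R: "polar_disintegration p \<alpha> R \<sigma> Qu" and q0: "\<And>u r. u \<in> sphere 0 1 \<Longrightarrow> 0 < r \<Longrightarrow> 0 \<le> q r u" and A[measurable]: "A \<in> sets borel"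
  shows "polar_tempered p \<alpha> q \<sigma> A = levy_mixture p \<alpha> R A"
proof -
  define F where "F x = (\<integral>\<^sup>+t\<in>{0<..}. indicator A (t *\<^sub>R x) * ennreal (t powr (- 1 - \<alpha>) * exp (- (t powr p))) \<partial>lborel)" for x :: 'a
  have Fm: "F \<in> borel_measurable borel" unfolding F_def by measurable
  have inner: "(\<integral>\<^sup>+s. F ((s powr (- 1 / p)) *\<^sub>R u) * ennreal (s powr (\<alpha> / p)) \<partial>Qu u) =
      (\<integral>\<^sup>+r\<in>{0<..}. indicator A (r *\<^sub>R u) * ennreal (q (r powr p) u * r powr (- \<alpha> - 1)) \<partial>lborel)"
    if "u \<in> space \<sigma>" for u
  proof -
    have u: "u \<in> sphere 0 1" using that sigma_space[OF Q p s\<sigma>] by simp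
    interpret S: sigma_finite_measure "Qu u" by (rule bernstein_sigma_finite[OF Q p u])
    interpret pair_sigma_finite "Qu u" lborel ..
    note [measurable_cong] = bernstein_sets[OF Q u]
    have "(\<integral>\<^sup>+s. F ((s powr (- 1 / p)) *\<^sub>R u) * ennreal (s powr (\<alpha> / p)) \<partial>Qu u) =
        (\<integral>\<^sup>+s. (\<integral>\<^sup>+r. indicator A (r *\<^sub>R u) * ennreal (r powr (- \<alpha> - 1) * exp (- (r powr p) * s)) * indicator {0<..} r \<partial>lborel) \<partial>Qu u)"
    proof (intro nn_integral_cong)
      fix s assume "s \<in> space (Qu u)"
      then have s: "0 < s" using bernstein_space[OF Q u] by auto
      \<comment> \<open>The scale for which \<open>r = t / c\<close> turns \<open>exp (- (t powr p))\<close> into \<open>exp (- (r powr p) * s)\<close>.\<close>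
      define c where "c = s powr (1 / p)"
      have c: "0 < c" "c powr \<alpha> = s powr (\<alpha> / p)" "c powr p = s" using s p by (simp_all add: c_def powr_powr)
      have ci: "s powr (- 1 / p) = inverse c" using s by (simp add: c_def powr_minus divide_inverse)
      have "(\<lambda>t. indicator A (t *\<^sub>R (inverse c *\<^sub>R u)) :: ennreal) \<in> borel_measurable borel" by measurable
      have cc: "c * x * inverse c = x" for x using c(1) by simp
      from radial_integral_scale[OF c(1) p \<open>(\<lambda>t. indicator A (t *\<^sub>R (inverse c *\<^sub>R u)) :: ennreal) \<in> borel_measurable borel\<close>, of \<alpha>]
      show "F ((s powr (- 1 / p)) *\<^sub>R u) * ennreal (s powr (\<alpha> / p)) =
        (\<integral>\<^sup>+r. indicator A (r *\<^sub>R u) * ennreal (r powr (- \<alpha> - 1) * exp (- (r powr p) * s)) * indicator {0<..} r \<partial>lborel)"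
        unfolding F_def ci c(2,3) scaleR_scaleR cc by simp
    qed
    also have "\<dots> = (\<integral>\<^sup>+r. (\<integral>\<^sup>+s. indicator A (r *\<^sub>R u) * ennreal (r powr (- \<alpha> - 1) * exp (- (r powr p) * s)) * indicator {0<..} r \<partial>Qu u) \<partial>lborel)"
    proof (rule Fubini'[symmetric])
      have [measurable]: "fst \<in> (Qu u \<Otimes>\<^sub>M lborel) \<rightarrow>\<^sub>M borel"
        by (rule measurable_compose[OF measurable_fst]) (simp add: measurable_cong_sets[OF bernstein_sets[OF Q u] refl] halfline_space_id)
      show "(\<lambda>(s, r). indicator A (r *\<^sub>R u) * ennreal (r powr (- \<alpha> - 1) * exp (- (r powr p) * s)) * indicator {0<..} r)
        \<in> borel_measurable (Qu u \<Otimes>\<^sub>M lborel)"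
        unfolding case_prod_beta' by measurable
    qed
    also have "\<dots> = (\<integral>\<^sup>+r\<in>{0<..}. indicator A (r *\<^sub>R u) * ennreal (q (r powr p) u * r powr (- \<alpha> - 1)) \<partial>lborel)"
    proof (intro nn_integral_cong)
      fix r :: real
      show "(\<integral>\<^sup>+s. indicator A (r *\<^sub>R u) * ennreal (r powr (- \<alpha> - 1) * exp (- (r powr p) * s)) * indicator {0<..} r \<partial>Qu u) =
        indicator A (r *\<^sub>R u) * ennreal (q (r powr p) u * r powr (- \<alpha> - 1)) * indicator {0<..} r"
      proof (cases "0 < r")
        case True
        then have rp: "0 < r powr p" by simp
        have "(\<integral>\<^sup>+s. indicator A (r *\<^sub>R u) * ennreal (r powr (- \<alpha> - 1) * exp (- (r powr p) * s)) * indicator {0<..} r \<partial>Qu u) =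
          (\<integral>\<^sup>+s. (indicator A (r *\<^sub>R u) * ennreal (r powr (- \<alpha> - 1))) * ennreal (exp (- (r powr p) * s)) \<partial>Qu u)"
          using True by (intro nn_integral_cong) (simp add: ennreal_mult mult.assoc)
        also have "\<dots> = (indicator A (r *\<^sub>R u) * ennreal (r powr (- \<alpha> - 1))) * ennreal (q (r powr p) u)"
        proof -
          have "(\<lambda>s. ennreal (exp (- (r powr p) * s))) \<in> borel_measurable (Qu u)"
            unfolding measurable_cong_sets[OF bernstein_sets[OF Q u] refl] by (rule exp_halfline_measurable)
          from nn_integral_cmult[OF this] show ?thesis unfolding bernstein_transform[OF Q p u rp] .
        qed
        finally show ?thesis using True q0[OF u rp] by (simp add: ennreal_mult mult_ac)
      qed simp
    qed
    finally show ?thesis .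
  qed
  have "levy_mixture p \<alpha> R A = (\<integral>\<^sup>+x. F x \<partial>R)" by (simp add: levy_mixture_def F_def)
  also have "\<dots> = (\<integral>\<^sup>+u. (\<integral>\<^sup>+s. F ((s powr (- 1 / p)) *\<^sub>R u) * ennreal (s powr (\<alpha> / p)) \<partial>Qu u) \<partial>\<sigma>)"
    using R Fm by (simp add: polar_disintegration_def)
  also have "\<dots> = polar_tempered p \<alpha> q \<sigma> A" unfolding polar_tempered_def by (intro nn_integral_cong inner)
  finally show ?thesis by simp
qed

lemma levy_mixture_alt:
  fixes R :: "'a::euclidean_space measure"
  assumes p: "0 < p" and sR: "sets R = sets borel" and A[measurable]: "A \<in> sets borel"
  shows "levy_mixture' p \<alpha> R A = levy_mixture p \<alpha> R A"
proof -
  note [measurable_cong] = sR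
  have "(\<integral>\<^sup>+t\<in>{0<..}. indicator A (t *\<^sub>R x) * ennreal (t powr (- 1 - \<alpha>) * exp (- (t powr p))) \<partial>lborel) =
     ennreal (1 / p) * (\<integral>\<^sup>+t\<in>{0<..}. indicator A ((t powr (1 / p)) *\<^sub>R x) * ennreal (t powr (- 1 - \<alpha> / p) * exp (- t)) \<partial>lborel)" for x :: 'a
  proof -
    have "(\<integral>\<^sup>+t\<in>{0<..}. indicator A (t *\<^sub>R x) * ennreal (t powr (- 1 - \<alpha>) * exp (- (t powr p))) \<partial>lborel) =
      (\<integral>\<^sup>+v\<in>{0<..}. (indicator A ((v powr (1 / p)) *\<^sub>R x) * ennreal ((v powr (1 / p)) powr (- 1 - \<alpha>) * exp (- ((v powr (1 / p)) powr p)))) * ennreal (1 / p * v powr (1 / p - 1)) \<partial>lborel)"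
      using p by (intro nn_integral_powr_substitution) auto
    also have "\<dots> = (\<integral>\<^sup>+t. ennreal (1 / p) * (indicator A ((t powr (1 / p)) *\<^sub>R x) * ennreal (t powr (- 1 - \<alpha> / p) * exp (- t)) * indicator {0<..} t) \<partial>lborel)"
    proof (intro nn_integral_cong)
      fix v :: real
      show "(indicator A ((v powr (1 / p)) *\<^sub>R x) * ennreal ((v powr (1 / p)) powr (- 1 - \<alpha>) * exp (- ((v powr (1 / p)) powr p)))) * ennreal (1 / p * v powr (1 / p - 1)) * indicator {0<..} v =
        ennreal (1 / p) * (indicator A ((v powr (1 / p)) *\<^sub>R x) * ennreal (v powr (- 1 - \<alpha> / p) * exp (- v)) * indicator {0<..} v)"
      proof (cases "0 < v")
        case True
        have e1: "(v powr (1 / p)) powr p = v" using True p by (simp add: powr_powr)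
        have "(v powr (1 / p)) powr (- 1 - \<alpha>) * v powr (1 / p - 1) = v powr (1 / p * (- 1 - \<alpha>) + (1 / p - 1))"
          by (simp only: powr_powr powr_add)
        also have "1 / p * (- 1 - \<alpha>) + (1 / p - 1) = - 1 - \<alpha> / p" using p by (simp add: field_simps)
        finally have e2: "(v powr (1 / p)) powr (- 1 - \<alpha>) * v powr (1 / p - 1) = v powr (- 1 - \<alpha> / p)" .
        have "ennreal ((v powr (1 / p)) powr (- 1 - \<alpha>) * exp (- v)) * ennreal (1 / p * v powr (1 / p - 1)) =
          ennreal (1 / p * (((v powr (1 / p)) powr (- 1 - \<alpha>) * v powr (1 / p - 1)) * exp (- v)))"
        proof -
          have "ennreal (V * E) * ennreal (1 / p * W) = ennreal (1 / p * ((V * W) * E))" if "0 \<le> V" "0 \<le> E" "0 \<le> W" for V E W :: real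
          proof -
            have "ennreal (V * E) * ennreal (1 / p * W) = ennreal ((V * E) * (1 / p * W))"
              using that p by (intro ennreal_mult[symmetric]) auto
            also have "(V * E) * (1 / p * W) = 1 / p * ((V * W) * E)" by (simp only: mult_ac)
            finally show ?thesis .
          qed
          then show ?thesis by simp
        qed
        also have "\<dots> = ennreal (1 / p) * ennreal (v powr (- 1 - \<alpha> / p) * exp (- v))"
          unfolding e2 using p by (intro ennreal_mult) auto
        finally show ?thesis using True unfolding e1 by (simp add: mult_ac)
      qed simp
    qed
    also have "\<dots> = ennreal (1 / p) * (\<integral>\<^sup>+t\<in>{0<..}. indicator A ((t powr (1 / p)) *\<^sub>R x) * ennreal (t powr (- 1 - \<alpha> / p) * exp (- t)) \<partial>lborel)"
      by (rule nn_integral_cmult) measurable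
    finally show ?thesis .
  qed
  then have "levy_mixture p \<alpha> R A = (\<integral>\<^sup>+x. ennreal (1 / p) * (\<integral>\<^sup>+t\<in>{0<..}. indicator A ((t powr (1 / p)) *\<^sub>R x) * ennreal (t powr (- 1 - \<alpha> / p) * exp (- t)) \<partial>lborel) \<partial>R)"
    unfolding levy_mixture_def by simp
  also have "\<dots> = levy_mixture' p \<alpha> R A"
    unfolding levy_mixture'_def by (rule nn_integral_cmult) measurable
  finally show ?thesis by simp
qed

section \<open>The integrability conditions\<close>

lemma nn_integral_powr_exp_finite:
  assumes p: "0 < p" and \<beta>: "-1 < (\<beta>::real)"
  shows "(\<integral>\<^sup>+t\<in>{0<..}. ennreal (t powr \<beta> * exp (- (t powr p))) \<partial>lborel) < \<top>"
proof -
  define z where "z = (\<beta> + 1) / p"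
  have z: "0 < z" using p \<beta> by (simp add: z_def)
  have "(\<integral>\<^sup>+t\<in>{0<..}. ennreal (t powr \<beta> * exp (- (t powr p))) \<partial>lborel) =
    (\<integral>\<^sup>+v\<in>{0<..}. ennreal ((v powr (1 / p)) powr \<beta> * exp (- ((v powr (1 / p)) powr p))) * ennreal (1 / p * v powr (1 / p - 1)) \<partial>lborel)"
    using p by (intro nn_integral_powr_substitution) auto
  also have "\<dots> \<le> (\<integral>\<^sup>+v. ennreal (1 / p) * ennreal (indicator {0..} v * v powr (z - 1) / exp v) \<partial>lborel)"
  proof (rule nn_integral_mono)
    fix v :: real
    show "ennreal ((v powr (1 / p)) powr \<beta> * exp (- ((v powr (1 / p)) powr p))) * ennreal (1 / p * v powr (1 / p - 1)) * indicator {0<..} v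
      \<le> ennreal (1 / p) * ennreal (indicator {0..} v * v powr (z - 1) / exp v)"
    proof (cases "0 < v")
      case True
      have e1: "(v powr (1 / p)) powr p = v" using True p by (simp add: powr_powr)
      have "(v powr (1 / p)) powr \<beta> * v powr (1 / p - 1) = v powr (1 / p * \<beta> + (1 / p - 1))"
        by (simp only: powr_powr powr_add)
      also have "1 / p * \<beta> + (1 / p - 1) = z - 1" using p by (simp add: z_def field_simps)
      finally have e2: "(v powr (1 / p)) powr \<beta> * v powr (1 / p - 1) = v powr (z - 1)" .
      have "ennreal ((v powr (1 / p)) powr \<beta> * exp (- v)) * ennreal (1 / p * v powr (1 / p - 1)) =
          ennreal ((v powr (1 / p)) powr \<beta> * exp (- v) * (1 / p * v powr (1 / p - 1)))"
        using p by (intro ennreal_mult[symmetric]) auto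
      also have "(v powr (1 / p)) powr \<beta> * exp (- v) * (1 / p * v powr (1 / p - 1)) =
          1 / p * (((v powr (1 / p)) powr \<beta> * v powr (1 / p - 1)) * exp (- v))" by (simp only: mult_ac)
      also have "\<dots> = 1 / p * (v powr (z - 1) / exp v)" unfolding e2 by (simp add: exp_minus divide_inverse)
      also have "ennreal \<dots> = ennreal (1 / p) * ennreal (v powr (z - 1) / exp v)" using p by (intro ennreal_mult) auto
      finally show ?thesis using True unfolding e1 by simp
    qed simp
  qed
  also have "\<dots> = ennreal (1 / p) * ennreal (Gamma z)"
    unfolding Gamma_conv_nn_integral_real[OF z] by (rule nn_integral_cmult) measurable
  also have "\<dots> < \<top>" by (simp add: ennreal_mult_less_top)
  finally show ?thesis .
qed

text \<open>
  The contribution of a unit mass of \<open>R\<close> at distance \<open>s\<close> from the origin to the truncated second moment of the mixture.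
\<close>

definition radial_levy_integral :: "real \<Rightarrow> real \<Rightarrow> real \<Rightarrow> ennreal" where
  "radial_levy_integral p \<alpha> s =
     (\<integral>\<^sup>+t\<in>{0<..}. ennreal (min ((t * s)\<^sup>2) 1) * ennreal (t powr (- 1 - \<alpha>) * exp (- (t powr p))) \<partial>lborel)"

definition levy_weight :: "real \<Rightarrow> real \<Rightarrow> real" where
  "levy_weight \<alpha> s = (if 0 < \<alpha> then min (s\<^sup>2) (s powr \<alpha>) else if \<alpha> = 0 then min (s\<^sup>2) (1 + max 0 (ln s)) else min (s\<^sup>2) 1)"

lemma levy_weight_measurable[measurable]: "levy_weight \<alpha> \<in> borel_measurable borel"
  unfolding levy_weight_def[abs_def] by measurable

lemma levy_weight_nonneg: "0 \<le> levy_weight \<alpha> s"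
  by (simp add: levy_weight_def)

lemma integrability_conditions_iff:
  "integrability_conditions \<alpha> R \<longleftrightarrow>
     \<alpha> < 2 \<and> emeasure R {0} = 0 \<and> (\<integral>\<^sup>+x. ennreal (levy_weight \<alpha> (norm x)) \<partial>R) < \<infinity>"
  unfolding integrability_conditions_def levy_weight_def by (cases "0 < \<alpha>"; cases "\<alpha> = 0") auto

lemma levy_weight_small:
  assumes "\<alpha> < 2" "0 < s" "s \<le> 1" shows "levy_weight \<alpha> s = s\<^sup>2"
proof -
  have "s\<^sup>2 \<le> 1" using assms by (simp add: power_le_one)
  moreover have "s powr 2 \<le> s powr \<alpha>" using assms by (intro powr_mono') auto
  ultimately show ?thesis using assms by (simp add: levy_weight_def min_def max_def ln_le_zero_iff)
qed

lemma levy_weight_large: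
  assumes "\<alpha> < 2" "1 < s"
  shows "levy_weight \<alpha> s = (if 0 < \<alpha> then s powr \<alpha> else if \<alpha> = 0 then 1 + ln s else 1)"
proof -
  have a: "s powr \<alpha> \<le> s\<^sup>2" using assms powr_mono[of \<alpha> 2 s] by simp
  have "ln s \<le> s - 1" using assms by (intro ln_le_minus_one) simp
  moreover have "s * 1 \<le> s * s" using assms by (intro mult_left_mono) auto
  ultimately have b: "1 + ln s \<le> s\<^sup>2" by (simp add: power2_eq_square)
  have c: "1 \<le> s\<^sup>2" using assms one_le_power[of s 2] by simp
  show ?thesis using a b c assms by (simp add: levy_weight_def min_absorb2)
qed

lemma powr_one_over: "0 < s \<Longrightarrow> (1 / s) powr c = s powr (- c)" for s c :: real
  by (simp add: powr_divide powr_minus_divide)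

lemma nn_integral_one_over:
  assumes "0 < a" "a \<le> b"
  shows "(\<integral>\<^sup>+t. ennreal (1 / t) * indicator {a..b} t \<partial>lborel) = ennreal (ln b - ln a)"
proof (rule nn_integral_FTC_Icc)
  fix x assume "x \<in> {a..b}"
  then have "0 < x" using assms by simp
  then show "DERIV ln x :> 1 / x" "0 \<le> 1 / x" by (auto intro!: derivative_eq_intros)
qed (use assms in auto)

lemma nn_integral_Icc_ge:
  assumes "a \<le> b" and "\<And>t. a \<le> t \<Longrightarrow> t \<le> b \<Longrightarrow> ennreal m \<le> f t"
  shows "ennreal (m * (b - a)) \<le> (\<integral>\<^sup>+t. f t \<partial>lborel)"
proof (cases "0 \<le> m")
  case True
  have "ennreal (m * (b - a)) = ennreal m * ennreal (b - a)" using assms(1) True by (intro ennreal_mult) auto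
  also have "\<dots> = (\<integral>\<^sup>+t. ennreal m * indicator {a..b} t \<partial>lborel)"
    using assms(1) by (simp add: nn_integral_cmult_indicator)
  also have "\<dots> \<le> (\<integral>\<^sup>+t. f t \<partial>lborel)"
    using assms(2) by (intro nn_integral_mono) (auto simp: indicator_def)
  finally show ?thesis .
next
  case False
  then have "m * (b - a) \<le> 0" using assms(1) by (simp add: mult_nonpos_nonneg)
  then show ?thesis by (simp add: ennreal_neg)
qed

lemma radial_density_lower:
  fixes a b p \<alpha> :: real
  assumes "0 < a" "a \<le> b" "0 < p"
  shows "\<exists>m>0. \<forall>t\<in>{a..b}. m \<le> t powr (- 1 - \<alpha>) * exp (- (t powr p))"
proof -
  have "continuous_on {a..b} (\<lambda>t. t powr (- 1 - \<alpha>) * exp (- (t powr p)))"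
    using assms by (auto intro!: continuous_on_mult continuous_on_exp continuous_on_minus continuous_on_powr continuous_on_id continuous_on_const)
  then obtain x where x: "x \<in> {a..b}" and min: "\<And>t. t \<in> {a..b} \<Longrightarrow> x powr (- 1 - \<alpha>) * exp (- (x powr p)) \<le> t powr (- 1 - \<alpha>) * exp (- (t powr p))"
    using continuous_attains_inf[OF compact_Icc, of a b "\<lambda>t. t powr (- 1 - \<alpha>) * exp (- (t powr p))"] assms by auto
  show ?thesis using x assms min by (intro exI[of _ "x powr (- 1 - \<alpha>) * exp (- (x powr p))"]) auto
qed

text \<open>
  For \<open>s \<le> 1\<close> the range \<open>1 / 2 \<le> t \<le> 1\<close> already contributes a multiple of \<open>s\<^sup>2\<close>. For \<open>s > 1\<close> the truncation
  is active from \<open>t = 1 / s\<close> on; the range between \<open>1 / s\<close> and \<open>2 / s\<close> gives \<open>s powr \<alpha>\<close> for positive \<open>\<alpha>\<close>,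
  the range between \<open>1 / s\<close> and 1 gives \<open>ln s\<close> for \<open>\<alpha> = 0\<close>, and the range between 1 and 2 always gives a constant.
\<close>

lemma radial_levy_integral_lower:
  assumes p: "0 < p" and \<alpha>: "\<alpha> < 2"
  shows "\<exists>c>0. \<forall>s>0. ennreal (c * levy_weight \<alpha> s) \<le> radial_levy_integral p \<alpha> s"
proof -
  define w where "w t = t powr (- 1 - \<alpha>) * exp (- (t powr p))" for t
  have w0: "0 \<le> w t" for t by (simp add: w_def)
  obtain m1 where m1: "0 < m1" "\<And>t. t \<in> {1/2..1} \<Longrightarrow> m1 \<le> w t"
    using radial_density_lower[of "1/2" 1 p \<alpha>] p by (auto simp: w_def)
  obtain m2 where m2: "0 < m2" "\<And>t. t \<in> {1..2} \<Longrightarrow> m2 \<le> w t"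
    using radial_density_lower[of 1 2 p \<alpha>] p by (auto simp: w_def)
  have g: "radial_levy_integral p \<alpha> s = (\<integral>\<^sup>+t. ennreal (min ((t * s)\<^sup>2) 1) * ennreal (w t) * indicator {0<..} t \<partial>lborel)" for s
    by (simp add: radial_levy_integral_def w_def)
  have one: "ennreal (w t) \<le> ennreal (min ((t * s)\<^sup>2) 1) * ennreal (w t) * indicator {0<..} t" if "1 \<le> t * s" "0 < t" for t s
    using that one_le_power[OF that(1), of 2] by simp
  have small: "ennreal (m1 / 8 * s\<^sup>2) \<le> radial_levy_integral p \<alpha> s" if s: "0 < s" "s \<le> 1" for s
  proof -
    have "ennreal (s\<^sup>2 / 4 * m1 * (1 - 1/2)) \<le> radial_levy_integral p \<alpha> s"
      unfolding g
    proof (rule nn_integral_Icc_ge)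
      fix t :: real assume t: "1/2 \<le> t" "t \<le> 1"
      have "t * s \<le> 1" using t s mult_le_one[of t s] by simp
      moreover have "1/2 * s \<le> t * s" using t s by (intro mult_right_mono) auto
      ultimately have "(1/2 * s)\<^sup>2 \<le> min ((t * s)\<^sup>2) 1" using s by (auto simp: power_le_one intro!: power_mono)
      then have "s\<^sup>2 / 4 * m1 \<le> min ((t * s)\<^sup>2) 1 * w t"
        using m1 t by (intro mult_mono) (auto simp: power_mult_distrib power_divide)
      then show "ennreal (s\<^sup>2 / 4 * m1) \<le> ennreal (min ((t * s)\<^sup>2) 1) * ennreal (w t) * indicator {0<..} t"
        using t w0 by (simp add: ennreal_mult[symmetric] ennreal_leI)
    qed simp
    then show ?thesis by (simp add: mult.commute)
  qed
  have large0: "ennreal m2 \<le> (\<integral>\<^sup>+t. ennreal (min ((t * s)\<^sup>2) 1) * ennreal (w t) * indicator {1<..} t \<partial>lborel)" if s: "1 < s" for s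
  proof -
    have "ennreal m2 = (\<integral>\<^sup>+t. ennreal m2 * indicator {1<..2::real} t \<partial>lborel)" by (simp add: nn_integral_cmult_indicator)
    also have "\<dots> \<le> (\<integral>\<^sup>+t. ennreal (min ((t * s)\<^sup>2) 1) * ennreal (w t) * indicator {1<..} t \<partial>lborel)"
    proof (rule nn_integral_mono)
      fix t :: real
      have "1 * 1 \<le> t * s" if "1 < t" using that s by (intro mult_mono) auto
      then show "ennreal m2 * indicator {1<..2} t \<le> ennreal (min ((t * s)\<^sup>2) 1) * ennreal (w t) * indicator {1<..} t"
        using m2(2)[of t] one_le_power[of "t * s" 2] by (auto simp: indicator_def ennreal_leI)
    qed
    finally show ?thesis .
  qed
  have large0': "ennreal m2 \<le> radial_levy_integral p \<alpha> s" if s: "1 < s" for s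
    unfolding g by (rule order_trans[OF large0[OF s]], rule nn_integral_mono) (auto simp: indicator_def)
  define cp where "cp = 2 powr (- 1 - \<alpha>) * exp (- (2 powr p))"
  have large_pos: "ennreal (cp * s powr \<alpha>) \<le> radial_levy_integral p \<alpha> s" if s: "1 < s" and "0 < \<alpha>" for s
  proof -
    have "ennreal ((2 / s) powr (- 1 - \<alpha>) * exp (- (2 powr p)) * (2 / s - 1 / s)) \<le> radial_levy_integral p \<alpha> s"
      unfolding g
    proof (rule nn_integral_Icc_ge)
      fix t assume t: "1 / s \<le> t" "t \<le> 2 / s"
      have t0: "0 < t" using s by (intro less_le_trans[OF _ t(1)]) simp
      have ts: "1 \<le> t * s" using t(1) s by (simp add: divide_le_eq)
      have "2 / s \<le> 2" using s by (simp add: divide_le_eq)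
      then have "t powr p \<le> 2 powr p" using t t0 p by (intro powr_mono2) auto
      moreover have "(2 / s) powr (- 1 - \<alpha>) \<le> t powr (- 1 - \<alpha>)" using t t0 \<open>0 < \<alpha>\<close> by (intro powr_mono2') auto
      ultimately have "(2 / s) powr (- 1 - \<alpha>) * exp (- (2 powr p)) \<le> w t" unfolding w_def by (intro mult_mono) auto
      then show "ennreal ((2 / s) powr (- 1 - \<alpha>) * exp (- (2 powr p))) \<le> ennreal (min ((t * s)\<^sup>2) 1) * ennreal (w t) * indicator {0<..} t"
        by (intro order_trans[OF ennreal_leI one[OF ts t0]])
    qed (use s in \<open>simp add: divide_right_mono\<close>)
    also have "(2 / s) powr (- 1 - \<alpha>) * exp (- (2 powr p)) * (2 / s - 1 / s) = cp * s powr \<alpha>"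
    proof -
      have "(2 / s) powr (- 1 - \<alpha>) = 2 powr (- 1 - \<alpha>) * s powr (1 + \<alpha>)"
        using s powr_one_over[of s "- 1 - \<alpha>"] powr_mult[of 2 "1 / s" "- 1 - \<alpha>"] by (simp add: add.commute)
      moreover have "s powr (1 + \<alpha>) = s * s powr \<alpha>" using s by (simp add: powr_add)
      moreover have "2 / s - 1 / s = 1 / s" by (simp add: diff_divide_distrib[symmetric])
      ultimately show ?thesis using s by (simp add: cp_def)
    qed
    finally show ?thesis .
  qed
  have large_zero: "ennreal (exp (-1) * ln s) + ennreal m2 \<le> radial_levy_integral p \<alpha> s" if s: "1 < s" and a0: "\<alpha> = 0" for s
  proof -
    have "(\<integral>\<^sup>+t. ennreal (1 / t) * indicator {1 / s..1} t \<partial>lborel) = ennreal (ln 1 - ln (1 / s))"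
      using s by (intro nn_integral_one_over) (auto simp: divide_le_eq)
    then have i: "(\<integral>\<^sup>+t. ennreal (1 / t) * indicator {1 / s..1} t \<partial>lborel) = ennreal (ln s)" using s by (simp add: ln_div)
    have "ennreal (exp (-1) * ln s) = ennreal (exp (-1)) * ennreal (ln s)" using s by (intro ennreal_mult) auto
    also have "\<dots> = (\<integral>\<^sup>+t. ennreal (exp (-1)) * (ennreal (1 / t) * indicator {1 / s..1} t) \<partial>lborel)"
      unfolding i[symmetric] by (rule nn_integral_cmult[symmetric]) measurable
    also have "\<dots> \<le> (\<integral>\<^sup>+t. ennreal (min ((t * s)\<^sup>2) 1) * ennreal (w t) * indicator {0<..1} t \<partial>lborel)"
    proof (rule nn_integral_mono)
      fix t :: real
      show "ennreal (exp (-1)) * (ennreal (1 / t) * indicator {1 / s..1} t) \<le> ennreal (min ((t * s)\<^sup>2) 1) * ennreal (w t) * indicator {0<..1} t"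
      proof (cases "t \<in> {1 / s..1}")
        case True
        then have t12: "1 / s \<le> t" "t \<le> 1" by auto
        have "0 < 1 / s" using s by simp
        then have t: "0 < t" "t \<le> 1" "1 \<le> t * s" using t12 s by (linarith, simp, simp add: divide_le_eq)
        have "t powr p \<le> 1 powr p" using t p by (intro powr_mono2) auto
        then have "exp (-1) * (1 / t) \<le> w t" using t a0 by (simp add: w_def powr_minus_divide divide_right_mono)
        then show ?thesis using True t one_le_power[OF t(3), of 2] by (simp add: ennreal_mult[symmetric] ennreal_leI)
      qed simp
    qed
    finally have "ennreal (exp (-1) * ln s) + ennreal m2 \<le>
      (\<integral>\<^sup>+t. ennreal (min ((t * s)\<^sup>2) 1) * ennreal (w t) * indicator {0<..1} t \<partial>lborel) +
      (\<integral>\<^sup>+t. ennreal (min ((t * s)\<^sup>2) 1) * ennreal (w t) * indicator {1<..} t \<partial>lborel)"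
      using large0[OF s] by (intro add_mono)
    also have "\<dots> = (\<integral>\<^sup>+t. ennreal (min ((t * s)\<^sup>2) 1) * ennreal (w t) * indicator {0<..1} t + ennreal (min ((t * s)\<^sup>2) 1) * ennreal (w t) * indicator {1<..} t \<partial>lborel)"
      by (rule nn_integral_add[symmetric]) (simp_all add: w_def)
    also have "\<dots> = radial_levy_integral p \<alpha> s"
      unfolding g by (intro nn_integral_cong) (auto simp: indicator_def)
    finally show ?thesis .
  qed
  define c where "c = min (m1 / 8) (min m2 (min cp (exp (-1))))"
  have c: "0 < c" "c \<le> m1 / 8" "c \<le> m2" "c \<le> cp" "c \<le> exp (-1)"
    using m1 m2 by (auto simp: c_def cp_def)
  have "ennreal (c * levy_weight \<alpha> s) \<le> radial_levy_integral p \<alpha> s" if s: "0 < s" for s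
  proof (cases "s \<le> 1")
    case True
    have "ennreal (c * levy_weight \<alpha> s) \<le> ennreal (m1 / 8 * s\<^sup>2)"
      unfolding levy_weight_small[OF \<alpha> s True] by (intro ennreal_leI mult_right_mono c) simp
    then show ?thesis using small[OF s True] by (rule order_trans)
  next
    case False
    then have s1: "1 < s" by simp
    consider "0 < \<alpha>" | "\<alpha> = 0" | "\<alpha> < 0" by linarith
    then show ?thesis
    proof cases
      case 1
      then have "ennreal (c * levy_weight \<alpha> s) \<le> ennreal (cp * s powr \<alpha>)"
        using c levy_weight_large[OF \<alpha> s1] by (intro ennreal_leI) (simp add: mult_right_mono)
      then show ?thesis using large_pos[OF s1 1] by (rule order_trans)
    next
      case 2
      have "c * ln s \<le> exp (-1) * ln s" using c s1 by (intro mult_right_mono) auto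
      then have "ennreal (c * levy_weight \<alpha> s) \<le> ennreal (exp (-1) * ln s + m2)"
        using c levy_weight_large[OF \<alpha> s1] 2 by (intro ennreal_leI) (simp add: distrib_left)
      also have "\<dots> = ennreal (exp (-1) * ln s) + ennreal m2" using s1 m2 by (intro ennreal_plus) auto
      finally show ?thesis using large_zero[OF s1 2] by (rule order_trans)
    next
      case 3
      then have "ennreal (c * levy_weight \<alpha> s) \<le> ennreal m2"
        using c levy_weight_large[OF \<alpha> s1] by (intro ennreal_leI) simp
      then show ?thesis using large0'[OF s1] by (rule order_trans)
    qed
  qed
  then show ?thesis using c(1) by blast
qed


lemma nn_integral_powr_from_0:
  assumes "-1 < (b::real)" "0 \<le> a"
  shows "(\<integral>\<^sup>+t. ennreal (t powr b) * indicator {0..a} t \<partial>lborel) = ennreal (a powr (b + 1) / (b + 1))"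
  by (rule nn_integral_has_integral_lebesgue'[OF _ has_integral_powr_from_0[OF assms]]) simp

lemma nn_integral_powr_to_inf:
  assumes "(b::real) < -1" "0 < a"
  shows "(\<integral>\<^sup>+t. ennreal (t powr b) * indicator {a..} t \<partial>lborel) = ennreal (- (a powr (b + 1)) / (b + 1))"
  by (rule nn_integral_has_integral_lebesgue'[OF _ has_integral_powr_to_inf[OF assms]]) simp

lemma ennreal_finite_bound: "(x::ennreal) < \<top> \<Longrightarrow> \<exists>C\<ge>0. x \<le> ennreal C"
  by (metis ennreal_enn2real enn2real_nonneg order_refl)

text \<open>
  Bounding the truncation by \<open>(t * s)\<^sup>2\<close> throughout gives \<open>s\<^sup>2\<close>, which suffices for \<open>s \<le> 1\<close>. For \<open>s > 1\<close> the integral is split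
  at \<open>1 / s\<close>: below, the quadratic bound integrates to \<open>s powr \<alpha> / (2 - \<alpha>)\<close>; above, the truncation is at most 1 and what remains is a power
  integral, a logarithm or a constant according to the sign of \<open>\<alpha>\<close>.
\<close>

lemma radial_levy_integral_upper:
  assumes p: "0 < p" and \<alpha>: "\<alpha> < 2"
  shows "\<exists>C\<ge>0. \<forall>s>0. radial_levy_integral p \<alpha> s \<le> ennreal (C * levy_weight \<alpha> s)"
proof -
  have split: "radial_levy_integral p \<alpha> s \<le> (\<integral>\<^sup>+t. f t \<partial>lborel)"
    if "\<And>t. 0 < t \<Longrightarrow> ennreal (min ((t * s)\<^sup>2) 1 * (t powr (- 1 - \<alpha>) * exp (- (t powr p)))) \<le> f t" for f s
    unfolding radial_levy_integral_def
    using that by (intro nn_integral_mono) (auto simp: indicator_def ennreal_mult[symmetric])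
  obtain C1 where C1: "0 \<le> C1" "(\<integral>\<^sup>+t\<in>{0<..}. ennreal (t powr (1 - \<alpha>) * exp (- (t powr p))) \<partial>lborel) \<le> ennreal C1"
    using ennreal_finite_bound[OF nn_integral_powr_exp_finite[OF p, of "1 - \<alpha>"]] \<alpha> by auto
  have sq: "(t * s)\<^sup>2 * t powr (- 1 - \<alpha>) = s\<^sup>2 * t powr (1 - \<alpha>)" if "0 < t" for t s :: real
  proof -
    have "t\<^sup>2 * t powr (- 1 - \<alpha>) = t powr 2 * t powr (- 1 - \<alpha>)" using that by simp
    also have "\<dots> = t powr (1 - \<alpha>)" unfolding powr_add[symmetric] by simp
    finally show ?thesis by (simp add: power_mult_distrib mult_ac)
  qed
  have small: "radial_levy_integral p \<alpha> s \<le> ennreal (C1 * s\<^sup>2)" for s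
  proof -
    have "radial_levy_integral p \<alpha> s \<le> (\<integral>\<^sup>+t. ennreal (s\<^sup>2) * (ennreal (t powr (1 - \<alpha>) * exp (- (t powr p))) * indicator {0<..} t) \<partial>lborel)"
    proof (rule split)
      fix t :: real assume t: "0 < t"
      have "min ((t * s)\<^sup>2) 1 * (t powr (- 1 - \<alpha>) * exp (- (t powr p))) \<le> (t * s)\<^sup>2 * (t powr (- 1 - \<alpha>) * exp (- (t powr p)))"
        by (intro mult_right_mono) auto
      also have "\<dots> = s\<^sup>2 * (t powr (1 - \<alpha>) * exp (- (t powr p)))" using sq[OF t, of s] by (simp add: mult.assoc[symmetric])
      finally show "ennreal (min ((t * s)\<^sup>2) 1 * (t powr (- 1 - \<alpha>) * exp (- (t powr p)))) \<le>
        ennreal (s\<^sup>2) * (ennreal (t powr (1 - \<alpha>) * exp (- (t powr p))) * indicator {0<..} t)"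
        using t by (simp add: ennreal_mult[symmetric] ennreal_leI)
    qed
    also have "\<dots> \<le> ennreal (s\<^sup>2) * ennreal C1" using C1(2) by (subst nn_integral_cmult) (auto intro!: mult_left_mono)
    also have "\<dots> = ennreal (C1 * s\<^sup>2)" using C1 by (simp add: ennreal_mult[symmetric] mult.commute)
    finally show ?thesis .
  qed
  have head: "(\<integral>\<^sup>+t. ennreal (s\<^sup>2) * (ennreal (t powr (1 - \<alpha>)) * indicator {0..1 / s} t) \<partial>lborel) = ennreal (s powr \<alpha> / (2 - \<alpha>))"
    if s: "1 < s" for s
  proof -
    have "s\<^sup>2 * ((1 / s) powr (2 - \<alpha>) / (2 - \<alpha>)) = s powr \<alpha> / (2 - \<alpha>)"
    proof -
      have "s\<^sup>2 * (1 / s) powr (2 - \<alpha>) = s powr 2 * s powr (- (2 - \<alpha>))" using s by (simp add: powr_one_over)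
      also have "\<dots> = s powr \<alpha>" unfolding powr_add[symmetric] by simp
      finally show ?thesis by simp
    qed
    then show ?thesis using s \<alpha> by (subst nn_integral_cmult, simp, subst nn_integral_powr_from_0) (auto simp: ennreal_mult[symmetric])
  qed
  have head_le: "ennreal (min ((t * s)\<^sup>2) 1 * (t powr (- 1 - \<alpha>) * exp (- (t powr p)))) \<le> ennreal (s\<^sup>2) * (ennreal (t powr (1 - \<alpha>)) * indicator {0..1 / s} t)"
    if "0 < t" "t \<le> 1 / s" for t s
  proof -
    have "min ((t * s)\<^sup>2) 1 * (t powr (- 1 - \<alpha>) * exp (- (t powr p))) \<le> (t * s)\<^sup>2 * (t powr (- 1 - \<alpha>) * 1)"
      by (intro mult_mono) auto
    also have "\<dots> = s\<^sup>2 * t powr (1 - \<alpha>)" using sq[OF that(1), of s] by simp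
    finally show ?thesis using that by (simp add: ennreal_mult[symmetric] ennreal_leI)
  qed
  have tail_le: "min ((t * s)\<^sup>2) 1 * (t powr (- 1 - \<alpha>) * exp (- (t powr p))) \<le> t powr (- 1 - \<alpha>) * exp (- (t powr p))" for t s
    using mult_right_mono[of "min ((t * s)\<^sup>2) 1" 1 "t powr (- 1 - \<alpha>) * exp (- (t powr p))"] by simp
  have "\<exists>C2\<ge>0. \<forall>s>1. radial_levy_integral p \<alpha> s \<le> ennreal (C2 * levy_weight \<alpha> s)"
  proof -
    consider "0 < \<alpha>" | "\<alpha> = 0" | "\<alpha> < 0" by linarith
    then show ?thesis
    proof cases
      case 1
      have "radial_levy_integral p \<alpha> s \<le> ennreal ((1 / (2 - \<alpha>) + 1 / \<alpha>) * levy_weight \<alpha> s)" if s: "1 < s" for s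
      proof -
        have "radial_levy_integral p \<alpha> s \<le> (\<integral>\<^sup>+t. ennreal (s\<^sup>2) * (ennreal (t powr (1 - \<alpha>)) * indicator {0..1 / s} t) +
            ennreal (t powr (- 1 - \<alpha>)) * indicator {1 / s..} t \<partial>lborel)"
        proof (rule split)
          fix t :: real assume t: "0 < t"
          show "ennreal (min ((t * s)\<^sup>2) 1 * (t powr (- 1 - \<alpha>) * exp (- (t powr p)))) \<le>
            ennreal (s\<^sup>2) * (ennreal (t powr (1 - \<alpha>)) * indicator {0..1 / s} t) + ennreal (t powr (- 1 - \<alpha>)) * indicator {1 / s..} t"
          proof (cases "t \<le> 1 / s")
            case True
            show ?thesis by (rule add_increasing2[OF _ head_le[OF t True]]) simp
          next
            case False
            have "t powr (- 1 - \<alpha>) * exp (- (t powr p)) \<le> t powr (- 1 - \<alpha>) * 1" by (intro mult_left_mono) auto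
            then have "ennreal (min ((t * s)\<^sup>2) 1 * (t powr (- 1 - \<alpha>) * exp (- (t powr p)))) \<le> ennreal (t powr (- 1 - \<alpha>))"
              using order_trans[OF tail_le] by (intro ennreal_leI) simp
            then show ?thesis using False by (intro add_increasing) (auto simp: indicator_def)
          qed
        qed
        also have "\<dots> = ennreal (s powr \<alpha> / (2 - \<alpha>)) + ennreal (- ((1 / s) powr (- 1 - \<alpha> + 1)) / (- 1 - \<alpha> + 1))"
          using 1 s head[OF s] by (subst nn_integral_add) (auto simp: nn_integral_powr_to_inf)
        also have "- ((1 / s) powr (- 1 - \<alpha> + 1)) / (- 1 - \<alpha> + 1) = s powr \<alpha> / \<alpha>"
          using s 1 by (simp add: powr_one_over)
        also have "ennreal (s powr \<alpha> / (2 - \<alpha>)) + ennreal (s powr \<alpha> / \<alpha>) = ennreal ((1 / (2 - \<alpha>) + 1 / \<alpha>) * levy_weight \<alpha> s)"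
          using 1 \<alpha> levy_weight_large[OF \<alpha> s] by (subst ennreal_plus[symmetric]) (auto simp: distrib_right)
        finally show ?thesis .
      qed
      then show ?thesis using 1 \<alpha> by (intro exI[of _ "1 / (2 - \<alpha>) + 1 / \<alpha>"]) auto
    next
      case 2
      have "radial_levy_integral p \<alpha> s \<le> ennreal ((1 + C1) * levy_weight \<alpha> s)" if s: "1 < s" for s
      proof -
        have log: "(\<integral>\<^sup>+t. ennreal (1 / t) * indicator {1 / s..1} t \<partial>lborel) = ennreal (ln s)"
        proof -
          have "(\<integral>\<^sup>+t. ennreal (1 / t) * indicator {1 / s..1} t \<partial>lborel) = ennreal (ln 1 - ln (1 / s))"
            using s by (intro nn_integral_one_over) (auto simp: divide_le_eq)
          then show ?thesis using s by (simp add: ln_div)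
        qed
        have "radial_levy_integral p \<alpha> s \<le> (\<integral>\<^sup>+t. ennreal (s\<^sup>2) * (ennreal (t powr (1 - \<alpha>)) * indicator {0..1 / s} t) +
            (ennreal (1 / t) * indicator {1 / s..1} t + ennreal (t powr (1 - \<alpha>) * exp (- (t powr p))) * indicator {0<..} t) \<partial>lborel)"
        proof (rule split)
          fix t :: real assume t: "0 < t"
          show "ennreal (min ((t * s)\<^sup>2) 1 * (t powr (- 1 - \<alpha>) * exp (- (t powr p)))) \<le>
            ennreal (s\<^sup>2) * (ennreal (t powr (1 - \<alpha>)) * indicator {0..1 / s} t) +
            (ennreal (1 / t) * indicator {1 / s..1} t + ennreal (t powr (1 - \<alpha>) * exp (- (t powr p))) * indicator {0<..} t)"
          proof (cases "t \<le> 1 / s")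
            case True
            show ?thesis by (rule add_increasing2[OF _ head_le[OF t True]]) simp
          next
            case False
            show ?thesis
            proof (cases "t \<le> 1")
              case True
              have "t powr (- 1 - \<alpha>) * exp (- (t powr p)) \<le> t powr (- 1 - \<alpha>) * 1" by (intro mult_left_mono) auto
              also have "\<dots> = 1 / t" using t 2 by (simp add: powr_minus_divide)
              finally have "ennreal (min ((t * s)\<^sup>2) 1 * (t powr (- 1 - \<alpha>) * exp (- (t powr p)))) \<le> ennreal (1 / t)"
                using order_trans[OF tail_le] by (intro ennreal_leI) simp
              then show ?thesis using False True by (intro add_increasing add_increasing2) (auto simp: indicator_def)
            next
              case False2: False
              have "t powr (- 1 - \<alpha>) \<le> t powr (1 - \<alpha>)" using False2 by (intro powr_mono) auto
              then have "t powr (- 1 - \<alpha>) * exp (- (t powr p)) \<le> t powr (1 - \<alpha>) * exp (- (t powr p))" by (intro mult_right_mono) auto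
              then have "ennreal (min ((t * s)\<^sup>2) 1 * (t powr (- 1 - \<alpha>) * exp (- (t powr p)))) \<le> ennreal (t powr (1 - \<alpha>) * exp (- (t powr p)))"
                using order_trans[OF tail_le] by (intro ennreal_leI) simp
              then show ?thesis using t by (intro add_increasing) (auto simp: indicator_def)
            qed
          qed
        qed
        also have "\<dots> \<le> ennreal (s powr \<alpha> / (2 - \<alpha>)) + (ennreal (ln s) + ennreal C1)"
          using head[OF s] log C1(2) by (subst nn_integral_add, simp, simp, subst nn_integral_add) (auto intro!: add_mono)
        also have "\<dots> = ennreal (1 / 2 + (ln s + C1))"
        proof -
          have "s powr \<alpha> / (2 - \<alpha>) = 1 / 2" using s 2 by simp
          moreover have "ennreal (ln s) + ennreal C1 = ennreal (ln s + C1)" using s C1 by (intro ennreal_plus[symmetric]) auto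
          moreover have "ennreal (1 / 2) + ennreal (ln s + C1) = ennreal (1 / 2 + (ln s + C1))"
            using s C1 by (intro ennreal_plus[symmetric]) auto
          ultimately show ?thesis by (simp only:)
        qed
        also have "\<dots> \<le> ennreal ((1 + C1) * levy_weight \<alpha> s)"
        proof (rule ennreal_leI)
          have "0 \<le> C1 * ln s" using C1 s by simp
          then show "1 / 2 + (ln s + C1) \<le> (1 + C1) * levy_weight \<alpha> s"
            using levy_weight_large[OF \<alpha> s] 2 by (simp add: algebra_simps)
        qed
        finally show ?thesis .
      qed
      then show ?thesis using C1 by (intro exI[of _ "1 + C1"]) auto
    next
      case 3
      obtain C0 where C0: "0 \<le> C0" "(\<integral>\<^sup>+t\<in>{0<..}. ennreal (t powr (- 1 - \<alpha>) * exp (- (t powr p))) \<partial>lborel) \<le> ennreal C0"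
        using ennreal_finite_bound[OF nn_integral_powr_exp_finite[OF p, of "- 1 - \<alpha>"]] 3 by auto
      have "radial_levy_integral p \<alpha> s \<le> ennreal (C0 * levy_weight \<alpha> s)" if s: "1 < s" for s
      proof -
        have "radial_levy_integral p \<alpha> s \<le> (\<integral>\<^sup>+t\<in>{0<..}. ennreal (t powr (- 1 - \<alpha>) * exp (- (t powr p))) \<partial>lborel)"
          using tail_le by (intro split) (auto simp: ennreal_leI)
        also have "\<dots> \<le> ennreal C0" by (rule C0)
        finally show ?thesis using levy_weight_large[OF \<alpha> s] 3 by simp
      qed
      then show ?thesis using C0 by blast
    qed
  qed
  then obtain C2 where C2: "0 \<le> C2" "\<And>s. 1 < s \<Longrightarrow> radial_levy_integral p \<alpha> s \<le> ennreal (C2 * levy_weight \<alpha> s)" by blast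
  have "radial_levy_integral p \<alpha> s \<le> ennreal (max C1 C2 * levy_weight \<alpha> s)" if s: "0 < s" for s
  proof (cases "s \<le> 1")
    case True
    have "ennreal (C1 * s\<^sup>2) \<le> ennreal (max C1 C2 * levy_weight \<alpha> s)"
      unfolding levy_weight_small[OF \<alpha> s True] by (intro ennreal_leI mult_right_mono) auto
    then show ?thesis using small[of s] by (rule order_trans[rotated])
  next
    case False
    have "ennreal (C2 * levy_weight \<alpha> s) \<le> ennreal (max C1 C2 * levy_weight \<alpha> s)"
      by (intro ennreal_leI mult_right_mono levy_weight_nonneg) auto
    then show ?thesis using C2(2)[of s] False by (intro order_trans[OF C2(2)]) auto
  qed
  then show ?thesis using C1 by (intro exI[of _ "max C1 C2"]) auto
qed

text \<open>
  Near 0 the integrand is at least a multiple of \<open>1 / t\<close>.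
\<close>

lemma radial_levy_integral_infinite:
  assumes p: "0 < p" and \<alpha>: "2 \<le> \<alpha>" and s: "0 < s"
  shows "radial_levy_integral p \<alpha> s = \<infinity>"
proof -
  define d where "d = min 1 (1 / s)"
  have d: "0 < d" "d \<le> 1" "d \<le> 1 / s" using s by (auto simp: d_def)
  define c where "c = s\<^sup>2 * exp (-1)"
  have c: "0 < c" using s by (simp add: c_def)
  have lower: "ennreal (c * (ln d - ln e)) \<le> radial_levy_integral p \<alpha> s" if e: "0 < e" "e \<le> d" for e
  proof -
    have i: "(\<integral>\<^sup>+t. ennreal (1 / t) * indicator {e..d} t \<partial>lborel) = ennreal (ln d - ln e)"
      using e by (intro nn_integral_one_over) (auto simp: divide_le_eq)
    have "ennreal (c * (ln d - ln e)) = (\<integral>\<^sup>+t. ennreal c * (ennreal (1 / t) * indicator {e..d} t) \<partial>lborel)"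
      using c e by (subst nn_integral_cmult) (auto simp: i ennreal_mult)
    also have "\<dots> \<le> radial_levy_integral p \<alpha> s"
      unfolding radial_levy_integral_def
    proof (rule nn_integral_mono)
      fix t :: real
      show "ennreal c * (ennreal (1 / t) * indicator {e..d} t) \<le>
        ennreal (min ((t * s)\<^sup>2) 1) * ennreal (t powr (- 1 - \<alpha>) * exp (- (t powr p))) * indicator {0<..} t"
      proof (cases "t \<in> {e..d}")
        case True
        then have t: "0 < t" "t \<le> 1" "t \<le> 1 / s" using e d by auto
        have "t * s \<le> 1" using t s by (simp add: le_divide_eq)
        then have m: "min ((t * s)\<^sup>2) 1 = (t * s)\<^sup>2" using t s by (simp add: power_le_one)
        have "t powr p \<le> 1 powr p" using t p by (intro powr_mono2) auto
        moreover have "t powr (-3) \<le> t powr (- 1 - \<alpha>)" using t \<alpha> by (intro powr_mono') auto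
        ultimately have "t powr (-3) * exp (-1) \<le> t powr (- 1 - \<alpha>) * exp (- (t powr p))" by (intro mult_mono) auto
        then have "(t * s)\<^sup>2 * (t powr (-3) * exp (-1)) \<le> (t * s)\<^sup>2 * (t powr (- 1 - \<alpha>) * exp (- (t powr p)))"
          by (intro mult_left_mono) auto
        moreover have "(t * s)\<^sup>2 * (t powr (-3) * exp (-1)) = c * (1 / t)"
        proof -
          have "t\<^sup>2 * t powr (-3) = t powr 2 * t powr (-3)" using t by simp
          also have "\<dots> = t powr (-1)" unfolding powr_add[symmetric] by simp
          also have "\<dots> = 1 / t" using t by (simp add: powr_minus_divide)
          finally show ?thesis by (simp add: c_def power_mult_distrib mult_ac)
        qed
        ultimately show ?thesis using True t c unfolding m by (simp add: ennreal_mult[symmetric] ennreal_leI)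
      qed simp
    qed
    finally show ?thesis .
  qed
  have "ennreal K \<le> radial_levy_integral p \<alpha> s" if "0 \<le> K" for K
  proof -
    have "ennreal (c * (ln d - ln (d * exp (- (K / c))))) \<le> radial_levy_integral p \<alpha> s"
      using that c d by (intro lower) auto
    moreover have "c * (ln d - ln (d * exp (- (K / c)))) = K" using c d by (simp add: ln_mult)
    ultimately show ?thesis by simp
  qed
  note big = this
  show ?thesis
  proof (rule ccontr)
    assume "radial_levy_integral p \<alpha> s \<noteq> \<infinity>"
    then obtain C where "0 \<le> C" "radial_levy_integral p \<alpha> s \<le> ennreal C"
      using ennreal_finite_bound[of "radial_levy_integral p \<alpha> s"] by (auto simp: less_top)
    moreover from this have "ennreal (C + 1) \<le> ennreal C" by (intro order_trans[OF big]) auto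
    ultimately show False by (subst (asm) ennreal_le_iff) auto
  qed
qed


lemma levy_mixture_functional:
  assumes sR: "sets R = sets (borel :: 'a::euclidean_space measure)"
  shows "positive_functional borel (\<lambda>f. \<integral>\<^sup>+x. (\<integral>\<^sup>+t\<in>{0<..}. f (t *\<^sub>R x) * ennreal (t powr (- 1 - \<alpha>) * exp (- (t powr p))) \<partial>lborel) \<partial>R)"
proof (rule positive_functional_integral)
  note [measurable_cong] = sR
  fix x :: 'a
  have "positive_functional borel (\<lambda>f. \<integral>\<^sup>+t. f (t *\<^sub>R x) * (ennreal (t powr (- 1 - \<alpha>) * exp (- (t powr p))) * indicator {0<..} t) \<partial>lborel)"
    by (rule positive_functional_weighted_integral) measurable
  then show "positive_functional borel (\<lambda>f. \<integral>\<^sup>+t\<in>{0<..}. f (t *\<^sub>R x) * ennreal (t powr (- 1 - \<alpha>) * exp (- (t powr p))) \<partial>lborel)"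
    by (simp add: mult.assoc)
next
  note [measurable_cong] = sR
  fix f :: "'a \<Rightarrow> ennreal" assume [measurable]: "f \<in> borel_measurable borel"
  show "(\<lambda>x. \<integral>\<^sup>+t\<in>{0<..}. f (t *\<^sub>R x) * ennreal (t powr (- 1 - \<alpha>) * exp (- (t powr p))) \<partial>lborel) \<in> borel_measurable R"
    by measurable
qed

lemma levy_mixture_measure_exists:
  assumes "sets R = sets (borel :: 'a::euclidean_space measure)"
  shows "\<exists>M. sets M = sets borel \<and> (\<forall>A\<in>sets borel. emeasure M A = levy_mixture p \<alpha> R A)"
  using measure_from_functional[OF levy_mixture_functional[OF assms, of \<alpha> p]] by (simp add: levy_mixture_def)

lemma nn_integral_levy_mixture:
  fixes R M :: "'a::euclidean_space measure"
  assumes sR: "sets R = sets borel" and sM: "sets M = sets borel"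
    and M: "\<And>A. A \<in> sets borel \<Longrightarrow> emeasure M A = levy_mixture p \<alpha> R A" and f: "f \<in> borel_measurable borel"
  shows "(\<integral>\<^sup>+x. f x \<partial>M) = (\<integral>\<^sup>+x. (\<integral>\<^sup>+t\<in>{0<..}. f (t *\<^sub>R x) * ennreal (t powr (- 1 - \<alpha>) * exp (- (t powr p))) \<partial>lborel) \<partial>R)"
proof (rule nn_integral_eq_functional[where I="\<lambda>f. \<integral>\<^sup>+x. (\<integral>\<^sup>+t\<in>{0<..}. f (t *\<^sub>R x) * ennreal (t powr (- 1 - \<alpha>) * exp (- (t powr p))) \<partial>lborel) \<partial>R"])
  show "positive_functional M (\<lambda>f. \<integral>\<^sup>+x. (\<integral>\<^sup>+t\<in>{0<..}. f (t *\<^sub>R x) * ennreal (t powr (- 1 - \<alpha>) * exp (- (t powr p))) \<partial>lborel) \<partial>R)"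
    using levy_mixture_functional[OF sR, of \<alpha> p] unfolding positive_functional_def measurable_cong_sets[OF sM refl] .
qed (use M sM f in \<open>auto simp: levy_mixture_def sets_eq_imp_space_eq[OF sM] cong: measurable_cong_sets\<close>)

lemma radial_levy_integral_measurable[measurable]: "radial_levy_integral p \<alpha> \<in> borel_measurable borel"
  unfolding radial_levy_integral_def[abs_def] by measurable

lemma radial_levy_integral_zero: "radial_levy_integral p \<alpha> 0 = 0"
  by (simp add: radial_levy_integral_def)

lemma levy_weight_zero: "levy_weight \<alpha> 0 = 0"
  by (simp add: levy_weight_def)

context
  fixes p \<alpha> :: real and R M :: "'a::euclidean_space measure"
  assumes p: "0 < p" and sR: "sets R = sets borel" and sM: "sets M = sets borel"
    and M: "\<And>A. A \<in> sets borel \<Longrightarrow> emeasure M A = levy_mixture p \<alpha> R A"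
begin

lemma levy_mixture_truncated_moment:
  "(\<integral>\<^sup>+x. ennreal (min ((norm x)\<^sup>2) 1) \<partial>M) = (\<integral>\<^sup>+x. radial_levy_integral p \<alpha> (norm x) \<partial>R)"
proof -
  have "(\<integral>\<^sup>+x. ennreal (min ((norm x)\<^sup>2) 1) \<partial>M) =
    (\<integral>\<^sup>+x. (\<integral>\<^sup>+t\<in>{0<..}. ennreal (min ((norm (t *\<^sub>R x))\<^sup>2) 1) * ennreal (t powr (- 1 - \<alpha>) * exp (- (t powr p))) \<partial>lborel) \<partial>R)"
    by (rule nn_integral_levy_mixture[OF sR sM]) (simp_all add: M)
  then show ?thesis by (simp add: radial_levy_integral_def power_mult_distrib)
qed

text \<open>
  A ray starting at a nonzero point does not meet the origin, so only the mass of \<open>R\<close> at the origin contributes, with a factor that may be infinite but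
  is not 0.
\<close>

lemma levy_mixture_origin: "emeasure M {0} = 0 \<longleftrightarrow> emeasure R {0} = 0"
proof -
  define K where "K = (\<integral>\<^sup>+t\<in>{0<..}. ennreal (t powr (- 1 - \<alpha>) * exp (- (t powr p))) \<partial>lborel)"
  have "emeasure M {0} = (\<integral>\<^sup>+x. K * indicator {0} x \<partial>R)"
    unfolding M[OF borel_singleton[OF sets.empty_sets]] levy_mixture_def
  proof (rule nn_integral_cong)
    fix x :: 'a
    have "(\<integral>\<^sup>+t\<in>{0<..}. indicator {0} (t *\<^sub>R x) * ennreal (t powr (- 1 - \<alpha>) * exp (- (t powr p))) \<partial>lborel) =
      (\<integral>\<^sup>+t. (ennreal (t powr (- 1 - \<alpha>) * exp (- (t powr p))) * indicator {0<..} t) * indicator {0} x \<partial>lborel)"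
      by (intro nn_integral_cong) (auto simp: indicator_def)
    also have "\<dots> = K * indicator {0} x" unfolding K_def by (rule nn_integral_multc) measurable
    finally show "(\<integral>\<^sup>+t\<in>{0<..}. indicator {0} (t *\<^sub>R x) * ennreal (t powr (- 1 - \<alpha>) * exp (- (t powr p))) \<partial>lborel) = K * indicator {0} x" .
  qed
  also have "\<dots> = K * emeasure R {0}" by (rule nn_integral_cmult_indicator) (simp add: sR)
  finally have e: "emeasure M {0} = K * emeasure R {0}" .
  obtain m where m: "0 < m" "\<And>t. t \<in> {1..2} \<Longrightarrow> m \<le> t powr (- 1 - \<alpha>) * exp (- (t powr p))"
    using radial_density_lower[of 1 2 p \<alpha>] p by auto
  have "ennreal (m * (2 - 1)) \<le> K" unfolding K_def
    by (rule nn_integral_Icc_ge) (use m in \<open>auto simp: indicator_def ennreal_leI\<close>)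
  then have "K \<noteq> 0" using m by (auto simp: ennreal_eq_0_iff)
  then show ?thesis unfolding e by simp
qed

text \<open>
  The truncated second moment of \<open>M\<close> is the integral of \<open>radial_levy_integral\<close> over \<open>R\<close>, which the preceding bounds compare with the weight. For
  \<open>2 \<le> \<alpha>\<close> the integrand is infinite off the origin, which leaves the zero measure only.
\<close>

lemma levy_mixture_levy_iff:
  "levy_measure M \<longleftrightarrow> R = null_measure borel \<or> integrability_conditions \<alpha> R"
proof -
  note [measurable_cong] = sR
  have levy: "levy_measure M \<longleftrightarrow> emeasure R {0} = 0 \<and> (\<integral>\<^sup>+x. radial_levy_integral p \<alpha> (norm x) \<partial>R) < \<infinity>"
    unfolding levy_measure_def levy_mixture_origin levy_mixture_truncated_moment using sM by simp
  show ?thesis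
  proof (cases "\<alpha> < 2")
    case True
    obtain c where c: "0 < c" "\<And>s. 0 < s \<Longrightarrow> ennreal (c * levy_weight \<alpha> s) \<le> radial_levy_integral p \<alpha> s"
      using radial_levy_integral_lower[OF p True] by blast
    obtain C where C: "0 \<le> C" "\<And>s. 0 < s \<Longrightarrow> radial_levy_integral p \<alpha> s \<le> ennreal (C * levy_weight \<alpha> s)"
      using radial_levy_integral_upper[OF p True] by blast
    have mult: "(\<integral>\<^sup>+x. ennreal (k * levy_weight \<alpha> (norm x)) \<partial>R) = ennreal k * (\<integral>\<^sup>+x. ennreal (levy_weight \<alpha> (norm x)) \<partial>R)"
      if "0 \<le> k" for k
      using that by (subst nn_integral_cmult[symmetric]) (auto simp: ennreal_mult levy_weight_nonneg)
    have lo: "ennreal c * (\<integral>\<^sup>+x. ennreal (levy_weight \<alpha> (norm x)) \<partial>R) \<le> (\<integral>\<^sup>+x. radial_levy_integral p \<alpha> (norm x) \<partial>R)"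
      unfolding mult[OF less_imp_le[OF c(1)], symmetric]
    proof (rule nn_integral_mono)
      fix x :: 'a show "ennreal (c * levy_weight \<alpha> (norm x)) \<le> radial_levy_integral p \<alpha> (norm x)"
        using c(2)[of "norm x"] by (cases "x = 0") (auto simp: levy_weight_zero)
    qed
    have up: "(\<integral>\<^sup>+x. radial_levy_integral p \<alpha> (norm x) \<partial>R) \<le> ennreal C * (\<integral>\<^sup>+x. ennreal (levy_weight \<alpha> (norm x)) \<partial>R)"
      unfolding mult[OF C(1), symmetric]
    proof (rule nn_integral_mono)
      fix x :: 'a show "radial_levy_integral p \<alpha> (norm x) \<le> ennreal (C * levy_weight \<alpha> (norm x))"
        using C(2)[of "norm x"] by (cases "x = 0") (auto simp: levy_weight_zero radial_levy_integral_zero)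
    qed
    have "(\<integral>\<^sup>+x. radial_levy_integral p \<alpha> (norm x) \<partial>R) < \<infinity> \<longleftrightarrow> (\<integral>\<^sup>+x. ennreal (levy_weight \<alpha> (norm x)) \<partial>R) < \<infinity>"
    proof
      assume "(\<integral>\<^sup>+x. radial_levy_integral p \<alpha> (norm x) \<partial>R) < \<infinity>"
      then have "ennreal c * (\<integral>\<^sup>+x. ennreal (levy_weight \<alpha> (norm x)) \<partial>R) < \<infinity>" using lo by (rule le_less_trans[rotated])
      then show "(\<integral>\<^sup>+x. ennreal (levy_weight \<alpha> (norm x)) \<partial>R) < \<infinity>" using c(1) by (auto simp: ennreal_mult_less_top)
    next
      assume "(\<integral>\<^sup>+x. ennreal (levy_weight \<alpha> (norm x)) \<partial>R) < \<infinity>"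
      then have "ennreal C * (\<integral>\<^sup>+x. ennreal (levy_weight \<alpha> (norm x)) \<partial>R) < \<infinity>" by (simp add: ennreal_mult_less_top)
      then show "(\<integral>\<^sup>+x. radial_levy_integral p \<alpha> (norm x) \<partial>R) < \<infinity>" using up by (rule le_less_trans[rotated])
    qed
    then have "levy_measure M \<longleftrightarrow> integrability_conditions \<alpha> R"
      unfolding levy integrability_conditions_iff using True by simp
    moreover have "integrability_conditions \<alpha> R" if "R = null_measure borel"
      using that True by (simp add: integrability_conditions_iff)
    ultimately show ?thesis by blast
  next
    case False
    have "levy_measure M" if "R = null_measure borel"
      unfolding levy using that by simp
    moreover have "R = null_measure borel" if "levy_measure M"
    proof -
      have z: "emeasure R {0} = 0" and f: "(\<integral>\<^sup>+x. radial_levy_integral p \<alpha> (norm x) \<partial>R) < \<infinity>"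
        using that unfolding levy by auto
      have "AE x in R. radial_levy_integral p \<alpha> (norm x) \<noteq> \<infinity>"
        using f by (intro nn_integral_noteq_infinite) auto
      moreover have "AE x in R. x \<noteq> 0" using z sR by (intro AE_I[of _ _ "{0}"]) auto
      ultimately have "AE x in R. False"
      proof eventually_elim
        case (elim x)
        then show ?case using radial_levy_integral_infinite[OF p, of \<alpha> "norm x"] False by simp
      qed
      then have "emeasure R (space R) = 0" using emeasure_eq_0_AE[of "\<lambda>_. True" R] by simp
      then have "emeasure R A = 0" for A using emeasure_space[of R A] by simp
      then show ?thesis using sR by (intro measure_eqI) auto
    qed
    moreover have "\<not> integrability_conditions \<alpha> R" using False by (simp add: integrability_conditions_def)
    ultimately show ?thesis by blast
  qed
qed

end

section \<open>The mixing measure is determined by the Levy measure\<close>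

lemma sigma_finite_from_integrable:
  assumes f: "f \<in> borel_measurable M" "\<And>x. x \<in> space M \<Longrightarrow> 0 < f x" "\<And>x. x \<in> space M \<Longrightarrow> f x < (\<top>::ennreal)" and fin: "(\<integral>\<^sup>+x. f x \<partial>M) < \<top>"
  shows "sigma_finite_measure M"
proof -
  define F where "F = density M f"
  have "emeasure F (space F) = (\<integral>\<^sup>+x. f x * indicator (space M) x \<partial>M)"
    unfolding F_def space_density by (rule emeasure_density[OF f(1)]) simp
  also have "\<dots> = (\<integral>\<^sup>+x. f x \<partial>M)" by (intro nn_integral_cong) simp
  finally interpret F: finite_measure F using fin by (intro finite_measureI) simp
  have m: "(\<lambda>x. 1 / f x) \<in> borel_measurable M" using f(1) by measurable
  have "density F (\<lambda>x. 1 / f x) = density M (\<lambda>x. f x * (1 / f x))"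
    unfolding F_def by (rule density_density_eq[OF f(1) m])
  also have "\<dots> = density M (\<lambda>_. 1)"
  proof (rule density_cong)
    show "AE x in M. f x * (1 / f x) = 1"
      using f(2,3) by (intro AE_I2) (simp add: ennreal_times_divide ennreal_divide_self less_imp_neq[symmetric])
  qed (use f(1) m in auto)
  finally have "M = density F (\<lambda>x. 1 / f x)" by (simp add: density_1)
  moreover have "sigma_finite_measure (density F (\<lambda>x. 1 / f x))"
  proof (subst F.sigma_finite_iff_density_finite)
    show "(\<lambda>x. 1 / f x) \<in> borel_measurable F" using m by (simp add: F_def)
    show "AE x in F. 1 / f x \<noteq> \<infinity>"
      using f(2) by (intro AE_I2) (simp add: F_def ennreal_divide_eq_top_iff less_imp_neq[symmetric])
  qed
  ultimately show ?thesis by simp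
qed

text \<open>
  A set of full measure is dense, so continuity fills in the exceptional points.
\<close>

lemma isCont_AE_zero_imp_zero:
  fixes f :: "real \<Rightarrow> real"
  assumes ae: "AE r in lborel. 0 < r \<longrightarrow> f r = 0" and cont: "\<And>r. 0 < r \<Longrightarrow> isCont f r" and r: "0 < r"
  shows "f r = 0"
proof (rule ccontr)
  assume "f r \<noteq> 0"
  then obtain d where d: "0 < d" "\<And>y. dist r y < d \<Longrightarrow> f y \<noteq> 0"
    using continuous_at_avoid[OF cont[OF r], of 0] by blast
  define e where "e = min d r"
  have e: "0 < e" "e \<le> d" "e \<le> r" using d(1) r by (auto simp: e_def)
  have "AE y in lborel. y \<notin> {r - e<..<r + e}"
    using ae
  proof eventually_elim
    case (elim y)
    show ?case
    proof
      assume "y \<in> {r - e<..<r + e}"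
      then have "r - e < y" "y < r + e" by auto
      then have "0 < y" "dist r y < d" using e by (auto simp: dist_real_def abs_less_iff)
      then show False using elim d(2) by blast
    qed
  qed
  then have "emeasure lborel {y \<in> space lborel. y \<in> {r - e<..<r + e}} = 0"
    by (rule emeasure_eq_0_AE)
  moreover have "{y \<in> space lborel. y \<in> {r - e<..<r + e}} = {r - e<..<r + e}" by auto
  ultimately have "emeasure lborel {r - e<..<r + e} = 0" by simp
  moreover have "emeasure lborel {r - e<..<r + e} = ennreal (2 * e)" using e(1) by (subst emeasure_lborel_Ioo) auto
  ultimately show False using e(1) by simp
qed

definition direction :: "'a::euclidean_space \<Rightarrow> 'a" where
  "direction x = x /\<^sub>R norm x"

lemma direction_measurable[measurable]: "direction \<in> borel_measurable borel"
  unfolding direction_def[abs_def] by measurable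

lemma direction_scaleR: "0 < t \<Longrightarrow> direction (t *\<^sub>R x) = direction x"
  by (simp add: direction_def)

lemma norm_direction: "x \<noteq> 0 \<Longrightarrow> norm (direction x) = 1"
  by (simp add: direction_def)

lemma norm_scaleR_direction: "norm x *\<^sub>R direction x = x"
  by (cases "x = 0") (simp_all add: direction_def)

text \<open>
  For large \<open>s\<close> the exponential tends to 1 and the weight dominates \<open>s powr \<alpha>\<close>; for small \<open>s\<close> the exponential decays faster than any power of \<open>s\<close>.
\<close>

lemma stable_weight_bound:
  assumes p: "0 < p" and \<alpha>: "\<alpha> < 2" and r: "0 < r"
  shows "\<exists>C\<ge>0. \<forall>s>0. s powr \<alpha> * exp (- r * s powr (- p)) \<le> C * levy_weight \<alpha> s"
proof -
  obtain k :: nat where k: "(2 - \<alpha>) / p \<le> real k" using real_arch_simple by blast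
  define C where "C = fact k * (2 / r) ^ k + 1"
  have C: "1 \<le> C" using r by (simp add: C_def)
  have "s powr \<alpha> * exp (- r * s powr (- p)) \<le> C * levy_weight \<alpha> s" if s: "0 < s" for s
  proof (cases "s \<le> 1")
    case True
    define y where "y = s powr (- p)"
    have y: "1 \<le> y" using True s p powr_mono'[of "- p" 0 s] by (simp add: y_def)
    have "s powr (\<alpha> - 2) = y powr ((2 - \<alpha>) / p)" using p s by (simp add: y_def powr_powr)
    also have "\<dots> \<le> y powr real k" using k y by (intro powr_mono) auto
    also have "\<dots> = y ^ k" using y by (simp add: powr_realpow)
    finally have "s powr (\<alpha> - 2) * exp (- r * y) \<le> y ^ k * exp (- r * y)" by (intro mult_right_mono) auto
    also have "\<dots> \<le> fact k * (2 / r) ^ k * exp (- (r / 2) * y)" using y r by (intro power_times_exp_le) auto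
    also have "\<dots> \<le> fact k * (2 / r) ^ k * 1" using y r by (intro mult_left_mono) auto
    also have "\<dots> \<le> C" by (simp add: C_def)
    finally have "s\<^sup>2 * (s powr (\<alpha> - 2) * exp (- r * y)) \<le> s\<^sup>2 * C" by (intro mult_left_mono) auto
    moreover have "s\<^sup>2 * s powr (\<alpha> - 2) = s powr \<alpha>"
    proof -
      have "s\<^sup>2 * s powr (\<alpha> - 2) = s powr 2 * s powr (\<alpha> - 2)" using s by simp
      then show ?thesis unfolding powr_add[symmetric] by simp
    qed
    ultimately show ?thesis
      using levy_weight_small[OF \<alpha> s True] by (simp add: y_def mult.assoc[symmetric] mult.commute)
  next
    case False
    then have s1: "1 < s" by simp
    have "s powr \<alpha> * exp (- r * s powr (- p)) \<le> s powr \<alpha> * 1" using r by (intro mult_left_mono) auto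
    also have "\<dots> \<le> levy_weight \<alpha> s"
      using levy_weight_large[OF \<alpha> s1] s1 powr_mono[of \<alpha> 0 s] by auto
    also have "\<dots> \<le> C * levy_weight \<alpha> s" using mult_right_mono[OF C levy_weight_nonneg[of \<alpha> s]] by simp
    finally show ?thesis .
  qed
  then show ?thesis using C by (intro exI[of _ C]) auto
qed

lemma stable_weight_integrable:
  assumes p: "0 < p" and R: "integrability_conditions \<alpha> R" and sR: "sets R = sets (borel :: 'a::euclidean_space measure)" and r: "0 < r"
  shows "(\<integral>\<^sup>+x. ennreal (norm x powr \<alpha> * exp (- r * norm x powr (- p))) \<partial>R) < \<top>"
proof -
  note [measurable_cong] = sR
  have \<alpha>: "\<alpha> < 2" and W: "(\<integral>\<^sup>+x. ennreal (levy_weight \<alpha> (norm x)) \<partial>R) < \<infinity>" using R by (auto simp: integrability_conditions_iff)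
  obtain C where C: "0 \<le> C" "\<And>s. 0 < s \<Longrightarrow> s powr \<alpha> * exp (- r * s powr (- p)) \<le> C * levy_weight \<alpha> s"
    using stable_weight_bound[OF p \<alpha> r] by blast
  have "(\<integral>\<^sup>+x. ennreal (norm x powr \<alpha> * exp (- r * norm x powr (- p))) \<partial>R) \<le> (\<integral>\<^sup>+x. ennreal C * ennreal (levy_weight \<alpha> (norm x)) \<partial>R)"
  proof (rule nn_integral_mono)
    fix x :: 'a
    show "ennreal (norm x powr \<alpha> * exp (- r * norm x powr (- p))) \<le> ennreal C * ennreal (levy_weight \<alpha> (norm x))"
      using C(2)[of "norm x"] C(1) by (cases "x = 0") (auto simp: ennreal_mult[symmetric] levy_weight_nonneg ennreal_leI)
  qed
  also have "\<dots> = ennreal C * (\<integral>\<^sup>+x. ennreal (levy_weight \<alpha> (norm x)) \<partial>R)" by (rule nn_integral_cmult) measurable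
  also have "\<dots> < \<top>" using W by (simp add: ennreal_mult_less_top)
  finally show ?thesis .
qed

text \<open>
  The part of \<open>R\<close> over the directions in \<open>A\<close>, weighted by \<open>norm x powr \<alpha>\<close> and pushed to \<open>s = norm x powr (- p)\<close>. For a polar
  disintegration of \<open>R\<close> this is the integral over \<open>A\<close> of the Bernstein measures.
\<close>

definition radial_measure :: "real \<Rightarrow> real \<Rightarrow> 'a::euclidean_space measure \<Rightarrow> 'a set \<Rightarrow> real measure" where
  "radial_measure p \<alpha> R A =
     distr (density R (\<lambda>x. ennreal (norm x powr \<alpha>) * indicator A (direction x))) borel (\<lambda>x. norm x powr (- p))"

context
  fixes p \<alpha> :: real and R :: "'a::euclidean_space measure" and A :: "'a set"
  assumes p: "0 < p" and sR: "sets R = sets borel" and A[measurable]: "A \<in> sets borel" and R: "integrability_conditions \<alpha> R"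
begin

lemma nn_integral_radial_measure:
  assumes [measurable]: "f \<in> borel_measurable borel"
  shows "(\<integral>\<^sup>+s. f s \<partial>radial_measure p \<alpha> R A) =
    (\<integral>\<^sup>+x. ennreal (norm x powr \<alpha>) * indicator A (direction x) * f (norm x powr (- p)) \<partial>R)"
proof -
  note [measurable_cong] = sR
  have "(\<integral>\<^sup>+s. f s \<partial>radial_measure p \<alpha> R A) =
    (\<integral>\<^sup>+x. f (norm x powr (- p)) \<partial>density R (\<lambda>x. ennreal (norm x powr \<alpha>) * indicator A (direction x)))"
    unfolding radial_measure_def by (rule nn_integral_distr) measurable
  also have "\<dots> = (\<integral>\<^sup>+x. ennreal (norm x powr \<alpha>) * indicator A (direction x) * f (norm x powr (- p)) \<partial>R)"
    by (rule nn_integral_density) measurable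
  finally show ?thesis .
qed

lemma radial_measure_exp_finite:
  assumes r: "0 < r" shows "(\<integral>\<^sup>+s. ennreal (exp (- r * s)) \<partial>radial_measure p \<alpha> R A) < \<top>"
proof -
  have "(\<integral>\<^sup>+s. ennreal (exp (- r * s)) \<partial>radial_measure p \<alpha> R A) \<le> (\<integral>\<^sup>+x. ennreal (norm x powr \<alpha> * exp (- r * norm x powr (- p))) \<partial>R)"
    by (subst nn_integral_radial_measure, measurable, rule nn_integral_mono) (auto simp: indicator_def ennreal_mult)
  also have "\<dots> < \<top>" by (rule stable_weight_integrable[OF p R sR r])
  finally show ?thesis .
qed

lemma sets_radial_measure: "sets (radial_measure p \<alpha> R A) = sets borel"
  by (simp add: radial_measure_def)

lemma radial_measure_nonneg: "AE s in radial_measure p \<alpha> R A. 0 \<le> s"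
proof -
  note [measurable_cong] = sR
  show ?thesis unfolding radial_measure_def by (subst AE_distr_iff) auto
qed

lemma radial_measure_laplace: "laplace_measure (radial_measure p \<alpha> R A)"
proof
  show "sets (radial_measure p \<alpha> R A) = sets borel" by (rule sets_radial_measure)
  show "AE s in radial_measure p \<alpha> R A. 0 \<le> s" by (rule radial_measure_nonneg)
  show "integrable (radial_measure p \<alpha> R A) (\<lambda>s. exp (- r * s))" if "0 < r" for r
    using radial_measure_exp_finite[OF that] sets_radial_measure
    by (intro integrableI_nonneg) (auto cong: measurable_cong_sets)
qed

text \<open>
  Along the ray through \<open>x\<close> the mixture has the density \<open>r powr (- \<alpha> - 1) * norm x powr \<alpha> * exp (- (r powr p) * norm x powr (- p))\<close> in the
  radius; integrating over \<open>x\<close> produces a Laplace transform at \<open>r powr p\<close>.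
\<close>

lemma emeasure_levy_mixture_cone:
  assumes C[measurable]: "C \<in> sets borel"
  shows "levy_mixture p \<alpha> R {x. x \<noteq> 0 \<and> direction x \<in> A \<and> norm x \<in> C} =
    (\<integral>\<^sup>+r. (ennreal (r powr (- \<alpha> - 1)) * indicator {0<..} r * (\<integral>\<^sup>+s. ennreal (exp (- (r powr p) * s)) \<partial>radial_measure p \<alpha> R A)) * indicator C r \<partial>lborel)"
proof -
  note [measurable_cong] = sR sets_radial_measure
  define \<psi> where "\<psi> s = (\<integral>\<^sup>+r. indicator C r * ennreal (r powr (- \<alpha> - 1) * exp (- (r powr p) * s)) * indicator {0<..} r \<partial>lborel)" for s
  have \<psi>m[measurable]: "\<psi> \<in> borel_measurable borel" unfolding \<psi>_def by measurable
  have "levy_mixture p \<alpha> R {x. x \<noteq> 0 \<and> direction x \<in> A \<and> norm x \<in> C} =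
    (\<integral>\<^sup>+x. ennreal (norm x powr \<alpha>) * indicator A (direction x) * \<psi> (norm x powr (- p)) \<partial>R)"
    unfolding levy_mixture_def
  proof (rule nn_integral_cong)
    fix x :: 'a
    show "(\<integral>\<^sup>+t\<in>{0<..}. indicator {x. x \<noteq> 0 \<and> direction x \<in> A \<and> norm x \<in> C} (t *\<^sub>R x) * ennreal (t powr (- 1 - \<alpha>) * exp (- (t powr p))) \<partial>lborel) =
      ennreal (norm x powr \<alpha>) * indicator A (direction x) * \<psi> (norm x powr (- p))"
    proof (cases "x = 0")
      case True then show ?thesis by simp
    next
      case False
      define c where "c = 1 / norm x"
      have c: "0 < c" using False by (simp add: c_def)
      have cp: "c powr p = norm x powr (- p)" "c powr \<alpha> * norm x powr \<alpha> = 1"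
        using False by (simp_all add: c_def powr_one_over powr_minus)
      have cm: "c * r * norm x = r" for r using False by (simp add: c_def)
      have "(\<integral>\<^sup>+t\<in>{0<..}. indicator {x. x \<noteq> 0 \<and> direction x \<in> A \<and> norm x \<in> C} (t *\<^sub>R x) * ennreal (t powr (- 1 - \<alpha>) * exp (- (t powr p))) \<partial>lborel) =
        (\<integral>\<^sup>+t. indicator A (direction x) * (indicator C (t * norm x) * ennreal (t powr (- 1 - \<alpha>) * exp (- (t powr p))) * indicator {0<..} t) \<partial>lborel)"
        using False by (intro nn_integral_cong) (auto simp: indicator_def direction_scaleR)
      also have "\<dots> = indicator A (direction x) * (\<integral>\<^sup>+t\<in>{0<..}. indicator C (t * norm x) * ennreal (t powr (- 1 - \<alpha>) * exp (- (t powr p))) \<partial>lborel)"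
        by (rule nn_integral_cmult) measurable
      also have "(\<integral>\<^sup>+t\<in>{0<..}. indicator C (t * norm x) * ennreal (t powr (- 1 - \<alpha>) * exp (- (t powr p))) \<partial>lborel) =
        (\<integral>\<^sup>+t\<in>{0<..}. indicator C (t * norm x) * ennreal (t powr (- 1 - \<alpha>) * exp (- (t powr p))) \<partial>lborel) * ennreal (c powr \<alpha> * norm x powr \<alpha>)"
        by (simp add: cp)
      also have "\<dots> = ((\<integral>\<^sup>+t\<in>{0<..}. indicator C (t * norm x) * ennreal (t powr (- 1 - \<alpha>) * exp (- (t powr p))) \<partial>lborel) * ennreal (c powr \<alpha>)) * ennreal (norm x powr \<alpha>)"
        by (simp add: ennreal_mult mult.assoc)
      also have "(\<integral>\<^sup>+t\<in>{0<..}. indicator C (t * norm x) * ennreal (t powr (- 1 - \<alpha>) * exp (- (t powr p))) \<partial>lborel) * ennreal (c powr \<alpha>) = \<psi> (norm x powr (- p))"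
        by (subst radial_integral_scale[OF c p, where f="\<lambda>t. indicator C (t * norm x)"]) (simp_all add: \<psi>_def cm cp)
      finally show ?thesis by (simp add: mult_ac)
    qed
  qed
  also have "\<dots> = (\<integral>\<^sup>+s. \<psi> s \<partial>radial_measure p \<alpha> R A)" by (rule nn_integral_radial_measure[symmetric]) measurable
  also have "\<dots> = (\<integral>\<^sup>+r. (\<integral>\<^sup>+s. indicator C r * ennreal (r powr (- \<alpha> - 1) * exp (- (r powr p) * s)) * indicator {0<..} r \<partial>radial_measure p \<alpha> R A) \<partial>lborel)"
  proof -
    have "sigma_finite_measure (radial_measure p \<alpha> R A)"
      by (rule sigma_finite_from_integrable[where f="\<lambda>s. ennreal (exp (- 1 * s))"]) (use radial_measure_exp_finite[of 1] in auto)
    then interpret N: sigma_finite_measure "radial_measure p \<alpha> R A" .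
    interpret pair_sigma_finite "radial_measure p \<alpha> R A" lborel ..
    show ?thesis unfolding \<psi>_def by (rule Fubini'[symmetric]) measurable
  qed
  also have "\<dots> = (\<integral>\<^sup>+r. (ennreal (r powr (- \<alpha> - 1)) * indicator {0<..} r * (\<integral>\<^sup>+s. ennreal (exp (- (r powr p) * s)) \<partial>radial_measure p \<alpha> R A)) * indicator C r \<partial>lborel)"
  proof (rule nn_integral_cong)
    fix r :: real
    have "(\<integral>\<^sup>+s. indicator C r * ennreal (r powr (- \<alpha> - 1) * exp (- (r powr p) * s)) * indicator {0<..} r \<partial>radial_measure p \<alpha> R A) =
      (\<integral>\<^sup>+s. (ennreal (r powr (- \<alpha> - 1)) * indicator {0<..} r * indicator C r) * ennreal (exp (- (r powr p) * s)) \<partial>radial_measure p \<alpha> R A)"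
      by (intro nn_integral_cong) (simp add: ennreal_mult mult_ac)
    also have "\<dots> = (ennreal (r powr (- \<alpha> - 1)) * indicator {0<..} r * indicator C r) * (\<integral>\<^sup>+s. ennreal (exp (- (r powr p) * s)) \<partial>radial_measure p \<alpha> R A)"
      by (rule nn_integral_cmult) measurable
    finally show "(\<integral>\<^sup>+s. indicator C r * ennreal (r powr (- \<alpha> - 1) * exp (- (r powr p) * s)) * indicator {0<..} r \<partial>radial_measure p \<alpha> R A) =
      (ennreal (r powr (- \<alpha> - 1)) * indicator {0<..} r * (\<integral>\<^sup>+s. ennreal (exp (- (r powr p) * s)) \<partial>radial_measure p \<alpha> R A)) * indicator C r"
      by (simp add: mult_ac)
  qed
  finally show ?thesis .
qed

end

text \<open>
  The mixture determines the radial densities of cones almost everywhere, hence the Laplace transforms, which are continuous, everywhere, and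
  therefore the radial measures.
\<close>

lemma radial_measure_determined:
  fixes R R' :: "'a::euclidean_space measure"
  assumes p: "0 < p" and R: "sets R = sets borel" "integrability_conditions \<alpha> R" and R': "sets R' = sets borel" "integrability_conditions \<alpha> R'"
    and eq: "\<And>B. B \<in> sets borel \<Longrightarrow> levy_mixture p \<alpha> R B = levy_mixture p \<alpha> R' B" and A[measurable]: "A \<in> sets borel"
  shows "radial_measure p \<alpha> R A = radial_measure p \<alpha> R' A"
proof -
  define N where "N = radial_measure p \<alpha> R A"
  define N' where "N' = radial_measure p \<alpha> R' A"
  interpret N: laplace_measure N unfolding N_def by (rule radial_measure_laplace[OF p R(1) A R(2)])
  interpret N': laplace_measure N' unfolding N'_def by (rule radial_measure_laplace[OF p R'(1) A R'(2)])
  define L where "L K r = (\<integral>\<^sup>+s. ennreal (exp (- r * s)) \<partial>K)" for K :: "real measure" and r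
  define h where "h K r = ennreal (r powr (- \<alpha> - 1)) * indicator {0<..} r * L K (r powr p)" for K r
  have LK: "L N r = ennreal (\<integral>s. exp (- r * s) \<partial>N)" "L N' r = ennreal (\<integral>s. exp (- r * s) \<partial>N')" if "0 < r" for r
    unfolding L_def using N.integrable_exp[OF that] N'.integrable_exp[OF that] by (auto intro!: nn_integral_eq_integral)
  have lm: "h K \<in> borel_measurable borel" if "sets K = sets borel" "sigma_finite_measure K" for K
  proof -
    interpret sigma_finite_measure K by fact
    note [measurable_cong] = that(1)
    show ?thesis unfolding h_def L_def by measurable
  qed
  have sf: "sigma_finite_measure N" "sigma_finite_measure N'"
  proof -
    have m: "(\<lambda>s::real. ennreal (exp (- 1 * s))) \<in> borel_measurable K" if "sets K = sets borel" for K
      unfolding measurable_cong_sets[OF that refl] by measurable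
    show "sigma_finite_measure N"
      by (rule sigma_finite_from_integrable[OF m[OF N.sets_Q]])
        (use radial_measure_exp_finite[OF p R(1) A R(2), of 1] in \<open>auto simp: N_def\<close>)
    show "sigma_finite_measure N'"
      by (rule sigma_finite_from_integrable[OF m[OF N'.sets_Q]])
        (use radial_measure_exp_finite[OF p R'(1) A R'(2), of 1] in \<open>auto simp: N'_def\<close>)
  qed
  have hm[measurable]: "h N \<in> borel_measurable borel" "h N' \<in> borel_measurable borel"
    using lm[OF N.sets_Q sf(1)] lm[OF N'.sets_Q sf(2)] by auto
  have "density lborel (h N) = density lborel (h N')"
  proof (rule measure_eqI)
    fix C assume "C \<in> sets (density lborel (h N))"
    then have C[measurable]: "C \<in> sets borel" by simp
    have "{x::'a. x \<noteq> 0 \<and> direction x \<in> A \<and> norm x \<in> C} \<in> sets borel" by measurable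
    from eq[OF this] have "(\<integral>\<^sup>+r. h N r * indicator C r \<partial>lborel) = (\<integral>\<^sup>+r. h N' r * indicator C r \<partial>lborel)"
      unfolding emeasure_levy_mixture_cone[OF p R(1) A R(2) C] emeasure_levy_mixture_cone[OF p R'(1) A R'(2) C] h_def L_def N_def N'_def .
    then show "emeasure (density lborel (h N)) C = emeasure (density lborel (h N')) C"
      by (simp add: emeasure_density)
  qed simp
  then have "AE r in lborel. h N r = h N' r" by (intro sigma_finite_measure.density_unique[OF sigma_finite_lborel]) auto
  then have ae: "AE r in lborel. 0 < r \<longrightarrow> (\<integral>s. exp (- (r powr p) * s) \<partial>N) - (\<integral>s. exp (- (r powr p) * s) \<partial>N') = 0"
  proof eventually_elim
    case (elim r)
    show ?case
    proof
      assume r: "0 < r"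
      then have rp: "0 < r powr p" and ra: "ennreal (r powr (- \<alpha> - 1)) \<noteq> 0" "ennreal (r powr (- \<alpha> - 1)) \<noteq> \<top>" by auto
      have "ennreal (r powr (- \<alpha> - 1)) * L N (r powr p) = ennreal (r powr (- \<alpha> - 1)) * L N' (r powr p)"
        using elim r by (simp add: h_def)
      then have "L N (r powr p) = L N' (r powr p)" using ra by (simp add: ennreal_mult_cancel_left)
      then have "(\<integral>s. exp (- (r powr p) * s) \<partial>N) = (\<integral>s. exp (- (r powr p) * s) \<partial>N')"
        unfolding LK[OF rp] by (subst (asm) ennreal_inj) auto
      then show "(\<integral>s. exp (- (r powr p) * s) \<partial>N) - (\<integral>s. exp (- (r powr p) * s) \<partial>N') = 0" by simp
    qed
  qed
  have "(\<integral>s. exp (- (r powr p) * s) \<partial>N) - (\<integral>s. exp (- (r powr p) * s) \<partial>N') = 0" if "0 < r" for r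
  proof (rule isCont_AE_zero_imp_zero[OF ae _ that])
    fix r :: real assume r: "0 < r"
    then have rp: "0 < r powr p" by simp
    have c: "isCont (\<lambda>r. r powr p) r" using r by (intro continuous_intros) auto
    show "isCont (\<lambda>r. (\<integral>s. exp (- (r powr p) * s) \<partial>N) - (\<integral>s. exp (- (r powr p) * s) \<partial>N')) r"
      by (intro continuous_diff isCont_o2[OF c N.isCont_laplace[OF rp]] isCont_o2[OF c N'.isCont_laplace[OF rp]])
  qed
  then have "(\<integral>s. exp (- v * s) \<partial>N) = (\<integral>s. exp (- v * s) \<partial>N')" if v: "0 < v" for v
  proof -
    have "(v powr (1 / p)) powr p = v" "0 < v powr (1 / p)" using v p by (auto simp: powr_powr)
    then show ?thesis using \<open>\<And>r. 0 < r \<Longrightarrow> (\<integral>s. exp (- (r powr p) * s) \<partial>N) - (\<integral>s. exp (- (r powr p) * s) \<partial>N') = 0\<close>[of "v powr (1 / p)"] by simp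
  qed
  then have Leq: "L N v = L N' v" if "0 < v" for v using that by (simp add: LK)
  have "N = N'"
  proof (rule laplace_unique)
    show "(\<integral>\<^sup>+s. ennreal (exp (- r * s)) \<partial>N) < \<infinity>" if "0 < r" for r
      unfolding N_def using radial_measure_exp_finite[OF p R(1) A R(2) that] by simp
    show "(\<integral>\<^sup>+s. ennreal (exp (- r * s)) \<partial>N) = (\<integral>\<^sup>+s. ennreal (exp (- r * s)) \<partial>N')" if "0 < r" for r
      using Leq[OF that] by (simp add: L_def)
  qed (rule N.sets_Q N.nonneg_AE N'.sets_Q N'.nonneg_AE)+
  then show ?thesis by (simp add: N_def N'_def)
qed

text \<open>
  \<open>R\<close> in the coordinates \<open>direction x\<close> and \<open>norm x powr (- p)\<close>, made finite by the exponential factor. A measure \<open>R\<close> that does not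
  charge the origin can be recovered from it, because the density is positive and the coordinates are one-to-one off the origin (\<open>integral_from_polar_measure\<close>).
\<close>

definition polar_measure :: "real \<Rightarrow> real \<Rightarrow> 'a::euclidean_space measure \<Rightarrow> ('a \<times> real) measure" where
  "polar_measure p \<alpha> R =
     distr (density R (\<lambda>x. ennreal (norm x powr \<alpha> * exp (- 1 * norm x powr (- p))))) (borel \<Otimes>\<^sub>M borel) (\<lambda>x. (direction x, norm x powr (- p)))"

lemma polar_measure_finite:
  assumes p: "0 < p" and R: "integrability_conditions \<alpha> R" and sR: "sets R = sets (borel :: 'a::euclidean_space measure)"
  shows "finite_measure (polar_measure p \<alpha> R)"
proof -
  note [measurable_cong] = sR
  have "finite_measure (density R (\<lambda>x. ennreal (norm x powr \<alpha> * exp (- 1 * norm x powr (- p)))))"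
  proof (rule finite_measureI)
    have "emeasure (density R (\<lambda>x. ennreal (norm x powr \<alpha> * exp (- 1 * norm x powr (- p))))) (space R) =
      (\<integral>\<^sup>+x. ennreal (norm x powr \<alpha> * exp (- 1 * norm x powr (- p))) * indicator (space R) x \<partial>R)"
      by (rule emeasure_density) auto
    also have "\<dots> = (\<integral>\<^sup>+x. ennreal (norm x powr \<alpha> * exp (- 1 * norm x powr (- p))) \<partial>R)" by (intro nn_integral_cong) simp
    finally show "emeasure (density R (\<lambda>x. ennreal (norm x powr \<alpha> * exp (- 1 * norm x powr (- p))))) (space (density R (\<lambda>x. ennreal (norm x powr \<alpha> * exp (- 1 * norm x powr (- p)))))) \<noteq> \<infinity>"
      using stable_weight_integrable[OF p R sR zero_less_one] by simp
  qed
  then show ?thesis unfolding polar_measure_def by (rule finite_measure.finite_measure_distr) measurable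
qed

lemma nn_integral_polar_measure:
  assumes sR: "sets R = sets (borel :: 'a::euclidean_space measure)" and f[measurable]: "f \<in> borel_measurable (borel \<Otimes>\<^sub>M borel)"
  shows "(\<integral>\<^sup>+z. f z \<partial>polar_measure p \<alpha> R) =
    (\<integral>\<^sup>+x. ennreal (norm x powr \<alpha> * exp (- 1 * norm x powr (- p))) * f (direction x, norm x powr (- p)) \<partial>R)"
proof -
  note [measurable_cong] = sR
  have "(\<integral>\<^sup>+z. f z \<partial>polar_measure p \<alpha> R) = (\<integral>\<^sup>+x. f (direction x, norm x powr (- p)) \<partial>density R (\<lambda>x. ennreal (norm x powr \<alpha> * exp (- 1 * norm x powr (- p)))))"
    unfolding polar_measure_def by (rule nn_integral_distr) measurable
  also have "\<dots> = (\<integral>\<^sup>+x. ennreal (norm x powr \<alpha> * exp (- 1 * norm x powr (- p))) * f (direction x, norm x powr (- p)) \<partial>R)"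
    by (rule nn_integral_density) measurable
  finally show ?thesis .
qed

lemma integral_from_polar_measure:
  assumes p: "0 < p" and R0: "emeasure R {0} = 0" and sR: "sets R = sets (borel :: 'a::euclidean_space measure)"
    and F[measurable]: "F \<in> borel_measurable borel"
  shows "(\<integral>\<^sup>+x. F x \<partial>R) = (\<integral>\<^sup>+(u, s). F ((s powr (- 1 / p)) *\<^sub>R u) * ennreal (s powr (\<alpha> / p) * exp s) \<partial>polar_measure p \<alpha> R)"
proof -
  note [measurable_cong] = sR
  have "(\<integral>\<^sup>+(u, s). F ((s powr (- 1 / p)) *\<^sub>R u) * ennreal (s powr (\<alpha> / p) * exp s) \<partial>polar_measure p \<alpha> R) =
    (\<integral>\<^sup>+x. ennreal (norm x powr \<alpha> * exp (- 1 * norm x powr (- p))) *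
      (F (((norm x powr (- p)) powr (- 1 / p)) *\<^sub>R direction x) * ennreal ((norm x powr (- p)) powr (\<alpha> / p) * exp (norm x powr (- p)))) \<partial>R)"
    by (subst nn_integral_polar_measure[OF sR]) simp_all
  also have "\<dots> = (\<integral>\<^sup>+x. F x \<partial>R)"
  proof (rule nn_integral_cong_AE)
    have "AE x in R. x \<noteq> 0" using R0 sR by (intro AE_I[of _ _ "{0}"]) auto
    then show "AE x in R. ennreal (norm x powr \<alpha> * exp (- 1 * norm x powr (- p))) *
      (F (((norm x powr (- p)) powr (- 1 / p)) *\<^sub>R direction x) * ennreal ((norm x powr (- p)) powr (\<alpha> / p) * exp (norm x powr (- p)))) = F x"
    proof eventually_elim
      case (elim x)
      define s where "s = norm x"
      have s: "0 < s" using elim by (simp add: s_def)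
      have e1: "(s powr (- p)) powr (- 1 / p) = s" "(s powr (- p)) powr (\<alpha> / p) = s powr (- \<alpha>)" using s p by (simp_all add: powr_powr)
      have "s powr \<alpha> * exp (- 1 * s powr (- p)) * (s powr (- \<alpha>) * exp (s powr (- p))) =
        (s powr \<alpha> * s powr (- \<alpha>)) * (exp (- 1 * s powr (- p)) * exp (s powr (- p)))" by (simp only: mult_ac)
      also have "\<dots> = 1" unfolding powr_add[symmetric] exp_add[symmetric] using s by simp
      finally have "ennreal (s powr \<alpha> * exp (- 1 * s powr (- p))) * ennreal (s powr (- \<alpha>) * exp (s powr (- p))) = 1"
        by (simp add: ennreal_mult[symmetric])
      then have "ennreal (s powr \<alpha> * exp (- 1 * s powr (- p))) * (F x * ennreal (s powr (- \<alpha>) * exp (s powr (- p)))) = F x"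
        by (metis mult.left_commute mult.right_neutral)
      then show ?case unfolding s_def[symmetric] e1 unfolding s_def norm_scaleR_direction .
    qed
  qed
  finally show ?thesis by simp
qed

text \<open>
  The values of the polar measure on rectangles are expressed through the radial measures, which the mixture determines.
\<close>

theorem levy_mixture_injective:
  fixes R R' :: "'a::euclidean_space measure"
  assumes p: "0 < p" and R: "sets R = sets borel" "integrability_conditions \<alpha> R" and R': "sets R' = sets borel" "integrability_conditions \<alpha> R'"
    and eq: "\<And>B. B \<in> sets borel \<Longrightarrow> levy_mixture p \<alpha> R B = levy_mixture p \<alpha> R' B"
  shows "R = R'"
proof -
  interpret P: finite_measure "polar_measure p \<alpha> R" by (rule polar_measure_finite[OF p R(2,1)])
  have rect: "emeasure (polar_measure p \<alpha> K) (A \<times> C) = (\<integral>\<^sup>+s. ennreal (exp (- s)) * indicator C s \<partial>radial_measure p \<alpha> K A)"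
    if K: "sets K = sets borel" "integrability_conditions \<alpha> K" and A[measurable]: "A \<in> sets borel" and C[measurable]: "C \<in> sets borel" for K A C
  proof -
    have "emeasure (polar_measure p \<alpha> K) (A \<times> C) = (\<integral>\<^sup>+z. indicator (A \<times> C) z \<partial>polar_measure p \<alpha> K)"
      by (rule nn_integral_indicator[symmetric]) (simp add: polar_measure_def)
    also have "\<dots> = (\<integral>\<^sup>+x. ennreal (norm x powr \<alpha> * exp (- 1 * norm x powr (- p))) * indicator (A \<times> C) (direction x, norm x powr (- p)) \<partial>K)"
      by (rule nn_integral_polar_measure[OF K(1)]) measurable
    also have "\<dots> = (\<integral>\<^sup>+x. ennreal (norm x powr \<alpha>) * indicator A (direction x) * (ennreal (exp (- (norm x powr (- p)))) * indicator C (norm x powr (- p))) \<partial>K)"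
      by (intro nn_integral_cong) (simp add: ennreal_mult indicator_times mult_ac)
    also have "\<dots> = (\<integral>\<^sup>+s. ennreal (exp (- s)) * indicator C s \<partial>radial_measure p \<alpha> K A)"
      by (rule nn_integral_radial_measure[OF p K(1) A K(2), symmetric]) measurable
    finally show ?thesis .
  qed
  have "polar_measure p \<alpha> R = polar_measure p \<alpha> R'"
  proof (rule measure_eqI_generator_eq[where E="{a \<times> b |a b. a \<in> sets borel \<and> b \<in> sets borel}" and \<Omega>=UNIV and A="\<lambda>_. UNIV"])
    show "Int_stable {a \<times> b |a b. a \<in> sets (borel :: 'a measure) \<and> b \<in> sets (borel :: real measure)}"
      by (rule Int_stable_pair_measure_generator)
    show "sets (polar_measure p \<alpha> R) = sigma_sets UNIV {a \<times> b |a b. a \<in> sets borel \<and> b \<in> sets borel}"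
      "sets (polar_measure p \<alpha> R') = sigma_sets UNIV {a \<times> b |a b. a \<in> sets borel \<and> b \<in> sets borel}"
      by (simp_all add: polar_measure_def sets_pair_measure)
    show "emeasure (polar_measure p \<alpha> R) X = emeasure (polar_measure p \<alpha> R') X"
      if "X \<in> {a \<times> b |a b. a \<in> sets borel \<and> b \<in> sets borel}" for X
      using that rect[OF R] rect[OF R'] radial_measure_determined[OF p R R' eq] by auto
    show "range (\<lambda>_::nat. UNIV) \<subseteq> {a \<times> b |a b. a \<in> sets (borel :: 'a measure) \<and> b \<in> sets (borel :: real measure)}"
      by (auto intro!: exI[of _ UNIV])
  qed (auto simp: P.emeasure_eq_measure)
  show ?thesis
  proof (rule measure_eqI)
    fix A assume "A \<in> sets R"
    then have A[measurable]: "A \<in> sets borel" using R by simp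
    have z: "emeasure R {0} = 0" "emeasure R' {0} = 0" using R R' by (auto simp: integrability_conditions_def)
    have "(\<integral>\<^sup>+x. indicator A x \<partial>R) = (\<integral>\<^sup>+x. indicator A x \<partial>R')"
      using integral_from_polar_measure[OF p z(1) R(1), of "indicator A" \<alpha>] integral_from_polar_measure[OF p z(2) R'(1), of "indicator A" \<alpha>]
        \<open>polar_measure p \<alpha> R = polar_measure p \<alpha> R'\<close> by simp
    then show "emeasure R A = emeasure R' A" using R R' by simp
  qed (simp add: R R')
qed

section \<open>Disintegration over the unit interval\<close>

text \<open>
  Conditional distributions of a variable in the unit interval, constructed from their moments. The measures
  \<open>\<integral> (1 - y) ^ k * y ^ n\<close> restricted to events in the first coordinate are absolutely continuous with respect to the marginal, and their densities
  satisfy the recursion of the Hausdorff moment problem almost everywhere. Solving that problem pointwise gives the kernel, whose measurability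
  follows from that of the densities.
\<close>

theorem unit_interval_disintegration:
  fixes P :: "('a \<times> real) measure"
  assumes fin: "finite_measure P" and sP: "sets P = sets (S \<Otimes>\<^sub>M borel)" and ne: "space S \<noteq> {}"
    and unit: "AE z in P. 0 \<le> snd z \<and> snd z \<le> 1"
  shows "\<exists>K. K \<in> S \<rightarrow>\<^sub>M subprob_algebra borel \<and> (\<forall>u\<in>space S. prob_space (K u) \<and> unit_interval_measure (K u)) \<and>
    (\<forall>f\<in>borel_measurable (S \<Otimes>\<^sub>M borel). (\<integral>\<^sup>+z. f z \<partial>P) = (\<integral>\<^sup>+u. (\<integral>\<^sup>+y. f (u, y) \<partial>K u) \<partial>distr P S fst))"
proof -
  interpret P: finite_measure P by fact
  note [measurable_cong] = sP
  define \<sigma> where "\<sigma> = distr P S fst"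
  have fstP[measurable]: "fst \<in> P \<rightarrow>\<^sub>M S" and sndP[measurable]: "snd \<in> P \<rightarrow>\<^sub>M borel" by measurable
  have s\<sigma>: "sets \<sigma> = sets S" "space \<sigma> = space S" by (simp_all add: \<sigma>_def)
  note [measurable_cong] = s\<sigma>(1)
  interpret \<sigma>: finite_measure \<sigma> unfolding \<sigma>_def by (rule P.finite_measure_distr) measurable
  define w where "w k n z = ennreal ((1 - snd z) ^ k * snd z ^ n)" for k n and z :: "'a \<times> real"
  have w[measurable]: "w k n \<in> borel_measurable P" for k n unfolding w_def by measurable
  define \<rho> where "\<rho> k n = distr (density P (w k n)) S fst" for k n
  have s\<rho>: "sets (\<rho> k n) = sets \<sigma>" for k n by (simp add: \<rho>_def s\<sigma>)
  have e\<rho>: "emeasure (\<rho> k n) B = (\<integral>\<^sup>+z. w k n z * indicator B (fst z) \<partial>P)" if B[measurable]: "B \<in> sets S" for k n B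
  proof -
    have "emeasure (\<rho> k n) B = (\<integral>\<^sup>+u. indicator B u \<partial>\<rho> k n)" by (simp add: \<rho>_def)
    also have "\<dots> = (\<integral>\<^sup>+z. indicator B (fst z) \<partial>density P (w k n))" unfolding \<rho>_def by (rule nn_integral_distr) measurable
    also have "\<dots> = (\<integral>\<^sup>+z. w k n z * indicator B (fst z) \<partial>P)" by (rule nn_integral_density) measurable
    finally show ?thesis .
  qed
  have e\<sigma>: "emeasure \<sigma> B = (\<integral>\<^sup>+z. indicator B (fst z) \<partial>P)" if B[measurable]: "B \<in> sets S" for B
  proof -
    have "emeasure \<sigma> B = (\<integral>\<^sup>+u. indicator B u \<partial>\<sigma>)" by (simp add: s\<sigma>)
    also have "\<dots> = (\<integral>\<^sup>+z. indicator B (fst z) \<partial>P)" unfolding \<sigma>_def by (rule nn_integral_distr) measurable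
    finally show ?thesis .
  qed
  have ac: "absolutely_continuous \<sigma> (\<rho> k n)" for k n
    unfolding absolutely_continuous_def
  proof
    fix B assume B: "B \<in> null_sets \<sigma>"
    then have BS[measurable]: "B \<in> sets S" and "(\<integral>\<^sup>+z. indicator B (fst z) \<partial>P) = 0" using e\<sigma>[of B] by (auto simp: s\<sigma> null_sets_def)
    then have "AE z in P. indicator B (fst z) = (0::ennreal)" by (subst (asm) nn_integral_0_iff_AE) auto
    then have "AE z in P. w k n z * indicator B (fst z) = 0" by eventually_elim simp
    then have "(\<integral>\<^sup>+z. w k n z * indicator B (fst z) \<partial>P) = 0" by (subst nn_integral_0_iff_AE) auto
    then show "B \<in> null_sets (\<rho> k n)" using BS by (auto simp: null_sets_def e\<rho> s\<rho> s\<sigma>)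
  qed
  define g where "g k n = RN_deriv \<sigma> (\<rho> k n)" for k n
  have g[measurable]: "g k n \<in> borel_measurable S" for k n
    using borel_measurable_RN_deriv[of \<sigma> "\<rho> k n"] by (simp add: g_def measurable_cong_sets[OF s\<sigma>(1) refl])
  have dg: "density \<sigma> (g k n) = \<rho> k n" for k n unfolding g_def by (rule \<sigma>.density_RN_deriv[OF ac s\<rho>])
  have ge: "(\<integral>\<^sup>+u. g k n u * indicator B u \<partial>\<sigma>) = (\<integral>\<^sup>+z. w k n z * indicator B (fst z) \<partial>P)" if B[measurable]: "B \<in> sets S" for k n B
  proof -
    have "(\<integral>\<^sup>+u. g k n u * indicator B u \<partial>\<sigma>) = emeasure (density \<sigma> (g k n)) B" by (rule emeasure_density[symmetric]) (simp_all add: s\<sigma>)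
    then show ?thesis by (simp add: dg e\<rho>)
  qed
  have rec: "AE u in \<sigma>. g k n u = g (Suc k) n u + g k (Suc n) u" for k n
  proof (rule \<sigma>.density_unique)
    show "density \<sigma> (g k n) = density \<sigma> (\<lambda>u. g (Suc k) n u + g k (Suc n) u)"
    proof (rule measure_eqI)
      fix B assume "B \<in> sets (density \<sigma> (g k n))"
      then have B[measurable]: "B \<in> sets S" by (simp add: s\<sigma>)
      have "emeasure (density \<sigma> (\<lambda>u. g (Suc k) n u + g k (Suc n) u)) B = (\<integral>\<^sup>+u. (g (Suc k) n u + g k (Suc n) u) * indicator B u \<partial>\<sigma>)"
        by (rule emeasure_density) (simp_all add: s\<sigma>)
      also have "\<dots> = (\<integral>\<^sup>+u. g (Suc k) n u * indicator B u \<partial>\<sigma>) + (\<integral>\<^sup>+u. g k (Suc n) u * indicator B u \<partial>\<sigma>)"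
        unfolding distrib_right by (rule nn_integral_add) measurable
      also have "\<dots> = (\<integral>\<^sup>+z. w (Suc k) n z * indicator B (fst z) \<partial>P) + (\<integral>\<^sup>+z. w k (Suc n) z * indicator B (fst z) \<partial>P)"
        by (simp only: ge[OF B])
      also have "\<dots> = (\<integral>\<^sup>+z. w (Suc k) n z * indicator B (fst z) + w k (Suc n) z * indicator B (fst z) \<partial>P)"
        by (rule nn_integral_add[symmetric]) measurable
      also have "\<dots> = (\<integral>\<^sup>+z. w k n z * indicator B (fst z) \<partial>P)"
      proof (rule nn_integral_cong_AE)
        show "AE z in P. w (Suc k) n z * indicator B (fst z) + w k (Suc n) z * indicator B (fst z) = w k n z * indicator B (fst z)"
          using unit
        proof eventually_elim
          case (elim z)
          then have "w (Suc k) n z + w k (Suc n) z = ennreal ((1 - snd z) ^ Suc k * snd z ^ n + (1 - snd z) ^ k * snd z ^ Suc n)"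
            unfolding w_def by (intro ennreal_plus[symmetric]) auto
          also have "(1 - snd z) ^ Suc k * snd z ^ n + (1 - snd z) ^ k * snd z ^ Suc n = (1 - snd z) ^ k * snd z ^ n"
            by (simp add: algebra_simps)
          finally show ?case by (simp add: w_def distrib_right[symmetric])
        qed
      qed
      also have "\<dots> = emeasure (density \<sigma> (g k n)) B" by (simp add: dg e\<rho>)
      finally show "emeasure (density \<sigma> (g k n)) B = emeasure (density \<sigma> (\<lambda>u. g (Suc k) n u + g k (Suc n) u)) B" by simp
    qed simp
  qed measurable
  have g00: "AE u in \<sigma>. g 0 0 u = 1"
  proof (rule \<sigma>.density_unique)
    show "density \<sigma> (g 0 0) = density \<sigma> (\<lambda>_. 1)"
      unfolding dg density_1 by (rule measure_eqI) (auto simp: s\<rho> s\<sigma> e\<rho> e\<sigma> w_def)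
  qed measurable
  define G where "G = {u \<in> space S. g 0 0 u = 1 \<and> (\<forall>k n. g k n u = g (Suc k) n u + g k (Suc n) u)}"
  have G[measurable]: "G \<in> sets S" unfolding G_def by measurable
  have aeG: "AE u in \<sigma>. u \<in> G"
  proof -
    have "AE u in \<sigma>. \<forall>k n. g k n u = g (Suc k) n u + g k (Suc n) u"
      unfolding AE_all_countable using rec by blast
    then show ?thesis using g00 AE_space
    proof eventually_elim
      case (elim u)
      then show ?case unfolding G_def s\<sigma>(2) by blast
    qed
  qed
  have G1: "g 0 0 u = 1" and Grec: "g k n u = g (Suc k) n u + g k (Suc n) u" if "u \<in> G" for u k n
    using that unfolding G_def by blast+
  have gle: "g k n u \<le> 1" if u: "u \<in> G" for k n u
  proof -
    note r = Grec[OF u]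
    have 1: "g k 0 u \<le> 1" for k
    proof (induction k)
      case (Suc k)
      have "g (Suc k) 0 u \<le> g k 0 u" unfolding r[of k 0] by simp
      then show ?case using Suc by (rule order_trans)
    qed (simp add: G1[OF u])
    show ?thesis
    proof (induction n)
      case (Suc n)
      have "g k (Suc n) u \<le> g k n u" unfolding r[of k n] by simp
      then show ?case using Suc by (rule order_trans)
    qed (rule 1)
  qed
  \<comment> \<open>On the exceptional null set the moments of the point mass at \<open>1 / 2\<close> are used, so that the kernel is defined everywhere.\<close>
  define D where "D u k n = (if u \<in> G then enn2real (g k n u) else (1 / 2) ^ (k + n))" for u k n
  have "\<forall>u. \<exists>\<kappa>. prob_space \<kappa> \<and> unit_interval_measure \<kappa> \<and> (\<forall>n. (\<integral>x. x ^ n \<partial>\<kappa>) = D u 0 n)"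
  proof
    fix u
    show "\<exists>\<kappa>. prob_space \<kappa> \<and> unit_interval_measure \<kappa> \<and> (\<forall>n. (\<integral>x. x ^ n \<partial>\<kappa>) = D u 0 n)"
    proof (rule hausdorff_moment_problem)
      show "0 \<le> D u k n" for k n by (simp add: D_def)
      show "D u 0 0 = 1" by (simp add: D_def G1)
      show "D u (Suc k) n = D u k n - D u k (Suc n)" for k n
      proof (cases "u \<in> G")
        case True
        have "g (Suc k) n u < \<top>" "g k (Suc n) u < \<top>"
          using gle[OF True, of "Suc k" n] gle[OF True, of k "Suc n"] by (auto intro: le_less_trans)
        then have "enn2real (g k n u) = enn2real (g (Suc k) n u) + enn2real (g k (Suc n) u)"
          unfolding Grec[OF True, of k n] by (rule enn2real_plus)
        then show ?thesis using True by (simp add: D_def)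
      qed (simp add: D_def)
    qed
  qed
  from choice[OF this] obtain K where K: "\<And>u. prob_space (K u)" "\<And>u. unit_interval_measure (K u)" "\<And>u n. (\<integral>x. x ^ n \<partial>K u) = D u 0 n"
    by blast
  have sK: "sets (K u) = sets borel" for u using K(2)[of u] by (simp add: unit_interval_measure_def)
  have Km[measurable]: "K \<in> S \<rightarrow>\<^sub>M subprob_algebra borel"
  proof (rule kernel_measurable_from_moments)
    show "(\<lambda>u. \<integral>x. x ^ n \<partial>K u) \<in> borel_measurable S" for n
      unfolding K(3) D_def by measurable
  qed (use K in auto)
  have Km\<sigma>: "K \<in> M \<rightarrow>\<^sub>M subprob_algebra borel" if "sets M = sets S" for M
    using Km measurable_cong_sets[OF that refl] by blast
  have unitK: "AE y in K u. 0 \<le> y \<and> y \<le> 1" for u using K(2)[of u] by (simp add: unit_interval_measure_def)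
  have momK: "(\<integral>\<^sup>+y. ennreal (y ^ n) \<partial>K u) = ennreal (D u 0 n)" for n u
  proof -
    have "(\<integral>\<^sup>+y. ennreal (y ^ n) \<partial>K u) = ennreal (\<integral>y. y ^ n \<partial>K u)"
      using unitK[of u] by (intro nn_integral_eq_integral unit_interval_power_integrable[OF K(2)]) (auto elim!: eventually_mono)
    then show ?thesis by (simp add: K(3))
  qed
  have unit_moment: "(\<integral>y. y ^ n \<partial>\<nu>) = enn2real (\<integral>\<^sup>+y. ennreal (y ^ n) \<partial>\<nu>)" if "unit_interval_measure \<nu>" for \<nu> n
    using that by (intro integral_eq_nn_integral) (auto simp: unit_interval_measure_def elim!: eventually_mono cong: measurable_cong_sets)
  \<comment> \<open>On a rectangle \<open>B \<times> C\<close> both measures are, as functions of \<open>C\<close>, measures on the unit interval, so equality of the moments suffices.\<close>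
  have rect: "(\<integral>\<^sup>+u. indicator B u * emeasure (K u) C \<partial>\<sigma>) = emeasure P (B \<times> C)" if B[measurable]: "B \<in> sets S" and C[measurable]: "C \<in> sets borel" for B C
  proof -
    define \<mu> where "\<mu> = distr (density P (\<lambda>z. indicator B (fst z))) borel snd"
    define \<nu> where "\<nu> = density \<sigma> (indicator B) \<bind> K"
    have sd: "sets (density \<sigma> (indicator B)) = sets S" by (simp add: s\<sigma>)
    have nned: "space (density \<sigma> (indicator B)) \<noteq> {}" using ne by (simp add: s\<sigma>)
    have s\<nu>: "sets \<nu> = sets borel" unfolding \<nu>_def by (rule sets_bind) (use sK nned in auto)
    have i\<mu>: "(\<integral>\<^sup>+y. f y \<partial>\<mu>) = (\<integral>\<^sup>+z. indicator B (fst z) * f (snd z) \<partial>P)" if [measurable]: "f \<in> borel_measurable borel" for f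
    proof -
      have "(\<integral>\<^sup>+y. f y \<partial>\<mu>) = (\<integral>\<^sup>+z. f (snd z) \<partial>density P (\<lambda>z. indicator B (fst z)))" unfolding \<mu>_def by (rule nn_integral_distr) measurable
      also have "\<dots> = (\<integral>\<^sup>+z. indicator B (fst z) * f (snd z) \<partial>P)" by (rule nn_integral_density) measurable
      finally show ?thesis .
    qed
    have i\<nu>: "(\<integral>\<^sup>+y. f y \<partial>\<nu>) = (\<integral>\<^sup>+u. indicator B u * (\<integral>\<^sup>+y. f y \<partial>K u) \<partial>\<sigma>)" if [measurable]: "f \<in> borel_measurable borel" for f
    proof -
      have "(\<integral>\<^sup>+y. f y \<partial>\<nu>) = (\<integral>\<^sup>+u. (\<integral>\<^sup>+y. f y \<partial>K u) \<partial>density \<sigma> (indicator B))"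
        unfolding \<nu>_def by (rule nn_integral_bind[OF that Km\<sigma>[OF sd]])
      also have "\<dots> = (\<integral>\<^sup>+u. indicator B u * (\<integral>\<^sup>+y. f y \<partial>K u) \<partial>\<sigma>)"
        by (rule nn_integral_density) (simp_all add: measurable_cong_sets[OF s\<sigma>(1) refl] nn_integral_measurable_subprob_algebra2[OF _ Km])
      finally show ?thesis .
    qed
    have u\<mu>: "unit_interval_measure \<mu>"
      unfolding unit_interval_measure_def
    proof (intro conjI)
      have "emeasure \<mu> (space \<mu>) = (\<integral>\<^sup>+y. 1 \<partial>\<mu>)" by simp
      also have "\<dots> = (\<integral>\<^sup>+z. indicator B (fst z) * 1 \<partial>P)" by (rule i\<mu>) measurable
      also have "\<dots> \<le> (\<integral>\<^sup>+z. 1 \<partial>P)" by (rule nn_integral_mono) (simp add: indicator_def)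
      also have "\<dots> < \<top>" by (simp add: P.emeasure_eq_measure)
      finally show "finite_measure \<mu>" by (intro finite_measureI) simp
      have "AE z in density P (\<lambda>z. indicator B (fst z)). 0 \<le> snd z \<and> snd z \<le> 1"
        by (subst AE_density, measurable) (use unit in eventually_elim, simp)
      then show "AE x in \<mu>. 0 \<le> x \<and> x \<le> 1" unfolding \<mu>_def
        by (subst AE_distr_iff) simp_all
    qed (simp add: \<mu>_def)
    have u\<nu>: "unit_interval_measure \<nu>"
      unfolding unit_interval_measure_def
    proof (intro conjI)
      have "emeasure \<nu> (space \<nu>) = (\<integral>\<^sup>+y. 1 \<partial>\<nu>)" by simp
      also have "\<dots> = (\<integral>\<^sup>+u. indicator B u * (\<integral>\<^sup>+y. 1 \<partial>K u) \<partial>\<sigma>)" by (rule i\<nu>) measurable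
      also have "\<dots> \<le> (\<integral>\<^sup>+u. 1 \<partial>\<sigma>)"
        by (rule nn_integral_mono) (simp add: indicator_def prob_space.emeasure_space_1[OF K(1)])
      also have "\<dots> < \<top>" by (simp add: \<sigma>.emeasure_eq_measure)
      finally show "finite_measure \<nu>" by (intro finite_measureI) simp
      have "(\<integral>\<^sup>+y. indicator (- {0..1}) y \<partial>\<nu>) = (\<integral>\<^sup>+u. indicator B u * (\<integral>\<^sup>+y. indicator (- {0..1}) y \<partial>K u) \<partial>\<sigma>)"
        by (rule i\<nu>) measurable
      also have "(\<lambda>u. (\<integral>\<^sup>+y. indicator (- {0..1::real}) y \<partial>K u)) = (\<lambda>u. 0 :: ennreal)"
      proof
        fix u
        show "(\<integral>\<^sup>+y. indicator (- {0..1::real}) y \<partial>K u) = 0"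
        proof (subst nn_integral_0_iff_AE)
          show "AE y in K u. indicator (- {0..1::real}) y = (0::ennreal)" using unitK[of u] by eventually_elim simp
        qed (simp add: measurable_cong_sets[OF sK refl])
      qed
      finally have "emeasure \<nu> (- {0..1}) = 0" by (simp add: s\<nu>)
      then have "AE x in \<nu>. x \<notin> - {0..1}" by (intro AE_not_in) (simp add: null_sets_def s\<nu>)
      then show "AE x in \<nu>. 0 \<le> x \<and> x \<le> 1" by eventually_elim simp
    qed (rule s\<nu>)
    have "\<mu> = \<nu>"
    proof (rule unit_interval_measure_eqI[OF u\<mu> u\<nu>])
      fix n
      have "(\<integral>\<^sup>+y. ennreal (y ^ n) \<partial>\<nu>) = (\<integral>\<^sup>+u. indicator B u * ennreal (D u 0 n) \<partial>\<sigma>)"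
        by (subst i\<nu>) (simp_all add: momK)
      also have "\<dots> = (\<integral>\<^sup>+u. g 0 n u * indicator B u \<partial>\<sigma>)"
      proof (rule nn_integral_cong_AE)
        show "AE u in \<sigma>. indicator B u * ennreal (D u 0 n) = g 0 n u * indicator B u"
          using aeG
        proof eventually_elim
          case (elim u)
          then have "g 0 n u < \<top>" using gle[OF elim, of 0 n] by (auto intro: le_less_trans)
          then show ?case using elim by (simp add: D_def mult.commute)
        qed
      qed
      also have "\<dots> = (\<integral>\<^sup>+z. w 0 n z * indicator B (fst z) \<partial>P)" by (rule ge[OF B])
      also have "\<dots> = (\<integral>\<^sup>+z. indicator B (fst z) * ennreal (snd z ^ n) \<partial>P)" by (simp add: w_def mult.commute)
      also have "\<dots> = (\<integral>\<^sup>+y. ennreal (y ^ n) \<partial>\<mu>)" by (rule i\<mu>[symmetric]) measurable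
      finally show "(\<integral>y. y ^ n \<partial>\<mu>) = (\<integral>y. y ^ n \<partial>\<nu>)"
        unfolding unit_moment[OF u\<mu>] unit_moment[OF u\<nu>] by simp
    qed
    then have "(\<integral>\<^sup>+y. indicator C y \<partial>\<mu>) = (\<integral>\<^sup>+y. indicator C y \<partial>\<nu>)" by simp
    then have "(\<integral>\<^sup>+z. indicator B (fst z) * indicator C (snd z) \<partial>P) = (\<integral>\<^sup>+u. indicator B u * (\<integral>\<^sup>+y. indicator C y \<partial>K u) \<partial>\<sigma>)"
      by (simp only: i\<mu> i\<nu> borel_measurable_indicator[OF C])
    moreover have "(\<integral>\<^sup>+z. indicator B (fst z) * indicator C (snd z) \<partial>P) = (\<integral>\<^sup>+z. indicator (B \<times> C) z \<partial>P)"
      by (intro nn_integral_cong) (auto simp: indicator_def)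
    moreover have "B \<times> C \<in> sets P" using B C by (simp add: sP)
    ultimately show ?thesis using C by (simp add: sK)
  qed
  define L where "L u = distr (K u) (S \<Otimes>\<^sub>M borel) (Pair u)" for u
  have Lm: "L \<in> S \<rightarrow>\<^sub>M subprob_algebra (S \<Otimes>\<^sub>M borel)"
    unfolding L_def by (rule measurable_distr2[OF _ Km]) simp
  then have Lm\<sigma>: "L \<in> \<sigma> \<rightarrow>\<^sub>M subprob_algebra (S \<Otimes>\<^sub>M borel)" using measurable_cong_sets[OF s\<sigma>(1) refl] by blast
  have iL: "(\<integral>\<^sup>+z. f z \<partial>L u) = (\<integral>\<^sup>+y. f (u, y) \<partial>K u)" if u: "u \<in> space S" and f[measurable]: "f \<in> borel_measurable (S \<Otimes>\<^sub>M borel)" for u f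
    unfolding L_def using u f by (intro nn_integral_distr) (simp_all add: measurable_cong_sets[OF sK refl])
  have iP': "(\<integral>\<^sup>+z. f z \<partial>(\<sigma> \<bind> L)) = (\<integral>\<^sup>+u. (\<integral>\<^sup>+y. f (u, y) \<partial>K u) \<partial>\<sigma>)" if f: "f \<in> borel_measurable (S \<Otimes>\<^sub>M borel)" for f
    unfolding nn_integral_bind[OF f Lm\<sigma>] using f by (intro nn_integral_cong iL) (simp_all add: s\<sigma>)
  have sP': "sets (\<sigma> \<bind> L) = sets (S \<Otimes>\<^sub>M borel)"
    by (rule sets_bind) (use ne in \<open>auto simp: L_def s\<sigma>\<close>)
  have "P = \<sigma> \<bind> L"
  proof (rule measure_eqI_generator_eq[where E="{a \<times> b |a b. a \<in> sets S \<and> b \<in> sets borel}" and \<Omega>="space S \<times> UNIV" and A="\<lambda>_. space S \<times> UNIV"])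
    show "Int_stable {a \<times> b |a b. a \<in> sets S \<and> b \<in> sets (borel :: real measure)}"
      by (rule Int_stable_pair_measure_generator)
    show "{a \<times> b |a b. a \<in> sets S \<and> b \<in> sets (borel :: real measure)} \<subseteq> Pow (space S \<times> UNIV)"
      using sets.sets_into_space by blast
    show "sets P = sigma_sets (space S \<times> UNIV) {a \<times> b |a b. a \<in> sets S \<and> b \<in> sets borel}"
      "sets (\<sigma> \<bind> L) = sigma_sets (space S \<times> UNIV) {a \<times> b |a b. a \<in> sets S \<and> b \<in> sets borel}"
      by (simp_all add: sP sP' sets_pair_measure)
    have "space S \<times> UNIV \<in> {a \<times> b |a b. a \<in> sets S \<and> b \<in> sets (borel :: real measure)}"
      using sets.top[of S] sets.top[of "borel :: real measure"] unfolding space_borel by blast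
    then show "range (\<lambda>_::nat. space S \<times> UNIV) \<subseteq> {a \<times> b |a b. a \<in> sets S \<and> b \<in> sets (borel :: real measure)}"
      by blast
    show "emeasure P (space S \<times> UNIV) \<noteq> \<infinity>" by (simp add: P.emeasure_eq_measure)
    fix X :: "('a \<times> real) set" assume "X \<in> {a \<times> b |a b. a \<in> sets S \<and> b \<in> sets borel}"
    then obtain B C where X: "X = B \<times> C" and B[measurable]: "B \<in> sets S" and C[measurable]: "C \<in> sets borel" by blast
    have "emeasure (\<sigma> \<bind> L) X = (\<integral>\<^sup>+z. indicator X z \<partial>(\<sigma> \<bind> L))" unfolding X by (simp add: sP')
    also have "\<dots> = (\<integral>\<^sup>+u. (\<integral>\<^sup>+y. indicator X (u, y) \<partial>K u) \<partial>\<sigma>)" unfolding X by (rule iP') measurable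
    also have "\<dots> = (\<integral>\<^sup>+u. indicator B u * emeasure (K u) C \<partial>\<sigma>)"
    proof (rule nn_integral_cong)
      fix u
      have "(\<integral>\<^sup>+y. indicator X (u, y) \<partial>K u) = (\<integral>\<^sup>+y. indicator B u * indicator C y \<partial>K u)"
        by (intro nn_integral_cong) (simp add: X indicator_times)
      also have "\<dots> = indicator B u * (\<integral>\<^sup>+y. indicator C y \<partial>K u)"
        by (rule nn_integral_cmult) (simp add: measurable_cong_sets[OF sK refl])
      finally show "(\<integral>\<^sup>+y. indicator X (u, y) \<partial>K u) = indicator B u * emeasure (K u) C" using C by (simp add: sK)
    qed
    also have "\<dots> = emeasure P X" unfolding X by (rule rect[OF B C])
    finally show "emeasure P X = emeasure (\<sigma> \<bind> L) X" by simp
  qed auto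
  then have "(\<integral>\<^sup>+z. f z \<partial>P) = (\<integral>\<^sup>+u. (\<integral>\<^sup>+y. f (u, y) \<partial>K u) \<partial>\<sigma>)" if "f \<in> borel_measurable (S \<Otimes>\<^sub>M borel)" for f
    using iP'[OF that] by simp
  then show ?thesis using K Km unfolding \<sigma>_def by blast
qed

section \<open>Tempered representations from a mixing measure\<close>

text \<open>
  The converse of Bernstein's theorem, with joint measurability. A Bernstein family constrains \<open>q0\<close> only at positive
  arguments; replacing it by the integral itself makes all derivatives those of a Laplace transform.
\<close>

lemma laplace_tempering_pair:
  fixes Qu :: "'a::euclidean_space \<Rightarrow> real measure"
  assumes Q: "bernstein_family p q0 Qu" and p: "0 < p" and s\<sigma>: "sets \<sigma> = sets sphere_space" and fin: "finite_measure \<sigma>"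
    and pos: "\<And>u. u \<in> sphere 0 1 \<Longrightarrow> 0 < q0 1 u"
  defines "q \<equiv> (\<lambda>r u. \<integral>s. exp (- r * s) \<partial>Qu u)"
  shows "tempering_pair q \<sigma>" "bernstein_family p q Qu"
proof -
  have em: "(\<lambda>s. exp (- r * s)) \<in> borel_measurable (Qu u)" if "u \<in> sphere 0 1" for u r
    unfolding measurable_cong_sets[OF bernstein_sets[OF Q that] refl] by (intro measurable_restrict_space1) simp
  have int: "integrable (Qu u) (\<lambda>s. exp (- r * s))" if "u \<in> sphere 0 1" "0 < r" for u r
    using bernstein_transform[OF Q p that] em[OF that(1), of r] by (intro integrableI_nonneg) auto
  have qeq: "(\<integral>\<^sup>+s. ennreal (exp (- r * s)) \<partial>Qu u) = ennreal (q r u)" if "u \<in> sphere 0 1" "0 < r" for u r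
    unfolding q_def by (rule nn_integral_eq_integral[OF int[OF that]]) simp
  show B: "bernstein_family p q Qu"
    using Q unfolding bernstein_family_def by (auto simp: qeq[symmetric])
  have idm: "(\<lambda>s. s) \<in> borel_measurable (Qu u)" if "u \<in> sphere 0 1" for u
    unfolding measurable_cong_sets[OF bernstein_sets[OF Q that] refl] by (rule halfline_space_id)
  have ae: "AE s in distr (Qu u) borel (\<lambda>s. s). 0 < s" if u: "u \<in> sphere 0 1" for u
  proof (subst AE_distr_iff[OF idm[OF u]])
    show "AE s in Qu u. 0 < s" by (rule AE_I2) (use bernstein_space[OF Q u] in auto)
  qed simp
  have lap: "laplace_measure (distr (Qu u) borel (\<lambda>s. s))" if u: "u \<in> sphere 0 1" for u
  proof
    show "AE s in distr (Qu u) borel (\<lambda>s. s). 0 \<le> s" using ae[OF u] by eventually_elim simp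
    show "integrable (distr (Qu u) borel (\<lambda>s. s)) (\<lambda>s. exp (- r * s))" if "0 < r" for r
      using int[OF u that] by (subst integrable_distr_eq[OF idm[OF u]]) simp_all
  qed simp
  have qN: "(\<lambda>r. q r u) = (\<lambda>r. \<integral>s. exp (- r * s) \<partial>distr (Qu u) borel (\<lambda>s. s))" if u: "u \<in> sphere 0 1" for u
    unfolding q_def by (subst integral_distr[OF idm[OF u]]) simp_all
  show "tempering_pair q \<sigma>"
    unfolding tempering_pair_def
  proof (intro conjI ballI allI impI)
    fix u :: 'a assume u: "u \<in> sphere 0 1"
    show "completely_monotone (\<lambda>r. q r u)"
      unfolding qN[OF u] by (rule laplace_measure.completely_monotone_laplace[OF lap[OF u]])
    show "((\<lambda>r. q r u) \<longlongrightarrow> 0) at_top"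
      unfolding qN[OF u] by (rule laplace_measure.laplace_tendsto_0[OF lap[OF u] ae[OF u]])
    fix r :: real assume r: "0 < r"
    have "0 \<le> q r u" unfolding q_def by (rule integral_nonneg_AE) simp
    moreover have "q r u \<noteq> 0"
    proof
      assume "q r u = 0"
      then have "(\<integral>\<^sup>+s. ennreal (exp (- r * s)) \<partial>Qu u) = 0" using qeq[OF u r] by simp
      then have "AE s in Qu u. ennreal (exp (- r * s)) = 0"
        using em[OF u, of r] by (subst (asm) nn_integral_0_iff_AE) auto
      then have "AE s in Qu u. ennreal (exp (- 1 * s)) = 0" by eventually_elim simp
      then have "(\<integral>\<^sup>+s. ennreal (exp (- 1 * s)) \<partial>Qu u) = 0"
        using em[OF u, of 1] by (subst nn_integral_0_iff_AE) auto
      then show False using bernstein_transform[OF Q p u zero_less_one] pos[OF u] by simp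
    qed
    ultimately show "0 < q r u" by simp
  next
    define m where "m u = (\<integral>\<^sup>+s. ennreal (exp (- s)) \<partial>Qu u)" for u
    have [measurable]: "m \<in> borel_measurable sphere_space"
      unfolding m_def by (rule bernstein_integral_measurable[OF Q]) measurable
    have Km: "(\<lambda>z. bernstein_kernel Qu (snd z)) \<in> (halfline_space \<Otimes>\<^sub>M sphere_space) \<rightarrow>\<^sub>M subprob_algebra halfline_space"
      by (rule measurable_compose[OF measurable_snd bernstein_kernel_measurable[OF Q p]])
    have [measurable]: "(\<lambda>x. snd x) \<in> borel_measurable (N \<Otimes>\<^sub>M halfline_space)"
      "(\<lambda>x. fst (fst x)) \<in> borel_measurable ((halfline_space \<Otimes>\<^sub>M (sphere_space :: 'a measure)) \<Otimes>\<^sub>M halfline_space)" for N :: "(real \<times> 'a) measure"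
      by (rule measurable_compose[OF measurable_snd halfline_space_id])
         (rule measurable_compose[OF measurable_fst measurable_compose[OF measurable_fst halfline_space_id]])
    have "(\<lambda>z. \<integral>\<^sup>+s. ennreal (exp (- fst z * s)) * (ennreal (exp s) * (1 + m (snd z))) \<partial>bernstein_kernel Qu (snd z))
        \<in> borel_measurable (halfline_space \<Otimes>\<^sub>M sphere_space)"
      by (rule nn_integral_measurable_subprob_algebra2[OF _ Km]) measurable
    then have "(\<lambda>z. enn2real (\<integral>\<^sup>+s. ennreal (exp (- fst z * s)) * (ennreal (exp s) * (1 + m (snd z))) \<partial>bernstein_kernel Qu (snd z)))
        \<in> borel_measurable (halfline_space \<Otimes>\<^sub>M sphere_space)" by measurable
    then show "(\<lambda>(r, u). q r u) \<in> borel_measurable (halfline_space \<Otimes>\<^sub>M sphere_space)"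
    proof (rule measurable_cong[THEN iffD1, rotated])
      fix z :: "real \<times> 'a" assume "z \<in> space (halfline_space \<Otimes>\<^sub>M sphere_space)"
      then obtain r u where z: "z = (r, u)" and r: "0 < r" and u: "u \<in> sphere 0 1" by (auto simp: space_pair_measure)
      have "(\<integral>\<^sup>+s. ennreal (exp (- r * s)) * (ennreal (exp s) * (1 + m u)) \<partial>bernstein_kernel Qu u) = (\<integral>\<^sup>+s. ennreal (exp (- r * s)) \<partial>Qu u)"
        unfolding m_def by (rule bernstein_kernel_inverse[OF Q p u exp_halfline_measurable, symmetric])
      also have "\<dots> = ennreal (q r u)" by (rule qeq[OF u r])
      finally show "enn2real (\<integral>\<^sup>+s. ennreal (exp (- fst z * s)) * (ennreal (exp s) * (1 + m (snd z))) \<partial>bernstein_kernel Qu (snd z)) = (case z of (r, u) \<Rightarrow> q r u)"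
        by (simp add: z q_def integral_nonneg_AE)
    qed
  qed (use s\<sigma> fin in auto)
qed

text \<open>
  The finite measure \<open>polar_measure p \<alpha> R\<close>, with its second coordinate moved to the unit interval by \<open>exp (- s)\<close>, is disintegrated over the
  direction. The integrability conditions make the Laplace transforms of the conditional measures finite for almost every direction, and
  undoing the weight \<open>exp (- s)\<close> gives the Bernstein measures.
\<close>

theorem polar_disintegration_exists:
  fixes R :: "'a::euclidean_space measure"
  assumes p: "0 < p" and R: "integrability_conditions \<alpha> R" and sR: "sets R = sets borel"
  shows "\<exists>q \<sigma> Qu. tempering_pair q \<sigma> \<and> bernstein_family p q Qu \<and> polar_disintegration p \<alpha> R \<sigma> Qu"
proof -
  note [measurable_cong] = sR
  obtain u0 :: 'a where u0: "norm u0 = 1" using vector_choose_size[of 1] by auto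
  \<comment> \<open>The fixed unit vector only serves points whose first coordinate is not a direction; they form a null set.\<close>
  define \<phi> where "\<phi> z = (if norm (fst z) = 1 then fst z else u0, exp (- snd z))" for z :: "'a \<times> real"
  have \<phi>1: "(\<lambda>z :: 'a \<times> real. if norm (fst z) = 1 then fst z else u0) \<in> (borel \<Otimes>\<^sub>M borel) \<rightarrow>\<^sub>M sphere_space"
  proof (rule measurable_restrict_space2)
    show "(\<lambda>z :: 'a \<times> real. if norm (fst z) = 1 then fst z else u0) \<in> borel_measurable (borel \<Otimes>\<^sub>M borel)" by measurable
  qed (use u0 in auto)
  then have \<phi>[measurable]: "\<phi> \<in> (borel \<Otimes>\<^sub>M borel) \<rightarrow>\<^sub>M (sphere_space \<Otimes>\<^sub>M borel)"
    unfolding \<phi>_def[abs_def] by (rule measurable_Pair) measurable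
  define PM where "PM = polar_measure p \<alpha> R"
  have sPM: "sets PM = sets (borel \<Otimes>\<^sub>M borel)" by (simp add: PM_def polar_measure_def)
  note [measurable_cong] = sPM
  interpret PM: finite_measure PM unfolding PM_def by (rule polar_measure_finite[OF p R sR])
  define P where "P = distr PM (sphere_space \<Otimes>\<^sub>M borel) \<phi>"
  interpret P: finite_measure P unfolding P_def by (rule PM.finite_measure_distr) measurable
  have R0: "emeasure R {0} = 0" using R by (simp add: integrability_conditions_def)
  have aePM: "AE z in PM. norm (fst z) = 1 \<and> 0 < snd z"
  proof -
    have "AE x in R. x \<noteq> 0" using R0 sR by (intro AE_I[of _ _ "{0}"]) auto
    then have "AE x in density R (\<lambda>x. ennreal (norm x powr \<alpha> * exp (- 1 * norm x powr (- p)))). norm (direction x) = 1 \<and> 0 < norm x powr (- p)"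
      by (subst AE_density, measurable) (elim eventually_mono, simp add: norm_direction)
    moreover have "{z \<in> space (borel \<Otimes>\<^sub>M borel). norm (fst z) = 1 \<and> 0 < snd z} \<in> sets ((borel :: 'a measure) \<Otimes>\<^sub>M (borel :: real measure))"
      by measurable
    moreover have "(\<lambda>x. (direction x, norm x powr (- p))) \<in> density R (\<lambda>x. ennreal (norm x powr \<alpha> * exp (- 1 * norm x powr (- p)))) \<rightarrow>\<^sub>M borel \<Otimes>\<^sub>M borel"
      by measurable
    ultimately show ?thesis unfolding PM_def polar_measure_def by (subst AE_distr_iff) (assumption | simp only: fst_conv snd_conv)+
  qed
  have iP: "(\<integral>\<^sup>+z. f z \<partial>P) = (\<integral>\<^sup>+z. f (\<phi> z) \<partial>PM)" if "f \<in> borel_measurable (sphere_space \<Otimes>\<^sub>M borel)" for f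
    unfolding P_def using that by (intro nn_integral_distr) simp_all
  have aeP: "AE z in P. 0 < snd z \<and> snd z < 1"
  proof -
    have "AE z in PM. 0 < snd (\<phi> z) \<and> snd (\<phi> z) < 1" using aePM by eventually_elim (simp add: \<phi>_def)
    moreover have "{z \<in> space (sphere_space \<Otimes>\<^sub>M borel). 0 < snd z \<and> snd z < 1} \<in> sets ((sphere_space :: 'a measure) \<Otimes>\<^sub>M (borel :: real measure))"
      by measurable
    moreover have "\<phi> \<in> PM \<rightarrow>\<^sub>M (sphere_space \<Otimes>\<^sub>M borel)" unfolding measurable_cong_sets[OF sPM refl] by (rule \<phi>)
    ultimately show ?thesis unfolding P_def by (subst AE_distr_iff) assumption+
  qed
  have sP: "sets P = sets (sphere_space \<Otimes>\<^sub>M borel)" by (simp add: P_def)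
  define \<sigma> where "\<sigma> = distr P sphere_space fst"
  have fstm: "fst \<in> P \<rightarrow>\<^sub>M sphere_space" unfolding measurable_cong_sets[OF sP refl] by measurable
  have fin\<sigma>: "finite_measure \<sigma>" unfolding \<sigma>_def by (rule P.finite_measure_distr[OF fstm])
  have s\<sigma>: "sets \<sigma> = sets sphere_space" "space \<sigma> = sphere 0 1" by (simp_all add: \<sigma>_def)
  have "space (sphere_space :: 'a measure) \<noteq> {}" using u0 by (auto intro!: exI[of _ u0])
  moreover have "AE z in P. 0 \<le> snd z \<and> snd z \<le> 1" using aeP by eventually_elim simp
  ultimately obtain K :: "'a \<Rightarrow> real measure" where Km[measurable]: "K \<in> sphere_space \<rightarrow>\<^sub>M subprob_algebra borel"
    and KK: "\<forall>u\<in>space sphere_space. prob_space (K u) \<and> unit_interval_measure (K u)"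
    and KP': "\<forall>f\<in>borel_measurable (sphere_space \<Otimes>\<^sub>M borel). (\<integral>\<^sup>+z. f z \<partial>P) = (\<integral>\<^sup>+u. (\<integral>\<^sup>+y. f (u, y) \<partial>K u) \<partial>\<sigma>)"
    using unit_interval_disintegration[OF P.finite_measure_axioms sP] unfolding \<sigma>_def by blast
  have K: "prob_space (K u)" "sets (K u) = sets borel" if "u \<in> sphere 0 1" for u
    using KK that by (simp_all add: unit_interval_measure_def)
  have KP: "(\<integral>\<^sup>+z. f z \<partial>P) = (\<integral>\<^sup>+u. (\<integral>\<^sup>+y. f (u, y) \<partial>K u) \<partial>\<sigma>)" if "f \<in> borel_measurable (sphere_space \<Otimes>\<^sub>M borel)" for f
    using KP' that by blast
  define \<tau> where "\<tau> r u = (\<integral>\<^sup>+y. ennreal (y powr (r - 1)) \<partial>K u)" for r u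
  have \<tau>[measurable]: "\<tau> r \<in> borel_measurable sphere_space" for r
    unfolding \<tau>_def by (rule nn_integral_measurable_subprob_algebra2[OF _ Km]) measurable
  have \<nu>[measurable]: "(\<lambda>u. \<integral>\<^sup>+y. indicator (- {0<..<1}) y \<partial>K u) \<in> borel_measurable sphere_space"
    by (rule nn_integral_measurable_subprob_algebra2[OF _ Km]) measurable
  \<comment> \<open>The good directions. Finiteness along \<open>r = 1 / (n + 1)\<close> implies finiteness for all positive \<open>r\<close>, since \<open>y powr (r - 1)\<close> decreases in \<open>r\<close>.\<close>
  define G where "G = {u \<in> space sphere_space. (\<integral>\<^sup>+y. indicator (- {0<..<1}) y \<partial>K u) = 0 \<and> (\<forall>n. \<tau> (1 / real (Suc n)) u \<noteq> \<infinity>)}"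
  have G[measurable]: "G \<in> sets sphere_space" unfolding G_def by measurable
  have mc: "f \<in> borel_measurable sphere_space \<Longrightarrow> f \<in> borel_measurable \<sigma>" for f :: "'a \<Rightarrow> ennreal"
    unfolding measurable_cong_sets[OF s\<sigma>(1) refl] .
  have aeG: "AE u in \<sigma>. u \<in> G"
  proof -
    have "(\<integral>\<^sup>+u. (\<integral>\<^sup>+y. indicator (- {0<..<1}) y \<partial>K u) \<partial>\<sigma>) = (\<integral>\<^sup>+z. indicator (- {0<..<1}) (snd z) \<partial>P)"
      by (subst KP) simp_all
    also have "\<dots> = 0"
    proof (subst nn_integral_0_iff_AE)
      show "AE z in P. indicator (- {0<..<1}) (snd z) = (0::ennreal)" using aeP by eventually_elim simp
      show "(\<lambda>z. indicator (- {0<..<1}) (snd z) :: ennreal) \<in> borel_measurable P"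
        unfolding measurable_cong_sets[OF sP refl] by measurable
    qed
    finally have 1: "AE u in \<sigma>. (\<integral>\<^sup>+y. indicator (- {0<..<1}) y \<partial>K u) = 0"
      by (subst (asm) nn_integral_0_iff_AE) (use mc[OF \<nu>] in auto)
    have "AE u in \<sigma>. \<tau> r u \<noteq> \<infinity>" if r: "0 < r" for r
    proof (rule nn_integral_PInf_AE)
      show "\<tau> r \<in> borel_measurable \<sigma>" by (rule mc[OF \<tau>])
      have "(\<integral>\<^sup>+u. \<tau> r u \<partial>\<sigma>) = (\<integral>\<^sup>+z. ennreal (snd z powr (r - 1)) \<partial>P)"
        unfolding \<tau>_def by (subst KP) simp_all
      also have "\<dots> = (\<integral>\<^sup>+z. ennreal (exp (- snd z) powr (r - 1)) \<partial>PM)"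
        by (subst iP) (simp_all add: \<phi>_def)
      also have "\<dots> = (\<integral>\<^sup>+x. ennreal (norm x powr \<alpha> * exp (- 1 * norm x powr (- p))) * ennreal (exp (- (norm x powr (- p))) powr (r - 1)) \<partial>R)"
        unfolding PM_def by (subst nn_integral_polar_measure[OF sR]) simp_all
      also have "\<dots> = (\<integral>\<^sup>+x. ennreal (norm x powr \<alpha> * exp (- r * norm x powr (- p))) \<partial>R)"
      proof (intro nn_integral_cong)
        fix x :: 'a
        define s where "s = norm x powr (- p)"
        have "exp (- 1 * s) * exp (- s) powr (r - 1) = exp (- r * s)"
          by (simp add: powr_def exp_add[symmetric] algebra_simps)
        then show "ennreal (norm x powr \<alpha> * exp (- 1 * norm x powr (- p))) * ennreal (exp (- (norm x powr (- p))) powr (r - 1)) =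
            ennreal (norm x powr \<alpha> * exp (- r * norm x powr (- p)))"
          unfolding s_def[symmetric] by (simp add: ennreal_mult[symmetric] mult.assoc)
      qed
      also have "\<dots> < \<top>" by (rule stable_weight_integrable[OF p R sR r])
      finally show "(\<integral>\<^sup>+u. \<tau> r u \<partial>\<sigma>) \<noteq> \<infinity>" by simp
    qed
    then have "AE u in \<sigma>. \<forall>n. \<tau> (1 / real (Suc n)) u \<noteq> \<infinity>" unfolding AE_all_countable by simp
    then show ?thesis using 1 AE_space
    proof eventually_elim
      case (elim u)
      then show ?case unfolding G_def s\<sigma>(2) space_sphere_space by blast
    qed
  qed
  \<comment> \<open>On the null set of bad directions any measure with finite transform will do.\<close>
  define K' where "K' u = (if u \<in> G then K u else return borel (1 / 2))" for u
  have G0: "G \<inter> sphere 0 1 = G" by (auto simp: G_def)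
  have K'm[measurable]: "K' \<in> sphere_space \<rightarrow>\<^sub>M subprob_algebra borel"
    unfolding K'_def using G by (intro measurable_If_set Km measurable_const) (auto simp: space_subprob_algebra prob_space_imp_subprob_space prob_space_return G0)
  have aeK': "AE y in K' u. 0 < y \<and> y < 1" if u: "u \<in> sphere 0 1" for u
  proof (cases "u \<in> G")
    case True
    then have "(\<integral>\<^sup>+y. indicator (- {0<..<1::real}) y \<partial>K u) = 0" by (simp add: G_def)
    then have "AE y in K u. indicator (- {0<..<1::real}) y = (0::ennreal)"
      by (subst (asm) nn_integral_0_iff_AE) (simp_all add: measurable_cong_sets[OF K(2)[OF u] refl])
    then have "AE y in K u. 0 < y \<and> y < 1" by eventually_elim (simp add: indicator_def split: if_splits)
    then show ?thesis unfolding K'_def if_P[OF True] .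
  next
    case False
    have "AE y in return borel (1 / 2::real). 0 < y \<and> y < 1" by (subst AE_return) auto
    then show ?thesis unfolding K'_def if_not_P[OF False] .
  qed
  define q0 where "q0 r u = enn2real (\<integral>\<^sup>+y. ennreal (y powr (r - 1)) \<partial>K' u)" for r u
  have q0: "(\<integral>\<^sup>+y. ennreal (y powr (r - 1)) \<partial>K' u) = ennreal (q0 r u)" if u: "u \<in> sphere 0 1" and r: "0 < r" for r u
  proof -
    have "(\<integral>\<^sup>+y. ennreal (y powr (r - 1)) \<partial>K' u) < \<top>"
    proof (cases "u \<in> G")
      case True
      obtain n where n: "1 / real (Suc n) < r" using nat_approx_posE[OF r] by blast
      have "(\<integral>\<^sup>+y. ennreal (y powr (r - 1)) \<partial>K' u) \<le> (\<integral>\<^sup>+y. ennreal (y powr (1 / real (Suc n) - 1)) \<partial>K' u)"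
      proof (rule nn_integral_mono_AE)
        show "AE y in K' u. ennreal (y powr (r - 1)) \<le> ennreal (y powr (1 / real (Suc n) - 1))"
          using aeK'[OF u] by eventually_elim (use n in \<open>auto intro!: ennreal_leI powr_mono'\<close>)
      qed
      also have "\<dots> < \<top>" using True by (simp add: K'_def G_def \<tau>_def less_top)
      finally show ?thesis .
    next
      case False
      then show ?thesis by (simp add: K'_def nn_integral_return)
    qed
    then show ?thesis by (simp add: q0_def)
  qed
  have "\<exists>Qu. bernstein_family p q0 Qu \<and> (\<forall>u\<in>sphere 0 1. \<forall>h\<in>borel_measurable halfline_space.
    (\<integral>\<^sup>+s. h s \<partial>Qu u) = (\<integral>\<^sup>+x. ennreal 1 * ennreal (exp (neg_log x)) * h (neg_log x) \<partial>K' u))"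
    by (rule bernstein_family_from_unit_kernel[OF K'm aeK']) (simp_all add: q0)
  then obtain Qu where Qu: "bernstein_family p q0 Qu" and iQ: "\<And>u h. u \<in> sphere 0 1 \<Longrightarrow> h \<in> borel_measurable halfline_space \<Longrightarrow>
    (\<integral>\<^sup>+s. h s \<partial>Qu u) = (\<integral>\<^sup>+x. ennreal (exp (neg_log x)) * h (neg_log x) \<partial>K' u)" by auto
  have pK': "prob_space (K' u)" if "u \<in> sphere 0 1" for u using K(1)[OF that] by (simp add: K'_def prob_space_return)
  have pos: "0 < q0 1 u" if u: "u \<in> sphere 0 1" for u
  proof -
    have "ennreal (q0 1 u) = (\<integral>\<^sup>+y. ennreal (y powr (1 - 1)) \<partial>K' u)" by (rule q0[OF u, symmetric]) simp
    also have "\<dots> = (\<integral>\<^sup>+y. 1 \<partial>K' u)" by (rule nn_integral_cong_AE) (use aeK'[OF u] in eventually_elim, simp)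
    also have "\<dots> = 1" using prob_space.emeasure_space_1[OF pK'[OF u]] by simp
    finally show ?thesis by (simp add: ennreal_eq_1)
  qed
  note LT = laplace_tempering_pair[OF Qu p s\<sigma>(1) fin\<sigma> pos]
  have "polar_disintegration p \<alpha> R \<sigma> Qu"
    unfolding polar_disintegration_def
  proof
    fix F :: "'a \<Rightarrow> ennreal" assume F[measurable]: "F \<in> borel_measurable borel"
    define h where "h u s = F ((s powr (- 1 / p)) *\<^sub>R u) * ennreal (s powr (\<alpha> / p))" for u s
    define f where "f z = ennreal (exp (neg_log (snd z))) * h (fst z) (neg_log (snd z))" for z :: "'a \<times> real"
    have [measurable]: "fst \<in> (sphere_space \<Otimes>\<^sub>M (borel :: real measure)) \<rightarrow>\<^sub>M (borel :: 'a measure)"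
      by (rule measurable_compose[OF measurable_fst sphere_space_id])
    have f: "f \<in> borel_measurable (sphere_space \<Otimes>\<^sub>M borel)" unfolding f_def h_def by measurable
    have hm: "h u \<in> borel_measurable halfline_space" for u unfolding h_def by (intro measurable_restrict_space1) measurable
    have "(\<integral>\<^sup>+x. F x \<partial>R) = (\<integral>\<^sup>+(u, s). F ((s powr (- 1 / p)) *\<^sub>R u) * ennreal (s powr (\<alpha> / p) * exp s) \<partial>PM)"
      unfolding PM_def by (rule integral_from_polar_measure[OF p R0 sR F])
    also have "\<dots> = (\<integral>\<^sup>+z. f (\<phi> z) \<partial>PM)"
    proof (rule nn_integral_cong_AE)
      show "AE z in PM. (case z of (u, s) \<Rightarrow> F ((s powr (- 1 / p)) *\<^sub>R u) * ennreal (s powr (\<alpha> / p) * exp s)) = f (\<phi> z)"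
        using aePM by eventually_elim (auto simp: f_def h_def \<phi>_def neg_log_def ennreal_mult mult_ac)
    qed
    also have "\<dots> = (\<integral>\<^sup>+z. f z \<partial>P)" by (rule iP[OF f, symmetric])
    also have "\<dots> = (\<integral>\<^sup>+u. (\<integral>\<^sup>+y. f (u, y) \<partial>K u) \<partial>\<sigma>)" by (rule KP[OF f])
    also have "\<dots> = (\<integral>\<^sup>+u. (\<integral>\<^sup>+y. f (u, y) \<partial>K' u) \<partial>\<sigma>)"
      by (rule nn_integral_cong_AE) (use aeG in eventually_elim, simp add: K'_def)
    also have "\<dots> = (\<integral>\<^sup>+u. (\<integral>\<^sup>+s. h u s \<partial>Qu u) \<partial>\<sigma>)"
      by (rule nn_integral_cong) (simp add: s\<sigma> iQ[OF _ hm] f_def)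
    finally show "(\<integral>\<^sup>+x. F x \<partial>R) = (\<integral>\<^sup>+u. (\<integral>\<^sup>+s. F ((s powr (- 1 / p)) *\<^sub>R u) * ennreal (s powr (\<alpha> / p)) \<partial>Qu u) \<partial>\<sigma>)"
      unfolding h_def .
  qed
  then show ?thesis using LT by blast
qed

section \<open>Normalized representations and the main theorem\<close>

text \<open>
  Monotone convergence: \<open>exp (- r * s)\<close> increases to 1 as \<open>r\<close> decreases to 0.
\<close>

lemma bernstein_mass_limit:
  assumes Q: "bernstein_family p q Qu" and p: "0 < p" and u: "u \<in> sphere 0 1"
  shows "(\<lambda>n. ennreal (q (1 / real (Suc n)) u)) \<longlonglongrightarrow> emeasure (Qu u) (space (Qu u))"
proof -
  \<comment> \<open>The maximum with 0 changes nothing on the half line and makes the sequence monotone on the whole line.\<close>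
  define f where "f n s = ennreal (exp (- (1 / real (Suc n)) * max 0 s))" for n s
  have "(\<lambda>n. \<integral>\<^sup>+s. f n s \<partial>Qu u) \<longlonglongrightarrow> (\<integral>\<^sup>+s. 1 \<partial>Qu u)"
  proof (rule nn_integral_LIMSEQ)
    show "incseq f"
    proof (intro incseq_SucI le_funI)
      fix n and s :: real
      have "1 / real (Suc (Suc n)) * max 0 s \<le> 1 / real (Suc n) * max 0 s"
        by (intro mult_right_mono) (auto simp: frac_le)
      then show "f n s \<le> f (Suc n) s" by (simp add: f_def)
    qed
    show "f n \<in> borel_measurable (Qu u)" for n
      unfolding measurable_cong_sets[OF bernstein_sets[OF Q u] refl] f_def by (intro measurable_restrict_space1) measurable
    show "(\<lambda>n. f n s) \<longlonglongrightarrow> 1" for s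
    proof -
      have "(\<lambda>n. exp (- (1 / real (Suc n)) * max 0 s)) \<longlonglongrightarrow> exp (- 0 * max 0 s)"
        by (intro tendsto_intros LIMSEQ_inverse_real_of_nat[unfolded inverse_eq_divide])
      then have "(\<lambda>n. f n s) \<longlonglongrightarrow> ennreal (exp (- 0 * max 0 s))" unfolding f_def by (rule tendsto_ennrealI)
      then show ?thesis by simp
    qed
  qed
  moreover have "(\<integral>\<^sup>+s. f n s \<partial>Qu u) = ennreal (q (1 / real (Suc n)) u)" for n
  proof -
    have "(\<integral>\<^sup>+s. f n s \<partial>Qu u) = (\<integral>\<^sup>+s. ennreal (exp (- (1 / real (Suc n)) * s)) \<partial>Qu u)"
      by (rule nn_integral_cong) (simp add: bernstein_space[OF Q u] f_def)
    also have "\<dots> = ennreal (q (1 / real (Suc n)) u)" by (rule bernstein_transform[OF Q p u]) simp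
    finally show ?thesis .
  qed
  ultimately show ?thesis by simp
qed

lemma normalized_imp_bernstein_mass_1:
  assumes Q: "bernstein_family p q Qu" and p: "0 < p" and u: "u \<in> sphere 0 1" and q: "normalized_tempering q"
  shows "emeasure (Qu u) (space (Qu u)) = 1"
proof -
  have "filterlim (\<lambda>n. 1 / real (Suc n)) (at_right 0) sequentially"
    by real_asymp
  then have "(\<lambda>n. q (1 / real (Suc n)) u) \<longlonglongrightarrow> 1"
    using q u unfolding normalized_tempering_def by (auto intro: filterlim_compose)
  then have "(\<lambda>n. ennreal (q (1 / real (Suc n)) u)) \<longlonglongrightarrow> ennreal 1" by (rule tendsto_ennrealI)
  from LIMSEQ_unique[OF bernstein_mass_limit[OF Q p u] this] show ?thesis by simp
qed

lemma laplace_transform_tendsto_mass: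
  assumes sN: "sets N = sets halfline_space" and N: "emeasure N (space N) = 1"
  shows "((\<lambda>r. \<integral>s. exp (- r * s) \<partial>N) \<longlongrightarrow> 1) (at_right 0)"
proof -
  interpret N: prob_space N using N by (rule prob_spaceI)
  have sp: "space N = {0<..}" using sets_eq_imp_space_eq[OF sN] by simp
  have "((\<lambda>r. \<integral>s. exp (- inverse r * s) \<partial>N) \<longlongrightarrow> (\<integral>s. 1 \<partial>N)) at_top"
  proof (rule integral_dominated_convergence_at_top[where w="\<lambda>_. 1"])
    show "(\<lambda>s. exp (- inverse r * s)) \<in> borel_measurable N" for r
      unfolding measurable_cong_sets[OF sN refl] by (intro measurable_restrict_space1) simp
    show "AE s in N. ((\<lambda>r. exp (- inverse r * s)) \<longlongrightarrow> 1) at_top"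
      by (rule AE_I2) real_asymp
    show "\<forall>\<^sub>F r in at_top. AE s in N. norm (exp (- inverse r * s)) \<le> 1"
      using eventually_gt_at_top[of 0] by eventually_elim (auto intro!: AE_I2 simp: sp)
  qed simp_all
  then show ?thesis unfolding filterlim_at_right_to_top by (simp add: N.prob_space)
qed

text \<open>
  At \<open>x = (s powr (- 1 / p)) *\<^sub>R u\<close> the factor \<open>norm x powr \<alpha>\<close> cancels the weight \<open>s powr (\<alpha> / p)\<close> of the polar formula, so each direction
  contributes the total mass of its Bernstein measure.
\<close>

lemma alpha_moment_cone:
  fixes R :: "'a::euclidean_space measure"
  assumes Q: "bernstein_family p q Qu" and p: "0 < p" and s\<sigma>: "sets \<sigma> = sets sphere_space"
    and R: "polar_disintegration p \<alpha> R \<sigma> Qu" and B[measurable]: "B \<in> sets borel"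
  shows "(\<integral>\<^sup>+x. indicator B (direction x) * ennreal (norm x powr \<alpha>) \<partial>R) = (\<integral>\<^sup>+u. indicator B u * emeasure (Qu u) (space (Qu u)) \<partial>\<sigma>)"
proof -
  have "(\<integral>\<^sup>+x. indicator B (direction x) * ennreal (norm x powr \<alpha>) \<partial>R) =
    (\<integral>\<^sup>+u. (\<integral>\<^sup>+s. (indicator B (direction ((s powr (- 1 / p)) *\<^sub>R u)) * ennreal (norm ((s powr (- 1 / p)) *\<^sub>R u) powr \<alpha>)) * ennreal (s powr (\<alpha> / p)) \<partial>Qu u) \<partial>\<sigma>)"
    using R unfolding polar_disintegration_def by (elim ballE[where x="\<lambda>x. indicator B (direction x) * ennreal (norm x powr \<alpha>)"]) (simp, measurable)
  also have "\<dots> = (\<integral>\<^sup>+u. indicator B u * emeasure (Qu u) (space (Qu u)) \<partial>\<sigma>)"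
  proof (rule nn_integral_cong)
    fix u assume "u \<in> space \<sigma>"
    then have u: "u \<in> sphere 0 1" using sigma_space[OF Q p s\<sigma>] by simp
    have "(\<integral>\<^sup>+s. (indicator B (direction ((s powr (- 1 / p)) *\<^sub>R u)) * ennreal (norm ((s powr (- 1 / p)) *\<^sub>R u) powr \<alpha>)) * ennreal (s powr (\<alpha> / p)) \<partial>Qu u) =
      (\<integral>\<^sup>+s. indicator B u \<partial>Qu u)"
    proof (rule nn_integral_cong)
      fix s assume "s \<in> space (Qu u)"
      then have s: "0 < s" using bernstein_space[OF Q u] by auto
      have d: "direction ((s powr (- 1 / p)) *\<^sub>R u) = u" using s u by (subst direction_scaleR) (auto simp: direction_def)
      have n: "norm ((s powr (- 1 / p)) *\<^sub>R u) powr \<alpha> = s powr (- (\<alpha> / p))" using u by (simp add: powr_powr)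
      have "ennreal (s powr (- (\<alpha> / p))) * ennreal (s powr (\<alpha> / p)) = 1"
        using s by (simp add: ennreal_mult[symmetric] powr_add[symmetric])
      then show "(indicator B (direction ((s powr (- 1 / p)) *\<^sub>R u)) * ennreal (norm ((s powr (- 1 / p)) *\<^sub>R u) powr \<alpha>)) * ennreal (s powr (\<alpha> / p)) = indicator B u"
        unfolding d n by (simp add: mult.assoc)
    qed
    then show "(\<integral>\<^sup>+s. (indicator B (direction ((s powr (- 1 / p)) *\<^sub>R u)) * ennreal (norm ((s powr (- 1 / p)) *\<^sub>R u) powr \<alpha>)) * ennreal (s powr (\<alpha> / p)) \<partial>Qu u) =
      indicator B u * emeasure (Qu u) (space (Qu u))" by simp
  qed
  finally show ?thesis .
qed

lemma tempered_representation_mixture: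
  assumes M: "tempered_representation p \<alpha> M q \<sigma>" and p: "0 < p" and R: "associated_measure p \<alpha> q \<sigma> R"
  shows "sets R = sets borel" "\<And>B. B \<in> sets borel \<Longrightarrow> emeasure M B = levy_mixture p \<alpha> R B"
proof -
  have q: "tempering_pair q \<sigma>" and MB: "\<And>B. B \<in> sets borel \<Longrightarrow> emeasure M B = polar_tempered p \<alpha> q \<sigma> B"
    using M by (auto simp: tempered_representation_def)
  have s\<sigma>: "sets \<sigma> = sets sphere_space" using q by (simp add: tempering_pair_def)
  obtain Qu where Qu: "bernstein_family p q Qu" "polar_disintegration p \<alpha> R \<sigma> Qu" "sets R = sets borel"
    using associated_measure_disintegration[OF R p s\<sigma>] by blast
  have q0: "0 \<le> q r u" if "u \<in> sphere 0 1" "0 < r" for r u using q that by (auto simp: tempering_pair_def intro: less_imp_le)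
  show "sets R = sets borel" by fact
  show "emeasure M B = levy_mixture p \<alpha> R B" if "B \<in> sets borel" for B
    using levy_mixture_eq_polar_tempered[OF Qu(1) p s\<sigma> Qu(2) q0 that] MB[OF that] by simp
qed

lemma integrability_conditions_of_levy:
  assumes p: "0 < p" and \<alpha>: "\<alpha> < 2" and M: "levy_measure M" and sR: "sets R = sets borel"
    and MR: "\<And>B. B \<in> sets borel \<Longrightarrow> emeasure M B = levy_mixture p \<alpha> R B"
  shows "integrability_conditions \<alpha> R"
proof -
  have sM: "sets M = sets borel" using M by (simp add: levy_measure_def)
  have "R = null_measure borel \<or> integrability_conditions \<alpha> R"
    using M levy_mixture_levy_iff[OF p sR sM MR] by blast
  then show ?thesis using \<alpha> by (auto simp: integrability_conditions_def)
qed

text \<open>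
  Both measures give the same mixture \<open>M\<close>, and \<open>M\<close> being a Levy measure they satisfy the integrability conditions. So the measure associated with
  a law does not depend on the representation.
\<close>

lemma associated_measure_unique:
  assumes p: "0 < p" and \<alpha>: "\<alpha> < 2" and M: "levy_measure M"
    and R: "tempered_representation p \<alpha> M q \<sigma>" "associated_measure p \<alpha> q \<sigma> R"
    and R': "tempered_representation p \<alpha> M q' \<sigma>'" "associated_measure p \<alpha> q' \<sigma>' R'"
  shows "R = R'"
proof (rule levy_mixture_injective[OF p])
  note MR = tempered_representation_mixture[OF R(1) p R(2)] and MR' = tempered_representation_mixture[OF R'(1) p R'(2)]
  show "sets R = sets borel" "sets R' = sets borel" by fact+
  show "integrability_conditions \<alpha> R" by (rule integrability_conditions_of_levy[OF p \<alpha> M MR])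
  show "integrability_conditions \<alpha> R'" by (rule integrability_conditions_of_levy[OF p \<alpha> M MR'])
  show "levy_mixture p \<alpha> R B = levy_mixture p \<alpha> R' B" if "B \<in> sets borel" for B using MR(2)[OF that] MR'(2)[OF that] by simp
qed

lemma sigma_from_alpha_moment:
  assumes p: "0 < p" and M: "tempered_representation p \<alpha> M q \<sigma>" and R: "associated_measure p \<alpha> q \<sigma> R"
    and n: "normalized_tempering q" and B: "B \<in> sets sphere_space"
  shows "emeasure \<sigma> B = (\<integral>\<^sup>+x. indicator B (direction x) * ennreal (norm x powr \<alpha>) \<partial>R)"
proof -
  have s\<sigma>: "sets \<sigma> = sets sphere_space" using M by (simp add: tempered_representation_def tempering_pair_def)
  obtain Qu where Qu: "bernstein_family p q Qu" "polar_disintegration p \<alpha> R \<sigma> Qu"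
    using associated_measure_disintegration[OF R p s\<sigma>] by blast
  have B': "B \<in> sets borel" using B by (simp add: sets_restrict_space_iff)
  have "(\<integral>\<^sup>+x. indicator B (direction x) * ennreal (norm x powr \<alpha>) \<partial>R) = (\<integral>\<^sup>+u. indicator B u * emeasure (Qu u) (space (Qu u)) \<partial>\<sigma>)"
    by (rule alpha_moment_cone[OF Qu(1) p s\<sigma> Qu(2) B'])
  also have "\<dots> = (\<integral>\<^sup>+u. indicator B u \<partial>\<sigma>)"
    using normalized_imp_bernstein_mass_1[OF Qu(1) p _ n] sigma_space[OF Qu(1) p s\<sigma>] by (intro nn_integral_cong) simp
  also have "\<dots> = emeasure \<sigma> B" using B s\<sigma> by simp
  finally show ?thesis by simp
qed

text \<open>
  Let \<open>c u\<close> be the total mass of the Bernstein measure in the direction \<open>u\<close>. A finite \<open>\<alpha>\<close>-moment says that \<open>c\<close> is integrable with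
  respect to \<open>\<sigma>\<close>, hence finite almost everywhere. Dividing the Bernstein measures by \<open>c\<close> and multiplying \<open>\<sigma>\<close> by \<open>c\<close> leaves the polar formula for
  \<open>R\<close> unchanged, and the new \<open>q\<close> tends to 1 at 0.
\<close>

lemma normalized_representation_exists:
  fixes M :: "'a::euclidean_space measure"
  assumes p: "0 < p" and M: "tempered_representation p \<alpha> M q \<sigma>" and R: "associated_measure p \<alpha> q \<sigma> R"
    and fin: "finite_alpha_moment \<alpha> R"
  shows "\<exists>q' \<sigma>'. tempered_representation p \<alpha> M q' \<sigma>' \<and> normalized_tempering q'"
proof -
  have q: "tempering_pair q \<sigma>" and sM: "sets M = sets borel" using M by (auto simp: tempered_representation_def)
  have s\<sigma>: "sets \<sigma> = sets sphere_space" using q by (simp add: tempering_pair_def)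
  obtain Qu where Q: "bernstein_family p q Qu" and P: "polar_disintegration p \<alpha> R \<sigma> Qu"
    using associated_measure_disintegration[OF R p s\<sigma>] by blast
  have qpos: "0 < q r u" if "u \<in> sphere 0 1" "0 < r" for r u using q that by (auto simp: tempering_pair_def)
  define c where "c u = emeasure (Qu u) {0<..}" for u
  have cm[measurable]: "c \<in> borel_measurable sphere_space"
    using Q unfolding bernstein_family_def c_def by (auto simp: sets_restrict_space_iff)
  have mc: "f \<in> borel_measurable sphere_space \<Longrightarrow> f \<in> borel_measurable \<sigma>" for f :: "'a \<Rightarrow> ennreal"
    by (rule sigma_measurable_cong[OF Q p s\<sigma>])
  have csp: "c u = emeasure (Qu u) (space (Qu u))" if "u \<in> sphere 0 1" for u using bernstein_space[OF Q that] by (simp add: c_def)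
  have c0: "c u \<noteq> 0" if u: "u \<in> sphere 0 1" for u
  proof
    assume "c u = 0"
    then have "AE s in Qu u. False" using csp[OF u] by (intro AE_I[of _ _ "space (Qu u)"]) auto
    then have "(\<integral>\<^sup>+s. ennreal (exp (- 1 * s)) \<partial>Qu u) = (\<integral>\<^sup>+s. 0 \<partial>Qu u)" by (intro nn_integral_cong_AE) (auto elim: eventually_mono)
    then show False using bernstein_transform[OF Q p u zero_less_one] qpos[OF u zero_less_one] by simp
  qed
  have cint: "(\<integral>\<^sup>+u. c u \<partial>\<sigma>) < \<top>"
  proof -
    have "(\<integral>\<^sup>+u. c u \<partial>\<sigma>) = (\<integral>\<^sup>+u. indicator UNIV u * emeasure (Qu u) (space (Qu u)) \<partial>\<sigma>)"
      using sigma_space[OF Q p s\<sigma>] by (intro nn_integral_cong) (simp add: csp)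
    also have "\<dots> = (\<integral>\<^sup>+x. indicator UNIV (direction x) * ennreal (norm x powr \<alpha>) \<partial>R)"
      by (rule alpha_moment_cone[OF Q p s\<sigma> P, symmetric]) simp
    also have "\<dots> < \<top>" using fin by (simp add: finite_alpha_moment_def)
    finally show ?thesis .
  qed
  have aec: "AE u in \<sigma>. c u \<noteq> \<infinity>" by (rule nn_integral_PInf_AE) (use mc[OF cm] cint in auto)
  \<comment> \<open>Where \<open>c\<close> is infinite, which happens on a null set, the point mass at 1 takes over, with transform \<open>exp (- r)\<close>.\<close>
  define Qn where "Qn u = (if c u = \<infinity> then return halfline_space 1 else scale_measure (1 / c u) (Qu u))" for u
  define q0 where "q0 r u = (if c u = \<infinity> then exp (- r) else q r u / enn2real (c u))" for r u
  have Qn: "bernstein_family p q0 Qn"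
    unfolding bernstein_family_def
  proof (intro conjI ballI allI impI)
    show "sets (Qn u) = sets halfline_space" if "u \<in> sphere 0 1" for u using bernstein_sets[OF Q that] by (simp add: Qn_def)
    show "(\<lambda>u. emeasure (Qn u) A) \<in> borel_measurable sphere_space" if A: "A \<in> sets halfline_space" for A
    proof -
      have [measurable]: "(\<lambda>u. emeasure (Qu u) A) \<in> borel_measurable sphere_space" using Q A by (auto simp: bernstein_family_def)
      have "(\<lambda>u. if c u = \<infinity> then indicator A 1 else 1 / c u * emeasure (Qu u) A) \<in> borel_measurable sphere_space" by measurable
      then show ?thesis by (rule measurable_cong[THEN iffD1, rotated]) (use A in \<open>simp add: Qn_def\<close>)
    qed
    fix u :: 'a and r :: real assume u: "u \<in> sphere 0 1" and r: "0 < r"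
    have rp: "0 < r powr p" using r by simp
    show "ennreal (q0 (r powr p) u) = (\<integral>\<^sup>+s. ennreal (exp (- (r powr p) * s)) \<partial>Qn u)"
    proof (cases "c u = \<infinity>")
      case True
      have "(\<integral>\<^sup>+s. ennreal (exp (- (r powr p) * s)) \<partial>return halfline_space 1) = ennreal (exp (- (r powr p) * 1))"
        by (rule nn_integral_return[OF _ exp_halfline_measurable]) simp
      then show ?thesis unfolding q0_def Qn_def if_P[OF True] by simp
    next
      case False
      have em: "(\<lambda>s. ennreal (exp (- (r powr p) * s))) \<in> borel_measurable (Qu u)"
        unfolding measurable_cong_sets[OF bernstein_sets[OF Q u] refl] by (rule exp_halfline_measurable)
      have "(\<integral>\<^sup>+s. ennreal (exp (- (r powr p) * s)) \<partial>Qn u) = 1 / c u * ennreal (q (r powr p) u)"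
        unfolding Qn_def if_not_P[OF False] nn_integral_scale_measure[OF em]
          bernstein_transform[OF Q p u rp] by simp
      also have "\<dots> = ennreal (q0 (r powr p) u)"
      proof -
        obtain k where k: "c u = ennreal k" "0 < k" using False c0[OF u] by (cases "c u") auto
        have "1 / c u * ennreal (q (r powr p) u) = ennreal (1 / k) * ennreal (q (r powr p) u)"
          unfolding k(1) ennreal_1[symmetric] using k(2) by (subst divide_ennreal) auto
        also have "\<dots> = ennreal (q (r powr p) u / k)" using k(2) qpos[OF u rp] by (subst ennreal_mult[symmetric]) auto
        finally show ?thesis using k by (simp add: q0_def)
      qed
      finally show ?thesis by simp
    qed
  qed
  have pos: "0 < q0 1 u" if u: "u \<in> sphere 0 1" for u
    using qpos[OF u, of 1] c0[OF u] by (auto simp: q0_def enn2real_positive_iff less_top zero_less_iff_neq_zero intro!: divide_pos_pos)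
  define \<sigma>' where "\<sigma>' = density \<sigma> c"
  have s\<sigma>': "sets \<sigma>' = sets sphere_space" by (simp add: \<sigma>'_def s\<sigma>)
  have fin\<sigma>': "finite_measure \<sigma>'"
  proof (rule finite_measureI)
    have "emeasure \<sigma>' (space \<sigma>') = (\<integral>\<^sup>+u. c u * indicator (space \<sigma>) u \<partial>\<sigma>)"
      unfolding \<sigma>'_def space_density by (rule emeasure_density[OF mc[OF cm]]) simp
    also have "\<dots> = (\<integral>\<^sup>+u. c u \<partial>\<sigma>)" by (intro nn_integral_cong) simp
    finally show "emeasure \<sigma>' (space \<sigma>') \<noteq> \<infinity>" using cint by simp
  qed
  define q' where "q' r u = (\<integral>s. exp (- r * s) \<partial>Qn u)" for r u
  have q': "tempering_pair q' \<sigma>'" "bernstein_family p q' Qn"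
    using laplace_tempering_pair[OF Qn p s\<sigma>' fin\<sigma>' pos] unfolding q'_def[abs_def] by blast+
  have P': "polar_disintegration p \<alpha> R \<sigma>' Qn"
    unfolding polar_disintegration_def
  proof
    fix F :: "'a \<Rightarrow> ennreal" assume F[measurable]: "F \<in> borel_measurable borel"
    define h where "h u s = F ((s powr (- 1 / p)) *\<^sub>R u) * ennreal (s powr (\<alpha> / p))" for u s
    have [measurable]: "fst \<in> (sphere_space \<Otimes>\<^sub>M halfline_space) \<rightarrow>\<^sub>M (borel :: 'a measure)"
      by (rule measurable_compose[OF measurable_fst sphere_space_id])
    have [measurable]: "snd \<in> ((sphere_space :: 'a measure) \<Otimes>\<^sub>M halfline_space) \<rightarrow>\<^sub>M borel"
      by (rule measurable_compose[OF measurable_snd halfline_space_id])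
    have "(\<lambda>(u, s). h u s) \<in> borel_measurable (sphere_space \<Otimes>\<^sub>M halfline_space)"
      unfolding h_def case_prod_beta' by measurable
    then have hn: "(\<lambda>u. \<integral>\<^sup>+s. h u s \<partial>Qn u) \<in> borel_measurable \<sigma>" by (intro mc bernstein_joint_measurable[OF Qn p])
    have "(\<integral>\<^sup>+u. (\<integral>\<^sup>+s. h u s \<partial>Qn u) \<partial>\<sigma>') = (\<integral>\<^sup>+u. c u * (\<integral>\<^sup>+s. h u s \<partial>Qn u) \<partial>\<sigma>)"
      unfolding \<sigma>'_def by (rule nn_integral_density[OF mc[OF cm] hn])
    also have "\<dots> = (\<integral>\<^sup>+u. (\<integral>\<^sup>+s. h u s \<partial>Qu u) \<partial>\<sigma>)"
    proof (rule nn_integral_cong_AE)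
      show "AE u in \<sigma>. c u * (\<integral>\<^sup>+s. h u s \<partial>Qn u) = (\<integral>\<^sup>+s. h u s \<partial>Qu u)"
        using aec AE_space
      proof eventually_elim
        case (elim u)
        then have u: "u \<in> sphere 0 1" using sigma_space[OF Q p s\<sigma>] by simp
        have "h u \<in> borel_measurable (Qu u)"
          unfolding measurable_cong_sets[OF bernstein_sets[OF Q u] refl] h_def by (intro measurable_restrict_space1) measurable
        then have "(\<integral>\<^sup>+s. h u s \<partial>Qn u) = 1 / c u * (\<integral>\<^sup>+s. h u s \<partial>Qu u)"
          using elim by (simp add: Qn_def nn_integral_scale_measure)
        moreover have "c u * (1 / c u) = 1" using elim c0[OF u] by (simp add: ennreal_times_divide ennreal_divide_self less_top)
        ultimately show ?case by (simp only: mult.assoc[symmetric] mult_1)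
      qed
    qed
    also have "\<dots> = (\<integral>\<^sup>+x. F x \<partial>R)" using P F by (simp add: polar_disintegration_def h_def)
    finally show "(\<integral>\<^sup>+x. F x \<partial>R) = (\<integral>\<^sup>+u. (\<integral>\<^sup>+s. F ((s powr (- 1 / p)) *\<^sub>R u) * ennreal (s powr (\<alpha> / p)) \<partial>Qn u) \<partial>\<sigma>')"
      by (simp add: h_def)
  qed
  have q'0: "0 \<le> q' r u" for r u unfolding q'_def by (rule integral_nonneg_AE) simp
  have "tempered_representation p \<alpha> M q' \<sigma>'"
    unfolding tempered_representation_def
    using q'(1) sM levy_mixture_eq_polar_tempered[OF q'(2) p s\<sigma>' P' q'0] tempered_representation_mixture(2)[OF M p R] by simp
  moreover have "normalized_tempering q'"
    unfolding normalized_tempering_def q'_def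
  proof
    fix u :: 'a assume u: "u \<in> sphere 0 1"
    show "((\<lambda>r. \<integral>s. exp (- r * s) \<partial>Qn u) \<longlongrightarrow> 1) (at_right 0)"
    proof (rule laplace_transform_tendsto_mass[OF bernstein_sets[OF Qn u]])
      have "emeasure (Qn u) (space (Qn u)) = emeasure (Qn u) {0<..}" using bernstein_space[OF Qn u] by simp
      also have "\<dots> = 1"
        using c0[OF u] by (auto simp: Qn_def c_def[symmetric] sets_restrict_space_iff ennreal_divide_times ennreal_divide_self less_top)
      finally show "emeasure (Qn u) (space (Qn u)) = 1" .
    qed
  qed
  ultimately show ?thesis by blast
qed

theorem theorem6:
  fixes p \<alpha> :: real
  assumes "p > 0"
  shows
    "(\<forall>(q :: real \<Rightarrow> 'a::euclidean_space \<Rightarrow> real) \<sigma>. tempering_pair q \<sigma> \<longrightarrow>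
        (\<exists>R. associated_measure p \<alpha> q \<sigma> R) \<and>
        (\<forall>R. associated_measure p \<alpha> q \<sigma> R \<longrightarrow>
          (\<forall>A\<in>sets borel. polar_tempered p \<alpha> q \<sigma> A = levy_mixture p \<alpha> R A \<and>
                          polar_tempered p \<alpha> q \<sigma> A = levy_mixture' p \<alpha> R A)))
     \<and>
     (\<forall>R :: 'a measure. sets R = sets borel \<longrightarrow>
        ((\<exists>M. levy_measure M \<and> (\<forall>A\<in>sets borel. emeasure M A = levy_mixture p \<alpha> R A))
           \<longleftrightarrow> R = null_measure borel \<or> integrability_conditions \<alpha> R) \<and>
        (integrability_conditions \<alpha> R \<longrightarrow>
           (\<forall>M. sets M = sets borel \<and> (\<forall>A\<in>sets borel. emeasure M A = levy_mixture p \<alpha> R A) \<longrightarrow>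
              (\<exists>\<mu>. tempered_stable p \<alpha> \<mu> \<and> nongaussian_with_levy_measure \<mu> M) \<and>
              (\<forall>R'. sets R' = sets borel \<and>
                    (\<forall>A\<in>sets borel. emeasure M A = levy_mixture p \<alpha> R' A) \<longrightarrow> R' = R))))
     \<and>
     (\<forall>(\<mu> :: 'a measure) R. tempered_stable p \<alpha> \<mu> \<and> associated_measure_of_law p \<alpha> \<mu> R \<longrightarrow>
        (proper_tempered_stable p \<alpha> \<mu> \<longleftrightarrow>
           integrability_conditions \<alpha> R \<and> finite_alpha_moment \<alpha> R))
     \<and>
     (\<forall>(\<mu> :: 'a measure) R. tempered_stable p \<alpha> \<mu> \<and> associated_measure_of_law p \<alpha> \<mu> R \<and>
          finite_alpha_moment \<alpha> R \<longrightarrow>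
        (\<forall>M q \<sigma>. nongaussian_with_levy_measure \<mu> M \<and> tempered_representation p \<alpha> M q \<sigma> \<and>
             normalized_tempering q \<longrightarrow>
           (\<forall>B\<in>sets (restrict_space borel (sphere 0 1)).
              emeasure \<sigma> B =
                (\<integral>\<^sup>+x. indicator B (x /\<^sub>R norm x) * ennreal (norm x powr \<alpha>) \<partial>R))))"
proof (intro conjI)
  note p = \<open>p > 0\<close>
  have ex: "\<exists>R. associated_measure p \<alpha> q \<sigma> R" if q: "tempering_pair q \<sigma>" for q :: "real \<Rightarrow> 'a \<Rightarrow> real" and \<sigma>
  proof -
    obtain Qu where Q: "bernstein_family p q Qu" using bernstein_family_exists[OF q] by blast
    then show ?thesis using q by (intro associated_exists[OF _ p]) (auto simp: tempering_pair_def)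
  qed
  have mix: "polar_tempered p \<alpha> q \<sigma> A = levy_mixture p \<alpha> R A \<and> polar_tempered p \<alpha> q \<sigma> A = levy_mixture' p \<alpha> R A"
    if q: "tempering_pair q \<sigma>" and R: "associated_measure p \<alpha> q \<sigma> R" and A: "A \<in> sets borel"
    for q :: "real \<Rightarrow> 'a \<Rightarrow> real" and \<sigma> R A
  proof -
    have s\<sigma>: "sets \<sigma> = sets sphere_space" using q by (simp add: tempering_pair_def)
    obtain Qu where Qu: "bernstein_family p q Qu" "polar_disintegration p \<alpha> R \<sigma> Qu" and sR: "sets R = sets borel"
      using associated_measure_disintegration[OF R p s\<sigma>] by blast
    have "polar_tempered p \<alpha> q \<sigma> A = levy_mixture p \<alpha> R A"
      using q by (intro levy_mixture_eq_polar_tempered[OF Qu(1) p s\<sigma> Qu(2) _ A]) (auto simp: tempering_pair_def intro: less_imp_le)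
    then show ?thesis using levy_mixture_alt[OF p sR A] by simp
  qed
  show "\<forall>(q :: real \<Rightarrow> 'a \<Rightarrow> real) \<sigma>. tempering_pair q \<sigma> \<longrightarrow>
        (\<exists>R. associated_measure p \<alpha> q \<sigma> R) \<and>
        (\<forall>R. associated_measure p \<alpha> q \<sigma> R \<longrightarrow>
          (\<forall>A\<in>sets borel. polar_tempered p \<alpha> q \<sigma> A = levy_mixture p \<alpha> R A \<and>
                          polar_tempered p \<alpha> q \<sigma> A = levy_mixture' p \<alpha> R A))"
    using ex mix by blast
  show "\<forall>R :: 'a measure. sets R = sets borel \<longrightarrow>
        ((\<exists>M. levy_measure M \<and> (\<forall>A\<in>sets borel. emeasure M A = levy_mixture p \<alpha> R A))
           \<longleftrightarrow> R = null_measure borel \<or> integrability_conditions \<alpha> R) \<and>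
        (integrability_conditions \<alpha> R \<longrightarrow>
           (\<forall>M. sets M = sets borel \<and> (\<forall>A\<in>sets borel. emeasure M A = levy_mixture p \<alpha> R A) \<longrightarrow>
              (\<exists>\<mu>. tempered_stable p \<alpha> \<mu> \<and> nongaussian_with_levy_measure \<mu> M) \<and>
              (\<forall>R'. sets R' = sets borel \<and>
                    (\<forall>A\<in>sets borel. emeasure M A = levy_mixture p \<alpha> R' A) \<longrightarrow> R' = R)))"
  proof (intro allI impI conjI)
    fix R :: "'a measure" assume sR: "sets R = sets borel"
    show "(\<exists>M. levy_measure M \<and> (\<forall>A\<in>sets borel. emeasure M A = levy_mixture p \<alpha> R A))
           \<longleftrightarrow> R = null_measure borel \<or> integrability_conditions \<alpha> R"
    proof
      assume "\<exists>M. levy_measure M \<and> (\<forall>A\<in>sets borel. emeasure M A = levy_mixture p \<alpha> R A)"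
      then obtain M where M: "levy_measure M" "\<And>A. A \<in> sets borel \<Longrightarrow> emeasure M A = levy_mixture p \<alpha> R A" by blast
      have "sets M = sets borel" using M(1) by (simp add: levy_measure_def)
      from levy_mixture_levy_iff[OF p sR this M(2)] M(1) show "R = null_measure borel \<or> integrability_conditions \<alpha> R" by blast
    next
      assume *: "R = null_measure borel \<or> integrability_conditions \<alpha> R"
      obtain M where M: "sets M = sets borel" "\<forall>A\<in>sets borel. emeasure M A = levy_mixture p \<alpha> R A"
        using levy_mixture_measure_exists[OF sR] by blast
      from levy_mixture_levy_iff[OF p sR M(1) bspec[OF M(2)]] * M show "\<exists>M. levy_measure M \<and> (\<forall>A\<in>sets borel. emeasure M A = levy_mixture p \<alpha> R A)" by blast
    qed
    fix M :: "'a measure"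
    assume R: "integrability_conditions \<alpha> R" and "sets M = sets borel \<and> (\<forall>A\<in>sets borel. emeasure M A = levy_mixture p \<alpha> R A)"
    then have sM: "sets M = sets borel" and MR: "\<And>A. A \<in> sets borel \<Longrightarrow> emeasure M A = levy_mixture p \<alpha> R A" by auto
    have \<alpha>: "\<alpha> < 2" using R by (simp add: integrability_conditions_def)
    have M: "levy_measure M" using levy_mixture_levy_iff[OF p sR sM MR] R by blast
    obtain \<mu> where \<mu>: "infinitely_divisible \<mu>" "nongaussian_with_levy_measure \<mu> M" using infinitely_divisible_exists[OF M] by blast
    obtain q \<sigma> Qu where q: "tempering_pair q \<sigma>" "bernstein_family p q Qu" "polar_disintegration p \<alpha> R \<sigma> Qu"
      using polar_disintegration_exists[OF p R sR] by blast
    have "polar_tempered p \<alpha> q \<sigma> A = levy_mixture p \<alpha> R A" if "A \<in> sets borel" for A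
      using q(1) by (intro levy_mixture_eq_polar_tempered[OF q(2) p _ q(3) _ that]) (auto simp: tempering_pair_def intro: less_imp_le)
    then have "tempered_representation p \<alpha> M q \<sigma>" using q(1) sM MR by (simp add: tempered_representation_def)
    then show "\<exists>\<mu>. tempered_stable p \<alpha> \<mu> \<and> nongaussian_with_levy_measure \<mu> M"
      using \<mu> \<alpha> p unfolding tempered_stable_def by blast
    fix R' :: "'a measure" assume "sets R' = sets borel \<and> (\<forall>A\<in>sets borel. emeasure M A = levy_mixture p \<alpha> R' A)"
    then have sR': "sets R' = sets borel" and MR': "\<And>A. A \<in> sets borel \<Longrightarrow> emeasure M A = levy_mixture p \<alpha> R' A" by auto
    have eq: "levy_mixture p \<alpha> R' B = levy_mixture p \<alpha> R B" if "B \<in> sets borel" for B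
      using MR[OF that] MR'[OF that] by simp
    have R': "integrability_conditions \<alpha> R'" by (rule integrability_conditions_of_levy[OF p \<alpha> M sR' MR'])
    show "R' = R" by (rule levy_mixture_injective[OF p sR' R' sR R eq])
  qed
  show "\<forall>(\<mu> :: 'a measure) R. tempered_stable p \<alpha> \<mu> \<and> associated_measure_of_law p \<alpha> \<mu> R \<longrightarrow>
        (proper_tempered_stable p \<alpha> \<mu> \<longleftrightarrow> integrability_conditions \<alpha> R \<and> finite_alpha_moment \<alpha> R)"
  proof (intro allI impI)
    fix \<mu> R :: "'a measure" assume "tempered_stable p \<alpha> \<mu> \<and> associated_measure_of_law p \<alpha> \<mu> R"
    then obtain M q \<sigma> where \<mu>: "tempered_stable p \<alpha> \<mu>" and \<mu>M: "nongaussian_with_levy_measure \<mu> M"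
      and M: "tempered_representation p \<alpha> M q \<sigma>" and R: "associated_measure p \<alpha> q \<sigma> R"
      unfolding associated_measure_of_law_def by blast
    have \<alpha>: "\<alpha> < 2" using \<mu> by (simp add: tempered_stable_def)
    have lM: "levy_measure M" using \<mu>M by (auto simp: nongaussian_with_levy_measure_def has_levy_triplet_def)
    show "proper_tempered_stable p \<alpha> \<mu> \<longleftrightarrow> integrability_conditions \<alpha> R \<and> finite_alpha_moment \<alpha> R"
    proof
      assume "proper_tempered_stable p \<alpha> \<mu>"
      then obtain M' q' \<sigma>' where "nongaussian_with_levy_measure \<mu> M'" and "tempered_representation p \<alpha> M' q' \<sigma>'"
        and n: "normalized_tempering q'" unfolding proper_tempered_stable_def by blast
      moreover have "M' = M" using levy_measure_unique calculation(1) \<mu>M by blast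
      ultimately have M': "tempered_representation p \<alpha> M q' \<sigma>'" by simp
      then have q': "tempering_pair q' \<sigma>'" by (simp add: tempered_representation_def)
      obtain R' where "associated_measure p \<alpha> q' \<sigma>' R'" using ex[OF q'] by blast
      moreover from this have "R = R'" by (rule associated_measure_unique[OF p \<alpha> lM M R M'])
      ultimately have R': "associated_measure p \<alpha> q' \<sigma>' R" by simp
      have "(\<integral>\<^sup>+x. ennreal (norm x powr \<alpha>) \<partial>R) = (\<integral>\<^sup>+x. indicator (sphere 0 1) (direction x) * ennreal (norm x powr \<alpha>) \<partial>R)"
      proof (rule nn_integral_cong_AE)
        have "integrability_conditions \<alpha> R" by (rule integrability_conditions_of_levy[OF p \<alpha> lM tempered_representation_mixture[OF M p R]])
        then have "AE x in R. x \<noteq> 0"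
          using tempered_representation_mixture(1)[OF M p R] by (intro AE_I[of _ _ "{0}"]) (auto simp: integrability_conditions_def)
        then show "AE x in R. ennreal (norm x powr \<alpha>) = indicator (sphere 0 1) (direction x) * ennreal (norm x powr \<alpha>)"
          by eventually_elim (simp add: norm_direction)
      qed
      also have "\<dots> = emeasure \<sigma>' (sphere 0 1)"
        by (rule sigma_from_alpha_moment[OF p M' R' n, symmetric]) (simp add: sets_restrict_space_iff)
      also have "\<dots> < \<infinity>"
        using q' finite_measure.emeasure_finite[of \<sigma>' "sphere 0 1"] by (simp add: tempering_pair_def less_top)
      finally show "integrability_conditions \<alpha> R \<and> finite_alpha_moment \<alpha> R"
        using integrability_conditions_of_levy[OF p \<alpha> lM tempered_representation_mixture[OF M p R]] by (simp add: finite_alpha_moment_def)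
    next
      assume "integrability_conditions \<alpha> R \<and> finite_alpha_moment \<alpha> R"
      then obtain q' \<sigma>' where "tempered_representation p \<alpha> M q' \<sigma>'" "normalized_tempering q'"
        using normalized_representation_exists[OF p M R] by blast
      then show "proper_tempered_stable p \<alpha> \<mu>" using \<mu> \<mu>M unfolding proper_tempered_stable_def by blast
    qed
  qed
  show "\<forall>(\<mu> :: 'a measure) R. tempered_stable p \<alpha> \<mu> \<and> associated_measure_of_law p \<alpha> \<mu> R \<and>
          finite_alpha_moment \<alpha> R \<longrightarrow>
        (\<forall>M q \<sigma>. nongaussian_with_levy_measure \<mu> M \<and> tempered_representation p \<alpha> M q \<sigma> \<and>
             normalized_tempering q \<longrightarrow>
           (\<forall>B\<in>sets (restrict_space borel (sphere 0 1)).
              emeasure \<sigma> B =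
                (\<integral>\<^sup>+x. indicator B (x /\<^sub>R norm x) * ennreal (norm x powr \<alpha>) \<partial>R)))"
  proof (intro allI impI ballI, elim conjE)
    fix \<mu> R M \<sigma> :: "'a measure" and q and B :: "'a set"
    assume \<mu>: "tempered_stable p \<alpha> \<mu>" "associated_measure_of_law p \<alpha> \<mu> R"
      and \<mu>M: "nongaussian_with_levy_measure \<mu> M" and M: "tempered_representation p \<alpha> M q \<sigma>" and n: "normalized_tempering q"
      and B: "B \<in> sets sphere_space"
    have \<alpha>: "\<alpha> < 2" using \<mu> by (simp add: tempered_stable_def)
    have lM: "levy_measure M" using \<mu>M by (auto simp: nongaussian_with_levy_measure_def has_levy_triplet_def)
    obtain M2 q2 \<sigma>2 where "nongaussian_with_levy_measure \<mu> M2" and "tempered_representation p \<alpha> M2 q2 \<sigma>2" and R: "associated_measure p \<alpha> q2 \<sigma>2 R"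
      using \<mu>(2) unfolding associated_measure_of_law_def by blast
    moreover have "M2 = M" using levy_measure_unique calculation(1) \<mu>M by blast
    ultimately have M2: "tempered_representation p \<alpha> M q2 \<sigma>2" by simp
    obtain R' where R': "associated_measure p \<alpha> q \<sigma> R'" using ex M unfolding tempered_representation_def by blast
    have "R = R'" by (rule associated_measure_unique[OF p \<alpha> lM M2 R M R'])
    then show "emeasure \<sigma> B = (\<integral>\<^sup>+x. indicator B (x /\<^sub>R norm x) * ennreal (norm x powr \<alpha>) \<partial>R)"
      using sigma_from_alpha_moment[OF p M R' n B] by (simp add: direction_def)
  qed
qed

end
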